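(* Let $A$ be a torsion abelian group and let $X$ be a fan equipped with an action of the group fan $\mathbb{G}(A)$. Then the categorical quotient $X \to X/\mathbb{G}(A)$ of $X$ by $\mathbb{G}(A)$, calculated in the category $\mathbf{MS}$ of monoidal spaces, is a map of fans which is a homeomorphism on underlying topological spaces and is also the categorical quotient of $X$ by $\mathbb{G}(A)$ in the category of locally monoidal spaces and in the category of fans.
   Context: Monoids are commutative, written additively, with $0$. $P^*$ is the group of units of $P$. A monoid map $h : Q \to P$ is local if $h^{-1}(P^* ) = Q^*$. A monoidal space is a topological space $X$ with a sheaf of monoids $\mathcal{M}_X$; a morphism of monoidal spaces $f : X \to Y$ is a continuous map together with a map $f^\dagger : f^{-1}\mathcal{M}_Y \to \mathcal{M}_X$ of sheaves of monoids (category $\mathbf{MS}$). It is a morphism of locally monoidal spaces if all stalk maps $\mathcal{M}_{Y,f(x)} \to \mathcal{M}_{X,x}$ are local (category $\mathbf{LMS}$, with the same objects as $\mathbf{MS}$). A face of $P$ is a submonoid $F$ such that $p+p' \in F$ implies $p,p' \in F$. $\operatorname{Spec} P$ is the set of faces of $P$, with the topology having basis $U_p = \{F : p \in F\}$ ($p \in P$), and with the structure sheaf $\mathcal{M}_P$ determined by $\mathcal{M}_P(U_p) = P[-p]$ (localization making $p$ invertible); its stalk at $F$ is $F^{-1}P$. A fan is a locally monoidal space locally isomorphic to $\operatorname{Spec} P$ for monoids $P$. Maps of fans are morphisms of locally monoidal spaces. Finite inverse limits of fans agree with those computed in $\mathbf{LMS}$ and in $\mathbf{MS}$. For an abelian group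 $A$, $\mathbb{G}(A)$ is the group object in fans with underlying fan $\operatorname{Spec} A$ (a one-point space) and group structure induced by the comultiplication $A \to A \oplus A$, $a \mapsto (a,a)$, and coinverse $a \mapsto -a$. The categorical quotient of $X$ by $\mathbb{G}(A)$ in a category is the coequalizer of the action map and the projection $\mathbb{G}(A) \times X \rightrightarrows X$. *)

theory Defs
  imports "HOL-Analysis.Abstract_Topology" "HOL-Analysis.Product_Topology"
    "HOL-Algebra.Group" "HOL-Algebra.Elementary_Groups"
begin

text \<open>
  Commutative monoids are HOL-Algebra's \<^locale>\<open>comm_monoid\<close>, written multiplicatively:
  the additive \<open>p + q\<close>, \<open>0\<close>, \<open>n p\<close>, \<open>P\<^sup>*\<close>, \<open>P \<oplus> Q\<close> of the mathematics are
  \<open>p \<otimes> q\<close>, \<open>\<one>\<close>, \<open>p [^] n\<close>, \<open>Units P\<close>, \<open>P \<times>\<times> Q\<close> here.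
\<close>

section \<open>Monoids\<close>

definition monoid_hom :: "('p, 'c) monoid_scheme \<Rightarrow> ('q, 'd) monoid_scheme \<Rightarrow> ('p \<Rightarrow> 'q) \<Rightarrow> bool" where
  "monoid_hom P Q h \<longleftrightarrow> h \<in> hom P Q \<and> h \<one>\<^bsub>P\<^esub> = \<one>\<^bsub>Q\<^esub>"

definition local_map :: "('q, 'c) monoid_scheme \<Rightarrow> ('p, 'd) monoid_scheme \<Rightarrow> ('q \<Rightarrow> 'p) \<Rightarrow> bool" where
  "local_map Q P h \<longleftrightarrow> {x \<in> carrier Q. h x \<in> Units P} = Units Q"

definition face :: "('p, 'c) monoid_scheme \<Rightarrow> 'p set \<Rightarrow> bool" where
  "face P F \<longleftrightarrow> submonoid F P \<and>
     (\<forall>p\<in>carrier P. \<forall>q\<in>carrier P. p \<otimes>\<^bsub>P\<^esub> q \<in> F \<longrightarrow> p \<in> F \<and> q \<in> F)"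

text \<open>
  \<open>fraction P S x a\<close> is the set of all pairs \<open>(y, b)\<close>, \<open>b \<in> S\<close>, for which \<open>y - b\<close> equals
  \<open>x - a\<close> in the localization of \<open>P\<close> at the submonoid \<open>S\<close>. We do not require \<open>a \<in> S\<close>: it is
  enough that \<open>a\<close> becomes invertible in the localization. So if the elements of \<open>S\<close> become
  invertible after localizing at \<open>T\<close>, the canonical map from the localization at \<open>S\<close> to the
  localization at \<open>T\<close> is \<open>localization_map P T\<close>.
\<close>

definition fraction :: "('p, 'c) monoid_scheme \<Rightarrow> 'p set \<Rightarrow> 'p \<Rightarrow> 'p \<Rightarrow> ('p \<times> 'p) set" where
  "fraction P S x a =
     {(y, b). y \<in> carrier P \<and> b \<in> S \<and>
        (\<exists>c\<in>S. x \<otimes>\<^bsub>P\<^esub> b \<otimes>\<^bsub>P\<^esub> c = y \<otimes>\<^bsub>P\<^esub> a \<otimes>\<^bsub>P\<^esub> c)}"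

definition localization :: "('p, 'c) monoid_scheme \<Rightarrow> 'p set \<Rightarrow> ('p \<times> 'p) set monoid" where
  "localization P S =
     \<lparr>carrier = {fraction P S x a | x a. x \<in> carrier P \<and> a \<in> S},
      monoid.mult = (\<lambda>c d. \<Union>(x, a)\<in>c. \<Union>(y, b)\<in>d. fraction P S (x \<otimes>\<^bsub>P\<^esub> y) (a \<otimes>\<^bsub>P\<^esub> b)),
      one = fraction P S \<one>\<^bsub>P\<^esub> \<one>\<^bsub>P\<^esub>\<rparr>"

definition localization_map :: "('p, 'c) monoid_scheme \<Rightarrow> 'p set \<Rightarrow> ('p \<times> 'p) set \<Rightarrow> ('p \<times> 'p) set" where
  "localization_map P T c = (\<Union>(x, a)\<in>c. fraction P T x a)"

definition powers :: "('p, 'c) monoid_scheme \<Rightarrow> 'p \<Rightarrow> 'p set" where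
  "powers P p = range (\<lambda>n::nat. p [^]\<^bsub>P\<^esub> n)"


section \<open>Sheaves of monoids and monoidal spaces\<close>

record ('x, 'm) presheaf =
  sections :: "'x set \<Rightarrow> 'm monoid"
  restr :: "'x set \<Rightarrow> 'x set \<Rightarrow> 'm \<Rightarrow> 'm"  \<comment> \<open>\<open>restr M U V\<close> maps sections over \<open>U\<close> to sections over \<open>V \<subseteq> U\<close>\<close>

definition monoid_presheaf :: "'x topology \<Rightarrow> ('x, 'm) presheaf \<Rightarrow> bool" where
  "monoid_presheaf T M \<longleftrightarrow>
     (\<forall>U. openin T U \<longrightarrow> comm_monoid (sections M U)) \<and>
     (\<forall>U V. openin T U \<and> openin T V \<and> V \<subseteq> U \<longrightarrow> monoid_hom (sections M U) (sections M V) (restr M U V)) \<and>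
     (\<forall>U. openin T U \<longrightarrow> (\<forall>s\<in>carrier (sections M U). restr M U U s = s)) \<and>
     (\<forall>U V W. openin T U \<and> openin T V \<and> openin T W \<and> W \<subseteq> V \<and> V \<subseteq> U \<longrightarrow>
        (\<forall>s\<in>carrier (sections M U). restr M V W (restr M U V s) = restr M U W s))"

definition monoid_sheaf :: "'x topology \<Rightarrow> ('x, 'm) presheaf \<Rightarrow> bool" where
  "monoid_sheaf T M \<longleftrightarrow> monoid_presheaf T M \<and>
     (\<forall>\<U> \<sigma>. (\<forall>V\<in>\<U>. openin T V \<and> \<sigma> V \<in> carrier (sections M V)) \<and>
        (\<forall>V\<in>\<U>. \<forall>W\<in>\<U>. restr M V (V \<inter> W) (\<sigma> V) = restr M W (V \<inter> W) (\<sigma> W)) \<longrightarrow>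
        (\<exists>!s. s \<in> carrier (sections M (\<Union>\<U>)) \<and> (\<forall>V\<in>\<U>. restr M (\<Union>\<U>) V s = \<sigma> V)))"

definition sheaf_hom ::
  "'x topology \<Rightarrow> ('x, 'm) presheaf \<Rightarrow> ('x, 'n) presheaf \<Rightarrow> ('x set \<Rightarrow> 'm \<Rightarrow> 'n) \<Rightarrow> bool" where
  "sheaf_hom T M N \<phi> \<longleftrightarrow>
     (\<forall>U. openin T U \<longrightarrow> monoid_hom (sections M U) (sections N U) (\<phi> U)) \<and>
     (\<forall>U V. openin T U \<and> openin T V \<and> V \<subseteq> U \<longrightarrow>
        (\<forall>s\<in>carrier (sections M U). \<phi> V (restr M U V s) = restr N U V (\<phi> U s)))"

definition germ :: "'x topology \<Rightarrow> ('x, 'm) presheaf \<Rightarrow> 'x \<Rightarrow> 'x set \<Rightarrow> 'm \<Rightarrow> ('x set \<times> 'm) set" where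
  "germ T M x U s =
     {(V, t). openin T V \<and> x \<in> V \<and> t \<in> carrier (sections M V) \<and>
        (\<exists>W. openin T W \<and> x \<in> W \<and> W \<subseteq> U \<inter> V \<and> restr M U W s = restr M V W t)}"

definition stalk :: "'x topology \<Rightarrow> ('x, 'm) presheaf \<Rightarrow> 'x \<Rightarrow> ('x set \<times> 'm) set monoid" where
  "stalk T M x =
     \<lparr>carrier = {germ T M x U s | U s. openin T U \<and> x \<in> U \<and> s \<in> carrier (sections M U)},
      monoid.mult = (\<lambda>g h. \<Union>(U, s)\<in>g. \<Union>(V, t)\<in>h.
        germ T M x (U \<inter> V) (restr M U (U \<inter> V) s \<otimes>\<^bsub>sections M (U \<inter> V)\<^esub> restr M V (U \<inter> V) t)),
      one = germ T M x (topspace T) \<one>\<^bsub>sections M (topspace T)\<^esub>\<rparr>"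

text \<open>
  The inverse image sheaf \<open>f\<^sup>-\<^sup>1 M\<close>, i.e. the sheafification of the presheaf sending \<open>U\<close> to the
  colimit of \<open>M V\<close> over the open \<open>V \<supseteq> f ` U\<close>: its sections over \<open>U\<close> are the functions
  assigning to \<open>x \<in> U\<close> a germ of \<open>M\<close> at \<open>f x\<close> which are locally induced by a section of \<open>M\<close>.
\<close>

definition inverse_image ::
  "'x topology \<Rightarrow> ('x \<Rightarrow> 'y) \<Rightarrow> 'y topology \<Rightarrow> ('y, 'n) presheaf \<Rightarrow> ('x, 'x \<Rightarrow> ('y set \<times> 'n) set) presheaf" where
  "inverse_image T f S M =
     \<lparr>sections = (\<lambda>U.
        \<lparr>carrier = {\<sigma> \<in> (\<Pi>\<^sub>E x\<in>U. carrier (stalk S M (f x))).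
           \<forall>x\<in>U. \<exists>W V t. openin T W \<and> x \<in> W \<and> W \<subseteq> U \<and> openin S V \<and> f ` W \<subseteq> V \<and>
             t \<in> carrier (sections M V) \<and> (\<forall>z\<in>W. \<sigma> z = germ S M (f z) V t)},
         monoid.mult = (\<lambda>\<sigma> \<tau>. \<lambda>x\<in>U. \<sigma> x \<otimes>\<^bsub>stalk S M (f x)\<^esub> \<tau> x),
         one = (\<lambda>x\<in>U. \<one>\<^bsub>stalk S M (f x)\<^esub>)\<rparr>),
      restr = (\<lambda>U V \<sigma>. restrict \<sigma> V)\<rparr>"

definition direct_sum :: "('x, 'm) presheaf \<Rightarrow> ('x, 'n) presheaf \<Rightarrow> ('x, 'm \<times> 'n) presheaf" where
  "direct_sum M N =
     \<lparr>sections = (\<lambda>U. sections M U \<times>\<times> sections N U),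
      restr = (\<lambda>U V. map_prod (restr M U V) (restr N U V))\<rparr>"

record ('x, 'm) mspace =
  pts :: "'x topology"
  shf :: "('x, 'm) presheaf"

definition monoidal_space :: "('x, 'm) mspace \<Rightarrow> bool" where
  "monoidal_space X \<longleftrightarrow> monoid_sheaf (pts X) (shf X)"

abbreviation pull :: "('x, 'm) mspace \<Rightarrow> ('x \<Rightarrow> 'y) \<Rightarrow> ('y, 'n) mspace \<Rightarrow> ('x, 'x \<Rightarrow> ('y set \<times> 'n) set) presheaf" where
  "pull X f Y \<equiv> inverse_image (pts X) f (pts Y) (shf Y)"

text \<open>
  Morphisms carry their source and target. The component \<open>comap\<close> is the sheaf map
  \<open>f\<^sup>\<dagger> : f\<^sup>-\<^sup>1 M\<^sub>Y \<rightarrow> M\<^sub>X\<close>.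
\<close>

record ('x, 'm, 'y, 'n) morphism =
  src :: "('x, 'm) mspace"
  tgt :: "('y, 'n) mspace"
  base_map :: "'x \<Rightarrow> 'y"
  comap :: "'x set \<Rightarrow> ('x \<Rightarrow> ('y set \<times> 'n) set) \<Rightarrow> 'm"

definition ms_morphism :: "('x, 'm, 'y, 'n) morphism \<Rightarrow> bool" where
  "ms_morphism f \<longleftrightarrow> monoidal_space (src f) \<and> monoidal_space (tgt f) \<and>
     continuous_map (pts (src f)) (pts (tgt f)) (base_map f) \<and>
     sheaf_hom (pts (src f)) (pull (src f) (base_map f) (tgt f)) (shf (src f)) (comap f)"

text \<open>Equality of morphisms, disregarding values outside the carriers.\<close>

definition mor_eq :: "('x, 'm, 'y, 'n) morphism \<Rightarrow> ('x, 'm, 'y, 'n) morphism \<Rightarrow> bool" (infix \<open>\<approx>\<close> 50) where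
  "f \<approx> g \<longleftrightarrow> src f = src g \<and> tgt f = tgt g \<and>
     (\<forall>x\<in>topspace (pts (src f)). base_map f x = base_map g x) \<and>
     (\<forall>U. openin (pts (src f)) U \<longrightarrow>
        (\<forall>\<sigma>\<in>carrier (sections (pull (src f) (base_map f) (tgt f)) U). comap f U \<sigma> = comap g U \<sigma>))"

abbreviation preimage :: "('x, 'm, 'y, 'n) morphism \<Rightarrow> 'y set \<Rightarrow> 'x set" where
  "preimage f V \<equiv> {x \<in> topspace (pts (src f)). base_map f x \<in> V}"

text \<open>The map \<open>M\<^sub>Y V \<rightarrow> M\<^sub>X (f\<^sup>-\<^sup>1 V)\<close> and the stalk map \<open>M\<^sub>Y\<^sub>,\<^sub>f\<^sub>x \<rightarrow> M\<^sub>X\<^sub>,\<^sub>x\<close> induced by \<open>f\<^sup>\<dagger>\<close>.\<close>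

definition sec_map :: "('x, 'm, 'y, 'n) morphism \<Rightarrow> 'y set \<Rightarrow> 'n \<Rightarrow> 'm" where
  "sec_map f V t =
     comap f (preimage f V) (\<lambda>x\<in>preimage f V. germ (pts (tgt f)) (shf (tgt f)) (base_map f x) V t)"

definition stalk_map :: "('x, 'm, 'y, 'n) morphism \<Rightarrow> 'x \<Rightarrow> ('y set \<times> 'n) set \<Rightarrow> ('x set \<times> 'm) set" where
  "stalk_map f x g =
     (\<Union>(V, t)\<in>g. germ (pts (src f)) (shf (src f)) x (preimage f V) (sec_map f V t))"

definition local_morphism :: "('x, 'm, 'y, 'n) morphism \<Rightarrow> bool" where
  "local_morphism f \<longleftrightarrow> (\<forall>x\<in>topspace (pts (src f)).
     local_map (stalk (pts (tgt f)) (shf (tgt f)) (base_map f x)) (stalk (pts (src f)) (shf (src f)) x) (stalk_map f x))"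

text \<open>A section of the identity inverse image of \<open>M\<^sub>X\<close> is identified with the section having these germs.\<close>

definition mor_id :: "('x, 'm) mspace \<Rightarrow> ('x, 'm, 'x, 'm) morphism" where
  "mor_id X =
     \<lparr>src = X, tgt = X, base_map = id,
      comap = (\<lambda>U \<sigma>. THE s. s \<in> carrier (sections (shf X) U) \<and> (\<forall>x\<in>U. germ (pts X) (shf X) x U s = \<sigma> x))\<rparr>"

text \<open>
  For \<open>g \<circ> f\<close>, the sheaf map is \<open>f\<^sup>-\<^sup>1 (g\<^sup>-\<^sup>1 M\<^sub>Z) \<rightarrow> f\<^sup>-\<^sup>1 M\<^sub>Y \<rightarrow> M\<^sub>X\<close>; the first of these maps is
  \<open>f\<^sup>-\<^sup>1\<close> of \<open>g\<^sup>\<dagger>\<close> and acts on germs through the stalk maps of \<open>g\<close>.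
\<close>

definition mor_comp ::
  "('y, 'n, 'z, 'k) morphism \<Rightarrow> ('x, 'm, 'y, 'n) morphism \<Rightarrow> ('x, 'm, 'z, 'k) morphism" (infixl \<open>\<odot>\<close> 70) where
  "g \<odot> f =
     \<lparr>src = src f, tgt = tgt g, base_map = base_map g \<circ> base_map f,
      comap = (\<lambda>U \<sigma>. comap f U (\<lambda>x\<in>U. stalk_map g (base_map f x) (\<sigma> x)))\<rparr>"

definition is_iso :: "('x, 'm, 'y, 'n) morphism \<Rightarrow> bool" where
  "is_iso f \<longleftrightarrow> ms_morphism f \<and>
     (\<exists>g. ms_morphism g \<and> src g = tgt f \<and> tgt g = src f \<and>
        g \<odot> f \<approx> mor_id (src f) \<and> f \<odot> g \<approx> mor_id (tgt f))"

definition open_subspace :: "('x, 'm) mspace \<Rightarrow> 'x set \<Rightarrow> ('x, 'm) mspace" where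
  "open_subspace X U = \<lparr>pts = subtopology (pts X) U, shf = shf X\<rparr>"


section \<open>Products of monoidal spaces\<close>

text \<open>
  The product in \<open>MS\<close>: the product space with the coproduct
  \<open>\<pi>\<^sub>1\<^sup>-\<^sup>1 M\<^sub>X \<oplus> \<pi>\<^sub>2\<^sup>-\<^sup>1 M\<^sub>Y\<close> of sheaves of monoids. For fans it is also the
  product in \<open>LMS\<close> and in fans.
\<close>

type_synonym ('x, 'm, 'y, 'n) prod_sec =
  "(('x \<times> 'y) \<Rightarrow> ('x set \<times> 'm) set) \<times> (('x \<times> 'y) \<Rightarrow> ('y set \<times> 'n) set)"

definition mprod ::
  "('x, 'm) mspace \<Rightarrow> ('y, 'n) mspace \<Rightarrow> ('x \<times> 'y, ('x, 'm, 'y, 'n) prod_sec) mspace" where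
  "mprod X Y =
     (let T = prod_topology (pts X) (pts Y) in
      \<lparr>pts = T,
       shf = direct_sum (inverse_image T fst (pts X) (shf X)) (inverse_image T snd (pts Y) (shf Y))\<rparr>)"

definition proj1 ::
  "('x, 'm) mspace \<Rightarrow> ('y, 'n) mspace \<Rightarrow> ('x \<times> 'y, ('x, 'm, 'y, 'n) prod_sec, 'x, 'm) morphism" where
  "proj1 X Y =
     \<lparr>src = mprod X Y, tgt = X, base_map = fst,
      comap = (\<lambda>U \<sigma>. (\<sigma>, \<one>\<^bsub>sections (pull (mprod X Y) snd Y) U\<^esub>))\<rparr>"

definition proj2 ::
  "('x, 'm) mspace \<Rightarrow> ('y, 'n) mspace \<Rightarrow> ('x \<times> 'y, ('x, 'm, 'y, 'n) prod_sec, 'y, 'n) morphism" where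
  "proj2 X Y =
     \<lparr>src = mprod X Y, tgt = Y, base_map = snd,
      comap = (\<lambda>U \<sigma>. (\<one>\<^bsub>sections (pull (mprod X Y) fst X) U\<^esub>, \<sigma>))\<rparr>"

text \<open>\<open>h\<close> is the morphism \<open>(f, g)\<close> into the product.\<close>

definition is_pairing ::
  "('z, 'k, 'x, 'm) morphism \<Rightarrow> ('z, 'k, 'y, 'n) morphism \<Rightarrow>
   ('z, 'k, 'x \<times> 'y, ('x, 'm, 'y, 'n) prod_sec) morphism \<Rightarrow> bool" where
  "is_pairing f g h \<longleftrightarrow> ms_morphism h \<and> tgt h = mprod (tgt f) (tgt g) \<and>
     proj1 (tgt f) (tgt g) \<odot> h \<approx> f \<and> proj2 (tgt f) (tgt g) \<odot> h \<approx> g"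


section \<open>Spectra and fans\<close>

type_synonym 'p spec_sec = "'p \<Rightarrow> ('p \<times> 'p) set"

definition basic_open :: "('p, 'c) monoid_scheme \<Rightarrow> 'p \<Rightarrow> 'p set set" where
  "basic_open P p = {F. face P F \<and> p \<in> F}"

abbreviation basics_in :: "('p, 'c) monoid_scheme \<Rightarrow> 'p set set \<Rightarrow> 'p set" where
  "basics_in P U \<equiv> {p \<in> carrier P. basic_open P p \<subseteq> U}"

text \<open>
  The sheaf determined by the values \<open>P[-p]\<close> on the basic opens \<open>U\<^sub>p\<close>: a section over \<open>U\<close> is a
  compatible family of elements of \<open>P[-p]\<close>, for all \<open>p\<close> with \<open>U\<^sub>p \<subseteq> U\<close>.
\<close>

definition Spec_sheaf :: "('p, 'c) monoid_scheme \<Rightarrow> ('p set, 'p spec_sec) presheaf" where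
  "Spec_sheaf P =
     \<lparr>sections = (\<lambda>U.
        \<lparr>carrier = {s \<in> (\<Pi>\<^sub>E p\<in>basics_in P U. carrier (localization P (powers P p))).
           \<forall>p\<in>basics_in P U. \<forall>q\<in>carrier P. basic_open P q \<subseteq> basic_open P p \<longrightarrow>
             localization_map P (powers P q) (s p) = s q},
         monoid.mult = (\<lambda>s t. \<lambda>p\<in>basics_in P U. s p \<otimes>\<^bsub>localization P (powers P p)\<^esub> t p),
         one = (\<lambda>p\<in>basics_in P U. \<one>\<^bsub>localization P (powers P p)\<^esub>)\<rparr>),
      restr = (\<lambda>U V s. restrict s (basics_in P V))\<rparr>"

definition Spec :: "('p, 'c) monoid_scheme \<Rightarrow> ('p set, 'p spec_sec) mspace" where
  "Spec P =
     \<lparr>pts = topology (arbitrary union_of (\<lambda>U. \<exists>p\<in>carrier P. U = basic_open P p)),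
      shf = Spec_sheaf P\<rparr>"

definition global_section :: "('p, 'c) monoid_scheme \<Rightarrow> 'p \<Rightarrow> 'p spec_sec" where
  "global_section P p = (\<lambda>r\<in>carrier P. fraction P (powers P r) p \<one>\<^bsub>P\<^esub>)"

text \<open>
  \<open>f\<close> is the morphism \<open>Spec P \<rightarrow> Spec Q\<close> induced by \<open>h : Q \<rightarrow> P\<close>: it sends a face to its preimage,
  and \<open>f\<^sup>\<dagger>\<close> extends \<open>h\<close> to the localizations, i.e. it is \<open>h\<close> on the global sections coming from \<open>Q\<close>.
\<close>

definition is_Spec_map ::
  "('q, 'c) monoid_scheme \<Rightarrow> ('p, 'd) monoid_scheme \<Rightarrow> ('q \<Rightarrow> 'p) \<Rightarrow>
   ('p set, 'p spec_sec, 'q set, 'q spec_sec) morphism \<Rightarrow> bool" where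
  "is_Spec_map Q P h f \<longleftrightarrow> ms_morphism f \<and> src f = Spec P \<and> tgt f = Spec Q \<and>
     (\<forall>F. face P F \<longrightarrow> base_map f F = {q \<in> carrier Q. h q \<in> F}) \<and>
     (\<forall>q\<in>carrier Q. sec_map f (topspace (pts (Spec Q))) (global_section Q q) = global_section P (h q))"

text \<open>
  If \<open>(U, M\<^sub>X|U)\<close> is isomorphic to \<open>Spec P\<close> then \<open>P\<close> is isomorphic to the monoid of sections of
  \<open>M\<^sub>X\<close> over \<open>U\<close>, so it is no restriction to take \<open>P\<close> over the type \<open>'m\<close>. Isomorphisms in \<open>MS\<close>
  are automatically local.
\<close>

definition fan :: "('x, 'm) mspace \<Rightarrow> bool" where
  "fan X \<longleftrightarrow> monoidal_space X \<and>
     (\<forall>x\<in>topspace (pts X). \<exists>U (P :: 'm monoid) \<phi>.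
        openin (pts X) U \<and> x \<in> U \<and> comm_monoid P \<and>
        is_iso \<phi> \<and> src \<phi> = open_subspace X U \<and> tgt \<phi> = Spec P)"

datatype category = MS | LMS | Fans

definition arrow :: "category \<Rightarrow> ('x, 'm, 'y, 'n) morphism \<Rightarrow> bool" where
  "arrow C f \<longleftrightarrow> ms_morphism f \<and>
     (C = LMS \<or> C = Fans \<longrightarrow> local_morphism f) \<and>
     (C = Fans \<longrightarrow> fan (src f) \<and> fan (tgt f))"


section \<open>Group fans, actions and quotients\<close>

abbreviation group_fan :: "'a monoid \<Rightarrow> ('a set, 'a spec_sec) mspace" where
  "group_fan A \<equiv> Spec A"

text \<open>
  The multiplication of \<open>G(A)\<close> is \<open>Spec\<close> of \<open>a \<mapsto> (a, a)\<close> under the identification \<open>\<iota>\<close> of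
  \<open>Spec (A \<oplus> A)\<close> with \<open>G(A) \<times> G(A)\<close>; the unit is \<open>Spec\<close> of \<open>A \<rightarrow> 0\<close>.
\<close>

definition group_fan_mult ::
  "'a monoid \<Rightarrow> ('a set \<times> 'a set, ('a set, 'a spec_sec, 'a set, 'a spec_sec) prod_sec, 'a set, 'a spec_sec) morphism \<Rightarrow> bool" where
  "group_fan_mult A \<mu> \<longleftrightarrow> ms_morphism \<mu> \<and>
     src \<mu> = mprod (group_fan A) (group_fan A) \<and> tgt \<mu> = group_fan A \<and>
     (\<exists>\<iota>. is_iso \<iota> \<and> src \<iota> = Spec (A \<times>\<times> A) \<and> tgt \<iota> = mprod (group_fan A) (group_fan A) \<and>
        is_Spec_map A (A \<times>\<times> A) (\<lambda>a. (a, \<one>\<^bsub>A\<^esub>)) (proj1 (group_fan A) (group_fan A) \<odot> \<iota>) \<and>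
        is_Spec_map A (A \<times>\<times> A) (\<lambda>a. (\<one>\<^bsub>A\<^esub>, a)) (proj2 (group_fan A) (group_fan A) \<odot> \<iota>) \<and>
        is_Spec_map A (A \<times>\<times> A) (\<lambda>a. (a, a)) (\<mu> \<odot> \<iota>))"

definition group_fan_unit ::
  "'a monoid \<Rightarrow> (unit set, unit spec_sec, 'a set, 'a spec_sec) morphism \<Rightarrow> bool" where
  "group_fan_unit A e \<longleftrightarrow> is_Spec_map A (singleton_group ()) (\<lambda>_. ()) e"

text \<open>
  The existential quantifiers range over morphisms that exist and are unique up to \<open>\<approx>\<close>:
  the structure maps \<open>\<mu>\<close>, \<open>e\<close> of \<open>G = G(A)\<close>, the map \<open>\<epsilon>\<close> from \<open>X\<close> to the terminal object, and
  \<open>u = (e \<epsilon>, id) : X \<rightarrow> G \<times> X\<close>, \<open>b = G \<times> act\<close>, \<open>d = \<mu> \<times> X : G \<times> (G \<times> X) \<rightarrow> G \<times> X\<close>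
  (with the auxiliary \<open>c : G \<times> (G \<times> X) \<rightarrow> G \<times> G\<close>).
\<close>

definition group_fan_action ::
  "'a monoid \<Rightarrow> ('x, 'm) mspace \<Rightarrow>
   ('a set \<times> 'x, ('a set, 'a spec_sec, 'x, 'm) prod_sec, 'x, 'm) morphism \<Rightarrow> bool" where
  "group_fan_action A X act \<longleftrightarrow>
     arrow Fans act \<and> src act = mprod (group_fan A) X \<and> tgt act = X \<and>
     (\<exists>e \<epsilon> u. group_fan_unit A e \<and>
        ms_morphism \<epsilon> \<and> src \<epsilon> = X \<and> tgt \<epsilon> = Spec (singleton_group ()) \<and>
        is_pairing (e \<odot> \<epsilon>) (mor_id X) u \<and>
        act \<odot> u \<approx> mor_id X) \<and>
     (let G = group_fan A; p1 = proj1 G (mprod G X); p2 = proj2 G (mprod G X) in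
      \<exists>\<mu> b c d. group_fan_mult A \<mu> \<and>
        is_pairing p1 (act \<odot> p2) b \<and>
        is_pairing p1 (proj1 G X \<odot> p2) c \<and>
        is_pairing (\<mu> \<odot> c) (proj2 G X \<odot> p2) d \<and>
        act \<odot> b \<approx> act \<odot> d)"

text \<open>
  The universal property is tested on the objects with points in \<open>'t\<close> and sections in \<open>'k\<close>;
  the type argument records \<open>'t\<close> and \<open>'k\<close>. Two coequalizers whose targets lie in such a class
  of test objects are isomorphic as soon as both are tested on this class.
\<close>

definition coequalizer ::
  "category \<Rightarrow> ('t \<times> 'k) itself \<Rightarrow> ('z, 'j, 'x, 'm) morphism \<Rightarrow> ('z, 'j, 'x, 'm) morphism \<Rightarrow>
   ('x, 'm, 'y, 'n) morphism \<Rightarrow> bool" where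
  "coequalizer C _ a b q \<longleftrightarrow>
     arrow C a \<and> arrow C b \<and> src a = src b \<and> tgt a = tgt b \<and>
     arrow C q \<and> src q = tgt a \<and> q \<odot> a \<approx> q \<odot> b \<and>
     (\<forall>t :: ('x, 'm, 't, 'k) morphism.
        arrow C t \<and> src t = tgt a \<and> t \<odot> a \<approx> t \<odot> b \<longrightarrow>
        (\<exists>h. arrow C h \<and> src h = tgt q \<and> tgt h = tgt t \<and> h \<odot> q \<approx> t \<and>
           (\<forall>h'. arrow C h' \<and> src h' = tgt q \<and> tgt h' = tgt t \<and> h' \<odot> q \<approx> t \<longrightarrow> h' \<approx> h)))"

definition categorical_quotient ::
  "category \<Rightarrow> ('t \<times> 'k) itself \<Rightarrow> 'a monoid \<Rightarrow> ('x, 'm) mspace \<Rightarrow>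
   ('a set \<times> 'x, ('a set, 'a spec_sec, 'x, 'm) prod_sec, 'x, 'm) morphism \<Rightarrow>
   ('x, 'm, 'y, 'n) morphism \<Rightarrow> bool" where
  "categorical_quotient C T A X act q \<longleftrightarrow> coequalizer C T act (proj2 (group_fan A) X) q"

end

theory Submission
  imports Defs
begin

text \<open>
  The unit law forces the action on sections to be \<open>m \<mapsto> (\<chi> m, m)\<close> with \<open>\<chi> m\<close> a locally constant
  function into a stalk of the group fan, which is a torsion group; on points the action is the
  projection. So the quotient in \<open>MS\<close> is the space \<open>X\<close> with the subsheaf of the sections \<open>m\<close> with
  \<open>\<chi> m = 1\<close>. An affine piece of \<open>X\<close> has a point whose only neighbourhood is the whole piece, so
  \<open>\<chi> m\<close> is constant there and a power of \<open>m\<close> lies in the subsheaf. Since an element and its powers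
  lie in the same faces, the subsheaf gives the piece the structure of the spectrum of the kernel of
  \<open>\<chi>\<close>. Inverses of sections of the subsheaf are again in the subsheaf, which makes the quotient map
  local, and locality of the maps induced on the quotient follows.
\<close>

text \<open>A sheaf map out of an inverse image acts on families of germs, which is clumsy to
  compute with. By adjunction it amounts to a compatible family of maps from the sections of the
  target over \<open>V\<close> to the sections of the source over the preimage of \<open>V\<close>;
  the arguments are carried out with these maps, and invertibility of a germ is likewise expressed
  by sections (\<open>unit_at\<close>). The definition of a fan asks for an isomorphism with a
  spectrum, and producing one directly for the subsheaf would mean comparing localizations of two
  monoids. The predicate \<open>affine\<close> avoids this: it describes affine pieces by unit loci,
  by faces, and by extension of sections after multiplication with powers, and these conditions pass
  to the subsheaf by taking powers. A coequalizer is determined only up to isomorphism and its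
  target may live over other types, so being a quotient is formulated without a model
  (\<open>is_quotient\<close>), and a given coequalizer is compared with the subsheaf through its
  universal property.\<close>

abbreviation opn :: "('x, 'm) mspace \<Rightarrow> 'x set \<Rightarrow> bool" where
  "opn X \<equiv> openin (pts X)"

abbreviation sec :: "('x, 'm) mspace \<Rightarrow> 'x set \<Rightarrow> 'm monoid" where
  "sec X \<equiv> sections (shf X)"

abbreviation res :: "('x, 'm) mspace \<Rightarrow> 'x set \<Rightarrow> 'x set \<Rightarrow> 'm \<Rightarrow> 'm" where
  "res X \<equiv> restr (shf X)"

abbreviation gm :: "('x, 'm) mspace \<Rightarrow> 'x \<Rightarrow> 'x set \<Rightarrow> 'm \<Rightarrow> ('x set \<times> 'm) set" where
  "gm X \<equiv> germ (pts X) (shf X)"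

abbreviation stk :: "('x, 'm) mspace \<Rightarrow> 'x \<Rightarrow> ('x set \<times> 'm) set monoid" where
  "stk X \<equiv> stalk (pts X) (shf X)"

abbreviation pre :: "('x, 'm) mspace \<Rightarrow> ('x \<Rightarrow> 'y) \<Rightarrow> 'y set \<Rightarrow> 'x set" where
  "pre X f V \<equiv> {x \<in> topspace (pts X). f x \<in> V}"

section \<open>Homomorphisms and units of monoids\<close>

lemma monoid_homI:
  assumes "\<And>x. x \<in> carrier P \<Longrightarrow> h x \<in> carrier Q"
    and "\<And>x y. x \<in> carrier P \<Longrightarrow> y \<in> carrier P \<Longrightarrow> h (x \<otimes>\<^bsub>P\<^esub> y) = h x \<otimes>\<^bsub>Q\<^esub> h y"
    and "h \<one>\<^bsub>P\<^esub> = \<one>\<^bsub>Q\<^esub>"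
  shows "monoid_hom P Q h"
  using assms by (auto simp: monoid_hom_def hom_def)

lemma monoid_hom_closed: "monoid_hom P Q h \<Longrightarrow> x \<in> carrier P \<Longrightarrow> h x \<in> carrier Q"
  and monoid_hom_mult: "monoid_hom P Q h \<Longrightarrow> x \<in> carrier P \<Longrightarrow> y \<in> carrier P \<Longrightarrow> h (x \<otimes>\<^bsub>P\<^esub> y) = h x \<otimes>\<^bsub>Q\<^esub> h y"
  and monoid_hom_one: "monoid_hom P Q h \<Longrightarrow> h \<one>\<^bsub>P\<^esub> = \<one>\<^bsub>Q\<^esub>"
  by (auto simp: monoid_hom_def hom_def)

lemma monoid_hom_pow:
  assumes "monoid_hom P Q h" "monoid P" "monoid Q" "x \<in> carrier P"
  shows "h (x [^]\<^bsub>P\<^esub> (n::nat)) = h x [^]\<^bsub>Q\<^esub> n"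
proof (induction n)
  case 0
  show ?case
    using assms(1) by (simp add: monoid_hom_one)
next
  case (Suc n)
  then show ?case
    using assms by (simp add: monoid_hom_mult monoid.nat_pow_closed)
qed

lemma monoid_hom_Units:
  assumes "monoid_hom P Q h" "x \<in> Units P"
  shows "h x \<in> Units Q"
proof -
  obtain y where "y \<in> carrier P" "x \<in> carrier P" "y \<otimes>\<^bsub>P\<^esub> x = \<one>\<^bsub>P\<^esub>" "x \<otimes>\<^bsub>P\<^esub> y = \<one>\<^bsub>P\<^esub>"
    using assms(2) by (auto simp: Units_def)
  then show ?thesis
    using assms(1) unfolding Units_def
    by (auto intro!: bexI[of _ "h y"] simp: monoid_hom_closed monoid_hom_mult[symmetric] monoid_hom_one)
qed

lemma comm_monoid_UnitsI:
  assumes "comm_monoid P" "x \<in> carrier P" "y \<in> carrier P" "x \<otimes>\<^bsub>P\<^esub> y = \<one>\<^bsub>P\<^esub>"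
  shows "x \<in> Units P"
  using assms comm_monoid.m_comm[OF assms(1-3)] by (auto simp: Units_def)

text \<open>Operations on fractions and germs are defined as unions over all representatives. Once
  the value is shown to be the same for every representative, the union over a nonempty class
  collapses to that value.\<close>

lemma UN_pair_const:
  assumes "(a0, b0) \<in> A" and "\<And>a b. (a, b) \<in> A \<Longrightarrow> F a b = K"
  shows "(\<Union>(a, b)\<in>A. F a b) = K"
proof -
  have "F (fst p) (snd p) = K" if "p \<in> A" for p
    using assms(2)[of "fst p" "snd p"] that by simp
  then show ?thesis
    using assms(1) by (auto simp: case_prod_beta)
qed

lemma UN_pair_const2:
  assumes "(a0, b0) \<in> A" "(c0, d0) \<in> B"
    and "\<And>a b c d. (a, b) \<in> A \<Longrightarrow> (c, d) \<in> B \<Longrightarrow> F a b c d = K"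
  shows "(\<Union>(a, b)\<in>A. \<Union>(c, d)\<in>B. F a b c d) = K"
proof -
  have "F (fst p) (snd p) (fst r) (snd r) = K" if "p \<in> A" "r \<in> B" for p r
    using assms(3)[of "fst p" "snd p" "fst r" "snd r"] that by simp
  then show ?thesis
    using assms(1,2) by (auto simp: case_prod_beta)
qed

section \<open>Sheaves\<close>

lemma sec_comm_monoid: "monoidal_space X \<Longrightarrow> opn X U \<Longrightarrow> comm_monoid (sec X U)"
  by (simp add: monoidal_space_def monoid_sheaf_def monoid_presheaf_def)

lemma sec_monoid: "monoidal_space X \<Longrightarrow> opn X U \<Longrightarrow> monoid (sec X U)"
  by (rule comm_monoid.axioms(1)[OF sec_comm_monoid])

lemma res_hom:
  "monoidal_space X \<Longrightarrow> opn X U \<Longrightarrow> opn X V \<Longrightarrow> V \<subseteq> U \<Longrightarrow> monoid_hom (sec X U) (sec X V) (res X U V)"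
  by (simp add: monoidal_space_def monoid_sheaf_def monoid_presheaf_def)

lemmas res_closed = monoid_hom_closed[OF res_hom]
  and res_mult = monoid_hom_mult[OF res_hom]
  and res_one = monoid_hom_one[OF res_hom]

lemma res_id: "monoidal_space X \<Longrightarrow> opn X U \<Longrightarrow> s \<in> carrier (sec X U) \<Longrightarrow> res X U U s = s"
  by (simp add: monoidal_space_def monoid_sheaf_def monoid_presheaf_def)

lemma res_res:
  "monoidal_space X \<Longrightarrow> opn X U \<Longrightarrow> opn X V \<Longrightarrow> opn X W \<Longrightarrow> W \<subseteq> V \<Longrightarrow> V \<subseteq> U \<Longrightarrow> s \<in> carrier (sec X U) \<Longrightarrow>
   res X V W (res X U V s) = res X U W s"
  by (simp add: monoidal_space_def monoid_sheaf_def monoid_presheaf_def)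

lemma opn_subset: "opn X U \<Longrightarrow> U \<subseteq> topspace (pts X)"
  by (rule openin_subset)

lemma monoidal_spaceI:
  assumes "monoid_presheaf (pts X) (shf X)"
    and "\<And>\<U> \<sigma>. \<forall>V\<in>\<U>. opn X V \<and> \<sigma> V \<in> carrier (sec X V) \<Longrightarrow>
      \<forall>V\<in>\<U>. \<forall>W\<in>\<U>. res X V (V \<inter> W) (\<sigma> V) = res X W (V \<inter> W) (\<sigma> W) \<Longrightarrow>
      \<exists>!s. s \<in> carrier (sec X (\<Union>\<U>)) \<and> (\<forall>V\<in>\<U>. res X (\<Union>\<U>) V s = \<sigma> V)"
  shows "monoidal_space X"
  unfolding monoidal_space_def monoid_sheaf_def
proof (intro conjI allI impI assms(1), elim conjE)
  fix \<U> \<sigma>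
  assume "\<forall>V\<in>\<U>. opn X V \<and> \<sigma> V \<in> carrier (sec X V)"
    and "\<forall>V\<in>\<U>. \<forall>W\<in>\<U>. res X V (V \<inter> W) (\<sigma> V) = res X W (V \<inter> W) (\<sigma> W)"
  then show "\<exists>!s. s \<in> carrier (sec X (\<Union>\<U>)) \<and> (\<forall>V\<in>\<U>. res X (\<Union>\<U>) V s = \<sigma> V)"
    by (rule assms(2))
qed

text \<open>The sheaf axiom indexes sections by the open sets themselves, whereas here two indices
  may carry the same open set. Compatibility on \<open>U i \<inter> U j\<close> with
  \<open>U i = U j\<close> forces the two sections to be equal, so choosing any index for an open
  set is harmless.\<close>

lemma sheaf_glue_ex1:
  assumes X: "monoidal_space X"
    and s: "\<And>i. i \<in> I \<Longrightarrow> opn X (U i)" "\<And>i. i \<in> I \<Longrightarrow> s i \<in> carrier (sec X (U i))"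
    and eq: "\<And>i j. i \<in> I \<Longrightarrow> j \<in> I \<Longrightarrow> res X (U i) (U i \<inter> U j) (s i) = res X (U j) (U i \<inter> U j) (s j)"
  shows "\<exists>!t. t \<in> carrier (sec X (\<Union>i\<in>I. U i)) \<and> (\<forall>i\<in>I. res X (\<Union>i\<in>I. U i) (U i) t = s i)"
proof -
  define \<sigma> where "\<sigma> V = s (SOME i. i \<in> I \<and> U i = V)" for V
  have \<sigma>: "\<sigma> (U i) = s i" if "i \<in> I" for i
  proof -
    have j: "(SOME j. j \<in> I \<and> U j = U i) \<in> I \<and> U (SOME j. j \<in> I \<and> U j = U i) = U i"
      by (rule someI[of _ i]) (use that in auto)
    show ?thesis
      unfolding \<sigma>_def using j eq[of i "SOME j. j \<in> I \<and> U j = U i"] that s X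
      by (metis inf.idem res_id)
  qed
  have "\<exists>!t. t \<in> carrier (sec X (\<Union>(U ` I))) \<and> (\<forall>V\<in>U ` I. res X (\<Union>(U ` I)) V t = \<sigma> V)"
    by (rule conjunct2[OF X[unfolded monoidal_space_def monoid_sheaf_def], rule_format, of "U ` I" \<sigma>])
      (use s \<sigma> eq in auto)
  then show ?thesis
    using \<sigma> by (simp cong: ball_cong)
qed

text \<open>Both \<open>s\<close> and \<open>t\<close> glue the restrictions of \<open>s\<close> to
  the open sets on which the two agree; these sets cover \<open>U\<close>, so the uniqueness half of
  the sheaf axiom applies.\<close>

lemma sheaf_sep:
  assumes X: "monoidal_space X" and U: "opn X U"
    and st: "s \<in> carrier (sec X U)" "t \<in> carrier (sec X U)"
    and loc: "\<And>x. x \<in> U \<Longrightarrow> \<exists>W. opn X W \<and> x \<in> W \<and> W \<subseteq> U \<and> res X U W s = res X U W t"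
  shows "s = t"
proof -
  define I where "I = {W. opn X W \<and> W \<subseteq> U \<and> res X U W s = res X U W t}"
  have UI: "(\<Union>W\<in>I. W) = U"
    using loc unfolding I_def by blast
  have "\<exists>!r. r \<in> carrier (sec X (\<Union>W\<in>I. W)) \<and> (\<forall>W\<in>I. res X (\<Union>W\<in>I. W) W r = res X U W s)"
  proof (rule sheaf_glue_ex1[OF X])
    fix V W assume "V \<in> I" "W \<in> I"
    then show "res X V (V \<inter> W) (res X U V s) = res X W (V \<inter> W) (res X U W s)"
      using X U st by (auto simp: I_def res_res openin_Int)
  qed (use X U st in \<open>auto simp: I_def res_closed\<close>)
  then show ?thesis
    unfolding UI using st by (auto simp: I_def)
qed

text \<open>Agreement is required only near each point of an overlap, which is the form available
  when sections are compared by germs; separatedness over \<open>U i \<inter> U j\<close> upgrades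
  it to agreement on the whole overlap.\<close>

lemma sheaf_glue:
  assumes X: "monoidal_space X"
    and s: "\<And>i. i \<in> I \<Longrightarrow> opn X (U i)" "\<And>i. i \<in> I \<Longrightarrow> s i \<in> carrier (sec X (U i))"
    and eq: "\<And>i j x. i \<in> I \<Longrightarrow> j \<in> I \<Longrightarrow> x \<in> U i \<Longrightarrow> x \<in> U j \<Longrightarrow>
      \<exists>W. opn X W \<and> x \<in> W \<and> W \<subseteq> U i \<and> W \<subseteq> U j \<and> res X (U i) W (s i) = res X (U j) W (s j)"
  obtains t where "t \<in> carrier (sec X (\<Union>i\<in>I. U i))" "\<And>i. i \<in> I \<Longrightarrow> res X (\<Union>i\<in>I. U i) (U i) t = s i"
proof -
  have "\<exists>!t. t \<in> carrier (sec X (\<Union>i\<in>I. U i)) \<and> (\<forall>i\<in>I. res X (\<Union>i\<in>I. U i) (U i) t = s i)"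
  proof (rule sheaf_glue_ex1[OF X s])
    fix i j assume ij: "i \<in> I" "j \<in> I"
    show "res X (U i) (U i \<inter> U j) (s i) = res X (U j) (U i \<inter> U j) (s j)"
    proof (rule sheaf_sep[OF X])
      fix x assume "x \<in> U i \<inter> U j"
      then obtain W where "opn X W \<and> x \<in> W \<and> W \<subseteq> U i \<and> W \<subseteq> U j \<and> res X (U i) W (s i) = res X (U j) W (s j)"
        using eq[OF ij, of x] by blast
      then show "\<exists>W. opn X W \<and> x \<in> W \<and> W \<subseteq> U i \<inter> U j \<and>
          res X (U i \<inter> U j) W (res X (U i) (U i \<inter> U j) (s i)) =
          res X (U i \<inter> U j) W (res X (U j) (U i \<inter> U j) (s j))"
        using ij s X by (intro exI[of _ W]) (auto simp: res_res openin_Int)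
    qed (use ij s X in \<open>auto simp: res_closed openin_Int\<close>)
  qed auto
  then show ?thesis
    using that by blast
qed


section \<open>Germs and stalks\<close>

lemma germ_mem_iff:
  "(V, t) \<in> gm X x U s \<longleftrightarrow> opn X V \<and> x \<in> V \<and> t \<in> carrier (sec X V) \<and>
     (\<exists>W. opn X W \<and> x \<in> W \<and> W \<subseteq> U \<and> W \<subseteq> V \<and> res X U W s = res X V W t)"
  by (auto simp: germ_def)

lemma germ_self_mem:
  "opn X U \<Longrightarrow> x \<in> U \<Longrightarrow> s \<in> carrier (sec X U) \<Longrightarrow> (U, s) \<in> gm X x U s"
  by (auto simp: germ_mem_iff)

text \<open>A germ is the full set of its representatives, so the claim is that agreeing near
  \<open>x\<close> is an equivalence relation; for transitivity the two neighbourhoods of agreement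
  are intersected.\<close>

lemma germ_eq_iff:
  assumes X: "monoidal_space X" and U: "opn X U" "x \<in> U" "s \<in> carrier (sec X U)"
    and V: "opn X V" "x \<in> V" "t \<in> carrier (sec X V)"
  shows "gm X x U s = gm X x V t \<longleftrightarrow>
    (\<exists>W. opn X W \<and> x \<in> W \<and> W \<subseteq> U \<and> W \<subseteq> V \<and> res X U W s = res X V W t)" (is "_ \<longleftrightarrow> ?R U s V t")
proof
  assume "gm X x U s = gm X x V t"
  then have "(V, t) \<in> gm X x U s"
    using germ_self_mem[OF V] by simp
  then show "?R U s V t"
    by (simp add: germ_mem_iff)
next
  have *: "gm X x V t \<subseteq> gm X x U s"
    if R: "?R U s V t" and U: "opn X U" "x \<in> U" "s \<in> carrier (sec X U)"
      and V: "opn X V" "x \<in> V" "t \<in> carrier (sec X V)" for U s V t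
  proof (rule subsetI, clarify)
    fix V' t' assume "(V', t') \<in> gm X x V t"
    then obtain W' where V': "opn X V'" "x \<in> V'" "t' \<in> carrier (sec X V')"
      and W': "opn X W'" "x \<in> W'" "W' \<subseteq> V" "W' \<subseteq> V'" "res X V W' t = res X V' W' t'"
      by (auto simp: germ_mem_iff)
    from R obtain W where W: "opn X W" "x \<in> W" "W \<subseteq> U" "W \<subseteq> V" "res X U W s = res X V W t"
      by blast
    have "res X U (W \<inter> W') s = res X V (W \<inter> W') t"
      using res_res[OF X U(1) W(1), of "W \<inter> W'" s] res_res[OF X V(1) W(1), of "W \<inter> W'" t] W W' U V
      by (simp add: openin_Int)
    also have "\<dots> = res X V' (W \<inter> W') t'"
      using res_res[OF X V(1) W'(1), of "W \<inter> W'" t] res_res[OF X V'(1) W'(1), of "W \<inter> W'" t'] W W' V V'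
      by (simp add: openin_Int)
    finally have "res X U (W \<inter> W') s = res X V' (W \<inter> W') t'" .
    then show "(V', t') \<in> gm X x U s"
      unfolding germ_mem_iff using V' W W' by (intro conjI exI[of _ "W \<inter> W'"] openin_Int) auto
  qed
  assume R: "?R U s V t"
  then obtain W where "opn X W" "x \<in> W" "W \<subseteq> U" "W \<subseteq> V" "res X U W s = res X V W t"
    by blast
  then have "?R V t U s"
    by (intro exI[of _ W]) simp
  with R show "gm X x U s = gm X x V t"
    using *[OF _ U V] *[OF _ V U] by blast
qed

lemma germ_eqI:
  assumes "monoidal_space X" "opn X U" "s \<in> carrier (sec X U)" "opn X V" "t \<in> carrier (sec X V)"
    "opn X W" "x \<in> W" "W \<subseteq> U" "W \<subseteq> V" "res X U W s = res X V W t"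
  shows "gm X x U s = gm X x V t"
  using assms by (subst germ_eq_iff) auto

lemma germ_mem_eq:
  assumes "monoidal_space X" "opn X U" "x \<in> U" "s \<in> carrier (sec X U)" "(V, t) \<in> gm X x U s"
  shows "gm X x V t = gm X x U s"
  using assms by (subst eq_commute) (auto simp: germ_eq_iff germ_mem_iff)

lemma germ_res:
  assumes "monoidal_space X" "opn X U" "opn X V" "x \<in> V" "V \<subseteq> U" "s \<in> carrier (sec X U)"
  shows "gm X x V (res X U V s) = gm X x U s"
  using assms by (intro germ_eqI[where W = V]) (auto simp: res_closed res_res)

lemma germ_in_stalk:
  "opn X U \<Longrightarrow> x \<in> U \<Longrightarrow> s \<in> carrier (sec X U) \<Longrightarrow> gm X x U s \<in> carrier (stk X x)"
  by (auto simp: stalk_def)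

lemma stalk_cases:
  assumes "g \<in> carrier (stk X x)"
  obtains U s where "opn X U" "x \<in> U" "s \<in> carrier (sec X U)" "g = gm X x U s"
  using assms by (auto simp: stalk_def)

text \<open>The product is a union over all pairs of representatives. Any two such pairs agree over
  the intersection of two neighbourhoods of agreement, hence have products with the same
  germ.\<close>

lemma stalk_mult:
  assumes X: "monoidal_space X" and U: "opn X U" "x \<in> U" "s \<in> carrier (sec X U)"
    and V: "opn X V" "x \<in> V" "t \<in> carrier (sec X V)"
  shows "gm X x U s \<otimes>\<^bsub>stk X x\<^esub> gm X x V t =
    gm X x (U \<inter> V) (res X U (U \<inter> V) s \<otimes>\<^bsub>sec X (U \<inter> V)\<^esub> res X V (U \<inter> V) t)" (is "_ = ?g U s V t")
proof -
  have eq: "?g U' s' V' t' = ?g U s V t"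
    if "(U', s') \<in> gm X x U s" "(V', t') \<in> gm X x V t" for U' s' V' t'
  proof -
    from that(1) obtain W where U': "opn X U'" "x \<in> U'" "s' \<in> carrier (sec X U')"
      and W: "opn X W" "x \<in> W" "W \<subseteq> U" "W \<subseteq> U'" "res X U W s = res X U' W s'"
      by (auto simp: germ_mem_iff)
    from that(2) obtain W' where V': "opn X V'" "x \<in> V'" "t' \<in> carrier (sec X V')"
      and W': "opn X W'" "x \<in> W'" "W' \<subseteq> V" "W' \<subseteq> V'" "res X V W' t = res X V' W' t'"
      by (auto simp: germ_mem_iff)
    let ?W = "W \<inter> W'"
    have o: "opn X ?W" "opn X (U \<inter> V)" "opn X (U' \<inter> V')"
      using U V U' V' W W' by (auto intro: openin_Int)
    have 1: "res X U' ?W s' = res X U ?W s"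
      using res_res[OF X U(1) W(1) o(1) _ _ U(3)] res_res[OF X U'(1) W(1) o(1) _ _ U'(3)] W by auto
    have 2: "res X V' ?W t' = res X V ?W t"
      using res_res[OF X V(1) W'(1) o(1) _ _ V(3)] res_res[OF X V'(1) W'(1) o(1) _ _ V'(3)] W' by auto
    have c: "res X U (U \<inter> V) s \<in> carrier (sec X (U \<inter> V))" "res X V (U \<inter> V) t \<in> carrier (sec X (U \<inter> V))"
      "res X U' (U' \<inter> V') s' \<in> carrier (sec X (U' \<inter> V'))" "res X V' (U' \<inter> V') t' \<in> carrier (sec X (U' \<inter> V'))"
      using X U V U' V' o by (auto intro: res_closed)
    show ?thesis
    proof (rule germ_eqI[OF X o(3) _ o(2) _ o(1)])
      show "res X (U' \<inter> V') ?W (res X U' (U' \<inter> V') s' \<otimes>\<^bsub>sec X (U' \<inter> V')\<^esub> res X V' (U' \<inter> V') t') =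
        res X (U \<inter> V) ?W (res X U (U \<inter> V) s \<otimes>\<^bsub>sec X (U \<inter> V)\<^esub> res X V (U \<inter> V) t)"
        apply (subst res_mult[OF X o(3,1) _ c(3,4)])
        using W W' apply blast
        apply (subst res_mult[OF X o(2,1) _ c(1,2)])
        using W W' apply blast
        apply (subst res_res[OF X U'(1) o(3,1) _ _ U'(3)])
        using W W' apply (blast, blast)
        apply (subst res_res[OF X V'(1) o(3,1) _ _ V'(3)])
        using W W' apply (blast, blast)
        apply (subst res_res[OF X U(1) o(2,1) _ _ U(3)])
        using W W' apply (blast, blast)
        apply (subst res_res[OF X V(1) o(2,1) _ _ V(3)])
        using W W' apply (blast, blast)
        using 1 2 by simp
    qed (use U V U' V' W W' o c in \<open>auto intro!: monoid.m_closed[OF sec_monoid[OF X]]\<close>)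
  qed
  have "(\<Union>(U', s')\<in>gm X x U s. \<Union>(V', t')\<in>gm X x V t. ?g U' s' V' t') = ?g U s V t"
    using germ_self_mem[OF U] germ_self_mem[OF V] eq by (rule UN_pair_const2)
  then show ?thesis
    by (simp add: stalk_def)
qed

lemma stalk_mult_same:
  assumes "monoidal_space X" "opn X U" "x \<in> U" "s \<in> carrier (sec X U)" "t \<in> carrier (sec X U)"
  shows "gm X x U s \<otimes>\<^bsub>stk X x\<^esub> gm X x U t = gm X x U (s \<otimes>\<^bsub>sec X U\<^esub> t)"
  using assms by (simp add: stalk_mult res_id)

lemma stalk_one:
  assumes "monoidal_space X" "opn X U" "x \<in> U"
  shows "\<one>\<^bsub>stk X x\<^esub> = gm X x U \<one>\<^bsub>sec X U\<^esub>"
proof -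
  have "opn X (topspace (pts X))" "U \<subseteq> topspace (pts X)"
    using opn_subset[OF assms(2)] by auto
  then show ?thesis
    using assms sec_monoid[OF assms(1)]
    by (simp add: stalk_def germ_eqI[where W = U] res_one monoid.one_closed)
qed

lemma stalk_common:
  assumes X: "monoidal_space X" and g: "g \<in> carrier (stk X x)" and h: "h \<in> carrier (stk X x)"
  obtains U s t where "opn X U" "x \<in> U" "s \<in> carrier (sec X U)" "t \<in> carrier (sec X U)"
    "g = gm X x U s" "h = gm X x U t"
proof -
  obtain U s where U: "opn X U" "x \<in> U" "s \<in> carrier (sec X U)" "g = gm X x U s"
    using g by (rule stalk_cases)
  obtain V t where V: "opn X V" "x \<in> V" "t \<in> carrier (sec X V)" "h = gm X x V t"
    using h by (rule stalk_cases)
  have "opn X (U \<inter> V)"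
    using U V by (auto intro: openin_Int)
  with U V X show ?thesis
    by (intro that[of "U \<inter> V" "res X U (U \<inter> V) s" "res X V (U \<inter> V) t"]) (auto simp: res_closed germ_res)
qed

text \<open>Each law involves at most three germs. They are represented over one common
  neighbourhood, where the law holds for sections.\<close>

lemma stalk_comm_monoid:
  assumes X: "monoidal_space X" and x: "x \<in> topspace (pts X)"
  shows "comm_monoid (stk X x)"
proof (rule comm_monoidI)
  note m = monoid.m_closed[OF sec_monoid[OF X]]
  fix g h assume gh: "g \<in> carrier (stk X x)" "h \<in> carrier (stk X x)"
  then obtain U s t where U: "opn X U" "x \<in> U" "s \<in> carrier (sec X U)" "t \<in> carrier (sec X U)"
    "g = gm X x U s" "h = gm X x U t"
    using stalk_common[OF X] by blast
  note U' = U(1-4)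
  interpret comm_monoid "sec X U" by (rule sec_comm_monoid[OF X U(1)])
  show "g \<otimes>\<^bsub>stk X x\<^esub> h \<in> carrier (stk X x)"
    using X U' by (simp add: U stalk_mult_same germ_in_stalk)
  show "g \<otimes>\<^bsub>stk X x\<^esub> h = h \<otimes>\<^bsub>stk X x\<^esub> g"
    using X U' by (simp add: U stalk_mult_same m_comm)
  show "\<one>\<^bsub>stk X x\<^esub> \<otimes>\<^bsub>stk X x\<^esub> g = g"
    using X U' by (simp add: U stalk_one[OF X U(1,2)] stalk_mult_same)
  fix k assume "k \<in> carrier (stk X x)"
  then obtain V r where V: "opn X V" "x \<in> V" "r \<in> carrier (sec X V)" "k = gm X x V r"
    by (rule stalk_cases)
  let ?W = "U \<inter> V"
  have W: "opn X ?W" "x \<in> ?W" "?W \<subseteq> U" "?W \<subseteq> V"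
    using U V by (auto intro: openin_Int)
  interpret W: comm_monoid "sec X ?W" by (rule sec_comm_monoid[OF X W(1)])
  define s' t' r' where "s' = res X U ?W s" "t' = res X U ?W t" "r' = res X V ?W r"
  have c: "s' \<in> carrier (sec X ?W)" "t' \<in> carrier (sec X ?W)" "r' \<in> carrier (sec X ?W)"
    using X U V W by (auto simp: s'_t'_r'_def res_closed)
  have "g = gm X x ?W s'" "h = gm X x ?W t'" "k = gm X x ?W r'"
    using X U' V(1-3) W by (simp_all add: s'_t'_r'_def U(5,6) V(4) germ_res)
  then show "g \<otimes>\<^bsub>stk X x\<^esub> h \<otimes>\<^bsub>stk X x\<^esub> k = g \<otimes>\<^bsub>stk X x\<^esub> (h \<otimes>\<^bsub>stk X x\<^esub> k)"
    using X W c by (simp add: stalk_mult_same W.m_assoc)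
next
  show "\<one>\<^bsub>stk X x\<^esub> \<in> carrier (stk X x)"
    using X x monoid.one_closed[OF sec_monoid[OF X]]
    by (subst stalk_one[of _ "topspace (pts X)"]) (auto intro!: germ_in_stalk)
qed

section \<open>Invertibility of a section at a point\<close>

definition unit_at :: "('x, 'm) mspace \<Rightarrow> 'x set \<Rightarrow> 'm \<Rightarrow> 'x \<Rightarrow> bool" where
  "unit_at X U s x \<longleftrightarrow> (\<exists>W. opn X W \<and> x \<in> W \<and> W \<subseteq> U \<and> res X U W s \<in> Units (sec X W))"

text \<open>An inverse germ is represented near \<open>x\<close>, and the relation that the product
  is \<open>\<one>\<close> holds on a possibly smaller neighbourhood. This lets locality of
  morphisms be treated without stalks.\<close>

lemma germ_Units_iff:
  assumes X: "monoidal_space X" and U: "opn X U" "x \<in> U" "s \<in> carrier (sec X U)"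
  shows "gm X x U s \<in> Units (stk X x) \<longleftrightarrow> unit_at X U s x"
proof
  assume "gm X x U s \<in> Units (stk X x)"
  then obtain h where h: "h \<in> carrier (stk X x)" "gm X x U s \<otimes>\<^bsub>stk X x\<^esub> h = \<one>\<^bsub>stk X x\<^esub>"
    by (auto simp: Units_def)
  obtain V t where V: "opn X V" "x \<in> V" "t \<in> carrier (sec X V)" "h = gm X x V t"
    using h(1) by (rule stalk_cases)
  let ?W = "U \<inter> V"
  have W: "opn X ?W" "x \<in> ?W" "?W \<subseteq> U" "?W \<subseteq> V"
    using U V by (auto intro: openin_Int)
  define s' t' where "s' = res X U ?W s" "t' = res X V ?W t"
  have c: "s' \<in> carrier (sec X ?W)" "t' \<in> carrier (sec X ?W)"
    using X U V W by (auto simp: s'_t'_def res_closed)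
  have eq: "gm X x U s = gm X x ?W s'" "h = gm X x ?W t'"
    using X U V(1-3) W by (simp_all add: s'_t'_def V(4) germ_res)
  interpret W: comm_monoid "sec X ?W" by (rule sec_comm_monoid[OF X W(1)])
  have "gm X x ?W (s' \<otimes>\<^bsub>sec X ?W\<^esub> t') = gm X x ?W \<one>\<^bsub>sec X ?W\<^esub>"
    using h(2) X W c by (simp add: eq stalk_mult_same stalk_one[OF X W(1,2)])
  then obtain W' where W': "opn X W'" "x \<in> W'" "W' \<subseteq> ?W"
    "res X ?W W' (s' \<otimes>\<^bsub>sec X ?W\<^esub> t') = res X ?W W' \<one>\<^bsub>sec X ?W\<^esub>"
    using X W c by (subst (asm) germ_eq_iff) auto
  have "res X ?W W' s' \<otimes>\<^bsub>sec X W'\<^esub> res X ?W W' t' = \<one>\<^bsub>sec X W'\<^esub>"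
    using W' X W c by (simp add: res_mult res_one)
  then have "res X ?W W' s' \<in> Units (sec X W')"
    using X W W' c by (intro comm_monoid_UnitsI[of _ _ "res X ?W W' t'"] sec_comm_monoid res_closed[of X ?W]) auto
  moreover have "res X ?W W' s' = res X U W' s"
    unfolding s'_t'_def using W' by (intro res_res[OF X U(1) W(1) _ _ _ U(3)]) auto
  ultimately show "unit_at X U s x"
    using W' by (auto simp: unit_at_def)
next
  assume "unit_at X U s x"
  then obtain W where W: "opn X W" "x \<in> W" "W \<subseteq> U" "res X U W s \<in> Units (sec X W)"
    by (auto simp: unit_at_def)
  then obtain t where t: "t \<in> carrier (sec X W)" "res X U W s \<otimes>\<^bsub>sec X W\<^esub> t = \<one>\<^bsub>sec X W\<^esub>"
    by (auto simp: Units_def)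
  have "gm X x U s = gm X x W (res X U W s)"
    using X U W by (simp add: germ_res)
  then have "gm X x U s \<otimes>\<^bsub>stk X x\<^esub> gm X x W t = \<one>\<^bsub>stk X x\<^esub>"
    using X U W t by (simp add: stalk_mult_same res_closed stalk_one[OF X W(1,2)])
  moreover have "x \<in> topspace (pts X)"
    using U opn_subset by blast
  ultimately show "gm X x U s \<in> Units (stk X x)"
    using X U W t by (intro comm_monoid_UnitsI[of _ _ "gm X x W t"] stalk_comm_monoid germ_in_stalk)
qed

lemma unit_at_res:
  assumes X: "monoidal_space X" and UV: "opn X U" "opn X V" "V \<subseteq> U" "x \<in> V" "s \<in> carrier (sec X U)"
  shows "unit_at X V (res X U V s) x \<longleftrightarrow> unit_at X U s x"
proof -
  have "gm X x V (res X U V s) = gm X x U s"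
    using X UV by (simp add: germ_res)
  then show ?thesis
    using germ_Units_iff[OF X UV(2,4) res_closed[OF X UV(1,2,3,5)]] germ_Units_iff[OF X UV(1) _ UV(5)] UV
    by auto
qed

text \<open>Inverses in a monoid are unique, so the local inverses agree on overlaps and glue; the
  glued section is an inverse by separatedness.\<close>

lemma Units_if_unit_at:
  assumes X: "monoidal_space X" and U: "opn X U" "s \<in> carrier (sec X U)"
    and u: "\<And>x. x \<in> U \<Longrightarrow> unit_at X U s x"
  shows "s \<in> Units (sec X U)"
proof -
  define I where "I = {W. opn X W \<and> W \<subseteq> U \<and> res X U W s \<in> Units (sec X W)}"
  have UI: "(\<Union>W\<in>I. W) = U"
    using u unfolding I_def unit_at_def by blast
  define r where "r W = m_inv (sec X W) (res X U W s)" for W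
  have r: "r W \<in> carrier (sec X W)" "res X U W s \<otimes>\<^bsub>sec X W\<^esub> r W = \<one>\<^bsub>sec X W\<^esub>" if "W \<in> I" for W
    using that monoid.Units_inv_closed[OF sec_monoid[OF X]] monoid.Units_r_inv[OF sec_monoid[OF X]]
    unfolding r_def I_def by auto
  obtain t where t: "t \<in> carrier (sec X U)" "\<And>W. W \<in> I \<Longrightarrow> res X U W t = r W"
  proof (rule sheaf_glue[OF X, of I "\<lambda>W. W" r])
    fix V W x assume VW: "V \<in> I" "W \<in> I" "x \<in> V" "x \<in> W"
    let ?W = "V \<inter> W"
    have o: "opn X V" "opn X W" "opn X ?W" "V \<subseteq> U" "W \<subseteq> U"
      using VW by (auto simp: I_def intro: openin_Int)
    interpret comm_monoid "sec X ?W" by (rule sec_comm_monoid[OF X o(3)])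
    have 1: "res X U ?W s \<otimes>\<^bsub>sec X ?W\<^esub> res X V ?W (r V) = \<one>\<^bsub>sec X ?W\<^esub>"
      using arg_cong[OF r(2)[OF VW(1)], of "res X V ?W"] X U o r(1)[OF VW(1)]
      by (simp add: res_mult res_one res_closed res_res)
    have 2: "res X U ?W s \<otimes>\<^bsub>sec X ?W\<^esub> res X W ?W (r W) = \<one>\<^bsub>sec X ?W\<^esub>"
      using arg_cong[OF r(2)[OF VW(2)], of "res X W ?W"] X U o r(1)[OF VW(2)]
      by (simp add: res_mult res_one res_closed res_res)
    have c: "res X U ?W s \<in> carrier (sec X ?W)" "res X V ?W (r V) \<in> carrier (sec X ?W)"
      "res X W ?W (r W) \<in> carrier (sec X ?W)"
      using X U o r VW by (auto intro!: res_closed)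
    have "res X V ?W (r V) = res X W ?W (r W)"
      using c 1 2 inv_unique m_comm by metis
    then show "\<exists>Z. opn X Z \<and> x \<in> Z \<and> Z \<subseteq> V \<and> Z \<subseteq> W \<and> res X V Z (r V) = res X W Z (r W)"
      using VW o by blast
  qed (use r UI in \<open>auto simp: I_def\<close>)
  interpret comm_monoid "sec X U" by (rule sec_comm_monoid[OF X U(1)])
  have "s \<otimes>\<^bsub>sec X U\<^esub> t = \<one>\<^bsub>sec X U\<^esub>"
  proof (rule sheaf_sep[OF X U(1)])
    fix x assume "x \<in> U"
    then obtain W where W: "W \<in> I" "x \<in> W" using UI by blast
    then have "opn X W" "W \<subseteq> U" by (auto simp: I_def)
    then show "\<exists>W. opn X W \<and> x \<in> W \<and> W \<subseteq> U \<and> res X U W (s \<otimes>\<^bsub>sec X U\<^esub> t) = res X U W \<one>\<^bsub>sec X U\<^esub>"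
      using W X U t r by (intro exI[of _ W]) (auto simp: res_mult res_one)
  qed (use U t in auto)
  then show ?thesis
    using U t by (intro comm_monoid_UnitsI comm_monoid_axioms)
qed

lemma Units_unit_at:
  assumes "monoidal_space X" "opn X U" "s \<in> Units (sec X U)" "x \<in> U"
  shows "unit_at X U s x"
proof -
  have "s \<in> carrier (sec X U)"
    using assms by (auto simp: Units_def)
  then show ?thesis
    using assms by (auto simp: unit_at_def res_id intro!: exI[of _ U])
qed

section \<open>Inverse images\<close>

abbreviation psec :: "('x, 'm) mspace \<Rightarrow> ('x \<Rightarrow> 'y) \<Rightarrow> ('y, 'n) mspace \<Rightarrow> 'x set \<Rightarrow> ('x \<Rightarrow> ('y set \<times> 'n) set) monoid" where
  "psec X f Y U \<equiv> sections (pull X f Y) U"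

definition germfun :: "('y, 'n) mspace \<Rightarrow> ('x \<Rightarrow> 'y) \<Rightarrow> 'y set \<Rightarrow> 'n \<Rightarrow> 'x set \<Rightarrow> 'x \<Rightarrow> ('y set \<times> 'n) set" where
  "germfun Y f V t U = (\<lambda>x\<in>U. gm Y (f x) V t)"

definition induced_on :: "('x, 'm) mspace \<Rightarrow> ('x \<Rightarrow> 'y) \<Rightarrow> ('y, 'n) mspace \<Rightarrow> 'x set \<Rightarrow> 'y set \<Rightarrow> 'n \<Rightarrow> ('x \<Rightarrow> ('y set \<times> 'n) set) \<Rightarrow> bool" where
  "induced_on X f Y W V t \<sigma> \<longleftrightarrow> opn X W \<and> opn Y V \<and> f ` W \<subseteq> V \<and> t \<in> carrier (sec Y V) \<and> (\<forall>z\<in>W. \<sigma> z = gm Y (f z) V t)"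

text \<open>A family induced by a section near every point has germs as values automatically, so
  extensionality is all that remains of the condition on its values.\<close>

lemma psec_carrier_iff:
  "\<sigma> \<in> carrier (psec X f Y U) \<longleftrightarrow>
     \<sigma> \<in> extensional U \<and> (\<forall>x\<in>U. \<exists>W V t. x \<in> W \<and> W \<subseteq> U \<and> induced_on X f Y W V t \<sigma>)" (is "?L \<longleftrightarrow> ?R")
proof -
  have L: "?L \<longleftrightarrow> \<sigma> \<in> (\<Pi>\<^sub>E x\<in>U. carrier (stk Y (f x))) \<and>
      (\<forall>x\<in>U. \<exists>W V t. x \<in> W \<and> W \<subseteq> U \<and> induced_on X f Y W V t \<sigma>)"
  proof -
    have Q: "(\<exists>W V t. opn X W \<and> x \<in> W \<and> W \<subseteq> U \<and> opn Y V \<and> f ` W \<subseteq> V \<and> t \<in> carrier (sec Y V) \<and>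
        (\<forall>z\<in>W. \<sigma> z = gm Y (f z) V t)) \<longleftrightarrow>
        (\<exists>W V t. x \<in> W \<and> W \<subseteq> U \<and> induced_on X f Y W V t \<sigma>)" for x
      unfolding induced_on_def by (intro iff_exI iffI; elim conjE; intro conjI; assumption)
    show ?thesis
      unfolding inverse_image_def presheaf.select_convs partial_object.select_convs mem_Collect_eq Q
      by (rule refl)
  qed
  show ?thesis
  proof
    assume ?L
    then show ?R
      unfolding L PiE_iff by (elim conjE, intro conjI)
  next
    assume R: ?R
    have "\<sigma> x \<in> carrier (stk Y (f x))" if x: "x \<in> U" for x
    proof -
      obtain W V t where "x \<in> W" "induced_on X f Y W V t \<sigma>"
        using bspec[OF conjunct2[OF R] x] by (elim exE conjE)
      then show ?thesis
        by (auto simp: induced_on_def intro!: germ_in_stalk)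
    qed
    then have "\<sigma> \<in> (\<Pi>\<^sub>E x\<in>U. carrier (stk Y (f x)))"
      using conjunct1[OF R] by (auto simp: PiE_iff)
    then show ?L
      unfolding L using conjunct2[OF R] by (rule conjI)
  qed
qed

lemma psec_ext: "\<sigma> \<in> carrier (psec X f Y U) \<Longrightarrow> \<sigma> \<in> extensional U"
  by (simp add: psec_carrier_iff)

lemma psec_stalk: "\<sigma> \<in> carrier (psec X f Y U) \<Longrightarrow> x \<in> U \<Longrightarrow> \<sigma> x \<in> carrier (stk Y (f x))"
  by (auto simp: inverse_image_def)

lemma psec_cases:
  assumes "\<sigma> \<in> carrier (psec X f Y U)" "x \<in> U"
  obtains W V t where "x \<in> W" "W \<subseteq> U" "induced_on X f Y W V t \<sigma>"
  using assms unfolding psec_carrier_iff by blast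

lemma psecI:
  assumes "\<sigma> \<in> extensional U"
    and "\<And>x. x \<in> U \<Longrightarrow> \<exists>W V t. x \<in> W \<and> W \<subseteq> U \<and> induced_on X f Y W V t \<sigma>"
  shows "\<sigma> \<in> carrier (psec X f Y U)"
  using assms by (simp add: psec_carrier_iff)

lemma psec_mult_def: "\<sigma> \<otimes>\<^bsub>psec X f Y U\<^esub> \<tau> = (\<lambda>x\<in>U. \<sigma> x \<otimes>\<^bsub>stk Y (f x)\<^esub> \<tau> x)"
  and psec_one_def: "\<one>\<^bsub>psec X f Y U\<^esub> = (\<lambda>x\<in>U. \<one>\<^bsub>stk Y (f x)\<^esub>)"
  and psec_restr_def: "restr (pull X f Y) U V \<sigma> = restrict \<sigma> V"
  by (simp_all add: inverse_image_def)

lemma induced_onD: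
  assumes "induced_on X f Y W V t \<sigma>"
  shows "opn X W" "opn Y V" "f ` W \<subseteq> V" "t \<in> carrier (sec Y V)" "\<And>z. z \<in> W \<Longrightarrow> \<sigma> z = gm Y (f z) V t"
  using assms by (auto simp: induced_on_def)

lemma induced_on_germfun:
  "opn X U \<Longrightarrow> opn Y V \<Longrightarrow> U \<subseteq> pre X f V \<Longrightarrow> t \<in> carrier (sec Y V) \<Longrightarrow> induced_on X f Y U V t (germfun Y f V t U)"
  by (auto simp: induced_on_def germfun_def)

lemma induced_on_subset:
  "induced_on X f Y W V t \<sigma> \<Longrightarrow> opn X W' \<Longrightarrow> W' \<subseteq> W \<Longrightarrow> (\<And>z. z \<in> W' \<Longrightarrow> \<tau> z = \<sigma> z) \<Longrightarrow> induced_on X f Y W' V t \<tau>"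
  by (auto simp: induced_on_def image_subset_iff subset_iff)

lemma germfun_closed:
  assumes "opn X U" "opn Y V" "U \<subseteq> pre X f V" "t \<in> carrier (sec Y V)"
  shows "germfun Y f V t U \<in> carrier (psec X f Y U)"
  using induced_on_germfun[OF assms] by (intro psecI) (auto simp: germfun_def)

lemma continuous_pre:
  "continuous_map (pts X) (pts Y) f \<Longrightarrow> opn Y V \<Longrightarrow> opn X (pre X f V)"
  by (rule openin_continuous_map_preimage)

lemma induced_on_res:
  assumes Y: "monoidal_space Y" and f: "continuous_map (pts X) (pts Y) f"
    and i: "induced_on X f Y W V t \<sigma>" and V': "opn Y V'" "V' \<subseteq> V"
  shows "induced_on X f Y (W \<inter> pre X f V') V' (res Y V V' t) \<sigma>"
proof -
  note i = induced_onD[OF i]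
  show ?thesis
    unfolding induced_on_def
    using Y i V' continuous_pre[OF f V'(1)] by (auto simp: res_closed germ_res openin_Int)
qed

text \<open>The two families are induced near \<open>x\<close> by sections over different open sets
  \<open>V\<close> and \<open>V'\<close>. Restricting both sections to \<open>V \<inter> V'\<close>
  and shrinking the neighbourhood into its preimage puts them in one monoid, where they can be
  multiplied.\<close>

lemma psec_common:
  assumes Y: "monoidal_space Y" and f: "continuous_map (pts X) (pts Y) f"
    and \<sigma>: "\<sigma> \<in> carrier (psec X f Y U)" and \<tau>: "\<tau> \<in> carrier (psec X f Y U)" and x: "x \<in> U"
  obtains W V s t where "x \<in> W" "W \<subseteq> U" "induced_on X f Y W V s \<sigma>" "induced_on X f Y W V t \<tau>"
proof -
  obtain W V s where 1: "x \<in> W" "W \<subseteq> U" "induced_on X f Y W V s \<sigma>"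
    using \<sigma> x by (rule psec_cases)
  obtain W' V' t where 2: "x \<in> W'" "W' \<subseteq> U" "induced_on X f Y W' V' t \<tau>"
    using \<tau> x by (rule psec_cases)
  note i1 = induced_onD[OF 1(3)] and i2 = induced_onD[OF 2(3)]
  have V: "opn Y (V \<inter> V')" using i1 i2 by (auto intro: openin_Int)
  let ?P = "pre X f (V \<inter> V')"
  have o: "opn X (W \<inter> W' \<inter> ?P)"
    using i1 i2 continuous_pre[OF f V] by (intro openin_Int)
  have xP: "x \<in> topspace (pts X)"
    using i1(1) 1(1) opn_subset by blast
  show thesis
  proof (rule that)
    show "induced_on X f Y (W \<inter> W' \<inter> ?P) (V \<inter> V') (res Y V (V \<inter> V') s) \<sigma>"
      by (rule induced_on_subset[OF induced_on_res[OF Y f 1(3) V]]) (use o in auto)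
    show "induced_on X f Y (W \<inter> W' \<inter> ?P) (V \<inter> V') (res Y V' (V \<inter> V') t) \<tau>"
      by (rule induced_on_subset[OF induced_on_res[OF Y f 2(3) V]]) (use o in auto)
  qed (use 1 2 i1 i2 xP in auto)
qed

lemma induced_on_mult:
  assumes Y: "monoidal_space Y"
    and s: "induced_on X f Y W V s \<sigma>" and t: "induced_on X f Y W V t \<tau>" and W: "W \<subseteq> U"
  shows "induced_on X f Y W V (s \<otimes>\<^bsub>sec Y V\<^esub> t) (\<sigma> \<otimes>\<^bsub>psec X f Y U\<^esub> \<tau>)"
proof -
  note s = induced_onD[OF s] and t = induced_onD[OF t]
  show ?thesis
    unfolding induced_on_def psec_mult_def
    using Y s t W monoid.m_closed[OF sec_monoid[OF Y s(2)]] by (auto simp: stalk_mult_same subset_iff)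
qed

lemma psec_mult_closed:
  assumes Y: "monoidal_space Y" and f: "continuous_map (pts X) (pts Y) f"
    and "\<sigma> \<in> carrier (psec X f Y U)" "\<tau> \<in> carrier (psec X f Y U)"
  shows "\<sigma> \<otimes>\<^bsub>psec X f Y U\<^esub> \<tau> \<in> carrier (psec X f Y U)"
proof (rule psecI)
  fix x assume x: "x \<in> U"
  obtain W V s t where W: "x \<in> W" "W \<subseteq> U" "induced_on X f Y W V s \<sigma>" "induced_on X f Y W V t \<tau>"
    by (rule psec_common[OF assms x])
  then show "\<exists>W V t. x \<in> W \<and> W \<subseteq> U \<and> induced_on X f Y W V t (\<sigma> \<otimes>\<^bsub>psec X f Y U\<^esub> \<tau>)"
    using induced_on_mult[OF Y W(3,4,2)] by blast
qed (simp add: psec_mult_def)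

lemma psec_one:
  assumes Y: "monoidal_space Y" and f: "continuous_map (pts X) (pts Y) f" and U: "opn X U"
    and V: "opn Y V" "U \<subseteq> pre X f V"
  shows "\<one>\<^bsub>psec X f Y U\<^esub> = germfun Y f V \<one>\<^bsub>sec Y V\<^esub> U"
  using assms by (auto simp: psec_one_def germfun_def fun_eq_iff stalk_one[OF Y V(1)] subset_iff)

lemma pre_topspace:
  "continuous_map (pts X) (pts Y) f \<Longrightarrow> pre X f (topspace (pts Y)) = topspace (pts X)"
  by (auto simp: continuous_map_def Pi_iff)

lemma psec_one_closed:
  assumes Y: "monoidal_space Y" and f: "continuous_map (pts X) (pts Y) f" and U: "opn X U"
  shows "\<one>\<^bsub>psec X f Y U\<^esub> \<in> carrier (psec X f Y U)"
proof -
  have V: "opn Y (topspace (pts Y))" "U \<subseteq> pre X f (topspace (pts Y))"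
    using opn_subset[OF U] f by (auto simp: continuous_map_def Pi_iff)
  then show ?thesis
    unfolding psec_one[OF Y f U V] by (intro germfun_closed U V monoid.one_closed[OF sec_monoid[OF Y]])
qed

lemma psec_restrict_closed:
  assumes "\<sigma> \<in> carrier (psec X f Y U)" "opn X V" "V \<subseteq> U"
  shows "restrict \<sigma> V \<in> carrier (psec X f Y V)"
proof (rule psecI)
  fix x assume x: "x \<in> V"
  then obtain W V' t where W: "x \<in> W" "W \<subseteq> U" "induced_on X f Y W V' t \<sigma>"
    using psec_cases[OF assms(1), of x] assms(3) by blast
  have "opn X (W \<inter> V)"
    using induced_onD(1)[OF W(3)] assms(2) by (rule openin_Int)
  then have "induced_on X f Y (W \<inter> V) V' t (restrict \<sigma> V)"
    by (rule induced_on_subset[OF W(3)]) auto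
  with W x show "\<exists>W V' t. x \<in> W \<and> W \<subseteq> V \<and> induced_on X f Y W V' t (restrict \<sigma> V)"
    by blast
qed simp


section \<open>Morphisms in terms of sections\<close>

text \<open>The maps of sections corresponding to \<open>f\<^sup>\<dagger>\<close> under the adjunction of \<open>f\<^sup>-\<^sup>1\<close> and \<open>f\<^sub>*\<close>.\<close>

definition cohom :: "('x, 'm) mspace \<Rightarrow> ('x \<Rightarrow> 'y) \<Rightarrow> ('y, 'n) mspace \<Rightarrow> ('y set \<Rightarrow> 'n \<Rightarrow> 'm) \<Rightarrow> bool" where
  "cohom X f Y \<phi> \<longleftrightarrow> continuous_map (pts X) (pts Y) f \<and>
     (\<forall>V. opn Y V \<longrightarrow> monoid_hom (sec Y V) (sec X (pre X f V)) (\<phi> V)) \<and>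
     (\<forall>V W. opn Y V \<and> opn Y W \<and> W \<subseteq> V \<longrightarrow>
        (\<forall>t\<in>carrier (sec Y V). \<phi> W (res Y V W t) = res X (pre X f V) (pre X f W) (\<phi> V t)))"

lemma cohom_cont: "cohom X f Y \<phi> \<Longrightarrow> continuous_map (pts X) (pts Y) f"
  and cohom_hom: "cohom X f Y \<phi> \<Longrightarrow> opn Y V \<Longrightarrow> monoid_hom (sec Y V) (sec X (pre X f V)) (\<phi> V)"
  and cohom_res: "cohom X f Y \<phi> \<Longrightarrow> opn Y V \<Longrightarrow> opn Y W \<Longrightarrow> W \<subseteq> V \<Longrightarrow> t \<in> carrier (sec Y V) \<Longrightarrow>
    \<phi> W (res Y V W t) = res X (pre X f V) (pre X f W) (\<phi> V t)"
  by (auto simp: cohom_def)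

lemmas cohom_closed = monoid_hom_closed[OF cohom_hom]
  and cohom_mult = monoid_hom_mult[OF cohom_hom]
  and cohom_one = monoid_hom_one[OF cohom_hom]

lemma cohom_pre: "cohom X f Y \<phi> \<Longrightarrow> opn Y V \<Longrightarrow> opn X (pre X f V)"
  by (rule continuous_pre[OF cohom_cont])

text \<open>This is the well-definedness of the stalk maps: agreement of \<open>t\<close> and
  \<open>t'\<close> on \<open>Z\<close> becomes agreement of their images on the preimage of
  \<open>Z\<close>, since \<open>\<phi>\<close> commutes with restriction.\<close>

lemma cohom_germ:
  assumes X: "monoidal_space X" and Y: "monoidal_space Y" and \<phi>: "cohom X f Y \<phi>"
    and V: "opn Y V" "t \<in> carrier (sec Y V)" and V': "opn Y V'" "t' \<in> carrier (sec Y V')"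
    and x: "x \<in> pre X f V" "x \<in> pre X f V'" and eq: "gm Y (f x) V t = gm Y (f x) V' t'"
  shows "gm X x (pre X f V) (\<phi> V t) = gm X x (pre X f V') (\<phi> V' t')"
proof -
  obtain Z where Z: "opn Y Z" "f x \<in> Z" "Z \<subseteq> V" "Z \<subseteq> V'" "res Y V Z t = res Y V' Z t'"
    using eq germ_eq_iff[OF Y V(1) _ V(2) V'(1) _ V'(2)] x by auto
  then have "res X (pre X f V) (pre X f Z) (\<phi> V t) = res X (pre X f V') (pre X f Z) (\<phi> V' t')"
    using cohom_res[OF \<phi> V(1) Z(1,3) V(2)] cohom_res[OF \<phi> V'(1) Z(1,4) V'(2)] by simp
  then show ?thesis
    using x Z cohom_closed[OF \<phi> V] cohom_closed[OF \<phi> V'] cohom_pre[OF \<phi>] V(1) V'(1)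
    by (intro germ_eqI[OF X, where W = "pre X f Z"]) auto
qed

lemma germ_sep:
  assumes X: "monoidal_space X" and U: "opn X U" "s \<in> carrier (sec X U)" "t \<in> carrier (sec X U)"
    and eq: "\<And>x. x \<in> U \<Longrightarrow> gm X x U s = gm X x U t"
  shows "s = t"
proof (rule sheaf_sep[OF X U])
  fix x assume x: "x \<in> U"
  show "\<exists>W. opn X W \<and> x \<in> W \<and> W \<subseteq> U \<and> res X U W s = res X U W t"
    using eq[OF x] germ_eq_iff[OF X U(1) x U(2) U(1) x U(3)] by auto
qed

text \<open>The inverse of the passage from \<open>f\<^sup>\<dagger>\<close> to \<^const>\<open>sec_map\<close>; the value is pinned down by its germs.\<close>

definition mk_comap :: "('x, 'm) mspace \<Rightarrow> ('x \<Rightarrow> 'y) \<Rightarrow> ('y, 'n) mspace \<Rightarrow> ('y set \<Rightarrow> 'n \<Rightarrow> 'm) \<Rightarrow> 'x set \<Rightarrow> ('x \<Rightarrow> ('y set \<times> 'n) set) \<Rightarrow> 'm" where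
  "mk_comap X f Y \<phi> U \<sigma> = (THE s. s \<in> carrier (sec X U) \<and>
     (\<forall>x\<in>U. \<forall>(V, t)\<in>\<sigma> x. gm X x U s = gm X x (pre X f V) (\<phi> V t)))"

text \<open>One representative of each germ is enough: \<open>cohom_germ\<close> carries the
  condition to all representatives, and a section with prescribed germs is unique by
  \<open>germ_sep\<close>.\<close>

lemma mk_comap_eqI:
  assumes X: "monoidal_space X" and Y: "monoidal_space Y" and \<phi>: "cohom X f Y \<phi>" and U: "opn X U"
    and s: "s \<in> carrier (sec X U)"
    and rep: "\<And>x. x \<in> U \<Longrightarrow> \<exists>V t. opn Y V \<and> t \<in> carrier (sec Y V) \<and> f x \<in> V \<and> \<sigma> x = gm Y (f x) V t \<and>
      gm X x U s = gm X x (pre X f V) (\<phi> V t)"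
  shows "mk_comap X f Y \<phi> U \<sigma> = s"
  unfolding mk_comap_def
proof (rule the_equality, intro conjI ballI s)
  fix x p assume x: "x \<in> U" and p: "p \<in> \<sigma> x"
  obtain V' t' where p': "p = (V', t')" by (cases p)
  obtain V t where V: "opn Y V" "t \<in> carrier (sec Y V)" "f x \<in> V" "\<sigma> x = gm Y (f x) V t"
    "gm X x U s = gm X x (pre X f V) (\<phi> V t)"
    using rep[OF x] by blast
  have xt: "x \<in> topspace (pts X)"
    using x opn_subset[OF U] by blast
  have m: "(V', t') \<in> gm Y (f x) V t"
    using p V p' by simp
  then have V': "opn Y V'" "f x \<in> V'" "t' \<in> carrier (sec Y V')"
    unfolding germ_mem_iff by auto
  have "gm X x (pre X f V) (\<phi> V t) = gm X x (pre X f V') (\<phi> V' t')"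
    using germ_mem_eq[OF Y V(1,3,2) m] V V' xt
    by (intro cohom_germ[OF X Y \<phi> V(1,2) V'(1,3)]) auto
  then show "case p of (V, t) \<Rightarrow> gm X x U s = gm X x (pre X f V) (\<phi> V t)"
    using V(5) by (simp add: p')
next
  fix r assume r: "r \<in> carrier (sec X U) \<and> (\<forall>x\<in>U. \<forall>(V, t)\<in>\<sigma> x. gm X x U r = gm X x (pre X f V) (\<phi> V t))"
  show "r = s"
  proof (rule germ_sep[OF X U _ s])
    fix x assume x: "x \<in> U"
    obtain V t where V: "opn Y V" "t \<in> carrier (sec Y V)" "f x \<in> V" "\<sigma> x = gm Y (f x) V t"
      "gm X x U s = gm X x (pre X f V) (\<phi> V t)"
      using rep[OF x] by blast
    have "(V, t) \<in> \<sigma> x"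
      using germ_self_mem[OF V(1,3,2)] V(4) by simp
    then show "gm X x U r = gm X x U s"
      using bspec[OF bspec[OF conjunct2[OF r] x]] V(5) by fastforce
  qed (use r in simp)
qed

text \<open>The wanted section is glued from the restrictions of \<open>\<phi> V t\<close> to the
  sets \<open>W\<close> on which \<open>t\<close> induces \<open>\<sigma>\<close>. Where two such
  sets meet, the pieces have equal germs by \<open>cohom_germ\<close>.\<close>

lemma mk_comap_props:
  assumes X: "monoidal_space X" and Y: "monoidal_space Y" and \<phi>: "cohom X f Y \<phi>" and U: "opn X U"
    and \<sigma>: "\<sigma> \<in> carrier (psec X f Y U)"
  shows mk_comap_closed: "mk_comap X f Y \<phi> U \<sigma> \<in> carrier (sec X U)"
    and mk_comap_germ: "\<And>x V t. x \<in> U \<Longrightarrow> opn Y V \<Longrightarrow> t \<in> carrier (sec Y V) \<Longrightarrow> f x \<in> V \<Longrightarrow> \<sigma> x = gm Y (f x) V t \<Longrightarrow>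
      gm X x U (mk_comap X f Y \<phi> U \<sigma>) = gm X x (pre X f V) (\<phi> V t)"
proof -
  define I where "I = {(W, V, t). W \<subseteq> U \<and> induced_on X f Y W V t \<sigma>}"
  have I: "opn X W" "W \<subseteq> U" "opn Y V" "t \<in> carrier (sec Y V)" "W \<subseteq> pre X f V"
    "\<And>z. z \<in> W \<Longrightarrow> \<sigma> z = gm Y (f z) V t" if "(W, V, t) \<in> I" for W V t
    using that opn_subset[of X W] by (auto simp: I_def induced_on_def)
  have UI: "(\<Union>i\<in>I. fst i) = U"
  proof
    show "U \<subseteq> (\<Union>i\<in>I. fst i)"
    proof
      fix x assume x: "x \<in> U"
      obtain W V t where "x \<in> W" "W \<subseteq> U" "induced_on X f Y W V t \<sigma>"
        by (rule psec_cases[OF \<sigma> x])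
      then have "x \<in> W" "(W, V, t) \<in> I"
        by (simp_all add: I_def)
      then show "x \<in> (\<Union>i\<in>I. fst i)" by (auto intro!: bexI[of _ "(W, V, t)"])
    qed
  qed (auto simp: I_def)
  define r where "r = (\<lambda>(W, V, t). res X (pre X f V) W (\<phi> V t))"
  have r: "r (W, V, t) \<in> carrier (sec X W)" if "(W, V, t) \<in> I" for W V t
    using I[OF that] cohom_closed[OF \<phi>] cohom_pre[OF \<phi>] by (auto simp: r_def intro!: res_closed[OF X])
  have r_germ: "gm X x W (r (W, V, t)) = gm X x (pre X f V) (\<phi> V t)" if "(W, V, t) \<in> I" "x \<in> W" for W V t x
    unfolding r_def using I[OF that(1)] that(2) cohom_closed[OF \<phi>] cohom_pre[OF \<phi>]
    by (simp add: germ_res[OF X])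
  obtain s where s: "s \<in> carrier (sec X (\<Union>i\<in>I. fst i))" "\<And>i. i \<in> I \<Longrightarrow> res X (\<Union>i\<in>I. fst i) (fst i) s = r i"
  proof (rule sheaf_glue[OF X, of I fst r])
    fix i assume "i \<in> I" then show "opn X (fst i)"
      using I by (cases i) auto
  next
    fix i assume "i \<in> I" then show "r i \<in> carrier (sec X (fst i))"
      using r by (cases i) auto
  next
    fix i j x assume ij: "i \<in> I" "j \<in> I" and x: "x \<in> fst i" "x \<in> fst j"
    obtain W V t W' V' t' where i: "i = (W, V, t)" and j: "j = (W', V', t')"
      by (cases i, cases j)
    note ij = ij[unfolded i] ij[unfolded j]
    note i1 = I[OF ij(1)] and i2 = I[OF ij(4)]
    have xx: "x \<in> W" "x \<in> W'" using x i j by auto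
    have "gm X x (pre X f V) (\<phi> V t) = gm X x (pre X f V') (\<phi> V' t')"
      using i1(5) i2(5) xx i1(6)[OF xx(1)] i2(6)[OF xx(2)]
      by (intro cohom_germ[OF X Y \<phi> i1(3,4) i2(3,4)]) auto
    then have "gm X x W (r i) = gm X x W' (r j)"
      unfolding i j using r_germ[OF ij(1) xx(1)] r_germ[OF ij(4) xx(2)] by simp
    then show "\<exists>Z. opn X Z \<and> x \<in> Z \<and> Z \<subseteq> fst i \<and> Z \<subseteq> fst j \<and> res X (fst i) Z (r i) = res X (fst j) Z (r j)"
      using germ_eq_iff[OF X i1(1) xx(1) r[OF ij(1)] i2(1) xx(2) r[OF ij(4)]] unfolding i j by simp
  qed auto
  note s = s[unfolded UI]
  have s_germ: "gm X x U s = gm X x (pre X f V) (\<phi> V t)" if "(W, V, t) \<in> I" "x \<in> W" for x W V t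
    using r_germ[OF that] s(2)[OF that(1)] germ_res[OF X U I(1)[OF that(1)] that(2) I(2)[OF that(1)] s(1)]
    by simp
  have eq: "mk_comap X f Y \<phi> U \<sigma> = s"
  proof (rule mk_comap_eqI[OF X Y \<phi> U s(1)])
    fix x assume x: "x \<in> U"
    obtain W V t where "x \<in> W" "W \<subseteq> U" "induced_on X f Y W V t \<sigma>"
      by (rule psec_cases[OF \<sigma> x])
    then have W: "x \<in> W" "(W, V, t) \<in> I"
      by (simp_all add: I_def)
    then show "\<exists>V t. opn Y V \<and> t \<in> carrier (sec Y V) \<and> f x \<in> V \<and> \<sigma> x = gm Y (f x) V t \<and>
      gm X x U s = gm X x (pre X f V) (\<phi> V t)"
      using I[OF W(2)] s_germ[OF W(2,1)] by (intro exI[of _ V] exI[of _ t]) auto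
  qed
  then show "mk_comap X f Y \<phi> U \<sigma> \<in> carrier (sec X U)"
    using s by simp
  fix x V t assume V: "x \<in> U" "opn Y V" "t \<in> carrier (sec Y V)" "f x \<in> V" "\<sigma> x = gm Y (f x) V t"
  obtain W V' t' where "x \<in> W" "W \<subseteq> U" "induced_on X f Y W V' t' \<sigma>"
    by (rule psec_cases[OF \<sigma> V(1)])
  then have W: "x \<in> W" "(W, V', t') \<in> I"
    by (simp_all add: I_def)
  have "gm X x (pre X f V') (\<phi> V' t') = gm X x (pre X f V) (\<phi> V t)"
    using I[OF W(2)] W(1) V opn_subset[OF U] by (intro cohom_germ[OF X Y \<phi>]) auto
  then show "gm X x U (mk_comap X f Y \<phi> U \<sigma>) = gm X x (pre X f V) (\<phi> V t)"
    using s_germ[OF W(2,1)] eq by simp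
qed

definition mk_mor :: "('x, 'm) mspace \<Rightarrow> ('x \<Rightarrow> 'y) \<Rightarrow> ('y, 'n) mspace \<Rightarrow> ('y set \<Rightarrow> 'n \<Rightarrow> 'm) \<Rightarrow> ('x, 'm, 'y, 'n) morphism" where
  "mk_mor X f Y \<phi> = \<lparr>src = X, tgt = Y, base_map = f, comap = mk_comap X f Y \<phi>\<rparr>"

lemma mk_mor_sel [simp]:
  "src (mk_mor X f Y \<phi>) = X" "tgt (mk_mor X f Y \<phi>) = Y" "base_map (mk_mor X f Y \<phi>) = f"
  "comap (mk_mor X f Y \<phi>) = mk_comap X f Y \<phi>"
  by (simp_all add: mk_mor_def)

lemma psec_germ_cases:
  assumes "\<sigma> \<in> carrier (psec X f Y U)" "x \<in> U"
  obtains V t where "opn Y V" "t \<in> carrier (sec Y V)" "f x \<in> V" "\<sigma> x = gm Y (f x) V t"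
proof -
  obtain W V t where "x \<in> W" "induced_on X f Y W V t \<sigma>"
    by (rule psec_cases[OF assms])
  then show ?thesis
    by (intro that[of V t]) (auto simp: induced_on_def)
qed

text \<open>The section produced by \<open>mk_comap\<close> is pinned down by its germs, so
  multiplicativity and compatibility with restriction are checked germ by germ, where they are the
  corresponding properties of \<open>\<phi>\<close>.\<close>

lemma mk_mor_morphism:
  assumes X: "monoidal_space X" and Y: "monoidal_space Y" and \<phi>: "cohom X f Y \<phi>"
  shows "ms_morphism (mk_mor X f Y \<phi>)"
proof -
  note cont = cohom_cont[OF \<phi>]
  let ?c = "mk_comap X f Y \<phi>"
  have "sheaf_hom (pts X) (pull X f Y) (shf X) ?c"
    unfolding sheaf_hom_def
  proof (intro conjI allI impI ballI)
    fix U assume U: "opn X U"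
    interpret comm_monoid "sec X U" by (rule sec_comm_monoid[OF X U])
    show "monoid_hom (psec X f Y U) (sec X U) (?c U)"
    proof (rule monoid_homI)
      show "?c U \<sigma> \<in> carrier (sec X U)" if "\<sigma> \<in> carrier (psec X f Y U)" for \<sigma>
        using mk_comap_closed[OF X Y \<phi> U that] .
    next
      fix \<sigma> \<tau> assume \<sigma>: "\<sigma> \<in> carrier (psec X f Y U)" and \<tau>: "\<tau> \<in> carrier (psec X f Y U)"
      show "?c U (\<sigma> \<otimes>\<^bsub>psec X f Y U\<^esub> \<tau>) = ?c U \<sigma> \<otimes>\<^bsub>sec X U\<^esub> ?c U \<tau>"
      proof (rule mk_comap_eqI[OF X Y \<phi> U])
        show "?c U \<sigma> \<otimes>\<^bsub>sec X U\<^esub> ?c U \<tau> \<in> carrier (sec X U)"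
          using mk_comap_closed[OF X Y \<phi> U] \<sigma> \<tau> by simp
        fix x assume x: "x \<in> U"
        obtain W V s t where W: "x \<in> W" "W \<subseteq> U" "induced_on X f Y W V s \<sigma>" "induced_on X f Y W V t \<tau>"
          by (rule psec_common[OF Y cont \<sigma> \<tau> x])
        note s = induced_onD[OF W(3)] and t = induced_onD[OF W(4)]
        have xV: "f x \<in> V" "x \<in> pre X f V" using s W x opn_subset[OF U] by auto
        have oP: "opn X (pre X f V)" using cohom_pre[OF \<phi> s(2)] .
        interpret V: comm_monoid "sec Y V" by (rule sec_comm_monoid[OF Y s(2)])
        have "gm X x U (?c U \<sigma> \<otimes>\<^bsub>sec X U\<^esub> ?c U \<tau>) = gm X x U (?c U \<sigma>) \<otimes>\<^bsub>stk X x\<^esub> gm X x U (?c U \<tau>)"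
          using X U x \<sigma> \<tau> by (simp add: stalk_mult_same mk_comap_closed[OF X Y \<phi> U])
        also have "\<dots> = gm X x (pre X f V) (\<phi> V s) \<otimes>\<^bsub>stk X x\<^esub> gm X x (pre X f V) (\<phi> V t)"
          using mk_comap_germ[OF X Y \<phi> U \<sigma> x s(2,4) xV(1) s(5)[OF W(1)]]
            mk_comap_germ[OF X Y \<phi> U \<tau> x t(2,4) xV(1) t(5)[OF W(1)]] by simp
        also have "\<dots> = gm X x (pre X f V) (\<phi> V (s \<otimes>\<^bsub>sec Y V\<^esub> t))"
          using s t xV oP by (simp add: stalk_mult_same[OF X] cohom_mult[OF \<phi>] cohom_closed[OF \<phi>])
        finally show "\<exists>V t. opn Y V \<and> t \<in> carrier (sec Y V) \<and> f x \<in> V \<and> (\<sigma> \<otimes>\<^bsub>psec X f Y U\<^esub> \<tau>) x = gm Y (f x) V t \<and>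
          gm X x U (?c U \<sigma> \<otimes>\<^bsub>sec X U\<^esub> ?c U \<tau>) = gm X x (pre X f V) (\<phi> V t)"
          using induced_onD[OF induced_on_mult[OF Y W(3,4,2)]] W(1) xV by blast
      qed
    next
      show "?c U \<one>\<^bsub>psec X f Y U\<^esub> = \<one>\<^bsub>sec X U\<^esub>"
      proof (rule mk_comap_eqI[OF X Y \<phi> U])
        fix x assume x: "x \<in> U"
        let ?V = "topspace (pts Y)"
        have V: "opn Y ?V" "U \<subseteq> pre X f ?V" "f x \<in> ?V"
          using opn_subset[OF U] cont x by (auto simp: continuous_map_def Pi_iff)
        show "\<exists>V t. opn Y V \<and> t \<in> carrier (sec Y V) \<and> f x \<in> V \<and> \<one>\<^bsub>psec X f Y U\<^esub> x = gm Y (f x) V t \<and>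
          gm X x U \<one>\<^bsub>sec X U\<^esub> = gm X x (pre X f V) (\<phi> V t)"
          using V x monoid.one_closed[OF sec_monoid[OF Y V(1)]] cohom_pre[OF \<phi> V(1)]
            stalk_one[OF X U x] stalk_one[OF X cohom_pre[OF \<phi> V(1)], of x] opn_subset[OF U]
          by (intro exI[of _ ?V] exI[of _ "\<one>\<^bsub>sec Y ?V\<^esub>"])
            (auto simp: psec_one[OF Y cont U V(1,2)] germfun_def cohom_one[OF \<phi>])
      qed simp
    qed
  next
    fix U W \<sigma> assume UW: "opn X U \<and> opn X W \<and> W \<subseteq> U" and \<sigma>: "\<sigma> \<in> carrier (psec X f Y U)"
    then have o: "opn X U" "opn X W" "W \<subseteq> U" by auto
    show "?c W (restr (pull X f Y) U W \<sigma>) = res X U W (?c U \<sigma>)"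
    proof (rule mk_comap_eqI[OF X Y \<phi> o(2)])
      show "res X U W (?c U \<sigma>) \<in> carrier (sec X W)"
        using o mk_comap_closed[OF X Y \<phi> o(1) \<sigma>] by (intro res_closed[OF X]) auto
      fix x assume x: "x \<in> W"
      obtain V t where V: "opn Y V" "t \<in> carrier (sec Y V)" "f x \<in> V" "\<sigma> x = gm Y (f x) V t"
        using psec_germ_cases[OF \<sigma>, of x] o x by (metis subsetD)
      then show "\<exists>V t. opn Y V \<and> t \<in> carrier (sec Y V) \<and> f x \<in> V \<and> restr (pull X f Y) U W \<sigma> x = gm Y (f x) V t \<and>
          gm X x W (res X U W (?c U \<sigma>)) = gm X x (pre X f V) (\<phi> V t)"
        using o x mk_comap_germ[OF X Y \<phi> o(1) \<sigma>, of x V t] mk_comap_closed[OF X Y \<phi> o(1) \<sigma>]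
        by (intro exI[of _ V] exI[of _ t]) (auto simp: psec_restr_def germ_res[OF X])
    qed
  qed
  then show ?thesis
    using X Y cont by (simp add: ms_morphism_def)
qed

lemma sec_map_germfun: "sec_map f V t = comap f (preimage f V) (germfun (tgt f) (base_map f) V t (preimage f V))"
  by (simp add: sec_map_def germfun_def)

lemma sec_map_mk_mor:
  assumes X: "monoidal_space X" and Y: "monoidal_space Y" and \<phi>: "cohom X f Y \<phi>"
    and V: "opn Y V" "t \<in> carrier (sec Y V)"
  shows "sec_map (mk_mor X f Y \<phi>) V t = \<phi> V t"
  unfolding sec_map_germfun mk_mor_sel
  by (rule mk_comap_eqI[OF X Y \<phi> cohom_pre[OF \<phi> V(1)] cohom_closed[OF \<phi> V]])
    (use V in \<open>auto simp: germfun_def\<close>)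

section \<open>Recovering a morphism from its maps of sections\<close>

lemma ms_morphismD:
  assumes "ms_morphism f"
  shows "monoidal_space (src f)" "monoidal_space (tgt f)"
    "continuous_map (pts (src f)) (pts (tgt f)) (base_map f)"
    "\<And>U. opn (src f) U \<Longrightarrow> monoid_hom (psec (src f) (base_map f) (tgt f) U) (sec (src f) U) (comap f U)"
    "\<And>U V \<sigma>. opn (src f) U \<Longrightarrow> opn (src f) V \<Longrightarrow> V \<subseteq> U \<Longrightarrow> \<sigma> \<in> carrier (psec (src f) (base_map f) (tgt f) U) \<Longrightarrow>
      comap f V (restrict \<sigma> V) = res (src f) U V (comap f U \<sigma>)"
  using assms by (auto simp: ms_morphism_def sheaf_hom_def psec_restr_def)

text \<open>A section \<open>t\<close> over \<open>V\<close> gives the family of its germs over the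
  preimage of \<open>V\<close>; forming this family is multiplicative and commutes with restriction,
  and so does the sheaf map applied to it.\<close>

lemma sec_map_cohom:
  assumes f: "ms_morphism f"
  shows "cohom (src f) (base_map f) (tgt f) (sec_map f)"
proof -
  let ?X = "src f" and ?Y = "tgt f" and ?b = "base_map f"
  note X = ms_morphismD(1)[OF f] and Y = ms_morphismD(2)[OF f] and cont = ms_morphismD(3)[OF f]
  have o: "opn ?X (preimage f V)" if "opn ?Y V" for V
    using continuous_pre[OF cont that] .
  show ?thesis
    unfolding cohom_def
  proof (intro conjI allI impI ballI cont)
    fix V assume V: "opn ?Y V"
    let ?U = "preimage f V"
    note h = ms_morphismD(4)[OF f o[OF V]]
    note gc = germfun_closed[OF o[OF V] V subset_refl]
    show "monoid_hom (sec ?Y V) (sec ?X ?U) (sec_map f V)"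
    proof (rule monoid_homI)
      show "sec_map f V s \<in> carrier (sec ?X ?U)" if "s \<in> carrier (sec ?Y V)" for s
        using that unfolding sec_map_germfun by (intro monoid_hom_closed[OF h] gc)
    next
      fix s t assume st: "s \<in> carrier (sec ?Y V)" "t \<in> carrier (sec ?Y V)"
      have "germfun ?Y ?b V (s \<otimes>\<^bsub>sec ?Y V\<^esub> t) ?U =
        germfun ?Y ?b V s ?U \<otimes>\<^bsub>psec ?X ?b ?Y ?U\<^esub> germfun ?Y ?b V t ?U"
        using st V by (auto simp: germfun_def psec_mult_def fun_eq_iff stalk_mult_same[OF Y])
      then show "sec_map f V (s \<otimes>\<^bsub>sec ?Y V\<^esub> t) = sec_map f V s \<otimes>\<^bsub>sec ?X ?U\<^esub> sec_map f V t"
        using st unfolding sec_map_germfun by (simp add: monoid_hom_mult[OF h] gc)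
    next
      show "sec_map f V \<one>\<^bsub>sec ?Y V\<^esub> = \<one>\<^bsub>sec ?X ?U\<^esub>"
        using monoid_hom_one[OF h] unfolding sec_map_germfun psec_one[OF Y cont o[OF V] V subset_refl] .
    qed
  next
    fix V W t assume VW: "opn ?Y V \<and> opn ?Y W \<and> W \<subseteq> V" and t: "t \<in> carrier (sec ?Y V)"
    then have V: "opn ?Y V" "opn ?Y W" "W \<subseteq> V" by auto
    have "germfun ?Y ?b W (res ?Y V W t) (preimage f W) = restrict (germfun ?Y ?b V t (preimage f V)) (preimage f W)"
      using V t by (auto simp: germfun_def fun_eq_iff germ_res[OF Y])
    moreover have "preimage f W \<subseteq> preimage f V" using V by auto
    ultimately show "sec_map f W (res ?Y V W t) = res ?X (preimage f V) (preimage f W) (sec_map f V t)"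
      using ms_morphismD(5)[OF f o[OF V(1)] o[OF V(2)]] t germfun_closed[OF o[OF V(1)] V(1) subset_refl]
      unfolding sec_map_germfun by simp
  qed
qed

text \<open>Near each point \<open>\<sigma>\<close> coincides with the family of germs of a section
  of the target, and \<open>comap f\<close> commutes with restriction to that neighbourhood.
  Together with \<open>sec_map_mk_mor\<close> this says that the two directions of the adjunction
  are inverse to each other.\<close>

lemma comap_eq_mk_comap:
  assumes f: "ms_morphism f" and U: "opn (src f) U"
    and \<sigma>: "\<sigma> \<in> carrier (psec (src f) (base_map f) (tgt f) U)"
  shows "comap f U \<sigma> = mk_comap (src f) (base_map f) (tgt f) (sec_map f) U \<sigma>"
proof (rule sym, rule mk_comap_eqI)
  let ?X = "src f" and ?Y = "tgt f" and ?b = "base_map f"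
  show X: "monoidal_space ?X" and Y: "monoidal_space ?Y" and \<phi>: "cohom ?X ?b ?Y (sec_map f)" and "opn ?X U"
    using ms_morphismD[OF f] sec_map_cohom[OF f] U by auto
  show c: "comap f U \<sigma> \<in> carrier (sec ?X U)"
    by (rule monoid_hom_closed[OF ms_morphismD(4)[OF f U] \<sigma>])
  fix x assume x: "x \<in> U"
  obtain W V t where W: "x \<in> W" "W \<subseteq> U" "induced_on ?X ?b ?Y W V t \<sigma>"
    using \<sigma> x by (rule psec_cases)
  note i = induced_onD[OF W(3)]
  let ?P = "preimage f V"
  have WP: "W \<subseteq> ?P" using i opn_subset[of ?X W] by auto
  have oP: "opn ?X ?P" using cohom_pre[OF \<phi> i(2)] .
  have "restrict \<sigma> W = restrict (germfun ?Y ?b V t ?P) W"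
    using i WP by (auto simp: germfun_def fun_eq_iff)
  then have "res ?X U W (comap f U \<sigma>) = res ?X ?P W (sec_map f V t)"
    using ms_morphismD(5)[OF f U i(1) W(2) \<sigma>]
      ms_morphismD(5)[OF f oP i(1) WP germfun_closed[OF oP i(2) subset_refl i(4)]]
    unfolding sec_map_germfun by simp
  then have "gm ?X x U (comap f U \<sigma>) = gm ?X x ?P (sec_map f V t)"
    using germ_eqI[OF X U c oP cohom_closed[OF \<phi> i(2,4)] i(1) W(1,2) WP] by simp
  then show "\<exists>V t. opn ?Y V \<and> t \<in> carrier (sec ?Y V) \<and> ?b x \<in> V \<and> \<sigma> x = gm ?Y (?b x) V t \<and>
    gm ?X x U (comap f U \<sigma>) = gm ?X x (preimage f V) (sec_map f V t)"
    using i W by (intro exI[of _ V] exI[of _ t]) auto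
qed

lemma comap_germ:
  assumes f: "ms_morphism f" and U: "opn (src f) U" "\<sigma> \<in> carrier (psec (src f) (base_map f) (tgt f) U)"
    and x: "x \<in> U" and V: "opn (tgt f) V" "t \<in> carrier (sec (tgt f) V)" "base_map f x \<in> V"
    and eq: "\<sigma> x = gm (tgt f) (base_map f x) V t"
  shows "gm (src f) x U (comap f U \<sigma>) = gm (src f) x (preimage f V) (sec_map f V t)"
  unfolding comap_eq_mk_comap[OF f U]
  using mk_comap_germ[OF ms_morphismD(1,2)[OF f] sec_map_cohom[OF f] U x V eq] .

text \<open>Being a morphism constrains \<open>comap\<close> only on actual sections of the inverse
  image. Hence a concretely defined \<open>comap\<close> is known to be a morphism as soon as it
  agrees there with one built by \<open>mk_mor\<close>.\<close>

lemma ms_morphism_cong: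
  assumes f: "ms_morphism f" and g: "src g = src f" "tgt g = tgt f" "base_map g = base_map f"
    and eq: "\<And>U \<sigma>. opn (src f) U \<Longrightarrow> \<sigma> \<in> carrier (psec (src f) (base_map f) (tgt f) U) \<Longrightarrow> comap g U \<sigma> = comap f U \<sigma>"
  shows "ms_morphism g"
proof -
  note fD = ms_morphismD[OF f]
  have "monoid_hom (psec (src f) (base_map f) (tgt f) U) (sec (src f) U) (comap g U)" if U: "opn (src f) U" for U
    using fD(4)[OF U] eq[OF U] psec_mult_closed[OF fD(2,3)] psec_one_closed[OF fD(2,3) U]
    by (auto simp: monoid_hom_def hom_def)
  moreover have "comap g V (restrict \<sigma> V) = res (src f) U V (comap g U \<sigma>)"
    if "opn (src f) U" "opn (src f) V" "V \<subseteq> U" "\<sigma> \<in> carrier (psec (src f) (base_map f) (tgt f) U)" for U V \<sigma>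
    using fD(5)[OF that] eq that psec_restrict_closed[OF that(4,2,3)] by simp
  ultimately show ?thesis
    using fD(1-3) unfolding ms_morphism_def g sheaf_hom_def psec_restr_def by blast
qed

lemma mor_eqD:
  assumes f: "ms_morphism f" and eq: "mor_eq f g"
  shows "src f = src g" "tgt f = tgt g" "\<And>x. x \<in> topspace (pts (src f)) \<Longrightarrow> base_map f x = base_map g x"
    "\<And>V t. opn (tgt f) V \<Longrightarrow> t \<in> carrier (sec (tgt f) V) \<Longrightarrow> sec_map f V t = sec_map g V t"
proof -
  show st: "src f = src g" "tgt f = tgt g" and b: "\<And>x. x \<in> topspace (pts (src f)) \<Longrightarrow> base_map f x = base_map g x"
    using eq by (auto simp: mor_eq_def)
  fix V t assume V: "opn (tgt f) V" "t \<in> carrier (sec (tgt f) V)"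
  have P: "preimage g V = preimage f V"
    using b st by auto
  have "germfun (tgt g) (base_map g) V t (preimage g V) = germfun (tgt f) (base_map f) V t (preimage f V)"
    unfolding P using b st by (auto simp: germfun_def fun_eq_iff)
  then show "sec_map f V t = sec_map g V t"
    using eq V germfun_closed[OF continuous_pre[OF ms_morphismD(3)[OF f] V(1)] V(1) subset_refl V(2)]
      continuous_pre[OF ms_morphismD(3)[OF f] V(1)]
    unfolding mor_eq_def sec_map_germfun P by simp
qed

text \<open>Both values of \<open>comap\<close> are sections over \<open>U\<close>, and their germs
  are computed from \<open>sec_map\<close> through any representative of
  \<open>\<sigma> x\<close>.\<close>

lemma mor_eqI:
  assumes f: "ms_morphism f" and g: "ms_morphism g" and st: "src f = src g" "tgt f = tgt g"
    and b: "\<And>x. x \<in> topspace (pts (src f)) \<Longrightarrow> base_map f x = base_map g x"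
    and s: "\<And>V t. opn (tgt f) V \<Longrightarrow> t \<in> carrier (sec (tgt f) V) \<Longrightarrow> sec_map f V t = sec_map g V t"
  shows "mor_eq f g"
  unfolding mor_eq_def
proof (intro conjI ballI allI impI st b)
  fix U \<sigma> assume U: "opn (src f) U" and \<sigma>: "\<sigma> \<in> carrier (psec (src f) (base_map f) (tgt f) U)"
  have b': "base_map f x = base_map g x" if "x \<in> U" for x
    using b that opn_subset[OF U] by blast
  \<comment> \<open>The base maps agree only on points of the source, so the two inverse images are
    identified over \<open>U\<close> before both sheaf maps can be applied to
    \<open>\<sigma>\<close>.\<close>
  have ind: "induced_on (src g) (base_map g) (tgt g) W V t \<sigma> \<longleftrightarrow> induced_on (src f) (base_map f) (tgt f) W V t \<sigma>"
    if "W \<subseteq> U" for W V t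
    using that b' unfolding induced_on_def st by (auto simp: subset_iff image_subset_iff)
  have \<sigma>': "\<sigma> \<in> carrier (psec (src g) (base_map g) (tgt g) U)"
    using \<sigma> ind unfolding psec_carrier_iff by blast
  have U': "opn (src g) U" using U st by simp
  show "comap f U \<sigma> = comap g U \<sigma>"
  proof (rule germ_sep[OF ms_morphismD(1)[OF f] U])
    show "comap f U \<sigma> \<in> carrier (sec (src f) U)"
      by (rule monoid_hom_closed[OF ms_morphismD(4)[OF f U] \<sigma>])
    show "comap g U \<sigma> \<in> carrier (sec (src f) U)"
      using monoid_hom_closed[OF ms_morphismD(4)[OF g U'] \<sigma>'] st by simp
    fix x assume x: "x \<in> U"
    then obtain V t where V: "opn (tgt f) V" "t \<in> carrier (sec (tgt f) V)" "base_map f x \<in> V"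
      "\<sigma> x = gm (tgt f) (base_map f x) V t"
      by (rule psec_germ_cases[OF \<sigma>])
    have "preimage g V = preimage f V"
      using b st by auto
    then show "gm (src f) x U (comap f U \<sigma>) = gm (src f) x U (comap g U \<sigma>)"
      using comap_germ[OF f U \<sigma> x V] comap_germ[OF g U' \<sigma>' x, of V t] V b'[OF x] s[OF V(1,2)] st by simp
  qed
qed

lemma stalk_map_germ:
  assumes f: "ms_morphism f" and x: "x \<in> topspace (pts (src f))"
    and V: "opn (tgt f) V" "t \<in> carrier (sec (tgt f) V)" "base_map f x \<in> V"
  shows "stalk_map f x (gm (tgt f) (base_map f x) V t) = gm (src f) x (preimage f V) (sec_map f V t)"
proof -
  have eq: "gm (src f) x (preimage f V') (sec_map f V' t') = gm (src f) x (preimage f V) (sec_map f V t)"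
    if "(V', t') \<in> gm (tgt f) (base_map f x) V t" for V' t'
  proof -
    have V': "opn (tgt f) V'" "base_map f x \<in> V'" "t' \<in> carrier (sec (tgt f) V')"
      using that unfolding germ_mem_iff by auto
    show ?thesis
      using germ_mem_eq[OF ms_morphismD(2)[OF f] V(1,3,2) that] V V' x
      by (intro cohom_germ[OF ms_morphismD(1,2)[OF f] sec_map_cohom[OF f]]) auto
  qed
  show ?thesis
    unfolding stalk_map_def
    using germ_self_mem[OF V(1,3,2)] eq by (rule UN_pair_const)
qed

section \<open>Composition, identities and isomorphisms\<close>

lemma mor_comp_sel [simp]:
  "src (g \<odot> f) = src f" "tgt (g \<odot> f) = tgt g" "base_map (g \<odot> f) = base_map g \<circ> base_map f"
  by (simp_all add: mor_comp_def)

lemma mor_id_sel [simp]: "src (mor_id X) = X" "tgt (mor_id X) = X" "base_map (mor_id X) = id"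
  by (simp_all add: mor_id_def)

lemma pre_comp:
  assumes "continuous_map (pts X) (pts Y) f"
  shows "pre X (g \<circ> f) V = pre X f (pre Y g V)"
  using assms by (auto simp: continuous_map_def Pi_iff)

lemma pre_id: "opn X V \<Longrightarrow> pre X id V = V"
  using opn_subset by fastforce

lemma pre_ident: "opn X V \<Longrightarrow> pre X (\<lambda>x. x) V = V"
  using pre_id[of X V] by (simp add: id_def)

lemma cohom_comp:
  assumes \<phi>: "cohom X f Y \<phi>" and \<psi>: "cohom Y g Z \<psi>"
  shows "cohom X (g \<circ> f) Z (\<lambda>V t. \<phi> (pre Y g V) (\<psi> V t))"
proof -
  have "pre Y g W \<subseteq> pre Y g V" if "W \<subseteq> V" for V W using that by auto
  then show ?thesis
    unfolding cohom_def pre_comp[OF cohom_cont[OF \<phi>]]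
    using cohom_res[OF \<psi>] cohom_res[OF \<phi> cohom_pre[OF \<psi>] cohom_pre[OF \<psi>]] cohom_closed[OF \<psi>]
      cohom_closed[OF \<phi> cohom_pre[OF \<psi>]] cohom_mult[OF \<psi>] cohom_mult[OF \<phi> cohom_pre[OF \<psi>]]
      cohom_one[OF \<psi>] cohom_one[OF \<phi> cohom_pre[OF \<psi>]]
    by (auto intro!: continuous_map_compose[OF cohom_cont[OF \<phi>] cohom_cont[OF \<psi>]] monoid_homI)
qed

lemma cohom_id: "monoidal_space X \<Longrightarrow> cohom X id X (\<lambda>V t. t)"
  by (auto simp: cohom_def pre_ident intro!: monoid_homI)

text \<open>On sections, composition is ordinary composition. To see this, the family of germs of
  the last space is turned by the stalk maps of \<open>g\<close> into a family \<open>\<tau>\<close>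
  of germs of the middle space, and the germs of \<open>comap f U \<tau>\<close> are read off from a
  section representing \<open>\<sigma>\<close>.\<close>

lemma mor_comp_props:
  assumes f: "ms_morphism f" and g: "ms_morphism g" and fg: "tgt f = src g"
  shows ms_morphism_comp: "ms_morphism (g \<odot> f)"
    and sec_map_comp: "\<And>V t. opn (tgt g) V \<Longrightarrow> t \<in> carrier (sec (tgt g) V) \<Longrightarrow>
      sec_map (g \<odot> f) V t = sec_map f (preimage g V) (sec_map g V t)"
proof -
  let ?X = "src f" and ?Y = "src g" and ?Z = "tgt g" and ?b = "base_map g \<circ> base_map f"
  note X = ms_morphismD(1)[OF f] and Y = ms_morphismD(1)[OF g] and Z = ms_morphismD(2)[OF g]
  note \<phi> = sec_map_cohom[OF f, unfolded fg] and \<psi> = sec_map_cohom[OF g]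
  let ?\<chi> = "\<lambda>V t. sec_map f (preimage g V) (sec_map g V t)"
  note \<chi> = cohom_comp[OF \<phi> \<psi>]
  have stk: "stalk_map g (base_map f x) (gm ?Z (?b x) V t) =
      gm ?Y (base_map f x) (preimage g V) (sec_map g V t)"
    if "x \<in> topspace (pts ?X)" "opn ?Z V" "t \<in> carrier (sec ?Z V)" "?b x \<in> V" for x V t
    using stalk_map_germ[OF g _ that(2,3)] that cohom_cont[OF \<phi>]
    by (auto simp: continuous_map_def Pi_iff)
  have eq: "comap (g \<odot> f) U \<sigma> = mk_comap ?X ?b ?Z ?\<chi> U \<sigma>"
    if U: "opn ?X U" and \<sigma>: "\<sigma> \<in> carrier (psec ?X ?b ?Z U)" for U \<sigma>
  proof -
    define \<tau> where "\<tau> = (\<lambda>x\<in>U. stalk_map g (base_map f x) (\<sigma> x))"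
    have UX: "x \<in> topspace (pts ?X)" if "x \<in> U" for x
      using that opn_subset[OF U] by blast
    have \<tau>: "\<tau> \<in> carrier (psec ?X (base_map f) (tgt f) U)"
    proof (rule psecI)
      fix x assume "x \<in> U"
      then obtain W V t where W: "x \<in> W" "W \<subseteq> U" "induced_on ?X ?b ?Z W V t \<sigma>"
        by (rule psec_cases[OF \<sigma>])
      note i = induced_onD[OF W(3)]
      have "induced_on ?X (base_map f) (tgt f) W (preimage g V) (sec_map g V t) \<tau>"
        unfolding induced_on_def fg
      proof (intro conjI ballI i(1) cohom_pre[OF \<psi> i(2)] cohom_closed[OF \<psi> i(2,4)])
        show "base_map f ` W \<subseteq> preimage g V"
          using i(3) W(2) UX cohom_cont[OF \<phi>] by (auto simp: continuous_map_def Pi_iff)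
        fix z assume z: "z \<in> W"
        have "z \<in> U" "?b z \<in> V" using z W(2) i(3) by auto
        then show "\<tau> z = gm ?Y (base_map f z) (preimage g V) (sec_map g V t)"
          using stk[OF UX i(2,4)] i(5)[OF z] by (simp add: \<tau>_def)
      qed
      with W show "\<exists>W V t. x \<in> W \<and> W \<subseteq> U \<and> induced_on ?X (base_map f) (tgt f) W V t \<tau>" by blast
    qed (simp add: \<tau>_def)
    have "mk_comap ?X ?b ?Z ?\<chi> U \<sigma> = comap f U \<tau>"
    proof (rule mk_comap_eqI[OF X Z \<chi> U])
      show "comap f U \<tau> \<in> carrier (sec ?X U)"
        by (rule monoid_hom_closed[OF ms_morphismD(4)[OF f U] \<tau>])
      fix x assume x: "x \<in> U"
      then obtain V t where V: "opn ?Z V" "t \<in> carrier (sec ?Z V)" "?b x \<in> V" "\<sigma> x = gm ?Z (?b x) V t"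
        by (rule psec_germ_cases[OF \<sigma>])
      have \<tau>x: "\<tau> x = gm (tgt f) (base_map f x) (preimage g V) (sec_map g V t)"
        using stk[OF UX[OF x] V(1-3)] V(4) x by (simp add: \<tau>_def fg)
      have bx: "base_map f x \<in> preimage g V"
        using UX[OF x] V(3) cohom_cont[OF \<phi>] by (auto simp: continuous_map_def Pi_iff)
      have "gm ?X x U (comap f U \<tau>) = gm ?X x (pre ?X ?b V) (?\<chi> V t)"
        unfolding pre_comp[OF cohom_cont[OF \<phi>]]
        by (rule comap_germ[OF f U \<tau> x _ _ bx \<tau>x]) (use fg cohom_pre[OF \<psi> V(1)] cohom_closed[OF \<psi> V(1,2)] in auto)
      with V show "\<exists>V t. opn ?Z V \<and> t \<in> carrier (sec ?Z V) \<and> ?b x \<in> V \<and> \<sigma> x = gm ?Z (?b x) V t \<and>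
        gm ?X x U (comap f U \<tau>) = gm ?X x (pre ?X ?b V) (?\<chi> V t)" by blast
    qed
    then show ?thesis
      by (simp add: mor_comp_def \<tau>_def)
  qed
  note m = mk_mor_morphism[OF X Z \<chi>]
  show "ms_morphism (g \<odot> f)"
    by (rule ms_morphism_cong[OF m]) (use eq in auto)
  fix V t assume V: "opn ?Z V" "t \<in> carrier (sec ?Z V)"
  have "sec_map (g \<odot> f) V t = sec_map (mk_mor ?X ?b ?Z ?\<chi>) V t"
    using eq[OF cohom_pre[OF \<chi> V(1)] germfun_closed[OF cohom_pre[OF \<chi> V(1)] V(1) subset_refl V(2)]]
    unfolding sec_map_germfun[of "g \<odot> f"] sec_map_germfun[of "mk_mor ?X ?b ?Z ?\<chi>"] mor_comp_sel mk_mor_sel .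
  then show "sec_map (g \<odot> f) V t = ?\<chi> V t"
    using sec_map_mk_mor[OF X Z \<chi> V] by simp
qed

lemma mor_id_props:
  assumes X: "monoidal_space X"
  shows ms_morphism_id: "ms_morphism (mor_id X)"
    and sec_map_id: "\<And>V t. opn X V \<Longrightarrow> t \<in> carrier (sec X V) \<Longrightarrow> sec_map (mor_id X) V t = t"
proof -
  note \<chi> = cohom_id[OF X]
  let ?c = "mk_comap X id X (\<lambda>V t. t)"
  have eq: "comap (mor_id X) U \<sigma> = ?c U \<sigma>" if U: "opn X U" and \<sigma>: "\<sigma> \<in> carrier (psec X id X U)" for U \<sigma>
  proof -
    note c = mk_comap_closed[OF X X \<chi> U \<sigma>]
    have g: "gm X x U (?c U \<sigma>) = \<sigma> x" if x: "x \<in> U" for x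
    proof -
      obtain V t where V: "opn X V" "t \<in> carrier (sec X V)" "id x \<in> V" "\<sigma> x = gm X (id x) V t"
        by (rule psec_germ_cases[OF \<sigma> x])
      have "gm X x U (?c U \<sigma>) = gm X x (pre X id V) t"
        by (rule mk_comap_germ[OF X X \<chi> U \<sigma> x V])
      then show ?thesis
        using V(4) unfolding pre_id[OF V(1)] by simp
    qed
    show ?thesis
      unfolding mor_id_def
    proof (simp, rule the_equality)
      fix s assume s: "s \<in> carrier (sec X U) \<and> (\<forall>x\<in>U. gm X x U s = \<sigma> x)"
      then show "s = ?c U \<sigma>"
        using g by (intro germ_sep[OF X U _ c]) auto
    qed (use c g in auto)
  qed
  note m = mk_mor_morphism[OF X X \<chi>]
  show "ms_morphism (mor_id X)"
    by (rule ms_morphism_cong[OF m]) (use eq in auto)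
  fix V t assume V: "opn X V" "t \<in> carrier (sec X V)"
  have "sec_map (mor_id X) V t = sec_map (mk_mor X id X (\<lambda>V t. t)) V t"
    using eq[OF cohom_pre[OF \<chi> V(1)] germfun_closed[OF cohom_pre[OF \<chi> V(1)] V(1) subset_refl V(2)]]
    unfolding sec_map_germfun mor_id_sel mk_mor_sel by assumption
  then show "sec_map (mor_id X) V t = t"
    using sec_map_mk_mor[OF X X \<chi> V] by simp
qed

lemma pre_homeomorphic:
  assumes hm: "homeomorphic_maps (pts X) (pts Y) f g"
  shows "U \<subseteq> topspace (pts X) \<Longrightarrow> pre X f (pre Y g U) = U"
  using hm unfolding homeomorphic_maps_def continuous_map_def by (auto simp: Pi_iff)

text \<open>Inverting the bijections of sections gives the maps of sections of the inverse morphism;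
  that they are homomorphisms and commute with restriction follows from injectivity of
  \<open>sec_map f\<close>.\<close>

lemma is_isoI:
  assumes f: "ms_morphism f" and homeo: "homeomorphic_map (pts (src f)) (pts (tgt f)) (base_map f)"
    and bij: "\<And>V. opn (tgt f) V \<Longrightarrow>
      bij_betw (sec_map f V) (carrier (sec (tgt f) V)) (carrier (sec (src f) (preimage f V)))"
  shows "is_iso f"
proof -
  let ?X = "src f" and ?Y = "tgt f" and ?b = "base_map f"
  note X = ms_morphismD(1)[OF f] and Y = ms_morphismD(2)[OF f] and \<phi> = sec_map_cohom[OF f]
  obtain g where hm: "homeomorphic_maps (pts ?X) (pts ?Y) ?b g"
    by (rule exE[OF homeo[unfolded homeomorphic_map_maps]])
  note hm' = hm[unfolded homeomorphic_maps_sym[of "pts ?X"]]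
  have cont: "continuous_map (pts ?Y) (pts ?X) g"
    using hm by (simp add: homeomorphic_maps_def)
  have PP: "preimage f (pre ?Y g U) = U" if "opn ?X U" for U
    using pre_homeomorphic[OF hm opn_subset[OF that]] .
  have PP': "pre ?Y g (preimage f V) = V" if "opn ?Y V" for V
    using pre_homeomorphic[OF hm' opn_subset[OF that]] .
  have op: "opn ?Y (pre ?Y g U)" if "opn ?X U" for U
    using continuous_pre[OF cont that] .
  \<comment> \<open>Every open \<open>U\<close> of the source is the preimage under \<open>f\<close>
    of \<open>pre ?Y g U\<close>, so the bijection over that open set is the one to invert.\<close>
  define \<psi> where "\<psi> U = the_inv_into (carrier (sec ?Y (pre ?Y g U))) (sec_map f (pre ?Y g U))" for U
  have inj: "inj_on (sec_map f V) (carrier (sec ?Y V))"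
    and im: "sec_map f V ` carrier (sec ?Y V) = carrier (sec ?X (preimage f V))" if "opn ?Y V" for V
    using bij[OF that] by (auto simp: bij_betw_def)
  have \<psi>_closed: "\<psi> U s \<in> carrier (sec ?Y (pre ?Y g U))" and s\<psi>: "sec_map f (pre ?Y g U) (\<psi> U s) = s"
    if U: "opn ?X U" and s: "s \<in> carrier (sec ?X U)" for U s
    using the_inv_into_into[OF inj[OF op[OF U]], of s] f_the_inv_into_f[OF inj[OF op[OF U]], of s]
      im[OF op[OF U]] s PP[OF U] by (auto simp: \<psi>_def)
  have \<psi>_eqI: "\<psi> U s = t"
    if U: "opn ?X U" and t: "t \<in> carrier (sec ?Y (pre ?Y g U))" "sec_map f (pre ?Y g U) t = s" for U s t
    using the_inv_into_f_f[OF inj[OF op[OF U]] t(1)] t(2) by (simp add: \<psi>_def)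
  have \<psi>: "cohom ?Y g ?X \<psi>"
    unfolding cohom_def
  proof (intro conjI allI impI ballI cont)
    fix U assume U: "opn ?X U"
    note h = cohom_hom[OF \<phi> op[OF U], unfolded PP[OF U]]
    interpret comm_monoid "sec ?Y (pre ?Y g U)" by (rule sec_comm_monoid[OF Y op[OF U]])
    show "monoid_hom (sec ?X U) (sec ?Y (pre ?Y g U)) (\<psi> U)"
    proof (rule monoid_homI)
      fix s t assume s: "s \<in> carrier (sec ?X U)" and t: "t \<in> carrier (sec ?X U)"
      show "\<psi> U (s \<otimes>\<^bsub>sec ?X U\<^esub> t) = \<psi> U s \<otimes>\<^bsub>sec ?Y (pre ?Y g U)\<^esub> \<psi> U t"
        using \<psi>_closed[OF U s] \<psi>_closed[OF U t] s\<psi>[OF U s] s\<psi>[OF U t]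
        by (intro \<psi>_eqI[OF U]) (simp_all only: m_closed monoid_hom_mult[OF h])
    next
      show "\<psi> U \<one>\<^bsub>sec ?X U\<^esub> = \<one>\<^bsub>sec ?Y (pre ?Y g U)\<^esub>"
        by (intro \<psi>_eqI[OF U]) (simp_all only: one_closed monoid_hom_one[OF h])
    qed (rule \<psi>_closed[OF U])
  next
    fix U W s assume UW: "opn ?X U \<and> opn ?X W \<and> W \<subseteq> U" and s: "s \<in> carrier (sec ?X U)"
    then have U: "opn ?X U" "opn ?X W" "pre ?Y g W \<subseteq> pre ?Y g U" by auto
    show "\<psi> W (res ?X U W s) = res ?Y (pre ?Y g U) (pre ?Y g W) (\<psi> U s)"
    proof (rule \<psi>_eqI[OF U(2)])
      show "res ?Y (pre ?Y g U) (pre ?Y g W) (\<psi> U s) \<in> carrier (sec ?Y (pre ?Y g W))"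
        by (rule res_closed[OF Y op[OF U(1)] op[OF U(2)] U(3) \<psi>_closed[OF U(1) s]])
      show "sec_map f (pre ?Y g W) (res ?Y (pre ?Y g U) (pre ?Y g W) (\<psi> U s)) = res ?X U W s"
        unfolding cohom_res[OF \<phi> op[OF U(1)] op[OF U(2)] U(3) \<psi>_closed[OF U(1) s]]
          PP[OF U(1)] PP[OF U(2)] s\<psi>[OF U(1) s] ..
    qed
  qed
  let ?g = "mk_mor ?Y g ?X \<psi>"
  have g: "ms_morphism ?g" by (rule mk_mor_morphism[OF Y X \<psi>])
  have "mor_eq (?g \<odot> f) (mor_id ?X)"
  proof (rule mor_eqI[OF ms_morphism_comp[OF f g] ms_morphism_id[OF X]])
    show "base_map (?g \<odot> f) x = base_map (mor_id ?X) x" if "x \<in> topspace (pts (src (?g \<odot> f)))" for x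
      using hm that by (simp add: homeomorphic_maps_def)
    fix V t assume "opn (tgt (?g \<odot> f)) V" "t \<in> carrier (sec (tgt (?g \<odot> f)) V)"
    then have V: "opn ?X V" "t \<in> carrier (sec ?X V)" by simp_all
    show "sec_map (?g \<odot> f) V t = sec_map (mor_id ?X) V t"
      using sec_map_comp[OF f g, of V t] V by (simp add: sec_map_mk_mor[OF Y X \<psi>] sec_map_id[OF X] s\<psi>)
  qed simp_all
  moreover have "mor_eq (f \<odot> ?g) (mor_id ?Y)"
  proof (rule mor_eqI[OF ms_morphism_comp[OF g f] ms_morphism_id[OF Y]])
    show "base_map (f \<odot> ?g) x = base_map (mor_id ?Y) x" if "x \<in> topspace (pts (src (f \<odot> ?g)))" for x
      using hm that by (simp add: homeomorphic_maps_def)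
    fix V t assume "opn (tgt (f \<odot> ?g)) V" "t \<in> carrier (sec (tgt (f \<odot> ?g)) V)"
    then have V: "opn ?Y V" "t \<in> carrier (sec ?Y V)" by simp_all
    have "\<psi> (preimage f V) (sec_map f V t) = t"
      by (intro \<psi>_eqI cohom_pre[OF \<phi> V(1)]) (simp_all only: PP'[OF V(1)] V)
    then show "sec_map (f \<odot> ?g) V t = sec_map (mor_id ?Y) V t"
      using sec_map_comp[OF g f, of V t] V
      by (simp add: sec_map_mk_mor[OF Y X \<psi> cohom_pre[OF \<phi>] cohom_closed[OF \<phi>]] sec_map_id[OF Y])
  qed simp_all
  ultimately show ?thesis
    using f g unfolding is_iso_def by (intro conjI exI[of _ ?g]) simp_all
qed

lemma is_isoD:
  assumes f: "is_iso f"
  shows "ms_morphism f" "homeomorphic_map (pts (src f)) (pts (tgt f)) (base_map f)"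
    "\<And>V. opn (tgt f) V \<Longrightarrow>
      bij_betw (sec_map f V) (carrier (sec (tgt f) V)) (carrier (sec (src f) (preimage f V)))"
proof -
  show m: "ms_morphism f" using f by (simp add: is_iso_def)
  obtain g where g: "ms_morphism g" "src g = tgt f" "tgt g = src f"
    and gf: "mor_eq (g \<odot> f) (mor_id (src f))" and fg: "mor_eq (f \<odot> g) (mor_id (tgt f))"
    using f unfolding is_iso_def by auto
  note X = ms_morphismD(1)[OF m] and Y = ms_morphismD(2)[OF m]
  note gf = mor_eqD[OF ms_morphism_comp[OF m g(1) g(2)[symmetric]] gf]
  note fg = mor_eqD[OF ms_morphism_comp[OF g(1) m g(3)] fg]
  have hm: "homeomorphic_maps (pts (src f)) (pts (tgt f)) (base_map f) (base_map g)"
    unfolding homeomorphic_maps_def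
    using ms_morphismD(3)[OF m] ms_morphismD(3)[OF g(1)] g gf(3) fg(3) by simp
  then show "homeomorphic_map (pts (src f)) (pts (tgt f)) (base_map f)"
    unfolding homeomorphic_map_maps by (rule exI[of _ "base_map g"])
  fix V assume V: "opn (tgt f) V"
  let ?U = "preimage f V"
  note \<phi> = sec_map_cohom[OF m] and \<psi> = sec_map_cohom[OF g(1), unfolded g]
  have U: "opn (src f) ?U" by (rule cohom_pre[OF \<phi> V])
  have P: "preimage g ?U = V"
    using pre_homeomorphic[OF hm[unfolded homeomorphic_maps_sym[of "pts (src f)"]] opn_subset[OF V]] g by simp
  show "bij_betw (sec_map f V) (carrier (sec (tgt f) V)) (carrier (sec (src f) ?U))"
  proof (rule bij_betw_byWitness[where f' = "sec_map g ?U"])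
    show "\<forall>t\<in>carrier (sec (tgt f) V). sec_map g ?U (sec_map f V t) = t"
      using sec_map_comp[OF g(1) m g(3) V] fg(4)[of V] sec_map_id[OF Y V] V by simp
    show "\<forall>s\<in>carrier (sec (src f) ?U). sec_map f V (sec_map g ?U s) = s"
      using sec_map_comp[OF m g(1) g(2)[symmetric], of ?U] gf(4)[of ?U] sec_map_id[OF X U] U P g by simp
    show "sec_map f V ` carrier (sec (tgt f) V) \<subseteq> carrier (sec (src f) ?U)"
      using cohom_closed[OF \<phi> V] by auto
    show "sec_map g ?U ` carrier (sec (src f) ?U) \<subseteq> carrier (sec (tgt f) V)"
      using cohom_closed[OF \<psi> U] P g by auto
  qed
qed

lemma is_iso_inverse:
  assumes "is_iso f"
  obtains g where "is_iso g" "src g = tgt f" "tgt g = src f"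
  using assms unfolding is_iso_def by metis

section \<open>Locality of morphisms in terms of sections\<close>

lemma unit_at_sec_map:
  assumes f: "ms_morphism f" and x: "x \<in> topspace (pts (src f))" "opn (tgt f) V" "base_map f x \<in> V"
    "t \<in> carrier (sec (tgt f) V)" and u: "unit_at (tgt f) V t (base_map f x)"
  shows "unit_at (src f) (preimage f V) (sec_map f V t) x"
proof -
  note \<phi> = sec_map_cohom[OF f]
  obtain W where W: "opn (tgt f) W" "base_map f x \<in> W" "W \<subseteq> V" "res (tgt f) V W t \<in> Units (sec (tgt f) W)"
    using u unfolding unit_at_def by (elim exE conjE)
  have "res (src f) (preimage f V) (preimage f W) (sec_map f V t) \<in> Units (sec (src f) (preimage f W))"
    using monoid_hom_Units[OF cohom_hom[OF \<phi> W(1)] W(4)] cohom_res[OF \<phi> x(2) W(1,3) x(4)] by simp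
  then show ?thesis
    unfolding unit_at_def using W x cohom_pre[OF \<phi> W(1)] by (intro exI[of _ "preimage f W"]) auto
qed

text \<open>Every stalk element is the germ of a section, and \<open>germ_Units_iff\<close>
  translates its invertibility. A map of stalks preserves units in any case, by
  \<open>unit_at_sec_map\<close>, so locality is the reflection of units.\<close>

lemma local_morphism_iff:
  assumes f: "ms_morphism f"
  shows "local_morphism f \<longleftrightarrow>
    (\<forall>x\<in>topspace (pts (src f)). \<forall>V t. opn (tgt f) V \<and> base_map f x \<in> V \<and> t \<in> carrier (sec (tgt f) V) \<and>
       unit_at (src f) (preimage f V) (sec_map f V t) x \<longrightarrow> unit_at (tgt f) V t (base_map f x))"
proof -
  let ?X = "src f" and ?Y = "tgt f" and ?b = "base_map f"
  note X = ms_morphismD(1)[OF f] and Y = ms_morphismD(2)[OF f] and \<phi> = sec_map_cohom[OF f]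
  have *: "stalk_map f x (gm ?Y (?b x) V t) \<in> Units (stk ?X x) \<longleftrightarrow> unit_at ?X (preimage f V) (sec_map f V t) x"
    "gm ?Y (?b x) V t \<in> Units (stk ?Y (?b x)) \<longleftrightarrow> unit_at ?Y V t (?b x)"
    if "x \<in> topspace (pts ?X)" "opn ?Y V" "?b x \<in> V" "t \<in> carrier (sec ?Y V)" for x V t
    using that germ_Units_iff[OF X cohom_pre[OF \<phi> that(2)] _ cohom_closed[OF \<phi> that(2,4)], of x]
      germ_Units_iff[OF Y that(2,3,4)] stalk_map_germ[OF f that(1,2,4,3)] by auto
  show ?thesis
  proof
    assume L: "local_morphism f"
    show "\<forall>x\<in>topspace (pts ?X). \<forall>V t. opn ?Y V \<and> ?b x \<in> V \<and> t \<in> carrier (sec ?Y V) \<and>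
       unit_at ?X (preimage f V) (sec_map f V t) x \<longrightarrow> unit_at ?Y V t (?b x)"
    proof (intro ballI allI impI, elim conjE)
      fix x V t assume a: "x \<in> topspace (pts ?X)" "opn ?Y V" "?b x \<in> V" "t \<in> carrier (sec ?Y V)"
        and u: "unit_at ?X (preimage f V) (sec_map f V t) x"
      have "gm ?Y (?b x) V t \<in> {g \<in> carrier (stk ?Y (?b x)). stalk_map f x g \<in> Units (stk ?X x)}"
        using *(1)[OF a] u germ_in_stalk[OF a(2,3,4)] by simp
      then have "gm ?Y (?b x) V t \<in> Units (stk ?Y (?b x))"
        using L a(1) unfolding local_morphism_def local_map_def by simp
      then show "unit_at ?Y V t (?b x)"
        using *(2)[OF a] by simp
    qed
  next
    assume R: "\<forall>x\<in>topspace (pts ?X). \<forall>V t. opn ?Y V \<and> ?b x \<in> V \<and> t \<in> carrier (sec ?Y V) \<and>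
       unit_at ?X (preimage f V) (sec_map f V t) x \<longrightarrow> unit_at ?Y V t (?b x)"
    show "local_morphism f"
      unfolding local_morphism_def local_map_def
    proof (rule ballI, rule Set.set_eqI)
      fix x g assume x: "x \<in> topspace (pts ?X)"
      show "g \<in> {g \<in> carrier (stk ?Y (?b x)). stalk_map f x g \<in> Units (stk ?X x)} \<longleftrightarrow>
        g \<in> Units (stk ?Y (?b x))"
      proof (cases "g \<in> carrier (stk ?Y (?b x))")
        case True
        then obtain V t where V: "opn ?Y V" "?b x \<in> V" "t \<in> carrier (sec ?Y V)" and g: "g = gm ?Y (?b x) V t"
          by (rule stalk_cases)
        have "unit_at ?X (preimage f V) (sec_map f V t) x \<longleftrightarrow> unit_at ?Y V t (?b x)"
          using R x V unit_at_sec_map[OF f x V] by blast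
        then show ?thesis
          using True *[OF x V] unfolding g by simp
      qed (auto simp: Units_def)
    qed
  qed
qed

lemma local_morphismD:
  assumes f: "ms_morphism f" "local_morphism f" and x: "x \<in> topspace (pts (src f))"
    and V: "opn (tgt f) V" "base_map f x \<in> V" "t \<in> carrier (sec (tgt f) V)"
    and u: "unit_at (src f) (preimage f V) (sec_map f V t) x"
  shows "unit_at (tgt f) V t (base_map f x)"
  by (rule mp[OF spec[OF spec[OF bspec[OF f(2)[unfolded local_morphism_iff[OF f(1)]] x]]]]) (intro conjI V u)

section \<open>Localization\<close>

text \<open>The elements which become invertible in the localization at \<open>S\<close>.\<close>

definition saturation :: "('p, 'c) monoid_scheme \<Rightarrow> 'p set \<Rightarrow> 'p set" where
  "saturation P S = {a \<in> carrier P. \<exists>y\<in>carrier P. a \<otimes>\<^bsub>P\<^esub> y \<in> S}"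

text \<open>For a submonoid \<open>S\<close> this says that \<open>x\<close> and \<open>y\<close>
  have the same image in the localization. Without cancellation in \<open>P\<close> the extra factor
  \<open>c\<close> is essential.\<close>

definition loc_eq :: "('p, 'c) monoid_scheme \<Rightarrow> 'p set \<Rightarrow> 'p \<Rightarrow> 'p \<Rightarrow> bool" where
  "loc_eq P S x y \<longleftrightarrow> (\<exists>c\<in>S. x \<otimes>\<^bsub>P\<^esub> c = y \<otimes>\<^bsub>P\<^esub> c)"

lemma localization_mult_def:
  "c \<otimes>\<^bsub>localization P S\<^esub> d = (\<Union>(x, a)\<in>c. \<Union>(y, b)\<in>d. fraction P S (x \<otimes>\<^bsub>P\<^esub> y) (a \<otimes>\<^bsub>P\<^esub> b))"
  by (simp add: localization_def)

lemma localization_one_def: "\<one>\<^bsub>localization P S\<^esub> = fraction P S \<one>\<^bsub>P\<^esub> \<one>\<^bsub>P\<^esub>"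
  by (simp add: localization_def)

locale mult_set = comm_monoid P for P :: "('p, 'c) monoid_scheme" (structure) and S +
  assumes S: "submonoid S P"

lemma (in mult_set) S_closed: "a \<in> S \<Longrightarrow> a \<in> carrier P"
  and S_one: "\<one> \<in> S"
  and S_mult: "a \<in> S \<Longrightarrow> b \<in> S \<Longrightarrow> a \<otimes> b \<in> S"
  using S by (auto simp: submonoid_def)

lemma (in mult_set) sat_closed: "a \<in> saturation P S \<Longrightarrow> a \<in> carrier P"
  by (simp add: saturation_def)

lemma (in mult_set) S_sat: "a \<in> S \<Longrightarrow> a \<in> saturation P S"
  using S_closed S_one by (auto simp: saturation_def intro!: bexI[of _ \<one>])

lemma (in mult_set) sat_mult:
  assumes "a \<in> saturation P S" "b \<in> saturation P S"
  shows "a \<otimes> b \<in> saturation P S"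
proof -
  obtain y z where y: "y \<in> carrier P" "a \<otimes> y \<in> S" and z: "z \<in> carrier P" "b \<otimes> z \<in> S"
    and ab: "a \<in> carrier P" "b \<in> carrier P"
    using assms unfolding saturation_def by auto
  have "(a \<otimes> b) \<otimes> (y \<otimes> z) = (a \<otimes> y) \<otimes> (b \<otimes> z)"
    using y z ab by (simp add: m_ac)
  then have "(a \<otimes> b) \<otimes> (y \<otimes> z) \<in> S"
    using S_mult[OF y(2) z(2)] by simp
  then show ?thesis
    using y z ab by (auto simp: saturation_def intro!: bexI[of _ "y \<otimes> z"])
qed

lemma (in mult_set) loc_eq_refl: "loc_eq P S x x"
  using S_one by (auto simp: loc_eq_def)

lemma (in mult_set) loc_eq_sym: "loc_eq P S x y \<Longrightarrow> loc_eq P S y x"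
  unfolding loc_eq_def by metis

lemma (in mult_set) loc_eq_trans:
  assumes "loc_eq P S x y" "loc_eq P S y z" "x \<in> carrier P" "y \<in> carrier P" "z \<in> carrier P"
  shows "loc_eq P S x z"
proof -
  obtain c d where cd: "c \<in> S" "x \<otimes> c = y \<otimes> c" "d \<in> S" "y \<otimes> d = z \<otimes> d"
    using assms by (auto simp: loc_eq_def)
  have cc: "c \<in> carrier P" "d \<in> carrier P"
    using cd S_closed by auto
  have "x \<otimes> (c \<otimes> d) = (x \<otimes> c) \<otimes> d"
    using assms(3-5) cc by (simp add: m_assoc)
  also have "\<dots> = (y \<otimes> d) \<otimes> c"
    unfolding cd(2) using assms(3-5) cc by (simp add: m_ac)
  also have "\<dots> = z \<otimes> (c \<otimes> d)"
    unfolding cd(4) using assms(3-5) cc by (simp add: m_ac)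
  finally show ?thesis
    using S_mult cd unfolding loc_eq_def by blast
qed

lemma (in mult_set) loc_eq_mult:
  assumes "loc_eq P S x y" "x \<in> carrier P" "y \<in> carrier P" "z \<in> carrier P"
  shows "loc_eq P S (x \<otimes> z) (y \<otimes> z)"
proof -
  obtain c where c: "c \<in> S" "x \<otimes> c = y \<otimes> c"
    using assms by (auto simp: loc_eq_def)
  have "x \<otimes> z \<otimes> c = (x \<otimes> c) \<otimes> z"
    using assms(2-4) S_closed[OF c(1)] by (simp add: m_ac)
  also have "\<dots> = y \<otimes> z \<otimes> c"
    unfolding c(2) using assms(2-4) S_closed[OF c(1)] by (simp add: m_ac)
  finally show ?thesis
    using c unfolding loc_eq_def by blast
qed

text \<open>Some multiple \<open>a \<otimes> z\<close> lies in \<open>S\<close>, so after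
  multiplying the relation by \<open>z\<close> the factor \<open>a\<close> is absorbed into the
  witness.\<close>

lemma (in mult_set) loc_eq_cancel:
  assumes "loc_eq P S (x \<otimes> a) (y \<otimes> a)" "x \<in> carrier P" "y \<in> carrier P" "a \<in> saturation P S"
  shows "loc_eq P S x y"
proof -
  obtain c where c: "c \<in> S" "x \<otimes> a \<otimes> c = y \<otimes> a \<otimes> c"
    using assms by (auto simp: loc_eq_def)
  obtain z where z: "z \<in> carrier P" "a \<otimes> z \<in> S" and a: "a \<in> carrier P"
    using assms(4) by (auto simp: saturation_def)
  have "x \<otimes> (a \<otimes> z \<otimes> c) = (x \<otimes> a \<otimes> c) \<otimes> z"
    using assms(2,3) S_closed[OF c(1)] z(1) a by (simp add: m_ac)
  also have "\<dots> = y \<otimes> (a \<otimes> z \<otimes> c)"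
    unfolding c(2) using assms(2,3) S_closed[OF c(1)] z(1) a by (simp add: m_ac)
  finally show ?thesis
    using S_mult[OF z(2) c(1)] unfolding loc_eq_def by blast
qed

lemma (in mult_set) fraction_mem: "(y, b) \<in> fraction P S x a \<longleftrightarrow> y \<in> carrier P \<and> b \<in> S \<and> loc_eq P S (x \<otimes> b) (y \<otimes> a)"
  by (simp add: fraction_def loc_eq_def)

text \<open>This is transitivity of equality of fractions: up to \<open>loc_eq\<close>,
  \<open>w \<otimes> a \<otimes> b\<close> equals \<open>x \<otimes> b \<otimes> d\<close>, which
  equals \<open>y \<otimes> a \<otimes> d\<close>, and then \<open>a\<close> is cancelled.\<close>

lemma (in mult_set) fraction_subset:
  assumes x: "x \<in> carrier P" "y \<in> carrier P" "a \<in> saturation P S" "b \<in> saturation P S"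
    and eq: "loc_eq P S (x \<otimes> b) (y \<otimes> a)"
  shows "fraction P S x a \<subseteq> fraction P S y b"
proof (rule subrelI)
  fix w d assume "(w, d) \<in> fraction P S x a"
  then have w: "w \<in> carrier P" "d \<in> S" "loc_eq P S (x \<otimes> d) (w \<otimes> a)"
    by (auto simp: fraction_mem)
  note c = x(1,2) sat_closed[OF x(3)] sat_closed[OF x(4)] w(1) S_closed[OF w(2)]
  have "loc_eq P S (w \<otimes> a \<otimes> b) (x \<otimes> d \<otimes> b)"
    using c by (intro loc_eq_mult loc_eq_sym[OF w(3)]) auto
  moreover have "x \<otimes> d \<otimes> b = x \<otimes> b \<otimes> d"
    using c by (simp add: m_ac)
  ultimately have 1: "loc_eq P S (w \<otimes> a \<otimes> b) (x \<otimes> b \<otimes> d)"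
    by simp
  have 2: "loc_eq P S (x \<otimes> b \<otimes> d) (y \<otimes> a \<otimes> d)"
    using c by (intro loc_eq_mult eq) auto
  have "loc_eq P S (w \<otimes> a \<otimes> b) (y \<otimes> a \<otimes> d)"
    by (rule loc_eq_trans[OF 1 2]) (use c in auto)
  moreover have "w \<otimes> a \<otimes> b = w \<otimes> b \<otimes> a" "y \<otimes> a \<otimes> d = y \<otimes> d \<otimes> a"
    using c by (simp_all add: m_ac)
  ultimately have "loc_eq P S (w \<otimes> b) (y \<otimes> d)"
    using c x(3) by (intro loc_eq_cancel[of "w \<otimes> b" a "y \<otimes> d"]) auto
  then show "(w, d) \<in> fraction P S y b"
    using w(1,2) by (simp add: fraction_mem loc_eq_sym)
qed

text \<open>The denominator \<open>a\<close> is only in the saturation, so \<open>(x, a)\<close>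
  itself may fail to be a representative. Expanding by \<open>u\<close> brings the denominator into
  \<open>S\<close> and shows that the class is nonempty.\<close>

lemma (in mult_set) fraction_self:
  assumes "x \<in> carrier P" "a \<in> saturation P S"
  obtains u where "u \<in> carrier P" "a \<otimes> u \<in> S" "(x \<otimes> u, a \<otimes> u) \<in> fraction P S x a"
proof -
  obtain u where u: "u \<in> carrier P" "a \<otimes> u \<in> S"
    using assms(2) unfolding saturation_def by auto
  moreover have "x \<otimes> (a \<otimes> u) = x \<otimes> u \<otimes> a"
    using assms u sat_closed by (simp add: m_ac)
  ultimately show thesis
    using assms by (intro that[of u]) (auto simp: fraction_mem loc_eq_refl)
qed

lemma (in mult_set) fraction_eq_iff:
  assumes x: "x \<in> carrier P" "y \<in> carrier P" "a \<in> saturation P S" "b \<in> saturation P S"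
  shows "fraction P S x a = fraction P S y b \<longleftrightarrow> loc_eq P S (x \<otimes> b) (y \<otimes> a)"
proof
  assume eq: "loc_eq P S (x \<otimes> b) (y \<otimes> a)"
  show "fraction P S x a = fraction P S y b"
    using fraction_subset[OF x eq] fraction_subset[OF x(2,1,4,3) loc_eq_sym[OF eq]] by blast
next
  assume eq: "fraction P S x a = fraction P S y b"
  obtain u where u: "u \<in> carrier P" "a \<otimes> u \<in> S" "(x \<otimes> u, a \<otimes> u) \<in> fraction P S x a"
    using fraction_self[OF x(1,3)] .
  note c = x(1,2) sat_closed[OF x(3)] sat_closed[OF x(4)] u(1)
  have "loc_eq P S (y \<otimes> (a \<otimes> u)) (x \<otimes> u \<otimes> b)"
    using u eq by (simp add: fraction_mem)
  moreover have "y \<otimes> (a \<otimes> u) = y \<otimes> a \<otimes> u" "x \<otimes> u \<otimes> b = x \<otimes> b \<otimes> u"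
    using c by (simp_all add: m_ac)
  moreover have "u \<in> saturation P S"
    using u c by (auto simp: saturation_def m_comm intro!: bexI[of _ a])
  ultimately have "loc_eq P S (y \<otimes> a) (x \<otimes> b)"
    using c by (intro loc_eq_cancel[of "y \<otimes> a" u "x \<otimes> b"]) auto
  then show "loc_eq P S (x \<otimes> b) (y \<otimes> a)"
    by (rule loc_eq_sym)
qed

lemma (in mult_set) fraction_mem_eq:
  assumes "x \<in> carrier P" "a \<in> saturation P S" "(y, b) \<in> fraction P S x a"
  shows "y \<in> carrier P" "b \<in> S" "fraction P S y b = fraction P S x a"
proof -
  show y: "y \<in> carrier P" "b \<in> S"
    using assms by (auto simp: fraction_mem)
  show "fraction P S y b = fraction P S x a"
    using assms y S_sat by (subst eq_commute) (simp add: fraction_eq_iff fraction_mem)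
qed

lemma (in mult_set) localization_cases:
  assumes "c \<in> carrier (localization P S)"
  obtains x a where "x \<in> carrier P" "a \<in> S" "c = fraction P S x a"
  using assms by (auto simp: localization_def)

lemma (in mult_set) fraction_closed:
  assumes "x \<in> carrier P" "a \<in> saturation P S"
  shows "fraction P S x a \<in> carrier (localization P S)"
proof -
  obtain u where u: "u \<in> carrier P" "a \<otimes> u \<in> S" "(x \<otimes> u, a \<otimes> u) \<in> fraction P S x a"
    using fraction_self[OF assms] .
  then have "fraction P S x a = fraction P S (x \<otimes> u) (a \<otimes> u)"
    using fraction_mem_eq[OF assms u(3)] by simp
  then show ?thesis
    using u assms by (auto simp: localization_def)
qed

lemma (in mult_set) fraction_mult:
  assumes x: "x \<in> carrier P" "a \<in> saturation P S" "y \<in> carrier P" "b \<in> saturation P S"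
  shows "fraction P S x a \<otimes>\<^bsub>localization P S\<^esub> fraction P S y b = fraction P S (x \<otimes> y) (a \<otimes> b)"
proof -
  obtain u v where "(x \<otimes> u, a \<otimes> u) \<in> fraction P S x a" "(y \<otimes> v, b \<otimes> v) \<in> fraction P S y b"
    by (metis fraction_self x)
  then show ?thesis
    unfolding localization_mult_def
  proof (rule UN_pair_const2)
    fix x' a' y' b' assume m: "(x', a') \<in> fraction P S x a" "(y', b') \<in> fraction P S y b"
    then have x': "x' \<in> carrier P" "a' \<in> S" "loc_eq P S (x \<otimes> a') (x' \<otimes> a)"
      and y': "y' \<in> carrier P" "b' \<in> S" "loc_eq P S (y \<otimes> b') (y' \<otimes> b)"
      by (auto simp: fraction_mem)
    note c = x(1,3) sat_closed[OF x(2)] sat_closed[OF x(4)] x'(1) S_closed[OF x'(2)] y'(1) S_closed[OF y'(2)]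
    have "loc_eq P S (x \<otimes> a' \<otimes> (y \<otimes> b')) (x' \<otimes> a \<otimes> (y \<otimes> b'))"
      using c by (intro loc_eq_mult x') auto
    moreover have "loc_eq P S (y \<otimes> b' \<otimes> (x' \<otimes> a)) (y' \<otimes> b \<otimes> (x' \<otimes> a))"
      using c by (intro loc_eq_mult y') auto
    moreover have "x \<otimes> a' \<otimes> (y \<otimes> b') = x \<otimes> y \<otimes> (a' \<otimes> b')" "x' \<otimes> a \<otimes> (y \<otimes> b') = y \<otimes> b' \<otimes> (x' \<otimes> a)"
      "y' \<otimes> b \<otimes> (x' \<otimes> a) = x' \<otimes> y' \<otimes> (a \<otimes> b)"
      using c by (simp_all add: m_ac)
    ultimately have 1: "loc_eq P S (x \<otimes> y \<otimes> (a' \<otimes> b')) (y \<otimes> b' \<otimes> (x' \<otimes> a))"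
      and 2: "loc_eq P S (y \<otimes> b' \<otimes> (x' \<otimes> a)) (x' \<otimes> y' \<otimes> (a \<otimes> b))"
      by simp_all
    have "loc_eq P S (x \<otimes> y \<otimes> (a' \<otimes> b')) (x' \<otimes> y' \<otimes> (a \<otimes> b))"
      by (rule loc_eq_trans[OF 1 2]) (use c in auto)
    then show "fraction P S (x' \<otimes> y') (a' \<otimes> b') = fraction P S (x \<otimes> y) (a \<otimes> b)"
      using x c sat_mult[OF x(2,4)] S_sat[OF S_mult[OF x'(2) y'(2)]]
      by (subst fraction_eq_iff) (auto intro!: loc_eq_sym[of "x \<otimes> y \<otimes> (a' \<otimes> b')"])
  qed
qed

lemma (in mult_set) sat_one: "\<one> \<in> saturation P S"
  by (rule S_sat[OF S_one])

lemma (in mult_set) localization_comm_monoid: "comm_monoid (localization P S)"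
proof (rule comm_monoidI)
  fix c d e
  assume c: "c \<in> carrier (localization P S)" and d: "d \<in> carrier (localization P S)"
  obtain x a where x: "x \<in> carrier P" "a \<in> S" "c = fraction P S x a"
    using c by (rule localization_cases)
  obtain y b where y: "y \<in> carrier P" "b \<in> S" "d = fraction P S y b"
    using d by (rule localization_cases)
  show "c \<otimes>\<^bsub>localization P S\<^esub> d \<in> carrier (localization P S)"
    using x y S_sat sat_mult by (simp add: fraction_mult fraction_closed)
  show "c \<otimes>\<^bsub>localization P S\<^esub> d = d \<otimes>\<^bsub>localization P S\<^esub> c"
    using x y S_sat S_closed by (simp add: fraction_mult m_comm)
  show "\<one>\<^bsub>localization P S\<^esub> \<otimes>\<^bsub>localization P S\<^esub> c = c"
    using x S_sat S_closed sat_one by (simp add: localization_one_def fraction_mult)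
  assume e: "e \<in> carrier (localization P S)"
  obtain z r where z: "z \<in> carrier P" "r \<in> S" "e = fraction P S z r"
    using e by (rule localization_cases)
  show "c \<otimes>\<^bsub>localization P S\<^esub> d \<otimes>\<^bsub>localization P S\<^esub> e = c \<otimes>\<^bsub>localization P S\<^esub> (d \<otimes>\<^bsub>localization P S\<^esub> e)"
    using x y z S_sat S_closed sat_mult by (simp add: fraction_mult m_assoc)
next
  show "\<one>\<^bsub>localization P S\<^esub> \<in> carrier (localization P S)"
    by (simp add: localization_one_def fraction_closed sat_one)
qed

text \<open>A divisor of an element dividing some element of \<open>T\<close> divides that element
  too, so the whole saturation of \<open>S\<close> lies in that of \<open>T\<close>. Hence equality
  of fractions over \<open>S\<close> implies equality over \<open>T\<close>, with the witness
  \<open>c\<close> cancelled there.\<close>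

lemma (in mult_set) localization_map_fraction:
  assumes T: "submonoid T P" and ST: "S \<subseteq> saturation P T"
    and x: "x \<in> carrier P" "a \<in> saturation P S"
  shows "localization_map P T (fraction P S x a) = fraction P T x a"
proof -
  interpret T: mult_set P T by (intro mult_set.intro mult_set_axioms.intro comm_monoid_axioms T)
  have sat: "saturation P S \<subseteq> saturation P T"
  proof
    fix b assume "b \<in> saturation P S"
    then obtain y where y: "b \<in> carrier P" "y \<in> carrier P" "b \<otimes> y \<in> saturation P T"
      using ST unfolding saturation_def[of P S] by auto
    then obtain z where "z \<in> carrier P" "b \<otimes> y \<otimes> z \<in> T"
      unfolding saturation_def by auto
    then show "b \<in> saturation P T"
      using y unfolding saturation_def by (auto simp: m_assoc intro!: bexI[of _ "y \<otimes> z"])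
  qed
  obtain u where "(x \<otimes> u, a \<otimes> u) \<in> fraction P S x a"
    using fraction_self[OF x] .
  then show ?thesis
    unfolding localization_map_def
  proof (rule UN_pair_const)
    fix y b assume yb: "(y, b) \<in> fraction P S x a"
    then have y: "y \<in> carrier P" "b \<in> S" "loc_eq P S (x \<otimes> b) (y \<otimes> a)"
      by (auto simp: fraction_mem)
    then obtain c where c: "c \<in> S" "x \<otimes> b \<otimes> c = y \<otimes> a \<otimes> c"
      by (auto simp: loc_eq_def)
    have "loc_eq P T (x \<otimes> b) (y \<otimes> a)"
    proof (rule T.loc_eq_cancel)
      show "loc_eq P T (x \<otimes> b \<otimes> c) (y \<otimes> a \<otimes> c)"
        unfolding c(2) by (rule T.loc_eq_refl)
    qed (use x y c ST S_closed sat_closed in auto)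
    then show "fraction P T y b = fraction P T x a"
      using x y sat S_sat by (subst T.fraction_eq_iff) (auto intro!: T.loc_eq_sym[of "x \<otimes> b"])
  qed
qed

section \<open>Spectra\<close>

lemma (in comm_monoid) powers_submonoid:
  assumes "p \<in> carrier G"
  shows "submonoid (powers G p) G"
proof
  show "powers G p \<subseteq> carrier G"
    using assms by (auto simp: powers_def)
  show "\<one> \<in> powers G p"
    unfolding powers_def by (rule range_eqI[of _ _ 0]) simp
  fix x y assume "x \<in> powers G p" "y \<in> powers G p"
  then obtain m n where "x = p [^] (m::nat)" "y = p [^] (n::nat)"
    by (auto simp: powers_def)
  then show "x \<otimes> y \<in> powers G p"
    unfolding powers_def using nat_pow_mult[OF assms] by auto
qed

lemma (in comm_monoid) powers_mult_set: "p \<in> carrier G \<Longrightarrow> mult_set G (powers G p)"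
  by (intro mult_set.intro mult_set_axioms.intro comm_monoid_axioms powers_submonoid)

lemma (in comm_monoid) powers_self: "p \<in> carrier G \<Longrightarrow> p \<in> powers G p"
  unfolding powers_def by (rule range_eqI[of _ _ 1]) simp

lemma (in comm_monoid) powers_pow: "p [^] (n::nat) \<in> powers G p"
  by (simp add: powers_def)

section \<open>Faces and saturations\<close>

lemma (in comm_monoid) face_subset: "face G F \<Longrightarrow> F \<subseteq> carrier G"
  and face_one: "face G F \<Longrightarrow> \<one> \<in> F"
  and face_mult: "face G F \<Longrightarrow> x \<in> F \<Longrightarrow> y \<in> F \<Longrightarrow> x \<otimes> y \<in> F"
  unfolding face_def submonoid_def by simp_all

lemma (in comm_monoid) face_mult_iff:
  "face G F \<Longrightarrow> x \<in> carrier G \<Longrightarrow> y \<in> carrier G \<Longrightarrow> x \<otimes> y \<in> F \<longleftrightarrow> x \<in> F \<and> y \<in> F"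
  unfolding face_def submonoid_def by blast

lemma (in comm_monoid) faceI:
  assumes "F \<subseteq> carrier G" "\<one> \<in> F"
    and "\<And>x y. x \<in> carrier G \<Longrightarrow> y \<in> carrier G \<Longrightarrow> x \<otimes> y \<in> F \<longleftrightarrow> x \<in> F \<and> y \<in> F"
  shows "face G F"
  using assms by (auto simp: face_def submonoid_def subset_iff)

lemma (in comm_monoid) face_pow: "face G F \<Longrightarrow> x \<in> F \<Longrightarrow> x [^] (n::nat) \<in> F"
  by (induction n) (auto simp: face_one face_mult)

text \<open>For \<open>n > 0\<close> the element \<open>x\<close> is a factor of its power; for
  \<open>n = 0\<close> the power is \<open>\<one>\<close>, which lies in every face.\<close>

lemma (in comm_monoid) face_pow_iff:
  assumes F: "face G F" and x: "x \<in> carrier G" and n: "n > 0"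
  shows "x [^] (n::nat) \<in> F \<longleftrightarrow> x \<in> F"
proof
  assume a: "x [^] n \<in> F"
  obtain m where m: "n = Suc m" using n by (cases n) auto
  then have "x \<otimes> x [^] m \<in> F"
    using a x by (simp add: m_comm)
  then show "x \<in> F"
    using F x by (simp add: face_mult_iff)
qed (rule face_pow[OF F])

text \<open>Factors of a divisor of an element of \<open>S\<close> again divide that element. The
  saturation is in fact the face generated by \<open>S\<close>, a point that plays a distinguished
  role in the topology.\<close>

lemma (in comm_monoid) saturation_face:
  assumes "mult_set G S"
  shows "face G (saturation G S)"
proof (rule faceI)
  interpret mult_set G S by fact
  show "saturation G S \<subseteq> carrier G" by (auto simp: saturation_def)
  show "\<one> \<in> saturation G S" by (rule sat_one)
  fix x y assume xy: "x \<in> carrier G" "y \<in> carrier G"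
  show "x \<otimes> y \<in> saturation G S \<longleftrightarrow> x \<in> saturation G S \<and> y \<in> saturation G S"
  proof
    assume "x \<otimes> y \<in> saturation G S"
    then obtain z where "z \<in> carrier G" "x \<otimes> y \<otimes> z \<in> S"
      by (auto simp: saturation_def)
    then have "x \<otimes> (y \<otimes> z) \<in> S" "y \<otimes> (x \<otimes> z) \<in> S" "y \<otimes> z \<in> carrier G" "x \<otimes> z \<in> carrier G"
      using xy by (simp_all add: m_assoc m_lcomm[of y x])
    then show "x \<in> saturation G S \<and> y \<in> saturation G S"
      using xy unfolding saturation_def by blast
  qed (auto intro: sat_mult)
qed

text \<open>The saturation of the powers of \<open>q\<close> is the smallest face containing
  \<open>q\<close>, so the inclusion needs testing at this one face; conversely a face containing
  \<open>q\<close> contains every divisor of a power of \<open>q\<close>.\<close>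

lemma (in comm_monoid) basic_open_subset_iff:
  assumes "p \<in> carrier G" "q \<in> carrier G"
  shows "basic_open G q \<subseteq> basic_open G p \<longleftrightarrow> p \<in> saturation G (powers G q)"
proof
  interpret q: mult_set G "powers G q" by (rule powers_mult_set[OF assms(2)])
  assume "basic_open G q \<subseteq> basic_open G p"
  moreover have "saturation G (powers G q) \<in> basic_open G q"
    unfolding basic_open_def
    using saturation_face[OF q.mult_set_axioms] q.S_sat[OF powers_self[OF assms(2)]] by simp
  ultimately show "p \<in> saturation G (powers G q)"
    by (auto simp: basic_open_def)
next
  assume "p \<in> saturation G (powers G q)"
  then obtain y n where y: "y \<in> carrier G" "p \<otimes> y = q [^] (n::nat)"
    by (auto simp: saturation_def powers_def)
  show "basic_open G q \<subseteq> basic_open G p"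
  proof
    fix F assume "F \<in> basic_open G q"
    then have F: "face G F" "q \<in> F" by (auto simp: basic_open_def)
    then have "p \<otimes> y \<in> F" using face_pow y by simp
    then show "F \<in> basic_open G p"
      using F face_mult_iff[OF F(1) assms(1) y(1)] by (simp add: basic_open_def)
  qed
qed

lemma (in comm_monoid) saturation_powers_mono:
  assumes "p \<in> carrier G" "q \<in> carrier G" "basic_open G q \<subseteq> basic_open G p"
  shows "powers G p \<subseteq> saturation G (powers G q)"
proof
  fix x assume "x \<in> powers G p"
  then obtain n where "x = p [^] (n::nat)" by (auto simp: powers_def)
  moreover have "p \<in> saturation G (powers G q)"
    using assms by (simp add: basic_open_subset_iff)
  ultimately show "x \<in> saturation G (powers G q)"
    using face_pow[OF saturation_face[OF powers_mult_set[OF assms(2)]]] by simp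
qed

section \<open>The topology of the spectrum\<close>

lemma (in comm_monoid) basic_open_Int:
  "p \<in> carrier G \<Longrightarrow> q \<in> carrier G \<Longrightarrow> basic_open G p \<inter> basic_open G q = basic_open G (p \<otimes> q)"
  by (auto simp: basic_open_def face_mult_iff)

text \<open>The basic open sets are closed under intersection, since \<open>p \<otimes> q\<close>
  lies in a face exactly when both factors do. So they are a base and their unions form a
  topology.\<close>

lemma (in comm_monoid) openin_Spec:
  "opn (Spec G) V \<longleftrightarrow> (\<forall>F\<in>V. \<exists>p\<in>carrier G. F \<in> basic_open G p \<and> basic_open G p \<subseteq> V)"
proof -
  let ?B = "\<lambda>U. \<exists>p\<in>carrier G. U = basic_open G p"
  have "istopology (arbitrary union_of ?B)"
  proof (rule istopology_base)
    fix S T assume "?B S" "?B T"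
    then obtain p q where "p \<in> carrier G" "q \<in> carrier G" "S = basic_open G p" "T = basic_open G q"
      by blast
    then show "?B (S \<inter> T)"
      by (intro bexI[of _ "p \<otimes> q"]) (auto simp: basic_open_Int)
  qed
  then have "opn (Spec G) V \<longleftrightarrow> (arbitrary union_of ?B) V"
    by (simp add: Spec_def topology_inverse')
  also have "\<dots> \<longleftrightarrow> (\<forall>F\<in>V. \<exists>U. ?B U \<and> F \<in> U \<and> U \<subseteq> V)"
    by (rule arbitrary_union_of_alt)
  also have "\<dots> \<longleftrightarrow> (\<forall>F\<in>V. \<exists>p\<in>carrier G. F \<in> basic_open G p \<and> basic_open G p \<subseteq> V)"
    by (intro ball_cong refl iffI) (auto)
  finally show ?thesis .
qed

lemma (in comm_monoid) open_basic_open: "p \<in> carrier G \<Longrightarrow> opn (Spec G) (basic_open G p)"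
  by (auto simp: openin_Spec)

lemma (in comm_monoid) topspace_Spec: "topspace (pts (Spec G)) = {F. face G F}"
proof
  show "topspace (pts (Spec G)) \<subseteq> {F. face G F}"
  proof
    fix F assume "F \<in> topspace (pts (Spec G))"
    then show "F \<in> {F. face G F}"
      using openin_Spec[of "topspace (pts (Spec G))"] by (auto simp: basic_open_def)
  qed
  have "{F. face G F} = basic_open G \<one>"
    by (auto simp: basic_open_def face_one)
  then show "{F. face G F} \<subseteq> topspace (pts (Spec G))"
    using openin_subset[OF open_basic_open[OF one_closed]] by simp
qed

text \<open>The face generated by \<open>p\<close> has no neighbourhood smaller than \<open>basic_open P p\<close>.\<close>

lemma (in comm_monoid) basic_open_cover:
  assumes p: "p \<in> carrier G" and U: "\<And>V. V \<in> \<U> \<Longrightarrow> opn (Spec G) V" and sub: "basic_open G p \<subseteq> \<Union>\<U>"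
  obtains V where "V \<in> \<U>" "basic_open G p \<subseteq> V"
proof -
  interpret p: mult_set G "powers G p" by (rule powers_mult_set[OF p])
  let ?F = "saturation G (powers G p)"
  have "?F \<in> basic_open G p"
    using saturation_face[OF p.mult_set_axioms] p.S_sat[OF powers_self[OF p]] by (simp add: basic_open_def)
  then obtain V where V: "V \<in> \<U>" "?F \<in> V"
    using sub by blast
  then obtain q where q: "q \<in> carrier G" "?F \<in> basic_open G q" "basic_open G q \<subseteq> V"
    using U[OF V(1)] unfolding openin_Spec by auto
  then have "basic_open G p \<subseteq> basic_open G q"
    using basic_open_subset_iff[OF q(1) p] by (simp add: basic_open_def)
  then show ?thesis
    using that V q by blast
qed

section \<open>Localizations at one element and the structure sheaf\<close>

abbreviation (in comm_monoid) "L p \<equiv> localization G (powers G p)"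
abbreviation (in comm_monoid) "lm q \<equiv> localization_map G (powers G q)"

lemma (in comm_monoid) lm_fraction:
  assumes "p \<in> carrier G" "q \<in> carrier G" "basic_open G q \<subseteq> basic_open G p"
    and "x \<in> carrier G" "a \<in> saturation G (powers G p)"
  shows "lm q (fraction G (powers G p) x a) = fraction G (powers G q) x a"
  using mult_set.localization_map_fraction[OF powers_mult_set powers_submonoid saturation_powers_mono] assms by simp

lemma (in comm_monoid) sat_powers_mono:
  assumes "p \<in> carrier G" "q \<in> carrier G" "basic_open G q \<subseteq> basic_open G p" "a \<in> saturation G (powers G p)"
  shows "a \<in> saturation G (powers G q)"
  using assms basic_open_subset_iff[of a p] basic_open_subset_iff[of a q] by (auto simp: saturation_def)

lemma (in comm_monoid) L_comm_monoid: "p \<in> carrier G \<Longrightarrow> comm_monoid (L p)"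
  by (rule mult_set.localization_comm_monoid[OF powers_mult_set])

lemma (in comm_monoid) L_cases:
  assumes "p \<in> carrier G" "c \<in> carrier (L p)"
  obtains x a where "x \<in> carrier G" "a \<in> powers G p" "a \<in> saturation G (powers G p)" "c = fraction G (powers G p) x a"
proof -
  interpret p: mult_set G "powers G p" by (rule powers_mult_set[OF assms(1)])
  obtain x a where "x \<in> carrier G" "a \<in> powers G p" "c = fraction G (powers G p) x a"
    using assms(2) by (rule p.localization_cases)
  then show ?thesis
    using that p.S_sat by blast
qed

lemmas (in comm_monoid) L_mult = mult_set.fraction_mult[OF powers_mult_set]
  and L_closed = mult_set.fraction_closed[OF powers_mult_set]
  and L_eq_iff = mult_set.fraction_eq_iff[OF powers_mult_set]

lemma (in comm_monoid) one_sat: "p \<in> carrier G \<Longrightarrow> \<one> \<in> saturation G (powers G p)"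
  by (rule mult_set.sat_one[OF powers_mult_set])

lemma (in comm_monoid) lm_hom:
  assumes pq: "p \<in> carrier G" "q \<in> carrier G" "basic_open G q \<subseteq> basic_open G p"
  shows "monoid_hom (L p) (L q) (lm q)"
proof (rule monoid_homI)
  interpret p: mult_set G "powers G p" by (rule powers_mult_set[OF pq(1)])
  show "lm q c \<in> carrier (L q)" if c: "c \<in> carrier (L p)" for c
  proof -
    obtain x a where x: "x \<in> carrier G" "a \<in> saturation G (powers G p)" "c = fraction G (powers G p) x a"
      by (rule L_cases[OF pq(1) c])
    then show ?thesis
      using pq sat_powers_mono[OF pq] by (simp add: lm_fraction L_closed)
  qed
  show "lm q (c \<otimes>\<^bsub>L p\<^esub> d) = lm q c \<otimes>\<^bsub>L q\<^esub> lm q d" if c: "c \<in> carrier (L p)" and d: "d \<in> carrier (L p)" for c d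
  proof -
    obtain x a where x: "x \<in> carrier G" "a \<in> saturation G (powers G p)" "c = fraction G (powers G p) x a"
      by (rule L_cases[OF pq(1) c])
    obtain y b where y: "y \<in> carrier G" "b \<in> saturation G (powers G p)" "d = fraction G (powers G p) y b"
      by (rule L_cases[OF pq(1) d])
    show ?thesis
      using pq sat_powers_mono[OF pq] x y p.sat_mult by (simp add: lm_fraction L_mult)
  qed
  show "lm q \<one>\<^bsub>L p\<^esub> = \<one>\<^bsub>L q\<^esub>"
    using pq one_sat[OF pq(1)] by (simp add: localization_one_def lm_fraction)
qed

lemma (in comm_monoid) Spec_sec_iff:
  "s \<in> carrier (sec (Spec G) U) \<longleftrightarrow> s \<in> extensional (basics_in G U) \<and>
     (\<forall>p\<in>basics_in G U. s p \<in> carrier (L p)) \<and>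
     (\<forall>p\<in>basics_in G U. \<forall>q\<in>carrier G. basic_open G q \<subseteq> basic_open G p \<longrightarrow> lm q (s p) = s q)"
  by (auto simp: Spec_def Spec_sheaf_def PiE_iff)

lemma (in comm_monoid) Spec_mult: "s \<otimes>\<^bsub>sec (Spec G) U\<^esub> t = (\<lambda>p\<in>basics_in G U. s p \<otimes>\<^bsub>L p\<^esub> t p)"
  and Spec_one: "\<one>\<^bsub>sec (Spec G) U\<^esub> = (\<lambda>p\<in>basics_in G U. \<one>\<^bsub>L p\<^esub>)"
  and Spec_res: "res (Spec G) U V s = restrict s (basics_in G V)"
  by (simp_all add: Spec_def Spec_sheaf_def)

lemma (in comm_monoid) Spec_secD:
  assumes "s \<in> carrier (sec (Spec G) U)" "p \<in> carrier G" "basic_open G p \<subseteq> U"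
  shows "s p \<in> carrier (L p)"
    and "\<And>q. q \<in> carrier G \<Longrightarrow> basic_open G q \<subseteq> basic_open G p \<Longrightarrow> lm q (s p) = s q"
  using assms unfolding Spec_sec_iff by auto

lemma (in comm_monoid) Spec_secI:
  assumes "s \<in> extensional (basics_in G U)"
    and "\<And>p. p \<in> carrier G \<Longrightarrow> basic_open G p \<subseteq> U \<Longrightarrow> s p \<in> carrier (L p)"
    and "\<And>p q. p \<in> carrier G \<Longrightarrow> basic_open G p \<subseteq> U \<Longrightarrow> q \<in> carrier G \<Longrightarrow> basic_open G q \<subseteq> basic_open G p \<Longrightarrow> lm q (s p) = s q"
  shows "s \<in> carrier (sec (Spec G) U)"
  using assms unfolding Spec_sec_iff by simp

lemma (in comm_monoid) Spec_sec_comm_monoid: "comm_monoid (sec (Spec G) U)"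
proof (rule comm_monoidI)
  fix s t assume s: "s \<in> carrier (sec (Spec G) U)" and t: "t \<in> carrier (sec (Spec G) U)"
  show "s \<otimes>\<^bsub>sec (Spec G) U\<^esub> t \<in> carrier (sec (Spec G) U)"
  proof (rule Spec_secI)
    fix p assume p: "p \<in> carrier G" "basic_open G p \<subseteq> U"
    interpret Lp: comm_monoid "L p" by (rule L_comm_monoid[OF p(1)])
    show "(s \<otimes>\<^bsub>sec (Spec G) U\<^esub> t) p \<in> carrier (L p)"
      using p Spec_secD(1)[OF s p] Spec_secD(1)[OF t p] by (simp add: Spec_mult)
    fix q assume q: "q \<in> carrier G" "basic_open G q \<subseteq> basic_open G p"
    then have "basic_open G q \<subseteq> U" using p by blast
    then show "lm q ((s \<otimes>\<^bsub>sec (Spec G) U\<^esub> t) p) = (s \<otimes>\<^bsub>sec (Spec G) U\<^esub> t) q"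
      using p q Spec_secD[OF s p] Spec_secD[OF t p] by (simp add: Spec_mult monoid_hom_mult[OF lm_hom])
  qed (simp add: Spec_mult)
  show "s \<otimes>\<^bsub>sec (Spec G) U\<^esub> t = t \<otimes>\<^bsub>sec (Spec G) U\<^esub> s"
    unfolding Spec_mult
    by (rule restrict_ext) (use comm_monoid.m_comm[OF L_comm_monoid] Spec_secD(1)[OF s] Spec_secD(1)[OF t] in auto)
  show "\<one>\<^bsub>sec (Spec G) U\<^esub> \<otimes>\<^bsub>sec (Spec G) U\<^esub> s = s"
  proof (rule extensionalityI)
    fix p assume p: "p \<in> basics_in G U"
    then interpret Lp: comm_monoid "L p" by (intro L_comm_monoid) simp
    show "(\<one>\<^bsub>sec (Spec G) U\<^esub> \<otimes>\<^bsub>sec (Spec G) U\<^esub> s) p = s p"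
      using p Spec_secD(1)[OF s, of p] by (simp add: Spec_mult Spec_one)
  qed (use s in \<open>auto simp: Spec_mult Spec_sec_iff\<close>)
  fix r assume r: "r \<in> carrier (sec (Spec G) U)"
  show "s \<otimes>\<^bsub>sec (Spec G) U\<^esub> t \<otimes>\<^bsub>sec (Spec G) U\<^esub> r = s \<otimes>\<^bsub>sec (Spec G) U\<^esub> (t \<otimes>\<^bsub>sec (Spec G) U\<^esub> r)"
    unfolding Spec_mult
  proof (rule restrict_ext)
    fix p assume p: "p \<in> basics_in G U"
    then interpret Lp: comm_monoid "L p" by (intro L_comm_monoid) simp
    show "(\<lambda>p\<in>basics_in G U. s p \<otimes>\<^bsub>L p\<^esub> t p) p \<otimes>\<^bsub>L p\<^esub> r p = s p \<otimes>\<^bsub>L p\<^esub> (\<lambda>p\<in>basics_in G U. t p \<otimes>\<^bsub>L p\<^esub> r p) p"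
      using p Spec_secD(1)[OF s, of p] Spec_secD(1)[OF t, of p] Spec_secD(1)[OF r, of p] by (simp add: Lp.m_assoc)
  qed
next
  show "\<one>\<^bsub>sec (Spec G) U\<^esub> \<in> carrier (sec (Spec G) U)"
  proof (rule Spec_secI)
    fix p assume p: "p \<in> carrier G" "basic_open G p \<subseteq> U"
    interpret Lp: comm_monoid "L p" by (rule L_comm_monoid[OF p(1)])
    show "\<one>\<^bsub>sec (Spec G) U\<^esub> p \<in> carrier (L p)"
      using p by (simp add: Spec_one)
    fix q assume q: "q \<in> carrier G" "basic_open G q \<subseteq> basic_open G p"
    then have "basic_open G q \<subseteq> U" using p by blast
    then show "lm q (\<one>\<^bsub>sec (Spec G) U\<^esub> p) = \<one>\<^bsub>sec (Spec G) U\<^esub> q"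
      using p q by (simp add: Spec_one monoid_hom_one[OF lm_hom])
  qed (simp add: Spec_one)
qed

lemma (in comm_monoid) basics_in_mono: "V \<subseteq> U \<Longrightarrow> basics_in G V \<subseteq> basics_in G U"
  by auto

lemma (in comm_monoid) Spec_res_closed:
  assumes s: "s \<in> carrier (sec (Spec G) U)" and VU: "V \<subseteq> U"
  shows "res (Spec G) U V s \<in> carrier (sec (Spec G) V)"
  unfolding Spec_res
proof (rule Spec_secI)
  fix p assume p: "p \<in> carrier G" "basic_open G p \<subseteq> V"
  then have pU: "basic_open G p \<subseteq> U" using VU by blast
  show "restrict s (basics_in G V) p \<in> carrier (L p)"
    using p Spec_secD(1)[OF s p(1) pU] by simp
  fix q assume q: "q \<in> carrier G" "basic_open G q \<subseteq> basic_open G p"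
  then have "basic_open G q \<subseteq> V" using p by blast
  then show "lm q (restrict s (basics_in G V) p) = restrict s (basics_in G V) q"
    using p q Spec_secD(2)[OF s p(1) pU q] by simp
qed simp

text \<open>By \<open>basic_open_cover\<close> a basic open set inside a union lies in a single
  member of the cover. The glued section therefore takes its value at \<open>p\<close> directly from
  such a member, and compatibility makes the value independent of the member chosen.\<close>

lemma (in comm_monoid) monoidal_space_Spec: "monoidal_space (Spec G)"
proof -
  have pre: "monoid_presheaf (pts (Spec G)) (shf (Spec G))"
    unfolding monoid_presheaf_def
  proof (intro conjI allI impI ballI)
    show "comm_monoid (sec (Spec G) U)" for U
      by (rule Spec_sec_comm_monoid)
  next
    fix U V assume UV: "opn (Spec G) U \<and> opn (Spec G) V \<and> V \<subseteq> U"
    then have sub: "basics_in G V \<subseteq> basics_in G U"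
      by (intro basics_in_mono) simp
    show "monoid_hom (sec (Spec G) U) (sec (Spec G) V) (res (Spec G) U V)"
    proof (rule monoid_homI)
      show "res (Spec G) U V s \<in> carrier (sec (Spec G) V)" if "s \<in> carrier (sec (Spec G) U)" for s
        using Spec_res_closed[OF that] UV by simp
    qed (use sub in \<open>auto simp: Spec_res Spec_mult Spec_one fun_eq_iff restrict_def\<close>)
  next
    fix U s assume "s \<in> carrier (sec (Spec G) U)"
    then show "res (Spec G) U U s = s"
      by (simp add: Spec_res Spec_sec_iff extensional_restrict)
  next
    fix U V W s assume "opn (Spec G) U \<and> opn (Spec G) V \<and> opn (Spec G) W \<and> W \<subseteq> V \<and> V \<subseteq> U"
    then have "basics_in G V \<inter> basics_in G W = basics_in G W"
      using basics_in_mono[of W V] by (intro Int_absorb1) simp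
    then show "res (Spec G) V W (res (Spec G) U V s) = res (Spec G) U W s"
      unfolding Spec_res restrict_restrict by simp
  qed
  have glue: "\<exists>!s. s \<in> carrier (sec (Spec G) (\<Union>\<U>)) \<and> (\<forall>V\<in>\<U>. res (Spec G) (\<Union>\<U>) V s = \<sigma> V)"
    if 1: "\<forall>V\<in>\<U>. opn (Spec G) V \<and> \<sigma> V \<in> carrier (sec (Spec G) V)"
      and 2: "\<forall>V\<in>\<U>. \<forall>W\<in>\<U>. res (Spec G) V (V \<inter> W) (\<sigma> V) = res (Spec G) W (V \<inter> W) (\<sigma> W)" for \<U> \<sigma>
  proof -
    define ch where "ch p = (SOME V. V \<in> \<U> \<and> basic_open G p \<subseteq> V)" for p
    have ch: "ch p \<in> \<U>" "basic_open G p \<subseteq> ch p" if p: "p \<in> basics_in G (\<Union>\<U>)" for p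
    proof -
      obtain V where "V \<in> \<U>" "basic_open G p \<subseteq> V"
        by (rule basic_open_cover[of p \<U>]) (use p 1 in auto)
      then have "\<exists>V. V \<in> \<U> \<and> basic_open G p \<subseteq> V"
        by (intro exI[of _ V]) simp
      from someI_ex[OF this] show "ch p \<in> \<U>" "basic_open G p \<subseteq> ch p"
        by (auto simp: ch_def)
    qed
    have comp: "\<sigma> V p = \<sigma> W p" if "V \<in> \<U>" "W \<in> \<U>" "p \<in> carrier G" "basic_open G p \<subseteq> V" "basic_open G p \<subseteq> W" for V W p
    proof -
      have "res (Spec G) V (V \<inter> W) (\<sigma> V) p = res (Spec G) W (V \<inter> W) (\<sigma> W) p"
        by (rule fun_cong[OF bspec[OF bspec[OF 2 that(1)] that(2)]])
      then show ?thesis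
        using that by (simp add: Spec_res)
    qed
    define s where "s = (\<lambda>p\<in>basics_in G (\<Union>\<U>). \<sigma> (ch p) p)"
    have s_eq: "s p = \<sigma> V p" if "V \<in> \<U>" "p \<in> carrier G" "basic_open G p \<subseteq> V" for V p
    proof -
      have p: "p \<in> basics_in G (\<Union>\<U>)" using that by blast
      show ?thesis
        using comp[OF ch(1)[OF p] that(1,2) ch(2)[OF p] that(3)] p by (simp add: s_def)
    qed
    show ?thesis
    proof (rule ex1I[of _ s], intro conjI ballI)
      show "s \<in> carrier (sec (Spec G) (\<Union>\<U>))"
      proof (rule Spec_secI)
        fix p assume p: "p \<in> carrier G" "basic_open G p \<subseteq> \<Union>\<U>"
        then have pp: "p \<in> basics_in G (\<Union>\<U>)" by simp
        note c = ch[OF pp]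
        have \<sigma>: "\<sigma> (ch p) \<in> carrier (sec (Spec G) (ch p))" using 1 c by simp
        show "s p \<in> carrier (L p)"
          using s_eq[OF c(1) p(1) c(2)] Spec_secD(1)[OF \<sigma> p(1) c(2)] by simp
        fix q assume q: "q \<in> carrier G" "basic_open G q \<subseteq> basic_open G p"
        then have "basic_open G q \<subseteq> ch p" using c by blast
        then show "lm q (s p) = s q"
          using s_eq[OF c(1) p(1) c(2)] s_eq[OF c(1) q(1)] Spec_secD(2)[OF \<sigma> p(1) c(2) q] by simp
      qed (simp add: s_def)
      fix V assume V: "V \<in> \<U>"
      show "res (Spec G) (\<Union>\<U>) V s = \<sigma> V"
      proof (rule extensionalityI)
        show "\<sigma> V \<in> extensional (basics_in G V)"
          using 1 V by (simp add: Spec_sec_iff)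
        fix p assume "p \<in> basics_in G V"
        then show "res (Spec G) (\<Union>\<U>) V s p = \<sigma> V p"
          using s_eq[OF V] by (simp add: Spec_res)
      qed (simp add: Spec_res)
    next
      fix r assume r: "r \<in> carrier (sec (Spec G) (\<Union>\<U>)) \<and> (\<forall>V\<in>\<U>. res (Spec G) (\<Union>\<U>) V r = \<sigma> V)"
      show "r = s"
      proof (rule extensionalityI)
        show "r \<in> extensional (basics_in G (\<Union>\<U>))"
          using r by (simp add: Spec_sec_iff)
        show "s \<in> extensional (basics_in G (\<Union>\<U>))"
          by (simp add: s_def)
        fix p assume p: "p \<in> basics_in G (\<Union>\<U>)"
        have "res (Spec G) (\<Union>\<U>) (ch p) r = \<sigma> (ch p)" using r ch[OF p] by blast
        then have "restrict r (basics_in G (ch p)) p = \<sigma> (ch p) p" by (simp add: Spec_res)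
        then show "r p = s p"
          using p ch[OF p] by (simp add: s_def)
      qed
    qed
  qed
  show ?thesis
    by (rule monoidal_spaceI[OF pre glue])
qed

section \<open>Affine monoidal spaces\<close>

text \<open>The intrinsic counterpart of a basic open set: on a spectrum, the unit locus of the
  global section given by \<open>p\<close> is \<open>basic_open P p\<close>.\<close>

definition unit_locus :: "('x, 'm) mspace \<Rightarrow> 'm \<Rightarrow> 'x set" where
  "unit_locus Y p = {x \<in> topspace (pts Y). unit_at Y (topspace (pts Y)) p x}"

abbreviation glob :: "('x, 'm) mspace \<Rightarrow> 'm monoid" where
  "glob Y \<equiv> sec Y (topspace (pts Y))"

text \<open>
  A description of the spaces isomorphic to the spectrum of their monoid of global sections which
  refers only to sections, so that it can be passed on to a subsheaf.
\<close>

definition affine :: "('x, 'm) mspace \<Rightarrow> bool" where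
  "affine Y \<longleftrightarrow> monoidal_space Y \<and>
     (\<forall>W x. opn Y W \<and> x \<in> W \<longrightarrow> (\<exists>p\<in>carrier (glob Y). x \<in> unit_locus Y p \<and> unit_locus Y p \<subseteq> W)) \<and>
     (\<forall>F. face (glob Y) F \<longrightarrow> (\<exists>x\<in>topspace (pts Y). {p \<in> carrier (glob Y). x \<in> unit_locus Y p} = F)) \<and>
     (\<forall>x\<in>topspace (pts Y). \<forall>y\<in>topspace (pts Y).
        (\<forall>p\<in>carrier (glob Y). x \<in> unit_locus Y p \<longleftrightarrow> y \<in> unit_locus Y p) \<longrightarrow> x = y) \<and>
     (\<forall>p\<in>carrier (glob Y). \<forall>s\<in>carrier (glob Y). \<forall>t\<in>carrier (glob Y).
        res Y (topspace (pts Y)) (unit_locus Y p) s = res Y (topspace (pts Y)) (unit_locus Y p) t \<longrightarrow>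
        (\<exists>k::nat. s \<otimes>\<^bsub>glob Y\<^esub> p [^]\<^bsub>glob Y\<^esub> k = t \<otimes>\<^bsub>glob Y\<^esub> p [^]\<^bsub>glob Y\<^esub> k)) \<and>
     (\<forall>p\<in>carrier (glob Y). \<forall>s\<in>carrier (sec Y (unit_locus Y p)).
        \<exists>k::nat. \<exists>t\<in>carrier (glob Y).
          s \<otimes>\<^bsub>sec Y (unit_locus Y p)\<^esub> res Y (topspace (pts Y)) (unit_locus Y p) (p [^]\<^bsub>glob Y\<^esub> k) =
          res Y (topspace (pts Y)) (unit_locus Y p) t)"

lemma affineD:
  assumes "affine Y"
  shows affine_space: "monoidal_space Y"
    and affine_basis: "\<And>W x. opn Y W \<Longrightarrow> x \<in> W \<Longrightarrow> \<exists>p\<in>carrier (glob Y). x \<in> unit_locus Y p \<and> unit_locus Y p \<subseteq> W"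
    and affine_face: "\<And>F. face (glob Y) F \<Longrightarrow> \<exists>x\<in>topspace (pts Y). {p \<in> carrier (glob Y). x \<in> unit_locus Y p} = F"
    and affine_inj: "\<And>x y. x \<in> topspace (pts Y) \<Longrightarrow> y \<in> topspace (pts Y) \<Longrightarrow>
      (\<And>p. p \<in> carrier (glob Y) \<Longrightarrow> x \<in> unit_locus Y p \<longleftrightarrow> y \<in> unit_locus Y p) \<Longrightarrow> x = y"
    and affine_eq: "\<And>p s t. p \<in> carrier (glob Y) \<Longrightarrow> s \<in> carrier (glob Y) \<Longrightarrow> t \<in> carrier (glob Y) \<Longrightarrow>
      res Y (topspace (pts Y)) (unit_locus Y p) s = res Y (topspace (pts Y)) (unit_locus Y p) t \<Longrightarrow>
      \<exists>k::nat. s \<otimes>\<^bsub>glob Y\<^esub> p [^]\<^bsub>glob Y\<^esub> k = t \<otimes>\<^bsub>glob Y\<^esub> p [^]\<^bsub>glob Y\<^esub> k"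
    and affine_ex: "\<And>p s. p \<in> carrier (glob Y) \<Longrightarrow> s \<in> carrier (sec Y (unit_locus Y p)) \<Longrightarrow>
      \<exists>k::nat. \<exists>t\<in>carrier (glob Y).
          s \<otimes>\<^bsub>sec Y (unit_locus Y p)\<^esub> res Y (topspace (pts Y)) (unit_locus Y p) (p [^]\<^bsub>glob Y\<^esub> k) =
          res Y (topspace (pts Y)) (unit_locus Y p) t"
  using assms unfolding affine_def by (elim conjE; simp)+

lemma affineI:
  assumes "monoidal_space Y"
    and "\<And>W x. opn Y W \<Longrightarrow> x \<in> W \<Longrightarrow> \<exists>p\<in>carrier (glob Y). x \<in> unit_locus Y p \<and> unit_locus Y p \<subseteq> W"
    and "\<And>F. face (glob Y) F \<Longrightarrow> \<exists>x\<in>topspace (pts Y). {p \<in> carrier (glob Y). x \<in> unit_locus Y p} = F"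
    and "\<And>x y. x \<in> topspace (pts Y) \<Longrightarrow> y \<in> topspace (pts Y) \<Longrightarrow>
      \<forall>p\<in>carrier (glob Y). x \<in> unit_locus Y p \<longleftrightarrow> y \<in> unit_locus Y p \<Longrightarrow> x = y"
    and "\<And>p s t. p \<in> carrier (glob Y) \<Longrightarrow> s \<in> carrier (glob Y) \<Longrightarrow> t \<in> carrier (glob Y) \<Longrightarrow>
      res Y (topspace (pts Y)) (unit_locus Y p) s = res Y (topspace (pts Y)) (unit_locus Y p) t \<Longrightarrow>
      \<exists>k::nat. s \<otimes>\<^bsub>glob Y\<^esub> p [^]\<^bsub>glob Y\<^esub> k = t \<otimes>\<^bsub>glob Y\<^esub> p [^]\<^bsub>glob Y\<^esub> k"
    and "\<And>p s. p \<in> carrier (glob Y) \<Longrightarrow> s \<in> carrier (sec Y (unit_locus Y p)) \<Longrightarrow>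
      \<exists>k::nat. \<exists>t\<in>carrier (glob Y).
          s \<otimes>\<^bsub>sec Y (unit_locus Y p)\<^esub> res Y (topspace (pts Y)) (unit_locus Y p) (p [^]\<^bsub>glob Y\<^esub> k) =
          res Y (topspace (pts Y)) (unit_locus Y p) t"
  shows "affine Y"
  unfolding affine_def
  by (intro conjI allI impI ballI; (elim conjE)?; rule assms; assumption)

lemma unit_locus_subset: "unit_locus Y p \<subseteq> topspace (pts Y)"
  by (auto simp: unit_locus_def)

lemma open_unit_locus:
  assumes Y: "monoidal_space Y" and p: "p \<in> carrier (glob Y)"
  shows "opn Y (unit_locus Y p)"
proof (subst openin_subopen, rule ballI)
  fix x assume "x \<in> unit_locus Y p"
  then obtain W where W: "opn Y W" "x \<in> W" "res Y (topspace (pts Y)) W p \<in> Units (sec Y W)"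
    unfolding unit_locus_def unit_at_def by auto
  then have "W \<subseteq> unit_locus Y p"
    using opn_subset[OF W(1)] unfolding unit_locus_def unit_at_def by auto
  with W show "\<exists>T. opn Y T \<and> x \<in> T \<and> T \<subseteq> unit_locus Y p" by blast
qed

lemma res_unit_locus_Units:
  assumes Y: "monoidal_space Y" and p: "p \<in> carrier (glob Y)" and W: "opn Y W" "W \<subseteq> unit_locus Y p"
  shows "res Y (topspace (pts Y)) W p \<in> Units (sec Y W)"
proof (rule Units_if_unit_at[OF Y W(1)])
  show "res Y (topspace (pts Y)) W p \<in> carrier (sec Y W)"
    using res_closed[OF Y openin_topspace W(1) opn_subset[OF W(1)] p] .
  fix x assume "x \<in> W"
  then show "unit_at Y W (res Y (topspace (pts Y)) W p) x"
    using unit_at_res[OF Y openin_topspace W(1) opn_subset[OF W(1)] _ p] W(2) by (auto simp: unit_locus_def)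
qed


section \<open>Global sections of a spectrum\<close>

lemma (in comm_monoid) global_section_apply: "r \<in> carrier G \<Longrightarrow> global_section G x r = fraction G (powers G r) x \<one>"
  by (simp add: global_section_def)

lemma (in comm_monoid) basics_in_topspace: "basics_in G (topspace (pts (Spec G))) = carrier G"
  by (auto simp: topspace_Spec basic_open_def)

lemma (in comm_monoid) global_section_closed:
  assumes "x \<in> carrier G"
  shows "global_section G x \<in> carrier (glob (Spec G))"
proof (rule Spec_secI)
  show "global_section G x \<in> extensional (basics_in G (topspace (pts (Spec G))))"
    unfolding basics_in_topspace by (simp add: global_section_def)
qed (use assms one_sat in \<open>auto simp: global_section_apply L_closed lm_fraction\<close>)

text \<open>Since \<open>basic_open G \<one>\<close> is the whole spectrum, a global section is
  determined by its value at \<open>\<one>\<close>. There the only denominator is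
  \<open>\<one>\<close>, so this value is an element of \<open>G\<close>.\<close>

lemma (in comm_monoid) global_section_cases:
  assumes s: "s \<in> carrier (glob (Spec G))"
  obtains x where "x \<in> carrier G" "s = global_section G x"
proof -
  have sub: "basic_open G p \<subseteq> topspace (pts (Spec G))" for p
    by (auto simp: topspace_Spec basic_open_def)
  have sub1: "basic_open G p \<subseteq> basic_open G \<one>" for p
    by (auto simp: basic_open_def face_one)
  have "s \<one> \<in> carrier (L \<one>)"
    by (rule Spec_secD(1)[OF s one_closed sub])
  then obtain x a where x: "x \<in> carrier G" "a \<in> powers G \<one>" "s \<one> = fraction G (powers G \<one>) x a"
    by (rule L_cases[OF one_closed])
  then have s1: "s \<one> = fraction G (powers G \<one>) x \<one>"
    by (auto simp: powers_def)
  show thesis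
  proof (rule that[OF x(1)], rule extensionalityI)
    show "s \<in> extensional (carrier G)"
      using s basics_in_topspace by (simp add: Spec_sec_iff)
    fix r assume r: "r \<in> carrier G"
    then show "s r = global_section G x r"
      using Spec_secD(2)[OF s one_closed sub r sub1] x(1) one_sat[OF one_closed]
      by (simp add: s1 global_section_apply lm_fraction[OF one_closed r sub1])
  qed (simp add: global_section_def)
qed

lemma (in comm_monoid) global_section_hom: "monoid_hom G (glob (Spec G)) (global_section G)"
proof (rule monoid_homI)
  show "global_section G (x \<otimes> y) = global_section G x \<otimes>\<^bsub>glob (Spec G)\<^esub> global_section G y"
    if "x \<in> carrier G" "y \<in> carrier G" for x y
    unfolding Spec_mult basics_in_topspace
    using that one_sat by (auto simp: global_section_def L_mult fun_eq_iff)
  show "global_section G \<one> = \<one>\<^bsub>glob (Spec G)\<^esub>"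
    unfolding Spec_one basics_in_topspace by (simp add: global_section_def localization_one_def)
qed (rule global_section_closed)

lemma (in comm_monoid) res_global_section:
  assumes "V \<subseteq> topspace (pts (Spec G))" "x \<in> carrier G"
  shows "res (Spec G) (topspace (pts (Spec G))) V (global_section G x) =
    (\<lambda>r\<in>basics_in G V. fraction G (powers G r) x \<one>)"
  by (auto simp: Spec_res global_section_def)

text \<open>Over \<open>basic_open G p\<close> the fractions \<open>1/p\<close> form an inverse.
  Conversely, an inverse on a basic neighbourhood of a face \<open>F\<close>, given by
  \<open>q\<close>, yields \<open>p \<otimes> y \<otimes> c = a \<otimes> c\<close> with
  \<open>a\<close> and \<open>c\<close> powers of \<open>q\<close>; as \<open>q\<close> lies in
  \<open>F\<close>, so does the factor \<open>p\<close>.\<close>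

lemma (in comm_monoid) unit_locus_global_section:
  assumes p: "p \<in> carrier G"
  shows "unit_locus (Spec G) (global_section G p) = basic_open G p"
proof
  let ?T = "topspace (pts (Spec G))"
  have sub: "basic_open G p \<subseteq> ?T"
    by (auto simp: topspace_Spec basic_open_def)
  let ?U = "basic_open G p"
  have psat: "p \<in> saturation G (powers G r)" if "r \<in> carrier G" "basic_open G r \<subseteq> ?U" for r
    using that p by (simp add: basic_open_subset_iff)
  let ?t = "\<lambda>r\<in>basics_in G ?U. fraction G (powers G r) \<one> p"
  have r: "res (Spec G) ?T ?U (global_section G p) \<in> carrier (sec (Spec G) ?U)"
    by (rule Spec_res_closed[OF global_section_closed[OF p] sub])
  have t: "?t \<in> carrier (sec (Spec G) ?U)"
  proof (rule Spec_secI)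
    fix r q assume r: "r \<in> carrier G" "basic_open G r \<subseteq> ?U" and q: "q \<in> carrier G" "basic_open G q \<subseteq> basic_open G r"
    then have "basic_open G q \<subseteq> ?U" by blast
    then show "lm q (?t r) = ?t q"
      using r q psat by (simp add: lm_fraction)
  qed (use psat in \<open>auto simp: L_closed\<close>)
  have "res (Spec G) ?T ?U (global_section G p) \<otimes>\<^bsub>sec (Spec G) ?U\<^esub> ?t = \<one>\<^bsub>sec (Spec G) ?U\<^esub>"
    unfolding Spec_mult Spec_one res_global_section[OF sub p]
  proof (rule restrict_ext)
    fix r assume r: "r \<in> basics_in G ?U"
    interpret r: mult_set G "powers G r" by (rule powers_mult_set) (use r in simp)
    show "(\<lambda>r\<in>basics_in G ?U. fraction G (powers G r) p \<one>) r \<otimes>\<^bsub>L r\<^esub> ?t r = \<one>\<^bsub>L r\<^esub>"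
      using r psat[of r] p one_sat[of r]
      by (simp add: L_mult localization_one_def L_eq_iff r.loc_eq_refl)
  qed
  then have "res (Spec G) ?T ?U (global_section G p) \<in> Units (sec (Spec G) ?U)"
    by (rule comm_monoid_UnitsI[OF Spec_sec_comm_monoid r t])
  then show "?U \<subseteq> unit_locus (Spec G) (global_section G p)"
    using open_basic_open[OF p] sub unfolding unit_locus_def unit_at_def by blast
  show "unit_locus (Spec G) (global_section G p) \<subseteq> ?U"
  proof
    fix F assume "F \<in> unit_locus (Spec G) (global_section G p)"
    then obtain W where F: "F \<in> ?T" and W: "opn (Spec G) W" "F \<in> W" "W \<subseteq> ?T"
      "res (Spec G) ?T W (global_section G p) \<in> Units (sec (Spec G) W)"
      unfolding unit_locus_def unit_at_def by auto
    obtain t where t: "t \<in> carrier (sec (Spec G) W)"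
      "res (Spec G) ?T W (global_section G p) \<otimes>\<^bsub>sec (Spec G) W\<^esub> t = \<one>\<^bsub>sec (Spec G) W\<^esub>"
      using W(4) unfolding Units_def by auto
    obtain q where q: "q \<in> carrier G" "F \<in> basic_open G q" "basic_open G q \<subseteq> W"
      using W(1,2) unfolding openin_Spec by auto
    have "t q \<in> carrier (L q)"
      by (rule Spec_secD(1)[OF t(1) q(1,3)])
    then obtain y a where y: "y \<in> carrier G" "a \<in> powers G q" "a \<in> saturation G (powers G q)"
      "t q = fraction G (powers G q) y a"
      by (rule L_cases[OF q(1)])
    interpret q: mult_set G "powers G q" by (rule powers_mult_set[OF q(1)])
    have "fraction G (powers G q) p \<one> \<otimes>\<^bsub>L q\<^esub> fraction G (powers G q) y a = fraction G (powers G q) \<one> \<one>"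
      using fun_cong[OF t(2), of q] q y p
      unfolding Spec_mult Spec_one res_global_section[OF W(3) p] by (simp add: localization_one_def)
    then have "loc_eq G (powers G q) (p \<otimes> y \<otimes> \<one>) (\<one> \<otimes> (\<one> \<otimes> a))"
      using p y one_sat[OF q(1)] q(1) by (simp add: L_mult L_eq_iff q.sat_mult del: r_one l_one)
    then obtain c where c: "c \<in> powers G q" "p \<otimes> y \<otimes> c = a \<otimes> c"
      using p y q.sat_closed by (auto simp: loc_eq_def)
    have FF: "face G F" "q \<in> F"
      using q(2) by (auto simp: basic_open_def)
    then have "powers G q \<subseteq> F"
      using face_pow[OF FF] by (auto simp: powers_def)
    then have "p \<otimes> y \<otimes> c \<in> F"
      using c y face_mult[OF FF(1), of a c] by auto
    then have "p \<otimes> y \<in> F"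
      using face_mult_iff[OF FF(1) m_closed[OF p y(1)] q.S_closed[OF c(1)]] by blast
    then have "p \<in> F"
      using face_mult_iff[OF FF(1) p y(1)] by blast
    then show "F \<in> ?U"
      using FF by (simp add: basic_open_def)
  qed
qed

text \<open>The global sections are a copy of \<open>G\<close> whose unit loci are the basic open
  sets. Under this identification the topological conditions are properties of faces, and the last
  two conditions say when fractions with denominators powers of \<open>p\<close> are equal and that
  every section over \<open>basic_open G p\<close> is such a fraction.\<close>

lemma (in comm_monoid) affine_Spec: "affine (Spec G)"
proof (rule affineI)
  let ?T = "topspace (pts (Spec G))"
  note h = global_section_hom
  interpret M: comm_monoid "glob (Spec G)" by (rule Spec_sec_comm_monoid)
  show "monoidal_space (Spec G)" by (rule monoidal_space_Spec)
  note ul = unit_locus_global_section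
  have pow: "global_section G p [^]\<^bsub>glob (Spec G)\<^esub> k = global_section G (p [^] k)" if "p \<in> carrier G" for p and k :: nat
    using monoid_hom_pow[OF h monoid_axioms M.monoid_axioms that] by simp
  have sub: "basic_open G p \<subseteq> ?T" for p
    by (auto simp: topspace_Spec basic_open_def)
  {
    fix W F assume "opn (Spec G) W" "F \<in> W"
    then obtain p where "p \<in> carrier G" "F \<in> basic_open G p" "basic_open G p \<subseteq> W"
      unfolding openin_Spec by auto
    then show "\<exists>p\<in>carrier (glob (Spec G)). F \<in> unit_locus (Spec G) p \<and> unit_locus (Spec G) p \<subseteq> W"
      using global_section_closed by (intro bexI[of _ "global_section G p"]) (simp_all add: ul)
  next
    fix F assume F: "face (glob (Spec G)) F"
    define F0 where "F0 = {p \<in> carrier G. global_section G p \<in> F}"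
    have F0: "face G F0"
    proof (rule faceI)
      show "\<one> \<in> F0"
        using M.face_one[OF F] monoid_hom_one[OF h] by (simp add: F0_def)
      fix x y assume "x \<in> carrier G" "y \<in> carrier G"
      then show "x \<otimes> y \<in> F0 \<longleftrightarrow> x \<in> F0 \<and> y \<in> F0"
        using M.face_mult_iff[OF F] global_section_closed by (simp add: F0_def monoid_hom_mult[OF h])
    qed (auto simp: F0_def)
    have "{p \<in> carrier (glob (Spec G)). F0 \<in> unit_locus (Spec G) p} = F"
    proof (rule Set.set_eqI)
      fix s
      show "s \<in> {p \<in> carrier (glob (Spec G)). F0 \<in> unit_locus (Spec G) p} \<longleftrightarrow> s \<in> F"
      proof (cases "s \<in> carrier (glob (Spec G))")
        case True
        then obtain x where x: "x \<in> carrier G" "s = global_section G x"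
          by (rule global_section_cases)
        then show ?thesis
          using True F0 by (simp add: ul basic_open_def) (simp add: F0_def)
      qed (use M.face_subset[OF F] in auto)
    qed
    then show "\<exists>x\<in>?T. {p \<in> carrier (glob (Spec G)). x \<in> unit_locus (Spec G) p} = F"
      using F0 by (intro bexI[of _ F0]) (simp_all add: topspace_Spec)
  next
    fix E F assume EF: "E \<in> ?T" "F \<in> ?T"
      and eq: "\<forall>p\<in>carrier (glob (Spec G)). E \<in> unit_locus (Spec G) p \<longleftrightarrow> F \<in> unit_locus (Spec G) p"
    then have EF: "face G E" "face G F" by (auto simp: topspace_Spec)
    have "p \<in> E \<longleftrightarrow> p \<in> F" if "p \<in> carrier G" for p
      using bspec[OF eq global_section_closed[OF that]] EF by (simp add: ul[OF that] basic_open_def)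
    then show "E = F"
      using face_subset[OF EF(1)] face_subset[OF EF(2)] by blast
  next
    fix p s t assume p: "p \<in> carrier (glob (Spec G))" and s: "s \<in> carrier (glob (Spec G))"
      and t: "t \<in> carrier (glob (Spec G))"
      and eq: "res (Spec G) ?T (unit_locus (Spec G) p) s = res (Spec G) ?T (unit_locus (Spec G) p) t"
    obtain p0 where p0: "p0 \<in> carrier G" "p = global_section G p0" using p by (rule global_section_cases)
    obtain x where x: "x \<in> carrier G" "s = global_section G x" using s by (rule global_section_cases)
    obtain y where y: "y \<in> carrier G" "t = global_section G y" using t by (rule global_section_cases)
    interpret p0: mult_set G "powers G p0" by (rule powers_mult_set[OF p0(1)])
    have "fraction G (powers G p0) x \<one> = fraction G (powers G p0) y \<one>"
      using fun_cong[OF eq, of p0] unfolding p0(2) ul[OF p0(1)] x(2) y(2)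
        res_global_section[OF sub x(1)] res_global_section[OF sub y(1)] using p0 by simp
    then obtain c where "c \<in> powers G p0" "x \<otimes> c = y \<otimes> c"
      using x y p0 one_sat by (auto simp: L_eq_iff loc_eq_def)
    then obtain k where "x \<otimes> p0 [^] (k::nat) = y \<otimes> p0 [^] k"
      by (auto simp: powers_def)
    then show "\<exists>k::nat. s \<otimes>\<^bsub>glob (Spec G)\<^esub> p [^]\<^bsub>glob (Spec G)\<^esub> k = t \<otimes>\<^bsub>glob (Spec G)\<^esub> p [^]\<^bsub>glob (Spec G)\<^esub> k"
      using p0 x y by (intro exI[of _ k]) (simp add: pow monoid_hom_mult[OF h, symmetric])
  next
    fix p s assume p: "p \<in> carrier (glob (Spec G))" and s: "s \<in> carrier (sec (Spec G) (unit_locus (Spec G) p))"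
    obtain p0 where p0: "p0 \<in> carrier G" "p = global_section G p0" using p by (rule global_section_cases)
    let ?U = "basic_open G p0"
    have U: "unit_locus (Spec G) p = ?U" using p0 ul by simp
    have s: "s \<in> carrier (sec (Spec G) ?U)" using s U by simp
    interpret p0: mult_set G "powers G p0" by (rule powers_mult_set[OF p0(1)])
    have "s p0 \<in> carrier (L p0)" by (rule Spec_secD(1)[OF s p0(1) subset_refl])
    then obtain x a where x: "x \<in> carrier G" "a \<in> powers G p0" "a \<in> saturation G (powers G p0)"
      "s p0 = fraction G (powers G p0) x a"
      by (rule L_cases[OF p0(1)])
    then obtain k where k: "a = p0 [^] (k::nat)" by (auto simp: powers_def)
    have a: "a \<in> carrier G" using k p0 by simp
    have "s \<otimes>\<^bsub>sec (Spec G) ?U\<^esub> res (Spec G) ?T ?U (global_section G a) =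
      res (Spec G) ?T ?U (global_section G x)"
      unfolding Spec_mult res_global_section[OF sub a] res_global_section[OF sub x(1)]
    proof (rule restrict_ext)
      fix r assume "r \<in> basics_in G ?U"
      then have r: "r \<in> carrier G" "basic_open G r \<subseteq> ?U" by auto
      interpret r: mult_set G "powers G r" by (rule powers_mult_set[OF r(1)])
      have ar: "a \<in> saturation G (powers G r)"
        by (rule sat_powers_mono[OF p0(1) r x(3)])
      have "s r = fraction G (powers G r) x a"
        using Spec_secD(2)[OF s p0(1) subset_refl r] x lm_fraction[OF p0(1) r x(1,3)] by simp
      then have "s r \<otimes>\<^bsub>L r\<^esub> fraction G (powers G r) a \<one> = fraction G (powers G r) (x \<otimes> a) (a \<otimes> \<one>)"
        using L_mult[OF r(1) x(1) ar a one_sat[OF r(1)]] by simp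
      also have "\<dots> = fraction G (powers G r) x \<one>"
        using r x(1) a ar one_sat[OF r(1)] by (simp add: L_eq_iff r.loc_eq_refl)
      finally show "s r \<otimes>\<^bsub>L r\<^esub> (\<lambda>r\<in>basics_in G ?U. fraction G (powers G r) a \<one>) r = fraction G (powers G r) x \<one>"
        using r by simp
    qed
    then show "\<exists>k::nat. \<exists>t\<in>carrier (glob (Spec G)).
          s \<otimes>\<^bsub>sec (Spec G) (unit_locus (Spec G) p)\<^esub> res (Spec G) ?T (unit_locus (Spec G) p) (p [^]\<^bsub>glob (Spec G)\<^esub> k) =
          res (Spec G) ?T (unit_locus (Spec G) p) t"
      using global_section_closed[OF x(1)] p0 k unfolding U
      by (intro exI[of _ k] bexI[of _ "global_section G x"]) (simp_all add: pow)
  }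
qed

section \<open>Unit loci of products and powers, and the face of a point\<close>

lemma (in comm_monoid) Units_mult_iff:
  assumes "a \<in> carrier G" "b \<in> carrier G"
  shows "a \<otimes> b \<in> Units G \<longleftrightarrow> a \<in> Units G \<and> b \<in> Units G"
proof
  assume "a \<otimes> b \<in> Units G"
  then obtain c where c: "c \<in> carrier G" "a \<otimes> b \<otimes> c = \<one>"
    unfolding Units_def using m_comm assms by auto
  then have "a \<otimes> (b \<otimes> c) = \<one>" "b \<otimes> (a \<otimes> c) = \<one>"
    using assms by (simp_all add: m_assoc m_lcomm[of b a])
  then show "a \<in> Units G \<and> b \<in> Units G"
    using comm_monoid_UnitsI[OF comm_monoid_axioms] assms c by (meson m_closed)
qed auto

lemma (in comm_monoid) Units_cancel_right:
  assumes "u \<in> Units G" "a \<in> carrier G" "b \<in> carrier G" "a \<otimes> u = b \<otimes> u"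
  shows "a = b"
proof -
  have "a \<otimes> (u \<otimes> inv u) = b \<otimes> (u \<otimes> inv u)"
    using assms Units_closed[OF assms(1)] by (simp only: m_assoc[symmetric] Units_inv_closed)
  then show ?thesis
    using assms by simp
qed

lemma unit_at_mult_iff:
  assumes Y: "monoidal_space Y" and U: "opn Y U" "x \<in> U" "p \<in> carrier (sec Y U)" "q \<in> carrier (sec Y U)"
  shows "unit_at Y U (p \<otimes>\<^bsub>sec Y U\<^esub> q) x \<longleftrightarrow> unit_at Y U p x \<and> unit_at Y U q x"
proof -
  have x: "x \<in> topspace (pts Y)" using U opn_subset by blast
  interpret comm_monoid "stk Y x" by (rule stalk_comm_monoid[OF Y x])
  interpret U: comm_monoid "sec Y U" by (rule sec_comm_monoid[OF Y U(1)])
  have "gm Y x U (p \<otimes>\<^bsub>sec Y U\<^esub> q) = gm Y x U p \<otimes>\<^bsub>stk Y x\<^esub> gm Y x U q"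
    using stalk_mult_same[OF Y U] by simp
  then show ?thesis
    using U germ_Units_iff[OF Y U(1,2)] Units_mult_iff[OF germ_in_stalk[OF U(1,2,3)] germ_in_stalk[OF U(1,2,4)]]
    by (metis U.m_closed)
qed

lemma unit_locus_mult:
  assumes Y: "monoidal_space Y" and p: "p \<in> carrier (glob Y)" "q \<in> carrier (glob Y)"
  shows "unit_locus Y (p \<otimes>\<^bsub>glob Y\<^esub> q) = unit_locus Y p \<inter> unit_locus Y q"
  using unit_at_mult_iff[OF Y openin_topspace _ p] by (auto simp: unit_locus_def)

lemma unit_locus_Units:
  assumes Y: "monoidal_space Y" and p: "p \<in> Units (glob Y)"
  shows "unit_locus Y p = topspace (pts Y)"
  using Units_unit_at[OF Y openin_topspace p] by (auto simp: unit_locus_def)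

text \<open>The zeroth power is \<open>\<one>\<close>, whose unit locus is everything; this is why
  equality is claimed for \<open>k > 0\<close> and only an inclusion in general.\<close>

lemma unit_locus_pow:
  assumes Y: "monoidal_space Y" and p: "p \<in> carrier (glob Y)"
  shows "unit_locus Y p \<subseteq> unit_locus Y (p [^]\<^bsub>glob Y\<^esub> (k::nat))"
    and "k > 0 \<Longrightarrow> unit_locus Y (p [^]\<^bsub>glob Y\<^esub> (k::nat)) = unit_locus Y p"
proof -
  interpret comm_monoid "glob Y" by (rule sec_comm_monoid[OF Y openin_topspace])
  show 1: "unit_locus Y p \<subseteq> unit_locus Y (p [^]\<^bsub>glob Y\<^esub> (k::nat))" for k
  proof (induction k)
    case 0
    then show ?case using unit_locus_Units[OF Y Units_one_closed] unit_locus_subset by simp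
  next
    case (Suc k)
    then show ?case using p by (simp add: unit_locus_mult[OF Y])
  qed
  assume "k > 0"
  then obtain m where "k = Suc m" by (cases k) auto
  then show "unit_locus Y (p [^]\<^bsub>glob Y\<^esub> (k::nat)) = unit_locus Y p"
    using p 1[of m] by (auto simp: unit_locus_mult[OF Y])
qed

text \<open>A product is invertible at \<open>x\<close> exactly when both factors are. This face is
  the complement of the prime ideal of sections that are not invertible at \<open>x\<close>.\<close>

lemma face_of_point:
  assumes Y: "monoidal_space Y" and x: "x \<in> topspace (pts Y)"
  shows "face (glob Y) {p \<in> carrier (glob Y). x \<in> unit_locus Y p}"
proof -
  interpret comm_monoid "glob Y" by (rule sec_comm_monoid[OF Y openin_topspace])
  show ?thesis
    using unit_locus_Units[OF Y Units_one_closed] x by (intro faceI) (auto simp: unit_locus_mult[OF Y])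
qed


section \<open>The isomorphism of an affine space with a spectrum\<close>

locale affine_mspace =
  fixes Y :: "('x, 'm) mspace"
  assumes aff: "affine Y"

sublocale affine_mspace \<subseteq> comm_monoid "glob Y"
  by (rule sec_comm_monoid[OF affine_space[OF aff] openin_topspace])

abbreviation (in affine_mspace) "T \<equiv> topspace (pts Y)"
abbreviation (in affine_mspace) "D \<equiv> unit_locus Y"
abbreviation (in affine_mspace) "P \<equiv> glob Y"
abbreviation (in affine_mspace) "rho q \<equiv> res Y T (D q)"

lemma (in affine_mspace) Y: "monoidal_space Y"
  by (rule affine_space[OF aff])

lemma (in affine_mspace) oD: "q \<in> carrier P \<Longrightarrow> opn Y (D q)"
  by (rule open_unit_locus[OF Y])

lemma (in affine_mspace) sD: "comm_monoid (sec Y (D q))" if "q \<in> carrier P"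
  by (rule sec_comm_monoid[OF Y oD[OF that]])

lemma (in affine_mspace) rho_hom: "q \<in> carrier P \<Longrightarrow> monoid_hom P (sec Y (D q)) (rho q)"
  by (rule res_hom[OF Y openin_topspace oD unit_locus_subset])

definition (in affine_mspace) fc :: "'x \<Rightarrow> 'm set" where
  "fc x = {p \<in> carrier P. x \<in> D p}"

text \<open>For a face \<open>F\<close> the face condition of \<open>affine\<close> provides such a
  point and the separation condition makes it unique, so \<open>pt\<close> is inverse to
  \<open>fc\<close>.\<close>

definition (in affine_mspace) pt :: "'m set \<Rightarrow> 'x" where
  "pt F = (SOME x. x \<in> T \<and> fc x = F)"

lemma (in affine_mspace) fc_face: "x \<in> T \<Longrightarrow> face P (fc x)"
  unfolding fc_def by (rule face_of_point[OF Y])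

lemma (in affine_mspace) pt_props:
  assumes "face P F"
  shows pt_in: "pt F \<in> T" and fc_pt: "fc (pt F) = F"
proof -
  have "\<exists>x. x \<in> T \<and> fc x = F"
    using affine_face[OF aff assms] unfolding fc_def by auto
  from someI_ex[OF this] show "pt F \<in> T" "fc (pt F) = F"
    unfolding pt_def by auto
qed

lemma (in affine_mspace) pt_fc:
  assumes x: "x \<in> T"
  shows "pt (fc x) = x"
proof (rule affine_inj[OF aff pt_in[OF fc_face[OF x]] x])
  fix p assume "p \<in> carrier P"
  then show "pt (fc x) \<in> D p \<longleftrightarrow> x \<in> D p"
    using fc_pt[OF fc_face[OF x]] unfolding fc_def by auto
qed

lemma (in affine_mspace) fc_basic: "x \<in> T \<Longrightarrow> p \<in> carrier P \<Longrightarrow> fc x \<in> basic_open P p \<longleftrightarrow> x \<in> D p"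
  using fc_face by (auto simp: basic_open_def fc_def)

lemma (in affine_mspace) pt_D: "face P F \<Longrightarrow> p \<in> carrier P \<Longrightarrow> pt F \<in> D p \<longleftrightarrow> p \<in> F"
  using fc_pt[of F] by (auto simp: fc_def)

text \<open>The two maps match the unit locus \<open>D p\<close> with \<open>basic_open P p\<close>.
  These sets are bases of the two topologies, which gives continuity in both directions.\<close>

lemma (in affine_mspace) homeo: "homeomorphic_maps (pts (Spec P)) (pts Y) pt fc"
  unfolding homeomorphic_maps_def
proof (intro conjI)
  show "continuous_map (pts (Spec P)) (pts Y) pt"
    unfolding continuous_map_def
  proof (intro conjI allI impI)
    show "pt \<in> topspace (pts (Spec P)) \<rightarrow> T"
      using pt_in by (auto simp: topspace_Spec)
    fix W assume W: "opn Y W"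
    show "opn (Spec P) (pre (Spec P) pt W)"
      unfolding openin_Spec
    proof
      fix F assume "F \<in> pre (Spec P) pt W"
      then have F: "face P F" "pt F \<in> W" by (auto simp: topspace_Spec)
      obtain p where p: "p \<in> carrier P" "pt F \<in> D p" "D p \<subseteq> W"
        using affine_basis[OF aff W F(2)] by auto
      then have "basic_open P p \<subseteq> pre (Spec P) pt W"
        using pt_D by (auto simp: basic_open_def topspace_Spec)
      then show "\<exists>p\<in>carrier P. F \<in> basic_open P p \<and> basic_open P p \<subseteq> pre (Spec P) pt W"
        using p F pt_D by (intro bexI[of _ p]) (auto simp: basic_open_def)
    qed
  qed
  show "continuous_map (pts Y) (pts (Spec P)) fc"
    unfolding continuous_map_def
  proof (intro conjI allI impI)
    show "fc \<in> T \<rightarrow> topspace (pts (Spec P))"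
      using fc_face by (auto simp: topspace_Spec)
    fix V assume V: "opn (Spec P) V"
    show "opn Y (pre Y fc V)"
    proof (subst openin_subopen, rule ballI)
      fix x assume x: "x \<in> pre Y fc V"
      then obtain p where p: "p \<in> carrier P" "fc x \<in> basic_open P p" "basic_open P p \<subseteq> V"
        using V unfolding openin_Spec by auto
      have "D p \<subseteq> pre Y fc V"
      proof
        fix z assume z: "z \<in> D p"
        then have zT: "z \<in> T" by (rule subsetD[OF unit_locus_subset])
        then show "z \<in> pre Y fc V" using fc_basic[OF zT p(1)] z p(3) by auto
      qed
      then show "\<exists>W. opn Y W \<and> x \<in> W \<and> W \<subseteq> pre Y fc V"
        using p x fc_basic[of x p] oD[OF p(1)] by (intro exI[of _ "D p"]) auto
    qed
  qed
  show "\<forall>F\<in>topspace (pts (Spec P)). fc (pt F) = F"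
    using fc_pt by (simp add: topspace_Spec)
  show "\<forall>x\<in>T. pt (fc x) = x"
    using pt_fc by simp
qed

lemma (in affine_mspace) basic_subset_iff:
  assumes W: "opn Y W" and q: "q \<in> carrier P"
  shows "basic_open P q \<subseteq> pre (Spec P) pt W \<longleftrightarrow> D q \<subseteq> W"
proof
  assume a: "basic_open P q \<subseteq> pre (Spec P) pt W"
  show "D q \<subseteq> W"
  proof
    fix x assume "x \<in> D q"
    then have x: "x \<in> T" "x \<in> D q" using subsetD[OF unit_locus_subset] by auto
    then have "fc x \<in> pre (Spec P) pt W"
      using a fc_basic[OF x(1) q] by auto
    then show "x \<in> W" using pt_fc[OF x(1)] by simp
  qed
next
  assume a: "D q \<subseteq> W"
  show "basic_open P q \<subseteq> pre (Spec P) pt W"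
    using a pt_D q by (auto simp: basic_open_def topspace_Spec)
qed

lemma (in affine_mspace) pre_pt_D: "q \<in> carrier P \<Longrightarrow> pre (Spec P) pt (D q) = basic_open P q"
  using pt_D by (auto simp: basic_open_def topspace_Spec)

lemma (in affine_mspace) sat_iff:
  assumes "q \<in> carrier P" "a \<in> carrier P"
  shows "a \<in> saturation P (powers P q) \<longleftrightarrow> D q \<subseteq> D a"
  using basic_open_subset_iff[OF assms(2,1)] basic_subset_iff[OF oD[OF assms(2)] assms(1)] pre_pt_D[OF assms(2)]
  by simp

section \<open>Sections over unit loci as fractions\<close>

lemma (in affine_mspace) rho_Units:
  assumes "q \<in> carrier P" "a \<in> saturation P (powers P q)"
  shows "rho q a \<in> Units (sec Y (D q))"
proof -
  have "a \<in> carrier P" using assms by (auto simp: saturation_def)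
  then show ?thesis
    using assms sat_iff by (intro res_unit_locus_Units[OF Y _ oD]) auto
qed

text \<open>A power of \<open>q\<close> is invertible over \<open>D q\<close> and can be cancelled
  there; the converse is the equality clause of \<open>affine\<close>. So the localization at
  \<open>q\<close> embeds into the sections over \<open>D q\<close>.\<close>

lemma (in affine_mspace) loc_eq_iff:
  assumes q: "q \<in> carrier P" and x: "x \<in> carrier P" "y \<in> carrier P"
  shows "loc_eq P (powers P q) x y \<longleftrightarrow> rho q x = rho q y"
proof
  interpret q: mult_set P "powers P q" by (rule powers_mult_set[OF q])
  interpret Dq: comm_monoid "sec Y (D q)" by (rule sD[OF q])
  note h = rho_hom[OF q]
  assume "loc_eq P (powers P q) x y"
  then obtain c where c: "c \<in> powers P q" "x \<otimes>\<^bsub>P\<^esub> c = y \<otimes>\<^bsub>P\<^esub> c" by (auto simp: loc_eq_def)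
  have "rho q x \<otimes>\<^bsub>sec Y (D q)\<^esub> rho q c = rho q y \<otimes>\<^bsub>sec Y (D q)\<^esub> rho q c"
    using c(2) x q.S_closed[OF c(1)] by (simp flip: monoid_hom_mult[OF h])
  then show "rho q x = rho q y"
    using Dq.Units_cancel_right[OF rho_Units[OF q q.S_sat[OF c(1)]]] x by (simp add: monoid_hom_closed[OF h])
next
  assume "rho q x = rho q y"
  then obtain k where "x \<otimes>\<^bsub>P\<^esub> q [^]\<^bsub>P\<^esub> (k::nat) = y \<otimes>\<^bsub>P\<^esub> q [^]\<^bsub>P\<^esub> k"
    using affine_eq[OF aff q x] by auto
  then show "loc_eq P (powers P q) x y"
    using powers_pow unfolding loc_eq_def by blast
qed

text \<open>The element of \<open>L q\<close> corresponding to \<open>t\<close>, given by all its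
  numerators and denominators at once. This has the same shape as \<open>fraction\<close>, so no
  representative has to be chosen.\<close>

definition (in affine_mspace) fractions :: "'m \<Rightarrow> 'm \<Rightarrow> ('m \<times> 'm) set" where
  "fractions q t = {(y, b). y \<in> carrier P \<and> b \<in> powers P q \<and> t \<otimes>\<^bsub>sec Y (D q)\<^esub> rho q b = rho q y}"

text \<open>As \<open>rho q a\<close> is a unit, \<open>t\<close> times \<open>rho q b\<close>
  equals \<open>rho q y\<close> exactly when this holds after multiplying by \<open>rho q a\<close>.
  The left side then becomes the image of \<open>x \<otimes> b\<close>, and
  \<open>loc_eq_iff\<close> recognizes equality of the two fractions.\<close>

lemma (in affine_mspace) fractions_eq:
  assumes q: "q \<in> carrier P" and t: "t \<in> carrier (sec Y (D q))"
    and x: "x \<in> carrier P" and a: "a \<in> saturation P (powers P q)"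
    and eq: "t \<otimes>\<^bsub>sec Y (D q)\<^esub> rho q a = rho q x"
  shows "fraction P (powers P q) x a = fractions q t"
proof -
  interpret q: mult_set P "powers P q" by (rule powers_mult_set[OF q])
  interpret Dq: comm_monoid "sec Y (D q)" by (rule sD[OF q])
  note h = rho_hom[OF q]
  have ac: "a \<in> carrier P" using a by (rule q.sat_closed)
  have "loc_eq P (powers P q) (x \<otimes>\<^bsub>P\<^esub> b) (y \<otimes>\<^bsub>P\<^esub> a) \<longleftrightarrow> t \<otimes>\<^bsub>sec Y (D q)\<^esub> rho q b = rho q y"
    if y: "y \<in> carrier P" and b: "b \<in> powers P q" for y b
  proof -
    have bc: "b \<in> carrier P" using b by (rule q.S_closed)
    note c = monoid_hom_closed[OF h x] monoid_hom_closed[OF h y] monoid_hom_closed[OF h bc] monoid_hom_closed[OF h ac] t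
    have "loc_eq P (powers P q) (x \<otimes>\<^bsub>P\<^esub> b) (y \<otimes>\<^bsub>P\<^esub> a) \<longleftrightarrow>
      rho q x \<otimes>\<^bsub>sec Y (D q)\<^esub> rho q b = rho q y \<otimes>\<^bsub>sec Y (D q)\<^esub> rho q a"
      using x y ac bc by (simp add: loc_eq_iff[OF q] monoid_hom_mult[OF h])
    also have "rho q x \<otimes>\<^bsub>sec Y (D q)\<^esub> rho q b = t \<otimes>\<^bsub>sec Y (D q)\<^esub> rho q b \<otimes>\<^bsub>sec Y (D q)\<^esub> rho q a"
      unfolding eq[symmetric] using c by (simp add: Dq.m_ac)
    also have "t \<otimes>\<^bsub>sec Y (D q)\<^esub> rho q b \<otimes>\<^bsub>sec Y (D q)\<^esub> rho q a = rho q y \<otimes>\<^bsub>sec Y (D q)\<^esub> rho q a \<longleftrightarrow>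
        t \<otimes>\<^bsub>sec Y (D q)\<^esub> rho q b = rho q y"
      using Dq.Units_cancel_right[OF rho_Units[OF q a]] c by (metis Dq.m_closed)
    finally show ?thesis .
  qed
  then show ?thesis
    unfolding fractions_def by (auto simp: q.fraction_mem)
qed

text \<open>The existence clause of \<open>affine\<close> supplies a power of \<open>q\<close> that
  clears the denominator of \<open>t\<close>.\<close>

lemma (in affine_mspace) section_fraction:
  assumes q: "q \<in> carrier P" and t: "t \<in> carrier (sec Y (D q))"
  obtains x a where "x \<in> carrier P" "a \<in> powers P q" "a \<in> carrier P" "a \<in> saturation P (powers P q)"
    "t \<otimes>\<^bsub>sec Y (D q)\<^esub> rho q a = rho q x" "fractions q t = fraction P (powers P q) x a"
proof -
  interpret q: mult_set P "powers P q" by (rule powers_mult_set[OF q])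
  obtain k x where x: "x \<in> carrier P" "t \<otimes>\<^bsub>sec Y (D q)\<^esub> rho q (q [^]\<^bsub>P\<^esub> (k::nat)) = rho q x"
    using affine_ex[OF aff q t] by auto
  have a: "q [^]\<^bsub>P\<^esub> k \<in> powers P q" by (rule powers_pow)
  show ?thesis
    by (rule that[OF x(1) a q.S_closed[OF a] q.S_sat[OF a] x(2) fractions_eq[OF q t x(1) q.S_sat[OF a] x(2), symmetric]])
qed

lemma (in affine_mspace) fractions_closed:
  assumes q: "q \<in> carrier P" and t: "t \<in> carrier (sec Y (D q))"
  shows "fractions q t \<in> carrier (L q)"
  by (rule section_fraction[OF q t]) (simp add: L_closed[OF q])

text \<open>Equal fractions are cross-multiplied, mapped to sections over \<open>D q\<close>, and
  the denominators, which are units there, are cancelled.\<close>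

lemma (in affine_mspace) fractions_inj:
  assumes q: "q \<in> carrier P" and t: "t \<in> carrier (sec Y (D q))" "t' \<in> carrier (sec Y (D q))"
    and eq: "fractions q t = fractions q t'"
  shows "t = t'"
proof -
  interpret Dq: comm_monoid "sec Y (D q)" by (rule sD[OF q])
  note h = rho_hom[OF q]
  obtain x a where x: "x \<in> carrier P" "a \<in> carrier P" "a \<in> saturation P (powers P q)"
    "t \<otimes>\<^bsub>sec Y (D q)\<^esub> rho q a = rho q x" "fractions q t = fraction P (powers P q) x a"
    by (rule section_fraction[OF q t(1)])
  obtain y b where y: "y \<in> carrier P" "b \<in> carrier P" "b \<in> saturation P (powers P q)"
    "t' \<otimes>\<^bsub>sec Y (D q)\<^esub> rho q b = rho q y" "fractions q t' = fraction P (powers P q) y b"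
    by (rule section_fraction[OF q t(2)])
  note c = t monoid_hom_closed[OF h x(1)] monoid_hom_closed[OF h x(2)] monoid_hom_closed[OF h y(1)] monoid_hom_closed[OF h y(2)]
  have "loc_eq P (powers P q) (x \<otimes>\<^bsub>P\<^esub> b) (y \<otimes>\<^bsub>P\<^esub> a)"
    using eq x y by (simp add: L_eq_iff[OF q])
  then have "rho q x \<otimes>\<^bsub>sec Y (D q)\<^esub> rho q b = rho q y \<otimes>\<^bsub>sec Y (D q)\<^esub> rho q a"
    using x y by (simp add: loc_eq_iff[OF q] monoid_hom_mult[OF h])
  then have eq': "t \<otimes>\<^bsub>sec Y (D q)\<^esub> rho q a \<otimes>\<^bsub>sec Y (D q)\<^esub> rho q b = t' \<otimes>\<^bsub>sec Y (D q)\<^esub> rho q b \<otimes>\<^bsub>sec Y (D q)\<^esub> rho q a"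
    unfolding x(4) y(4) .
  have "rho q a \<otimes>\<^bsub>sec Y (D q)\<^esub> rho q b \<in> Units (sec Y (D q))"
    using rho_Units[OF q x(3)] rho_Units[OF q y(3)] by simp
  then show ?thesis
    by (rule Dq.Units_cancel_right[OF _ t]) (use eq' c in \<open>simp add: Dq.m_ac\<close>)
qed

text \<open>The denominator becomes a unit over \<open>D q\<close>, so the quotient of the images of
  numerator and denominator is a section there.\<close>

lemma (in affine_mspace) fractions_surj:
  assumes q: "q \<in> carrier P" and c: "c \<in> carrier (L q)"
  obtains t where "t \<in> carrier (sec Y (D q))" "fractions q t = c"
proof -
  interpret Dq: comm_monoid "sec Y (D q)" by (rule sD[OF q])
  note h = rho_hom[OF q]
  obtain x a where x: "x \<in> carrier P" "a \<in> saturation P (powers P q)" "c = fraction P (powers P q) x a"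
    by (rule L_cases[OF q c])
  note u = rho_Units[OF q x(2)]
  let ?t = "rho q x \<otimes>\<^bsub>sec Y (D q)\<^esub> inv\<^bsub>sec Y (D q)\<^esub> (rho q a)"
  note rx = monoid_hom_closed[OF h x(1)]
  have t: "?t \<in> carrier (sec Y (D q))" using rx u by simp
  have "?t \<otimes>\<^bsub>sec Y (D q)\<^esub> rho q a = rho q x"
    using rx u Dq.Units_closed[OF u] by (simp add: Dq.m_assoc)
  from that[OF t] fractions_eq[OF q t x(1,2) this] x(3) show ?thesis by simp
qed

lemma (in affine_mspace) D_subset:
  assumes "q \<in> carrier P" "r \<in> carrier P" "basic_open P r \<subseteq> basic_open P q"
  shows "D r \<subseteq> D q"
  using basic_subset_iff[OF oD[OF assms(1)] assms(2)] pre_pt_D[OF assms(1)] assms(3) by simp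

text \<open>A numerator and a denominator of \<open>t\<close> over \<open>D q\<close> serve its
  restriction as well, except that the denominator is then only in the saturation of the powers of
  \<open>r\<close>.\<close>

lemma (in affine_mspace) fractions_res:
  assumes q: "q \<in> carrier P" and r: "r \<in> carrier P" and sub: "basic_open P r \<subseteq> basic_open P q"
    and t: "t \<in> carrier (sec Y (D q))"
  shows "lm r (fractions q t) = fractions r (res Y (D q) (D r) t)"
proof -
  have Dr: "D r \<subseteq> D q" by (rule D_subset[OF q r sub])
  obtain x a where x: "x \<in> carrier P" "a \<in> carrier P" "a \<in> saturation P (powers P q)"
    "t \<otimes>\<^bsub>sec Y (D q)\<^esub> rho q a = rho q x" "fractions q t = fraction P (powers P q) x a"
    by (rule section_fraction[OF q t])
  have rr: "res Y (D q) (D r) (rho q z) = rho r z" if "z \<in> carrier P" for z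
    by (rule res_res[OF Y openin_topspace oD[OF q] oD[OF r] Dr unit_locus_subset that])
  have "res Y (D q) (D r) t \<otimes>\<^bsub>sec Y (D r)\<^esub> rho r a = rho r x"
    using arg_cong[OF x(4), of "res Y (D q) (D r)"] t x(1,2)
      res_mult[OF Y oD[OF q] oD[OF r] Dr t monoid_hom_closed[OF rho_hom[OF q] x(2)]]
    by (simp add: rr)
  then have "fraction P (powers P r) x a = fractions r (res Y (D q) (D r) t)"
    by (intro fractions_eq[OF r res_closed[OF Y oD[OF q] oD[OF r] Dr t] x(1) sat_powers_mono[OF q r sub x(3)]])
  then show ?thesis
    using lm_fraction[OF q r sub x(1,3)] x(5) by simp
qed

lemma (in affine_mspace) fractions_mult:
  assumes q: "q \<in> carrier P" and t: "t \<in> carrier (sec Y (D q))" "t' \<in> carrier (sec Y (D q))"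
  shows "fractions q (t \<otimes>\<^bsub>sec Y (D q)\<^esub> t') = fractions q t \<otimes>\<^bsub>L q\<^esub> fractions q t'"
proof -
  interpret q: mult_set P "powers P q" by (rule powers_mult_set[OF q])
  interpret Dq: comm_monoid "sec Y (D q)" by (rule sD[OF q])
  note h = rho_hom[OF q]
  obtain x a where x: "x \<in> carrier P" "a \<in> carrier P" "a \<in> saturation P (powers P q)"
    "t \<otimes>\<^bsub>sec Y (D q)\<^esub> rho q a = rho q x" "fractions q t = fraction P (powers P q) x a"
    by (rule section_fraction[OF q t(1)])
  obtain y b where y: "y \<in> carrier P" "b \<in> carrier P" "b \<in> saturation P (powers P q)"
    "t' \<otimes>\<^bsub>sec Y (D q)\<^esub> rho q b = rho q y" "fractions q t' = fraction P (powers P q) y b"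
    by (rule section_fraction[OF q t(2)])
  note c = t monoid_hom_closed[OF h x(2)] monoid_hom_closed[OF h y(2)]
  have "t \<otimes>\<^bsub>sec Y (D q)\<^esub> t' \<otimes>\<^bsub>sec Y (D q)\<^esub> (rho q a \<otimes>\<^bsub>sec Y (D q)\<^esub> rho q b) =
    (t \<otimes>\<^bsub>sec Y (D q)\<^esub> rho q a) \<otimes>\<^bsub>sec Y (D q)\<^esub> (t' \<otimes>\<^bsub>sec Y (D q)\<^esub> rho q b)"
    using c by (simp add: Dq.m_ac)
  then have "t \<otimes>\<^bsub>sec Y (D q)\<^esub> t' \<otimes>\<^bsub>sec Y (D q)\<^esub> rho q (a \<otimes>\<^bsub>P\<^esub> b) = rho q (x \<otimes>\<^bsub>P\<^esub> y)"
    using x y by (simp add: monoid_hom_mult[OF h])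
  then have "fraction P (powers P q) (x \<otimes>\<^bsub>P\<^esub> y) (a \<otimes>\<^bsub>P\<^esub> b) = fractions q (t \<otimes>\<^bsub>sec Y (D q)\<^esub> t')"
    using x y q.sat_mult t by (intro fractions_eq[OF q]) auto
  then show ?thesis
    using L_mult[OF q x(1,3) y(1,3)] x(5) y(5) by simp
qed

lemma (in affine_mspace) fractions_one:
  assumes q: "q \<in> carrier P"
  shows "fractions q \<one>\<^bsub>sec Y (D q)\<^esub> = \<one>\<^bsub>L q\<^esub>"
proof -
  interpret Dq: comm_monoid "sec Y (D q)" by (rule sD[OF q])
  show ?thesis
    unfolding localization_one_def using one_sat[OF q]
    by (intro fractions_eq[OF q, symmetric]) (auto simp: monoid_hom_one[OF rho_hom[OF q]])
qed

section \<open>Comparison of the structure sheaves\<close>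

definition (in affine_mspace) to_Spec :: "'x set \<Rightarrow> 'm \<Rightarrow> 'm spec_sec" where
  "to_Spec W t = (\<lambda>q\<in>basics_in P (pre (Spec P) pt W). fractions q (res Y W (D q) t))"

lemma (in affine_mspace) to_Spec_cohom: "cohom (Spec P) pt Y to_Spec"
  unfolding cohom_def
proof (intro conjI allI impI ballI)
  show cont: "continuous_map (pts (Spec P)) (pts Y) pt"
    using homeo by (simp add: homeomorphic_maps_def)
  have bs: "q \<in> carrier P \<and> D q \<subseteq> W" if "q \<in> basics_in P (pre (Spec P) pt W)" "opn Y W" for q W
    using that basic_subset_iff[of W q] by simp
  fix W assume W: "opn Y W"
  let ?V = "pre (Spec P) pt W"
  note rc = res_closed[OF Y W oD]
  show "monoid_hom (sec Y W) (sec (Spec P) ?V) (to_Spec W)"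
  proof (rule monoid_homI)
    fix t assume t: "t \<in> carrier (sec Y W)"
    show "to_Spec W t \<in> carrier (sec (Spec P) ?V)"
    proof (rule Spec_secI)
      fix p assume p: "p \<in> carrier P" "basic_open P p \<subseteq> ?V"
      then have pD: "D p \<subseteq> W" using basic_subset_iff[OF W] by simp
      show "to_Spec W t p \<in> carrier (L p)"
        using p fractions_closed[OF p(1) rc[OF p(1) pD t]] by (simp add: to_Spec_def)
      fix q assume q: "q \<in> carrier P" "basic_open P q \<subseteq> basic_open P p"
      then have "basic_open P q \<subseteq> ?V" using p by blast
      then show "lm q (to_Spec W t p) = to_Spec W t q"
        using fractions_res[OF p(1) q rc[OF p(1) pD t]] p q
          res_res[OF Y W oD[OF p(1)] oD[OF q(1)] D_subset[OF p(1) q] pD t]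
        by (simp add: to_Spec_def)
    qed (simp add: to_Spec_def)
    fix t' assume t': "t' \<in> carrier (sec Y W)"
    show "to_Spec W (t \<otimes>\<^bsub>sec Y W\<^esub> t') = to_Spec W t \<otimes>\<^bsub>sec (Spec P) ?V\<^esub> to_Spec W t'"
      unfolding to_Spec_def Spec_mult
    proof (rule restrict_ext)
      fix q assume q': "q \<in> basics_in P ?V"
      have q: "q \<in> carrier P" "D q \<subseteq> W" using conjunct1[OF bs[OF q' W]] conjunct2[OF bs[OF q' W]] .
      show "fractions q (res Y W (D q) (t \<otimes>\<^bsub>sec Y W\<^esub> t')) =
        (\<lambda>q\<in>basics_in P ?V. fractions q (res Y W (D q) t)) q \<otimes>\<^bsub>L q\<^esub> (\<lambda>q\<in>basics_in P ?V. fractions q (res Y W (D q) t')) q"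
        unfolding restrict_apply'[OF q'] res_mult[OF Y W oD[OF q(1)] q(2) t t']
          fractions_mult[OF q(1) rc[OF q t] rc[OF q t']] ..
    qed
  next
    show "to_Spec W \<one>\<^bsub>sec Y W\<^esub> = \<one>\<^bsub>sec (Spec P) ?V\<^esub>"
      unfolding to_Spec_def Spec_one
    proof (rule restrict_ext)
      fix q assume q': "q \<in> basics_in P ?V"
      have q: "q \<in> carrier P" "D q \<subseteq> W" using conjunct1[OF bs[OF q' W]] conjunct2[OF bs[OF q' W]] .
      show "fractions q (res Y W (D q) \<one>\<^bsub>sec Y W\<^esub>) = \<one>\<^bsub>L q\<^esub>"
        using res_one[OF Y W oD[OF q(1)] q(2)] fractions_one[OF q(1)] by simp
    qed
  qed
next
  fix W W' t assume o: "opn Y W \<and> opn Y W' \<and> W' \<subseteq> W" and t: "t \<in> carrier (sec Y W)"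
  then have W: "opn Y W" "opn Y W'" "W' \<subseteq> W" by auto
  have sub: "basics_in P (pre (Spec P) pt W') \<subseteq> basics_in P (pre (Spec P) pt W)"
    using W(3) by auto
  show "to_Spec W' (res Y W W' t) = res (Spec P) (pre (Spec P) pt W) (pre (Spec P) pt W') (to_Spec W t)"
  proof (rule extensionalityI)
    fix q assume q: "q \<in> basics_in P (pre (Spec P) pt W')"
    then have "q \<in> carrier P" "D q \<subseteq> W'" using basic_subset_iff[OF W(2), of q] by auto
    then show "to_Spec W' (res Y W W' t) q = res (Spec P) (pre (Spec P) pt W) (pre (Spec P) pt W') (to_Spec W t) q"
      using q subsetD[OF sub q] res_res[OF Y W(1,2) oD _ W(3) t] by (simp add: to_Spec_def Spec_res)
  qed (unfold to_Spec_def Spec_res, (rule restrict_extensional)+)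
qed

text \<open>The sets \<open>D q\<close> inside \<open>W\<close> cover it, which gives injectivity.
  For surjectivity each value \<open>s q\<close> is the fraction of a unique section over
  \<open>D q\<close>; uniqueness makes these sections compatible and they glue.\<close>

lemma (in affine_mspace) to_Spec_bij:
  assumes W: "opn Y W"
  shows "bij_betw (to_Spec W) (carrier (sec Y W)) (carrier (sec (Spec P) (pre (Spec P) pt W)))"
proof -
  let ?V = "pre (Spec P) pt W"
  define I where "I = {q \<in> carrier P. D q \<subseteq> W}"
  have I: "basics_in P ?V = I"
    using basic_subset_iff[OF W] by (auto simp: I_def)
  have UI: "(\<Union>q\<in>I. D q) = W"
  proof
    show "W \<subseteq> (\<Union>q\<in>I. D q)"
    proof
      fix x assume "x \<in> W"
      then show "x \<in> (\<Union>q\<in>I. D q)"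
        using affine_basis[OF aff W] unfolding I_def by blast
    qed
  qed (auto simp: I_def)
  have ts: "to_Spec W t q = fractions q (res Y W (D q) t)" if "q \<in> I" for t q
    using that I by (simp add: to_Spec_def)
  note rc = res_closed[OF Y W oD]
  show ?thesis
  proof (rule bij_betw_imageI)
    show "inj_on (to_Spec W) (carrier (sec Y W))"
    proof (rule inj_onI, rule sheaf_sep[OF Y W])
      fix t t' x assume t: "t \<in> carrier (sec Y W)" "t' \<in> carrier (sec Y W)" and eq: "to_Spec W t = to_Spec W t'"
        and x: "x \<in> W"
      then obtain q where q: "q \<in> I" "x \<in> D q" using UI by blast
      then have q': "q \<in> carrier P" "D q \<subseteq> W" by (auto simp: I_def)
      have "fractions q (res Y W (D q) t) = fractions q (res Y W (D q) t')"
        using fun_cong[OF eq, of q] by (simp add: ts[OF q(1)])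
      then have "res Y W (D q) t = res Y W (D q) t'"
        by (rule fractions_inj[OF q'(1) rc[OF q' t(1)] rc[OF q' t(2)]])
      then show "\<exists>Z. opn Y Z \<and> x \<in> Z \<and> Z \<subseteq> W \<and> res Y W Z t = res Y W Z t'"
        using q q' oD by blast
    qed
    show "to_Spec W ` carrier (sec Y W) = carrier (sec (Spec P) ?V)"
    proof
      show "to_Spec W ` carrier (sec Y W) \<subseteq> carrier (sec (Spec P) ?V)"
        using cohom_closed[OF to_Spec_cohom W] by auto
      show "carrier (sec (Spec P) ?V) \<subseteq> to_Spec W ` carrier (sec Y W)"
      proof
        fix s assume s: "s \<in> carrier (sec (Spec P) ?V)"
        have Iq: "q \<in> carrier P" "D q \<subseteq> W" "basic_open P q \<subseteq> ?V" if "q \<in> I" for q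
          using that I by (auto simp: I_def)
        have "\<exists>t. t \<in> carrier (sec Y (D q)) \<and> fractions q t = s q" if q: "q \<in> I" for q
          by (rule fractions_surj[OF Iq(1)[OF q] Spec_secD(1)[OF s Iq(1,3)[OF q]]]) blast
        then obtain \<tau> where \<tau>: "\<And>q. q \<in> I \<Longrightarrow> \<tau> q \<in> carrier (sec Y (D q))" "\<And>q. q \<in> I \<Longrightarrow> fractions q (\<tau> q) = s q"
          by metis
        have res_\<tau>: "res Y (D q) (D r) (\<tau> q) = \<tau> r"
          if q: "q \<in> I" and r: "r \<in> I" and sub: "basic_open P r \<subseteq> basic_open P q" for q r
        proof (rule fractions_inj[OF Iq(1)[OF r]])
          have Dr: "D r \<subseteq> D q" by (rule D_subset[OF Iq(1)[OF q] Iq(1)[OF r] sub])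
          show "res Y (D q) (D r) (\<tau> q) \<in> carrier (sec Y (D r))"
            by (rule res_closed[OF Y oD[OF Iq(1)[OF q]] oD[OF Iq(1)[OF r]] Dr \<tau>(1)[OF q]])
          show "fractions r (res Y (D q) (D r) (\<tau> q)) = fractions r (\<tau> r)"
            using fractions_res[OF Iq(1)[OF q] Iq(1)[OF r] sub \<tau>(1)[OF q]] \<tau>(2)[OF q] \<tau>(2)[OF r]
              Spec_secD(2)[OF s Iq(1,3)[OF q] Iq(1)[OF r] sub] by simp
        qed (rule \<tau>(1)[OF r])
        obtain t where t: "t \<in> carrier (sec Y (\<Union>q\<in>I. D q))" "\<And>q. q \<in> I \<Longrightarrow> res Y (\<Union>q\<in>I. D q) (D q) t = \<tau> q"
        proof (rule sheaf_glue[OF Y, of I D \<tau>])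
          fix q r x assume q: "q \<in> I" and r: "r \<in> I" and x: "x \<in> D q" "x \<in> D r"
          \<comment> \<open>Compatibility is known along inclusions of basic open sets only; the
            product \<open>q \<otimes> r\<close>, whose unit locus is the intersection, mediates
            between \<open>q\<close> and \<open>r\<close>.\<close>
          let ?m = "q \<otimes>\<^bsub>P\<^esub> r"
          have m: "?m \<in> carrier P" "D ?m = D q \<inter> D r" "basic_open P ?m = basic_open P q \<inter> basic_open P r"
            using Iq(1)[OF q] Iq(1)[OF r] by (simp_all add: unit_locus_mult[OF Y] basic_open_Int)
          then have mI: "?m \<in> I" using Iq(2)[OF q] by (auto simp: I_def)
          have "res Y (D q) (D ?m) (\<tau> q) = res Y (D r) (D ?m) (\<tau> r)"
            using res_\<tau>[OF q mI] res_\<tau>[OF r mI] m(3) by simp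
          then show "\<exists>Z. opn Y Z \<and> x \<in> Z \<and> Z \<subseteq> D q \<and> Z \<subseteq> D r \<and> res Y (D q) Z (\<tau> q) = res Y (D r) Z (\<tau> r)"
            using m x oD[OF m(1)] by (intro exI[of _ "D ?m"]) simp
        qed (use \<tau> Iq oD in auto)
        note t = t[unfolded UI]
        have "to_Spec W t = s"
        proof (rule extensionalityI)
          show "s \<in> extensional (basics_in P ?V)" using s by (simp add: Spec_sec_iff)
          fix q assume "q \<in> basics_in P ?V"
          then have "q \<in> I" using I by simp
          then show "to_Spec W t q = s q"
            using ts t(2) \<tau>(2) by simp
        qed (simp add: to_Spec_def)
        then show "s \<in> to_Spec W ` carrier (sec Y W)"
          using t(1) by blast
      qed
    qed
  qed
qed

text \<open>The map \<open>to_Spec\<close> goes from sections of \<open>Y\<close> to sections of the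
  spectrum and so belongs to a morphism from the spectrum to \<open>Y\<close>; the isomorphism asked
  for is its inverse.\<close>

lemma affine_iso_Spec:
  assumes "affine Y"
  obtains \<phi> where "is_iso \<phi>" "src \<phi> = Y" "tgt \<phi> = Spec (glob Y)"
proof -
  interpret affine_mspace Y by unfold_locales (rule assms)
  let ?g = "mk_mor (Spec P) pt Y to_Spec"
  have m: "ms_morphism ?g"
    by (rule mk_mor_morphism[OF monoidal_space_Spec Y to_Spec_cohom])
  have "is_iso ?g"
  proof (rule is_isoI[OF m])
    show "homeomorphic_map (pts (src ?g)) (pts (tgt ?g)) (base_map ?g)"
      unfolding homeomorphic_map_maps mk_mor_sel by (rule exI[of _ fc]) (rule homeo)
    fix V assume "opn (tgt ?g) V"
    then have V: "opn Y V" by simp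
    have "bij_betw (sec_map ?g V) (carrier (sec Y V)) (carrier (sec (Spec P) (pre (Spec P) pt V)))"
      by (rule iffD2[OF bij_betw_cong[OF sec_map_mk_mor[OF monoidal_space_Spec Y to_Spec_cohom V]] to_Spec_bij[OF V]])
    then show "bij_betw (sec_map ?g V) (carrier (sec (tgt ?g) V)) (carrier (sec (src ?g) (preimage ?g V)))"
      by simp
  qed
  then show ?thesis
    using is_iso_inverse that by (metis mk_mor_sel(1,2))
qed

section \<open>Affine subsheaves\<close>

text \<open>The whole monoid is a face, and the point belonging to it lies in every unit locus. In
  particular no unit locus is empty.\<close>

lemma affine_generic_point:
  assumes "affine Y"
  obtains x where "x \<in> topspace (pts Y)" "\<And>p. p \<in> carrier (glob Y) \<Longrightarrow> x \<in> unit_locus Y p"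
proof -
  interpret comm_monoid "glob Y" by (rule sec_comm_monoid[OF affine_space[OF assms] openin_topspace])
  have "face (glob Y) (carrier (glob Y))"
    by (rule faceI) auto
  then obtain x where "x \<in> topspace (pts Y)" "{p \<in> carrier (glob Y). x \<in> unit_locus Y p} = carrier (glob Y)"
    using affine_face[OF assms] by auto
  then show thesis
    by (intro that) auto
qed

text \<open>
  The power hypothesis suffices because \<open>p\<close> and its powers have the same unit locus. The rigidity
  hypothesis turns numerators found in the larger sheaf into sections of the subsheaf.
\<close>

lemma affine_transfer:
  assumes aff: "affine Y" and Z: "monoidal_space Z" and \<phi>: "cohom Y f Z \<phi>"
    and homeo: "homeomorphic_map (pts Y) (pts Z) f"
    and inj: "\<And>V. opn Z V \<Longrightarrow> inj_on (\<phi> V) (carrier (sec Z V))"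
    and power: "\<And>m. m \<in> carrier (glob Y) \<Longrightarrow>
      \<exists>n>0. \<exists>z\<in>carrier (glob Z). \<phi> (topspace (pts Z)) z = m [^]\<^bsub>glob Y\<^esub> (n::nat)"
    and rigid: "\<And>m W. m \<in> carrier (glob Y) \<Longrightarrow> opn Z W \<Longrightarrow> W \<noteq> {} \<Longrightarrow>
      res Y (topspace (pts Y)) (pre Y f W) m \<in> \<phi> W ` carrier (sec Z W) \<Longrightarrow>
      m \<in> \<phi> (topspace (pts Z)) ` carrier (glob Z)"
    and inverse: "\<And>W z m. opn Z W \<Longrightarrow> z \<in> carrier (sec Z W) \<Longrightarrow> m \<in> carrier (sec Y (pre Y f W)) \<Longrightarrow>
      \<phi> W z \<otimes>\<^bsub>sec Y (pre Y f W)\<^esub> m = \<one>\<^bsub>sec Y (pre Y f W)\<^esub> \<Longrightarrow> m \<in> \<phi> W ` carrier (sec Z W)"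
  shows "affine Z"
proof -
  let ?TY = "topspace (pts Y)" and ?TZ = "topspace (pts Z)"
  note Y = affine_space[OF aff]
  note cont = cohom_cont[OF \<phi>]
  note PT = pre_topspace[OF cont]
  define j where "j = \<phi> ?TZ"
  have j: "monoid_hom (glob Z) (glob Y) j"
    using cohom_hom[OF \<phi> openin_topspace] unfolding PT j_def .
  note jc = monoid_hom_closed[OF j] and jm = monoid_hom_mult[OF j]
  have jinj: "a = b" if "j a = j b" "a \<in> carrier (glob Z)" "b \<in> carrier (glob Z)" for a b
    using inj_onD[OF inj[OF openin_topspace]] that unfolding j_def by blast
  obtain g where hm: "homeomorphic_maps (pts Y) (pts Z) f g"
    by (rule exE[OF homeo[unfolded homeomorphic_map_maps]])
  note hm' = hm[unfolded homeomorphic_maps_sym[of "pts Y"]]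
  have contg: "continuous_map (pts Z) (pts Y) g"
    using hm by (simp add: homeomorphic_maps_def)
  have fg: "f (g y) = y" "g y \<in> ?TY" if "y \<in> ?TZ" for y
    using hm that contg by (auto simp: homeomorphic_maps_def continuous_map_def)
  have gf: "g (f x) = x" "f x \<in> ?TZ" if "x \<in> ?TY" for x
    using hm that cont by (auto simp: homeomorphic_maps_def continuous_map_def)
  interpret QY: comm_monoid "glob Y" by (rule sec_comm_monoid[OF Y openin_topspace])
  interpret QZ: comm_monoid "glob Z" by (rule sec_comm_monoid[OF Z openin_topspace])
  have jpow: "j (a [^]\<^bsub>glob Z\<^esub> (k::nat)) = j a [^]\<^bsub>glob Y\<^esub> k" if "a \<in> carrier (glob Z)" for a k
    by (rule monoid_hom_pow[OF j QZ.monoid_axioms QY.monoid_axioms that])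
  let ?DY = "unit_locus Y" and ?DZ = "unit_locus Z"
  have jres: "\<phi> W (res Z ?TZ W z) = res Y ?TY (pre Y f W) (j z)" if "opn Z W" "z \<in> carrier (glob Z)" for W z
    using cohom_res[OF \<phi> openin_topspace that(1) opn_subset[OF that(1)] that(2)] unfolding PT j_def .
  \<comment> \<open>Units are preserved by \<open>\<phi>\<close>. They are also reflected: an
    inverse of the image comes from \<open>Z\<close> by the hypothesis \<open>inverse\<close>, and
    injectivity of \<open>\<phi>\<close> carries the relation back.\<close>
  have loc: "f x \<in> ?DZ z \<longleftrightarrow> x \<in> ?DY (j z)" if x: "x \<in> ?TY" and z: "z \<in> carrier (glob Z)" for x z
  proof
    assume "f x \<in> ?DZ z"
    then obtain W where W: "opn Z W" "f x \<in> W" "res Z ?TZ W z \<in> Units (sec Z W)"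
      unfolding unit_locus_def unit_at_def by auto
    have "res Y ?TY (pre Y f W) (j z) \<in> Units (sec Y (pre Y f W))"
      using monoid_hom_Units[OF cohom_hom[OF \<phi> W(1)] W(3)] jres[OF W(1) z] by simp
    then show "x \<in> ?DY (j z)"
      using x W cohom_pre[OF \<phi> W(1)] unfolding unit_locus_def unit_at_def
      by (auto intro!: exI[of _ "pre Y f W"])
  next
    assume "x \<in> ?DY (j z)"
    then obtain U where U: "opn Y U" "x \<in> U" "res Y ?TY U (j z) \<in> Units (sec Y U)"
      unfolding unit_locus_def unit_at_def by auto
    define W where "W = pre Z g U"
    have W: "opn Z W" unfolding W_def by (rule continuous_pre[OF contg U(1)])
    have PW: "pre Y f W = U" unfolding W_def by (rule pre_homeomorphic[OF hm opn_subset[OF U(1)]])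
    interpret W: comm_monoid "sec Z W" by (rule sec_comm_monoid[OF Z W])
    have zc: "res Z ?TZ W z \<in> carrier (sec Z W)"
      by (rule res_closed[OF Z openin_topspace W opn_subset[OF W] z])
    obtain m where m: "m \<in> carrier (sec Y (pre Y f W))"
      "\<phi> W (res Z ?TZ W z) \<otimes>\<^bsub>sec Y (pre Y f W)\<^esub> m = \<one>\<^bsub>sec Y (pre Y f W)\<^esub>"
      using U(3) unfolding jres[OF W z] PW Units_def by auto
    then obtain z' where z': "z' \<in> carrier (sec Z W)" "m = \<phi> W z'"
      using inverse[OF W zc m] by auto
    have "\<phi> W (res Z ?TZ W z \<otimes>\<^bsub>sec Z W\<^esub> z') = \<phi> W \<one>\<^bsub>sec Z W\<^esub>"
      using m(2) z' by (simp add: cohom_mult[OF \<phi> W zc z'(1)] cohom_one[OF \<phi> W])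
    then have "res Z ?TZ W z \<otimes>\<^bsub>sec Z W\<^esub> z' = \<one>\<^bsub>sec Z W\<^esub>"
      using inj_onD[OF inj[OF W]] zc z' by simp
    then have "res Z ?TZ W z \<in> Units (sec Z W)"
      by (rule comm_monoid_UnitsI[OF W.comm_monoid_axioms zc z'(1)])
    then show "f x \<in> ?DZ z"
      using W U(2) x gf[OF x] opn_subset[OF W] unfolding unit_locus_def unit_at_def W_def by auto
  qed
  have preD: "pre Y f (?DZ z) = ?DY (j z)" if "z \<in> carrier (glob Z)" for z
    using loc[OF _ that] subsetD[OF unit_locus_subset[of Y "j z"]] by auto
  have DYpow: "?DY (p [^]\<^bsub>glob Y\<^esub> n) = ?DY p" if "p \<in> carrier (glob Y)" "n > 0" for p and n :: nat
    by (rule unit_locus_pow(2)[OF Y that])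
  show ?thesis
  proof (rule affineI[OF Z])
    fix W y assume W: "opn Z W" "y \<in> W"
    then have yT: "y \<in> ?TZ" using opn_subset by blast
    have "g y \<in> pre Y f W" using fg[OF yT] W by simp
    then obtain p where p: "p \<in> carrier (glob Y)" "g y \<in> ?DY p" "?DY p \<subseteq> pre Y f W"
      using affine_basis[OF aff cohom_pre[OF \<phi> W(1)]] by auto
    obtain n z where z: "n > 0" "z \<in> carrier (glob Z)" "j z = p [^]\<^bsub>glob Y\<^esub> (n::nat)"
      using power[OF p(1)] unfolding j_def by auto
    have D: "?DY (j z) = ?DY p" using DYpow[OF p(1) z(1)] z(3) by simp
    have "y \<in> ?DZ z"
      using loc[OF fg(2)[OF yT] z(2)] fg(1)[OF yT] p(2) D by simp
    moreover have "?DZ z \<subseteq> W"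
    proof
      fix v assume v: "v \<in> ?DZ z"
      then have vT: "v \<in> ?TZ" by (rule subsetD[OF unit_locus_subset])
      have "g v \<in> ?DY p" using loc[OF fg(2)[OF vT] z(2)] fg(1)[OF vT] v D by simp
      then have "f (g v) \<in> W" using p(3) by blast
      then show "v \<in> W" using fg(1)[OF vT] by simp
    qed
    ultimately show "\<exists>p\<in>carrier (glob Z). y \<in> ?DZ p \<and> ?DZ p \<subseteq> W"
      using z(2) by blast
  next
    fix F assume F: "face (glob Z) F"
    \<comment> \<open>Points are available in \<open>Y\<close>, so a face of \<open>glob Y\<close>
      inducing \<open>F\<close> is needed: the elements with a positive power in the image of
      \<open>F\<close>. The restriction \<open>n > 0\<close> matters, since the zeroth power would
      admit every element.\<close>
    define E where "E = {p \<in> carrier (glob Y). \<exists>n>0. \<exists>z\<in>F. p [^]\<^bsub>glob Y\<^esub> (n::nat) = j z}"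
    have Fc: "z \<in> carrier (glob Z)" if "z \<in> F" for z
      using QZ.face_subset[OF F] that by blast
    have jE: "j z \<in> E \<longleftrightarrow> z \<in> F" if z: "z \<in> carrier (glob Z)" for z
    proof
      assume "j z \<in> E"
      then obtain n w where w: "n > 0" "w \<in> F" "j (z [^]\<^bsub>glob Z\<^esub> (n::nat)) = j w"
        using jpow[OF z] unfolding E_def by auto
      then have "z [^]\<^bsub>glob Z\<^esub> n = w"
        using jinj[OF w(3)] z Fc by simp
      then show "z \<in> F" using QZ.face_pow_iff[OF F z w(1)] w(2) by simp
    next
      assume "z \<in> F"
      then show "j z \<in> E" unfolding E_def using jc[OF z] by (auto intro!: exI[of _ "1::nat"] bexI[of _ z])
    qed
    have E: "face (glob Y) E"
    proof (rule QY.faceI)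
      show "\<one>\<^bsub>glob Y\<^esub> \<in> E"
        using jE[OF QZ.one_closed] QZ.face_one[OF F] monoid_hom_one[OF j] by simp
      fix p q assume p: "p \<in> carrier (glob Y)" and q: "q \<in> carrier (glob Y)"
      show "p \<otimes>\<^bsub>glob Y\<^esub> q \<in> E \<longleftrightarrow> p \<in> E \<and> q \<in> E"
      proof
        assume "p \<in> E \<and> q \<in> E"
        then obtain m n u v where u: "m > 0" "u \<in> F" "p [^]\<^bsub>glob Y\<^esub> (m::nat) = j u"
          and v: "n > 0" "v \<in> F" "q [^]\<^bsub>glob Y\<^esub> (n::nat) = j v"
          unfolding E_def by auto
        have "(p \<otimes>\<^bsub>glob Y\<^esub> q) [^]\<^bsub>glob Y\<^esub> (m * n) = (p [^]\<^bsub>glob Y\<^esub> m) [^]\<^bsub>glob Y\<^esub> n \<otimes>\<^bsub>glob Y\<^esub> (q [^]\<^bsub>glob Y\<^esub> n) [^]\<^bsub>glob Y\<^esub> m"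
          using p q by (simp add: QY.nat_pow_distrib QY.nat_pow_pow mult.commute)
        also have "\<dots> = j (u [^]\<^bsub>glob Z\<^esub> n \<otimes>\<^bsub>glob Z\<^esub> v [^]\<^bsub>glob Z\<^esub> m)"
          using u v Fc by (simp add: jm jpow)
        finally show "p \<otimes>\<^bsub>glob Y\<^esub> q \<in> E"
          unfolding E_def using p q u v QZ.face_mult[OF F QZ.face_pow[OF F u(2)] QZ.face_pow[OF F v(2)]]
          by (auto intro!: exI[of _ "m * n"])
      next
        assume "p \<otimes>\<^bsub>glob Y\<^esub> q \<in> E"
        then obtain n w where w: "n > 0" "w \<in> F" "(p \<otimes>\<^bsub>glob Y\<^esub> q) [^]\<^bsub>glob Y\<^esub> (n::nat) = j w"
          unfolding E_def by auto
        obtain a u where u: "a > 0" "u \<in> carrier (glob Z)" "j u = p [^]\<^bsub>glob Y\<^esub> (a::nat)"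
          using power[OF p] unfolding j_def by auto
        obtain b v where v: "b > 0" "v \<in> carrier (glob Z)" "j v = q [^]\<^bsub>glob Y\<^esub> (b::nat)"
          using power[OF q] unfolding j_def by auto
        \<comment> \<open>Only \<open>p [^] a\<close> and \<open>q [^] b\<close> are known to come
          from \<open>Z\<close>. Raising the relation for \<open>w\<close> to the power
          \<open>a * b\<close> turns the two factors into powers of these, with exponents
          \<open>b * n\<close> and \<open>a * n\<close>.\<close>
        have 1: "j (w [^]\<^bsub>glob Z\<^esub> (a * b)) = j (u [^]\<^bsub>glob Z\<^esub> (b * n) \<otimes>\<^bsub>glob Z\<^esub> v [^]\<^bsub>glob Z\<^esub> (a * n))"
          using u v w(3)[symmetric] Fc[OF w(2)] p q
          by (simp add: jm jpow QY.nat_pow_distrib QY.nat_pow_pow) (simp add: mult_ac)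
        then have "w [^]\<^bsub>glob Z\<^esub> (a * b) = u [^]\<^bsub>glob Z\<^esub> (b * n) \<otimes>\<^bsub>glob Z\<^esub> v [^]\<^bsub>glob Z\<^esub> (a * n)"
          using u v Fc[OF w(2)] by (intro jinj[OF 1]) auto
        then have "u [^]\<^bsub>glob Z\<^esub> (b * n) \<otimes>\<^bsub>glob Z\<^esub> v [^]\<^bsub>glob Z\<^esub> (a * n) \<in> F"
          using QZ.face_pow[OF F w(2), of "a * b"] by simp
        then have "u [^]\<^bsub>glob Z\<^esub> (b * n) \<in> F" "v [^]\<^bsub>glob Z\<^esub> (a * n) \<in> F"
          using QZ.face_mult_iff[OF F] u v by simp_all
        then have "u \<in> F" "v \<in> F"
          using QZ.face_pow_iff[OF F] u v w(1) by simp_all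
        then show "p \<in> E \<and> q \<in> E"
          unfolding E_def using p q u(1) v(1) u(3)[symmetric] v(3)[symmetric] by blast
      qed
    qed (auto simp: E_def)
    then obtain x where x: "x \<in> ?TY" "{p \<in> carrier (glob Y). x \<in> ?DY p} = E"
      using affine_face[OF aff] by auto
    have "{z \<in> carrier (glob Z). f x \<in> ?DZ z} = F"
    proof (rule Set.set_eqI)
      fix z
      show "z \<in> {z \<in> carrier (glob Z). f x \<in> ?DZ z} \<longleftrightarrow> z \<in> F"
      proof (cases "z \<in> carrier (glob Z)")
        case True
        then show ?thesis
          using loc[OF x(1) True] jE[OF True] jc[OF True] x(2) by auto
      qed (use Fc in auto)
    qed
    then show "\<exists>y\<in>?TZ. {z \<in> carrier (glob Z). y \<in> ?DZ z} = F"
      using gf(2)[OF x(1)] by blast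
  next
    fix x y assume xy: "x \<in> ?TZ" "y \<in> ?TZ"
      and eq: "\<forall>p\<in>carrier (glob Z). x \<in> ?DZ p \<longleftrightarrow> y \<in> ?DZ p"
    have "g x = g y"
    proof (rule affine_inj[OF aff fg(2)[OF xy(1)] fg(2)[OF xy(2)]])
      fix p assume p: "p \<in> carrier (glob Y)"
      obtain n z where z: "n > 0" "z \<in> carrier (glob Z)" "j z = p [^]\<^bsub>glob Y\<^esub> (n::nat)"
        using power[OF p] unfolding j_def by auto
      show "g x \<in> ?DY p \<longleftrightarrow> g y \<in> ?DY p"
        using loc[OF fg(2)[OF xy(1)] z(2)] loc[OF fg(2)[OF xy(2)] z(2)] bspec[OF eq z(2)]
          fg(1)[OF xy(1)] fg(1)[OF xy(2)] DYpow[OF p z(1)] z(3) by simp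
    qed
    then show "x = y" using fg(1)[OF xy(1)] fg(1)[OF xy(2)] by metis
  next
    fix p s t assume p: "p \<in> carrier (glob Z)" and s: "s \<in> carrier (glob Z)" and t: "t \<in> carrier (glob Z)"
      and eq: "res Z ?TZ (?DZ p) s = res Z ?TZ (?DZ p) t"
    note oD = open_unit_locus[OF Z p]
    have "res Y ?TY (?DY (j p)) (j s) = res Y ?TY (?DY (j p)) (j t)"
      using arg_cong[OF eq, of "\<phi> (?DZ p)"] unfolding jres[OF oD s] jres[OF oD t] preD[OF p] .
    then obtain k where "j s \<otimes>\<^bsub>glob Y\<^esub> j p [^]\<^bsub>glob Y\<^esub> (k::nat) = j t \<otimes>\<^bsub>glob Y\<^esub> j p [^]\<^bsub>glob Y\<^esub> k"
      using affine_eq[OF aff jc[OF p] jc[OF s] jc[OF t]] by auto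
    then have "j (s \<otimes>\<^bsub>glob Z\<^esub> p [^]\<^bsub>glob Z\<^esub> k) = j (t \<otimes>\<^bsub>glob Z\<^esub> p [^]\<^bsub>glob Z\<^esub> k)"
      using s t p by (simp add: jm jpow)
    then have "s \<otimes>\<^bsub>glob Z\<^esub> p [^]\<^bsub>glob Z\<^esub> k = t \<otimes>\<^bsub>glob Z\<^esub> p [^]\<^bsub>glob Z\<^esub> k"
      by (rule jinj) (use s t p in auto)
    then show "\<exists>k::nat. s \<otimes>\<^bsub>glob Z\<^esub> p [^]\<^bsub>glob Z\<^esub> k = t \<otimes>\<^bsub>glob Z\<^esub> p [^]\<^bsub>glob Z\<^esub> k" ..
  next
    fix p s assume p: "p \<in> carrier (glob Z)" and s: "s \<in> carrier (sec Z (?DZ p))"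
    note oD = open_unit_locus[OF Z p]
    interpret DZ: comm_monoid "sec Z (?DZ p)" by (rule sec_comm_monoid[OF Z oD])
    have \<phi>s: "\<phi> (?DZ p) s \<in> carrier (sec Y (?DY (j p)))"
      using cohom_closed[OF \<phi> oD s] unfolding preD[OF p] .
    obtain k t where t: "t \<in> carrier (glob Y)"
      and eq: "\<phi> (?DZ p) s \<otimes>\<^bsub>sec Y (?DY (j p))\<^esub> res Y ?TY (?DY (j p)) (j p [^]\<^bsub>glob Y\<^esub> (k::nat)) =
        res Y ?TY (?DY (j p)) t"
      using affine_ex[OF aff jc[OF p] \<phi>s] by auto
    let ?pk = "res Z ?TZ (?DZ p) (p [^]\<^bsub>glob Z\<^esub> k)"
    have pk: "?pk \<in> carrier (sec Z (?DZ p))"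
      using p by (intro res_closed[OF Z openin_topspace oD unit_locus_subset]) simp
    have eq': "\<phi> (?DZ p) (s \<otimes>\<^bsub>sec Z (?DZ p)\<^esub> ?pk) = res Y ?TY (pre Y f (?DZ p)) t"
      using eq p by (simp add: cohom_mult[OF \<phi> oD s pk] jres[OF oD] preD[OF p] jpow)
    \<comment> \<open>The hypothesis \<open>rigid\<close> concerns nonempty open sets; the point
      lying in all unit loci shows that \<open>?DZ p\<close> is one.\<close>
    obtain x where x: "x \<in> ?TY" "x \<in> ?DY (j p)"
      by (rule affine_generic_point[OF aff]) (use jc[OF p] in blast)
    then have ne: "?DZ p \<noteq> {}" using loc[OF x(1) p] by auto
    have "res Y ?TY (pre Y f (?DZ p)) t \<in> \<phi> (?DZ p) ` carrier (sec Z (?DZ p))"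
      unfolding eq'[symmetric] using s pk by blast
    then obtain t' where t': "t' \<in> carrier (glob Z)" "t = j t'"
      using rigid[OF t oD ne] unfolding j_def by auto
    have "s \<otimes>\<^bsub>sec Z (?DZ p)\<^esub> ?pk = res Z ?TZ (?DZ p) t'"
    proof (rule inj_onD[OF inj[OF oD]])
      show "\<phi> (?DZ p) (s \<otimes>\<^bsub>sec Z (?DZ p)\<^esub> ?pk) = \<phi> (?DZ p) (res Z ?TZ (?DZ p) t')"
        unfolding eq' jres[OF oD t'(1)] t'(2) ..
      show "res Z ?TZ (?DZ p) t' \<in> carrier (sec Z (?DZ p))"
        by (rule res_closed[OF Z openin_topspace oD unit_locus_subset t'(1)])
    qed (use s pk in auto)
    then show "\<exists>k::nat. \<exists>t\<in>carrier (glob Z). s \<otimes>\<^bsub>sec Z (?DZ p)\<^esub> res Z ?TZ (?DZ p) (p [^]\<^bsub>glob Z\<^esub> k) = res Z ?TZ (?DZ p) t"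
      using t'(1) by blast
  qed
qed

text \<open>An isomorphism is the extreme case of \<open>affine_transfer\<close>, where every
  section comes from the target: the first power suffices, and rigidity and the condition on
  inverses are immediate from surjectivity.\<close>

lemma affine_iso:
  assumes \<phi>: "is_iso \<phi>" and aff: "affine (src \<phi>)"
  shows "affine (tgt \<phi>)"
proof -
  note m = is_isoD(1)[OF \<phi>]
  let ?Y = "src \<phi>" and ?Z = "tgt \<phi>" and ?f = "base_map \<phi>"
  let ?TZ = "topspace (pts ?Z)"
  note Y = ms_morphismD(1)[OF m]
  have inj: "inj_on (sec_map \<phi> V) (carrier (sec ?Z V))"
    and im: "sec_map \<phi> V ` carrier (sec ?Z V) = carrier (sec ?Y (preimage \<phi> V))" if "opn ?Z V" for V
    using is_isoD(3)[OF \<phi> that] by (auto simp: bij_betw_def)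
  have imT: "sec_map \<phi> ?TZ ` carrier (glob ?Z) = carrier (glob ?Y)"
    using im[OF openin_topspace] unfolding pre_topspace[OF ms_morphismD(3)[OF m]] .
  interpret comm_monoid "glob ?Y" by (rule sec_comm_monoid[OF Y openin_topspace])
  show ?thesis
  proof (rule affine_transfer[OF aff ms_morphismD(2)[OF m] sec_map_cohom[OF m] is_isoD(2)[OF \<phi>] inj])
    fix p assume p: "p \<in> carrier (glob ?Y)"
    then obtain z where "z \<in> carrier (glob ?Z)" "p = sec_map \<phi> ?TZ z"
      using imT by auto
    then show "\<exists>n>0. \<exists>z\<in>carrier (glob ?Z). sec_map \<phi> ?TZ z = p [^]\<^bsub>glob ?Y\<^esub> (n::nat)"
      using p by (intro exI[of _ 1]) auto
  qed (use im imT in auto)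
qed


section \<open>Open subspaces and fans\<close>

lemma opn_open_subspace:
  assumes "opn X U"
  shows "opn (open_subspace X U) V \<longleftrightarrow> opn X V \<and> V \<subseteq> U"
  using assms by (auto simp: open_subspace_def openin_open_subtopology)

lemma open_subspace_sel:
  "shf (open_subspace X U) = shf X"
  "opn X U \<Longrightarrow> topspace (pts (open_subspace X U)) = U"
  using opn_subset[of X U] by (auto simp: open_subspace_def)

lemma monoidal_space_open_subspace:
  assumes X: "monoidal_space X" and U: "opn X U"
  shows "monoidal_space (open_subspace X U)"
proof -
  let ?S = "open_subspace X U"
  note s = opn_open_subspace[OF U] open_subspace_sel
  have "monoid_presheaf (pts ?S) (shf ?S)"
    using X unfolding monoidal_space_def monoid_sheaf_def monoid_presheaf_def s by simp
  moreover have "\<exists>!t. t \<in> carrier (sec ?S (\<Union>\<U>)) \<and> (\<forall>V\<in>\<U>. res ?S (\<Union>\<U>) V t = \<sigma> V)"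
    if 1: "\<forall>V\<in>\<U>. opn ?S V \<and> \<sigma> V \<in> carrier (sec ?S V)"
      and 2: "\<forall>V\<in>\<U>. \<forall>W\<in>\<U>. res ?S V (V \<inter> W) (\<sigma> V) = res ?S W (V \<inter> W) (\<sigma> W)" for \<U> \<sigma>
  proof -
    have "\<exists>!t. t \<in> carrier (sec X (\<Union>V\<in>\<U>. V)) \<and> (\<forall>V\<in>\<U>. res X (\<Union>V\<in>\<U>. V) V t = \<sigma> V)"
    proof (rule sheaf_glue_ex1[OF X])
      fix V W assume "V \<in> \<U>" "W \<in> \<U>"
      then show "res X V (V \<inter> W) (\<sigma> V) = res X W (V \<inter> W) (\<sigma> W)"
        by (rule bspec[OF bspec[OF 2[unfolded s]]])
    qed (use 1[unfolded s] in auto)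
    then show ?thesis
      unfolding s by simp
  qed
  ultimately show ?thesis
    by (rule monoidal_spaceI)
qed

lemma pre_open_subspace:
  assumes f: "continuous_map (pts X) (pts Y) f" and V: "opn Y V"
  shows "W \<subseteq> V \<Longrightarrow> pre (open_subspace X (pre X f V)) f W = pre X f W"
  using open_subspace_sel(2)[OF continuous_pre[OF f V]] by auto

lemma cohom_open_subspace:
  assumes \<phi>: "cohom X f Y \<phi>" and V: "opn Y V"
  shows "cohom (open_subspace X (pre X f V)) f (open_subspace Y V) \<phi>"
proof -
  note P = pre_open_subspace[OF cohom_cont[OF \<phi>] V]
  note oX = opn_open_subspace[OF cohom_pre[OF \<phi> V]] and oY = opn_open_subspace[OF V]
  have c: "continuous_map (pts (open_subspace X (pre X f V))) (pts (open_subspace Y V)) f"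
    unfolding open_subspace_def
    using cohom_cont[OF \<phi>] by (auto simp: continuous_map_in_subtopology continuous_map_from_subtopology)
  show ?thesis
    unfolding cohom_def open_subspace_sel(1)
  proof (intro conjI allI impI ballI c)
    fix W assume "opn (open_subspace Y V) W"
    then show "monoid_hom (sec Y W) (sec X (pre (open_subspace X (pre X f V)) f W)) (\<phi> W)"
      using cohom_hom[OF \<phi>, of W] P[of W] unfolding oY by simp
  next
    fix W W' t
    assume "opn (open_subspace Y V) W \<and> opn (open_subspace Y V) W' \<and> W' \<subseteq> W" "t \<in> carrier (sec Y W)"
    then show "\<phi> W' (res Y W W' t) = res X (pre (open_subspace X (pre X f V)) f W) (pre (open_subspace X (pre X f V)) f W') (\<phi> W t)"
      using cohom_res[OF \<phi>, of W W' t] P[of W] P[of W'] unfolding oY by simp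
  qed
qed

lemma homeomorphic_open_subspace:
  assumes f: "homeomorphic_map (pts X) (pts Y) f" and V: "opn Y V"
  shows "homeomorphic_map (pts (open_subspace X (pre X f V))) (pts (open_subspace Y V)) f"
  unfolding open_subspace_def mspace.select_convs
proof (rule homeomorphic_map_subtopologies[OF f])
  have "f ` topspace (pts X) = topspace (pts Y)"
    using f by (rule homeomorphic_imp_surjective_map)
  then show "f ` (topspace (pts X) \<inter> pre X f V) = topspace (pts Y) \<inter> V"
    using opn_subset[OF V] by auto
qed

text \<open>A chart is inverted and the property \<open>affine\<close> of the spectrum is carried
  along it. In the other direction the sections over \<open>U\<close> serve as the monoid
  \<open>P\<close>, which therefore has the type required by the definition of a fan.\<close>

lemma fan_iff_affine:
  fixes X :: "('x, 'm) mspace"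
  shows "fan X \<longleftrightarrow> monoidal_space X \<and>
    (\<forall>x\<in>topspace (pts X). \<exists>U. opn X U \<and> x \<in> U \<and> affine (open_subspace X U))"
proof
  assume X: "fan X"
  show "monoidal_space X \<and> (\<forall>x\<in>topspace (pts X). \<exists>U. opn X U \<and> x \<in> U \<and> affine (open_subspace X U))"
  proof (intro conjI ballI)
    show "monoidal_space X" using X by (simp add: fan_def)
    fix x assume "x \<in> topspace (pts X)"
    then obtain U P \<phi> where U: "opn X U" "x \<in> U" "comm_monoid (P :: 'm monoid)"
      and \<phi>: "is_iso \<phi>" "src \<phi> = open_subspace X U" "tgt \<phi> = Spec P"
      using X unfolding fan_def by metis
    obtain g where g: "is_iso g" "src g = tgt \<phi>" "tgt g = src \<phi>"
      by (rule is_iso_inverse[OF \<phi>(1)])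
    have "affine (open_subspace X U)"
      using affine_iso[OF g(1)] comm_monoid.affine_Spec[OF U(3)] g \<phi> by simp
    with U show "\<exists>U. opn X U \<and> x \<in> U \<and> affine (open_subspace X U)" by blast
  qed
next
  assume R: "monoidal_space X \<and> (\<forall>x\<in>topspace (pts X). \<exists>U. opn X U \<and> x \<in> U \<and> affine (open_subspace X U))"
  show "fan X"
    unfolding fan_def
  proof (intro conjI ballI)
    show X: "monoidal_space X" using R by simp
    fix x assume "x \<in> topspace (pts X)"
    then obtain U where U: "opn X U" "x \<in> U" "affine (open_subspace X U)" using R by blast
    obtain \<phi> where \<phi>: "is_iso \<phi>" "src \<phi> = open_subspace X U" "tgt \<phi> = Spec (glob (open_subspace X U))"
      by (rule affine_iso_Spec[OF U(3)])
    have "comm_monoid (glob (open_subspace X U))"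
      by (rule sec_comm_monoid[OF affine_space[OF U(3)] openin_topspace])
    with U \<phi> show "\<exists>U (P :: 'm monoid) \<phi>. opn X U \<and> x \<in> U \<and> comm_monoid P \<and> is_iso \<phi> \<and>
        src \<phi> = open_subspace X U \<and> tgt \<phi> = Spec P"
      by blast
  qed
qed

section \<open>Coequalizers of morphisms with the same map of points\<close>

text \<open>With equal maps of points, the images of a section over \<open>U\<close> under the two
  morphisms live over the same open set, so they can be compared and their equalizer taken.\<close>

locale parallel_pair =
  fixes a b :: "('z, 'j, 'x, 'm) morphism"
  assumes a: "ms_morphism a" and b: "ms_morphism b"
    and src_eq: "src b = src a" and tgt_eq: "tgt b = tgt a"
    and base_eq: "\<And>z. z \<in> topspace (pts (src a)) \<Longrightarrow> base_map b z = base_map a z"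

abbreviation (in parallel_pair) "Z \<equiv> src a"
abbreviation (in parallel_pair) "X \<equiv> tgt a"

definition (in parallel_pair) eq_sec :: "'x set \<Rightarrow> 'm set" where
  "eq_sec U = {m \<in> carrier (sec X U). sec_map a U m = sec_map b U m}"

text \<open>This determines \<open>q\<close> up to isomorphism without naming a model of the target,
  so it also applies to a coequalizer whose target has its own types of points and sections.\<close>

definition (in parallel_pair) is_quotient :: "('x, 'm, 'y, 'n) morphism \<Rightarrow> bool" where
  "is_quotient q \<longleftrightarrow> ms_morphism q \<and> src q = X \<and>
     homeomorphic_map (pts X) (pts (tgt q)) (base_map q) \<and>
     (\<forall>V. opn (tgt q) V \<longrightarrow>
        bij_betw (sec_map q V) (carrier (sec (tgt q) V)) (eq_sec (preimage q V)))"

lemma (in parallel_pair) XZ: "monoidal_space X" "monoidal_space Z"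
  using ms_morphismD[OF a] by auto

lemma (in parallel_pair) cohom_ab:
  "cohom Z (base_map a) X (sec_map a)" "cohom Z (base_map a) X (sec_map b)"
proof -
  show "cohom Z (base_map a) X (sec_map a)" by (rule sec_map_cohom[OF a])
  have c: "cohom Z (base_map b) X (sec_map b)"
    using sec_map_cohom[OF b] unfolding src_eq tgt_eq .
  have P: "pre Z (base_map b) U = pre Z (base_map a) U" for U
    using base_eq by auto
  show "cohom Z (base_map a) X (sec_map b)"
    unfolding cohom_def
  proof (intro conjI allI impI ballI cohom_cont[OF sec_map_cohom[OF a]], goal_cases)
    case (1 V)
    then show ?case using cohom_hom[OF c, of V] unfolding P by simp
  next
    case (2 V W t)
    then show ?case using cohom_res[OF c, of V W t] unfolding P by simp
  qed
qed

lemma (in parallel_pair) eq_sec_carrier: "m \<in> eq_sec U \<Longrightarrow> m \<in> carrier (sec X U)"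
  by (simp add: eq_sec_def)

lemma (in parallel_pair) eq_sec_mult:
  assumes "opn X U" "m \<in> eq_sec U" "n \<in> eq_sec U"
  shows "m \<otimes>\<^bsub>sec X U\<^esub> n \<in> eq_sec U"
proof -
  interpret comm_monoid "sec X U" by (rule sec_comm_monoid[OF XZ(1) assms(1)])
  show ?thesis
    using assms by (simp add: eq_sec_def cohom_mult[OF cohom_ab(1)] cohom_mult[OF cohom_ab(2)])
qed

lemma (in parallel_pair) eq_sec_one:
  assumes "opn X U"
  shows "\<one>\<^bsub>sec X U\<^esub> \<in> eq_sec U"
proof -
  interpret comm_monoid "sec X U" by (rule sec_comm_monoid[OF XZ(1) assms(1)])
  show ?thesis
    using assms by (simp add: eq_sec_def cohom_one[OF cohom_ab(1)] cohom_one[OF cohom_ab(2)])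
qed

lemma (in parallel_pair) eq_sec_res:
  assumes "opn X U" "opn X V" "V \<subseteq> U" "m \<in> eq_sec U"
  shows "res X U V m \<in> eq_sec V"
  using assms
  by (simp add: eq_sec_def res_closed[OF XZ(1)] cohom_res[OF cohom_ab(1)] cohom_res[OF cohom_ab(2)])

text \<open>Equality of the two images can be tested locally on the source of the pair. This is what
  makes the equalizing sections a sheaf.\<close>

lemma (in parallel_pair) eq_sec_local:
  assumes U: "opn X U" and m: "m \<in> carrier (sec X U)"
    and loc: "\<And>x. x \<in> U \<Longrightarrow> \<exists>W. opn X W \<and> x \<in> W \<and> W \<subseteq> U \<and> res X U W m \<in> eq_sec W"
  shows "m \<in> eq_sec U"
proof -
  have "sec_map a U m = sec_map b U m"
  proof (rule sheaf_sep[OF XZ(2) cohom_pre[OF cohom_ab(1) U]])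
    fix z assume "z \<in> pre Z (base_map a) U"
    then have z: "z \<in> topspace (pts Z)" "base_map a z \<in> U" by auto
    obtain W where W: "opn X W" "base_map a z \<in> W" "W \<subseteq> U" "res X U W m \<in> eq_sec W"
      using loc[OF z(2)] by auto
    then have "sec_map a W (res X U W m) = sec_map b W (res X U W m)"
      by (simp add: eq_sec_def)
    then have "res Z (pre Z (base_map a) U) (pre Z (base_map a) W) (sec_map a U m) =
      res Z (pre Z (base_map a) U) (pre Z (base_map a) W) (sec_map b U m)"
      unfolding cohom_res[OF cohom_ab(1) U W(1,3) m] cohom_res[OF cohom_ab(2) U W(1,3) m] .
    then show "\<exists>W. opn Z W \<and> z \<in> W \<and> W \<subseteq> pre Z (base_map a) U \<and>
        res Z (pre Z (base_map a) U) W (sec_map a U m) = res Z (pre Z (base_map a) U) W (sec_map b U m)"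
      using z W cohom_pre[OF cohom_ab(1) W(1)] by (intro exI[of _ "pre Z (base_map a) W"]) auto
  qed (use cohom_closed[OF cohom_ab(1) U m] cohom_closed[OF cohom_ab(2) U m] in auto)
  then show ?thesis
    using m by (simp add: eq_sec_def)
qed

text \<open>The two images of \<open>n\<close> are inverses of one and the same element, the common
  image of \<open>m\<close>, and inverses are unique.\<close>

lemma (in parallel_pair) eq_sec_inverse:
  assumes U: "opn X U" and m: "m \<in> eq_sec U" and n: "n \<in> carrier (sec X U)"
    and mn: "m \<otimes>\<^bsub>sec X U\<^esub> n = \<one>\<^bsub>sec X U\<^esub>"
  shows "n \<in> eq_sec U"
proof -
  let ?P = "sec Z (pre Z (base_map a) U)"
  interpret P: comm_monoid ?P by (rule sec_comm_monoid[OF XZ(2) cohom_pre[OF cohom_ab(1) U]])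
  note mc = eq_sec_carrier[OF m]
  have eq: "sec_map a U m = sec_map b U m" using m by (simp add: eq_sec_def)
  have 1: "sec_map b U m \<otimes>\<^bsub>?P\<^esub> sec_map a U n = \<one>\<^bsub>?P\<^esub>"
    using cohom_mult[OF cohom_ab(1) U mc n] cohom_one[OF cohom_ab(1) U] mn eq by simp
  have 2: "sec_map b U m \<otimes>\<^bsub>?P\<^esub> sec_map b U n = \<one>\<^bsub>?P\<^esub>"
    using cohom_mult[OF cohom_ab(2) U mc n] cohom_one[OF cohom_ab(2) U] mn by simp
  note c = cohom_closed[OF cohom_ab(2) U mc] cohom_closed[OF cohom_ab(1) U n] cohom_closed[OF cohom_ab(2) U n]
  have "sec_map a U n = sec_map b U n"
    by (rule P.inv_unique[OF _ 2 c(1,2,3)]) (use 1 P.m_comm[OF c(1,2)] in simp)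
  then show ?thesis using n by (simp add: eq_sec_def)
qed

definition (in parallel_pair) quot_space :: "('x, 'm) mspace" where
  "quot_space = \<lparr>pts = pts X, shf = \<lparr>sections = (\<lambda>U. (sec X U)\<lparr>carrier := eq_sec U\<rparr>), restr = res X\<rparr>\<rparr>"

lemma (in parallel_pair) quot_space_sel:
  "pts quot_space = pts X" "carrier (sec quot_space U) = eq_sec U"
  "s \<otimes>\<^bsub>sec quot_space U\<^esub> t = s \<otimes>\<^bsub>sec X U\<^esub> t" "\<one>\<^bsub>sec quot_space U\<^esub> = \<one>\<^bsub>sec X U\<^esub>"
  "res quot_space = res X"
  by (simp_all add: quot_space_def)

lemma (in parallel_pair) monoidal_space_quot_space: "monoidal_space quot_space"
proof (rule monoidal_spaceI)
  show "monoid_presheaf (pts quot_space) (shf quot_space)"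
    unfolding monoid_presheaf_def
  proof (intro conjI allI impI ballI)
    fix U assume "opn quot_space U"
    then have U: "opn X U" by (simp add: quot_space_sel)
    interpret comm_monoid "sec X U" by (rule sec_comm_monoid[OF XZ(1) U])
    show "comm_monoid (sec quot_space U)"
      by (rule comm_monoidI)
        (auto simp: quot_space_sel eq_sec_mult[OF U] eq_sec_one[OF U] eq_sec_carrier m_assoc intro: m_comm eq_sec_carrier)
  next
    fix U V assume "opn quot_space U \<and> opn quot_space V \<and> V \<subseteq> U"
    then have U: "opn X U" "opn X V" "V \<subseteq> U" by (simp_all add: quot_space_sel)
    show "monoid_hom (sec quot_space U) (sec quot_space V) (res quot_space U V)"
      by (rule monoid_homI)
        (simp_all add: quot_space_sel eq_sec_res[OF U] res_mult[OF XZ(1) U] res_one[OF XZ(1) U] eq_sec_carrier)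
  next
    fix U s assume "opn quot_space U" "s \<in> carrier (sec quot_space U)"
    then show "res quot_space U U s = s"
      using res_id[OF XZ(1)] by (simp add: quot_space_sel eq_sec_carrier)
  next
    fix U V W s assume "opn quot_space U \<and> opn quot_space V \<and> opn quot_space W \<and> W \<subseteq> V \<and> V \<subseteq> U"
      and "s \<in> carrier (sec quot_space U)"
    then show "res quot_space V W (res quot_space U V s) = res quot_space U W s"
      using res_res[OF XZ(1), of U V W s] by (simp add: quot_space_sel eq_sec_carrier)
  qed
next
  fix \<U> \<sigma>
  assume 1: "\<forall>V\<in>\<U>. opn quot_space V \<and> \<sigma> V \<in> carrier (sec quot_space V)"
    and 2: "\<forall>V\<in>\<U>. \<forall>W\<in>\<U>. res quot_space V (V \<inter> W) (\<sigma> V) = res quot_space W (V \<inter> W) (\<sigma> W)"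
  note 1 = 1[unfolded quot_space_sel] and 2 = 2[unfolded quot_space_sel]
  have ex: "\<exists>!t. t \<in> carrier (sec X (\<Union>V\<in>\<U>. V)) \<and> (\<forall>V\<in>\<U>. res X (\<Union>V\<in>\<U>. V) V t = \<sigma> V)"
  proof (rule sheaf_glue_ex1[OF XZ(1)])
    fix V W assume "V \<in> \<U>" "W \<in> \<U>"
    then show "res X V (V \<inter> W) (\<sigma> V) = res X W (V \<inter> W) (\<sigma> W)"
      by (rule bspec[OF bspec[OF 2]])
  qed (use 1 eq_sec_carrier in auto)
  have o: "opn X (\<Union>\<U>)" using 1 by auto
  have "t \<in> eq_sec (\<Union>\<U>)" if t: "t \<in> carrier (sec X (\<Union>\<U>))" "\<forall>V\<in>\<U>. res X (\<Union>\<U>) V t = \<sigma> V" for t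
  proof (rule eq_sec_local[OF o t(1)])
    fix x assume "x \<in> \<Union>\<U>"
    then obtain V where "V \<in> \<U>" "x \<in> V" by blast
    then show "\<exists>W. opn X W \<and> x \<in> W \<and> W \<subseteq> \<Union>\<U> \<and> res X (\<Union>\<U>) W t \<in> eq_sec W"
      using 1 t(2) by (intro exI[of _ V]) auto
  qed
  then have "t \<in> eq_sec (\<Union>\<U>) \<and> (\<forall>V\<in>\<U>. res X (\<Union>\<U>) V t = \<sigma> V) \<longleftrightarrow>
      t \<in> carrier (sec X (\<Union>\<U>)) \<and> (\<forall>V\<in>\<U>. res X (\<Union>\<U>) V t = \<sigma> V)" for t
    using eq_sec_carrier by blast
  then show "\<exists>!s. s \<in> carrier (sec quot_space (\<Union>\<U>)) \<and> (\<forall>V\<in>\<U>. res quot_space (\<Union>\<U>) V s = \<sigma> V)"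
    using ex unfolding quot_space_sel by simp
qed

lemma (in parallel_pair) ex_quotient: "\<exists>q :: ('x, 'm, 'x, 'm) morphism. is_quotient q"
proof -
  have \<phi>: "cohom X (\<lambda>x. x) quot_space (\<lambda>V m. m)"
    unfolding cohom_def quot_space_sel
  proof (intro conjI allI impI ballI)
    fix V assume V: "opn X V"
    show "monoid_hom (sec quot_space V) (sec X (pre X (\<lambda>x. x) V)) (\<lambda>m. m)"
      unfolding pre_ident[OF V] by (rule monoid_homI) (simp_all add: quot_space_sel eq_sec_carrier)
  qed (simp_all add: pre_ident)
  let ?q = "mk_mor X (\<lambda>x. x) quot_space (\<lambda>V m. m)"
  have "is_quotient ?q"
    unfolding is_quotient_def
  proof (intro conjI allI impI)
    show "ms_morphism ?q" by (rule mk_mor_morphism[OF XZ(1) monoidal_space_quot_space \<phi>])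
    fix V assume V: "opn (tgt ?q) V"
    then have V': "opn X V" by (simp add: quot_space_sel)
    have "sec_map ?q V m = m" if "m \<in> eq_sec V" for m
      using sec_map_mk_mor[OF XZ(1) monoidal_space_quot_space \<phi>, of V m] V that by (simp add: quot_space_sel)
    then have "bij_betw (sec_map ?q V) (eq_sec V) (eq_sec V)"
      by (auto simp: bij_betw_def inj_on_def)
    then show "bij_betw (sec_map ?q V) (carrier (sec (tgt ?q) V)) (eq_sec (preimage ?q V))"
      using pre_ident[OF V'] by (simp add: quot_space_sel)
  qed (simp_all add: quot_space_sel homeomorphic_map_id[unfolded id_def])
  then show ?thesis by blast
qed

section \<open>Locality and universal property of quotients\<close>

lemma (in parallel_pair) quotientD:
  assumes "is_quotient q"
  shows "ms_morphism q" "src q = X" "homeomorphic_map (pts X) (pts (tgt q)) (base_map q)"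
    "\<And>V. opn (tgt q) V \<Longrightarrow> inj_on (sec_map q V) (carrier (sec (tgt q) V))"
    "\<And>V. opn (tgt q) V \<Longrightarrow> sec_map q V ` carrier (sec (tgt q) V) = eq_sec (pre X (base_map q) V)"
  using assms unfolding is_quotient_def bij_betw_def by auto

lemma (in parallel_pair) quotient_surj:
  assumes q: "is_quotient q" and y: "y \<in> topspace (pts (tgt q))"
  obtains x where "x \<in> topspace (pts X)" "base_map q x = y"
  using homeomorphic_imp_surjective_map[OF quotientD(3)[OF q]] y by (metis imageE)

lemma (in parallel_pair) quotient_local:
  assumes q: "is_quotient q"
  shows "local_morphism q"
proof -
  note qD = quotientD[OF q]
  let ?Q = "tgt q" and ?f = "base_map q"
  note \<phi> = sec_map_cohom[OF qD(1), unfolded qD(2)]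
  note Q = ms_morphismD(2)[OF qD(1)]
  obtain g where hm: "homeomorphic_maps (pts X) (pts ?Q) ?f g"
    by (rule exE[OF qD(3)[unfolded homeomorphic_map_maps]])
  have contg: "continuous_map (pts ?Q) (pts X) g"
    using hm by (simp add: homeomorphic_maps_def)
  show ?thesis
    unfolding local_morphism_iff[OF qD(1)] qD(2)
  proof (intro ballI allI impI, elim conjE)
    fix x V t assume x: "x \<in> topspace (pts X)" and V: "opn ?Q V" "?f x \<in> V" "t \<in> carrier (sec ?Q V)"
      and u: "unit_at X (pre X ?f V) (sec_map q V t) x"
    obtain U where U: "opn X U" "x \<in> U" "U \<subseteq> pre X ?f V"
      "res X (pre X ?f V) U (sec_map q V t) \<in> Units (sec X U)"
      using u unfolding unit_at_def by (elim exE conjE)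
    \<comment> \<open>The inverse lives on a neighbourhood of \<open>x\<close> in the source; the
      homeomorphism turns it into a neighbourhood of the image point, on which \<open>t\<close> can
      be inverted.\<close>
    define W where "W = pre ?Q g U"
    have W: "opn ?Q W" unfolding W_def by (rule continuous_pre[OF contg U(1)])
    have PW: "pre X ?f W = U" unfolding W_def by (rule pre_homeomorphic[OF hm opn_subset[OF U(1)]])
    have xW: "?f x \<in> W" using PW U(2) by auto
    have WV: "W \<subseteq> V"
    proof
      fix y assume y: "y \<in> W"
      then have "y \<in> topspace (pts ?Q)" "g y \<in> U" by (auto simp: W_def)
      then have "?f (g y) = y" "?f (g y) \<in> V"
        using hm U(3) by (auto simp: homeomorphic_maps_def)
      then show "y \<in> V" by simp
    qed
    have rc: "res ?Q V W t \<in> carrier (sec ?Q W)"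
      by (rule res_closed[OF Q V(1) W WV V(3)])
    have eq: "sec_map q W (res ?Q V W t) = res X (pre X ?f V) U (sec_map q V t)"
      using cohom_res[OF \<phi> V(1) W WV V(3)] unfolding PW .
    obtain m where m: "m \<in> carrier (sec X U)" "sec_map q W (res ?Q V W t) \<otimes>\<^bsub>sec X U\<^esub> m = \<one>\<^bsub>sec X U\<^esub>"
      using U(4) unfolding eq Units_def by auto
    have "sec_map q W (res ?Q V W t) \<in> eq_sec U"
      using qD(5)[OF W] rc unfolding PW by blast
    then have "m \<in> eq_sec U"
      using eq_sec_inverse[OF U(1) _ m] by simp
    then obtain t' where t': "t' \<in> carrier (sec ?Q W)" "m = sec_map q W t'"
      using qD(5)[OF W] unfolding PW by blast
    interpret W: comm_monoid "sec ?Q W" by (rule sec_comm_monoid[OF Q W])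
    have "sec_map q W (res ?Q V W t \<otimes>\<^bsub>sec ?Q W\<^esub> t') = sec_map q W \<one>\<^bsub>sec ?Q W\<^esub>"
      using m(2) unfolding t'(2) cohom_mult[OF \<phi> W rc t'(1)] cohom_one[OF \<phi> W] PW .
    then have "res ?Q V W t \<otimes>\<^bsub>sec ?Q W\<^esub> t' = \<one>\<^bsub>sec ?Q W\<^esub>"
      by (rule inj_onD[OF qD(4)[OF W]]) (use rc t' in auto)
    then have "res ?Q V W t \<in> Units (sec ?Q W)"
      by (rule comm_monoid_UnitsI[OF W.comm_monoid_axioms rc t'(1)])
    then show "unit_at ?Q V t (?f x)"
      using W xW WV unfolding unit_at_def by blast
  qed
qed

lemma (in parallel_pair) quotient_coequalizes:
  assumes q: "is_quotient q"
  shows "mor_eq (q \<odot> a) (q \<odot> b)"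
proof -
  note qD = quotientD[OF q]
  have qa: "ms_morphism (q \<odot> a)" "ms_morphism (q \<odot> b)"
    using ms_morphism_comp[OF a qD(1)] ms_morphism_comp[OF b qD(1)] qD(2) tgt_eq by auto
  show ?thesis
  proof (rule mor_eqI[OF qa])
    fix V t assume "opn (tgt (q \<odot> a)) V" "t \<in> carrier (sec (tgt (q \<odot> a)) V)"
    then have V: "opn (tgt q) V" "t \<in> carrier (sec (tgt q) V)" by simp_all
    have "sec_map q V t \<in> eq_sec (pre X (base_map q) V)"
      using qD(5)[OF V(1)] V(2) by blast
    then show "sec_map (q \<odot> a) V t = sec_map (q \<odot> b) V t"
      using sec_map_comp[OF a qD(1) qD(2)[symmetric] V] sec_map_comp[OF b qD(1) _ V] qD(2) tgt_eq
      by (simp add: eq_sec_def)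
  qed (use src_eq base_eq in auto)
qed

text \<open>The coequalizing property, read on sections, says that pullbacks along \<open>t\<close>
  have the same image under both morphisms of the pair.\<close>

lemma (in parallel_pair) coequalizing_sec:
  assumes t: "ms_morphism t" "src t = X" and eq: "mor_eq (t \<odot> a) (t \<odot> b)"
    and V: "opn (tgt t) V" "s \<in> carrier (sec (tgt t) V)"
  shows "sec_map t V s \<in> eq_sec (pre X (base_map t) V)"
proof -
  have ta: "ms_morphism (t \<odot> a)" by (rule ms_morphism_comp[OF a t(1) t(2)[symmetric]])
  have "sec_map (t \<odot> a) V s = sec_map (t \<odot> b) V s"
    using mor_eqD(4)[OF ta eq] V by simp
  then show ?thesis
    using sec_map_comp[OF a t(1) t(2)[symmetric] V] sec_map_comp[OF b t(1) _ V] t(2) tgt_eq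
      cohom_closed[OF sec_map_cohom[OF t(1)] V]
    by (simp add: eq_sec_def)
qed

text \<open>On points the factorization is \<open>t\<close> after the inverse homeomorphism.
  Sections pulled back along \<open>t\<close> lie in \<open>eq_sec\<close>, hence come from a unique
  section of the quotient; uniqueness makes the assignment \<eta> multiplicative and compatible with
  restriction.\<close>

lemma (in parallel_pair) quotient_factor:
  assumes q: "is_quotient q" and t: "ms_morphism t" "src t = X" and eq: "mor_eq (t \<odot> a) (t \<odot> b)"
  obtains h where "ms_morphism h" "src h = tgt q" "tgt h = tgt t" "mor_eq (h \<odot> q) t"
proof -
  note qD = quotientD[OF q]
  let ?Q = "tgt q" and ?f = "base_map q" and ?T = "tgt t"
  note \<phi> = sec_map_cohom[OF qD(1), unfolded qD(2)]
  note \<psi> = sec_map_cohom[OF t(1), unfolded t(2)]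
  note Q = ms_morphismD(2)[OF qD(1)] and T = ms_morphismD(2)[OF t(1)]
  obtain g where hm: "homeomorphic_maps (pts X) (pts ?Q) ?f g"
    by (rule exE[OF qD(3)[unfolded homeomorphic_map_maps]])
  have contg: "continuous_map (pts ?Q) (pts X) g"
    using hm by (simp add: homeomorphic_maps_def)
  let ?k = "base_map t \<circ> g"
  have contk: "continuous_map (pts ?Q) (pts ?T) ?k"
    by (rule continuous_map_compose[OF contg cohom_cont[OF \<psi>]])
  define W where "W V = pre ?Q ?k V" for V
  have W: "opn ?Q (W V)" if "opn ?T V" for V
    unfolding W_def by (rule continuous_pre[OF contk that])
  have PW: "pre X ?f (W V) = pre X (base_map t) V" for V
    using hm unfolding W_def homeomorphic_maps_def continuous_map_def by (auto simp: Pi_iff)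
  have Wm: "W V' \<subseteq> W V" if "V' \<subseteq> V" for V V'
    using that unfolding W_def by auto
  have ex: "\<exists>r. r \<in> carrier (sec ?Q (W V)) \<and> sec_map q (W V) r = sec_map t V s"
    if V: "opn ?T V" and s: "s \<in> carrier (sec ?T V)" for V s
  proof -
    have "sec_map t V s \<in> sec_map q (W V) ` carrier (sec ?Q (W V))"
      using coequalizing_sec[OF t eq V s] unfolding qD(5)[OF W[OF V]] PW .
    then obtain r where "sec_map t V s = sec_map q (W V) r" "r \<in> carrier (sec ?Q (W V))"
      by (rule imageE)
    then show ?thesis by (intro exI[of _ r]) simp
  qed
  define \<eta> where "\<eta> V s = (SOME r. r \<in> carrier (sec ?Q (W V)) \<and> sec_map q (W V) r = sec_map t V s)" for V s
  have \<eta>c: "\<eta> V s \<in> carrier (sec ?Q (W V))" and \<eta>q: "sec_map q (W V) (\<eta> V s) = sec_map t V s"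
    if V: "opn ?T V" and s: "s \<in> carrier (sec ?T V)" for V s
    using someI_ex[OF ex[OF V s]] unfolding \<eta>_def by auto
  have \<eta>I: "\<eta> V s = r" if V: "opn ?T V" and s: "s \<in> carrier (sec ?T V)"
    and r: "r \<in> carrier (sec ?Q (W V))" "sec_map q (W V) r = sec_map t V s" for V s r
    by (rule inj_onD[OF qD(4)[OF W[OF V]] _ \<eta>c[OF V s] r(1)]) (simp add: \<eta>q[OF V s] r(2))
  have \<eta>: "cohom ?Q ?k ?T \<eta>"
    unfolding cohom_def W_def[symmetric]
  proof (intro conjI allI impI ballI contk)
    fix V assume V: "opn ?T V"
    interpret TV: comm_monoid "sec ?T V" by (rule sec_comm_monoid[OF T V])
    interpret QV: comm_monoid "sec ?Q (W V)" by (rule sec_comm_monoid[OF Q W[OF V]])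
    show "monoid_hom (sec ?T V) (sec ?Q (W V)) (\<eta> V)"
    proof (rule monoid_homI)
      fix r s assume r: "r \<in> carrier (sec ?T V)" and s: "s \<in> carrier (sec ?T V)"
      show "\<eta> V (r \<otimes>\<^bsub>sec ?T V\<^esub> s) = \<eta> V r \<otimes>\<^bsub>sec ?Q (W V)\<^esub> \<eta> V s"
        using cohom_mult[OF \<phi> W[OF V] \<eta>c[OF V r] \<eta>c[OF V s]] cohom_mult[OF \<psi> V r s]
          \<eta>q[OF V r] \<eta>q[OF V s] \<eta>c[OF V r] \<eta>c[OF V s] r s unfolding PW
        by (intro \<eta>I[OF V]) auto
    next
      show "\<eta> V \<one>\<^bsub>sec ?T V\<^esub> = \<one>\<^bsub>sec ?Q (W V)\<^esub>"
        using cohom_one[OF \<phi> W[OF V]] cohom_one[OF \<psi> V] unfolding PW by (intro \<eta>I[OF V]) auto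
    qed (rule \<eta>c[OF V])
  next
    fix V V' s assume "opn ?T V \<and> opn ?T V' \<and> V' \<subseteq> V" and s: "s \<in> carrier (sec ?T V)"
    then have V: "opn ?T V" "opn ?T V'" "V' \<subseteq> V" by auto
    show "\<eta> V' (res ?T V V' s) = res ?Q (W V) (W V') (\<eta> V s)"
    proof (rule \<eta>I[OF V(2)])
      show "res ?T V V' s \<in> carrier (sec ?T V')" by (rule res_closed[OF T V s])
      show "res ?Q (W V) (W V') (\<eta> V s) \<in> carrier (sec ?Q (W V'))"
        by (rule res_closed[OF Q W[OF V(1)] W[OF V(2)] Wm[OF V(3)] \<eta>c[OF V(1) s]])
      show "sec_map q (W V') (res ?Q (W V) (W V') (\<eta> V s)) = sec_map t V' (res ?T V V' s)"
        unfolding cohom_res[OF \<phi> W[OF V(1)] W[OF V(2)] Wm[OF V(3)] \<eta>c[OF V(1) s]] PW \<eta>q[OF V(1) s]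
          cohom_res[OF \<psi> V s] ..
    qed
  qed
  let ?h = "mk_mor ?Q ?k ?T \<eta>"
  have h: "ms_morphism ?h" by (rule mk_mor_morphism[OF Q T \<eta>])
  have "mor_eq (?h \<odot> q) t"
  proof (rule mor_eqI[OF ms_morphism_comp[OF qD(1) h] t(1)])
    show "base_map (?h \<odot> q) x = base_map t x" if "x \<in> topspace (pts (src (?h \<odot> q)))" for x
      using that hm qD(2) by (simp add: homeomorphic_maps_def)
    fix V s assume "opn (tgt (?h \<odot> q)) V" "s \<in> carrier (sec (tgt (?h \<odot> q)) V)"
    then have V: "opn ?T V" "s \<in> carrier (sec ?T V)" by simp_all
    have "sec_map (?h \<odot> q) V s = sec_map q (W V) (sec_map ?h V s)"
      using sec_map_comp[OF qD(1) h _, of V s] V by (simp add: W_def)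
    then show "sec_map (?h \<odot> q) V s = sec_map t V s"
      using sec_map_mk_mor[OF Q T \<eta> V] \<eta>q[OF V] by simp
  qed (use qD t in auto)
  with h show thesis by (intro that[of ?h]) simp_all
qed

text \<open>A quotient is surjective on points and injective on sections, so it can be cancelled on
  the right.\<close>

lemma (in parallel_pair) quotient_epi:
  assumes q: "is_quotient q" and h: "ms_morphism h" "src h = tgt q" and k: "ms_morphism k" "src k = tgt q"
    and hk: "tgt h = tgt k" and eq: "mor_eq (h \<odot> q) t" "mor_eq (k \<odot> q) t"
  shows "mor_eq h k"
proof -
  note qD = quotientD[OF q]
  have hq: "ms_morphism (h \<odot> q)" "ms_morphism (k \<odot> q)"
    using ms_morphism_comp[OF qD(1) h(1) h(2)[symmetric]] ms_morphism_comp[OF qD(1) k(1) k(2)[symmetric]] .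
  note e1 = mor_eqD[OF hq(1) eq(1)] and e2 = mor_eqD[OF hq(2) eq(2)]
  have base: "base_map h y = base_map k y" if y: "y \<in> topspace (pts (tgt q))" for y
  proof -
    obtain x where x: "x \<in> topspace (pts X)" "base_map q x = y"
      by (rule quotient_surj[OF q y])
    show ?thesis using e1(3)[of x] e2(3)[of x] x qD(2) by simp
  qed
  show ?thesis
  proof (rule mor_eqI[OF h(1) k(1)])
    fix V s assume V: "opn (tgt h) V" "s \<in> carrier (sec (tgt h) V)"
    let ?W = "preimage h V"
    have W: "preimage k V = ?W" using base h k by auto
    note \<phi> = sec_map_cohom[OF h(1)] and \<psi> = sec_map_cohom[OF k(1)]
    have oW: "opn (tgt q) ?W" using cohom_pre[OF \<phi> V(1)] h by simp
    show "sec_map h V s = sec_map k V s"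
    proof (rule inj_onD[OF qD(4)[OF oW]])
      show "sec_map h V s \<in> carrier (sec (tgt q) ?W)"
        using cohom_closed[OF \<phi> V] h by simp
      show "sec_map k V s \<in> carrier (sec (tgt q) ?W)"
        using cohom_closed[OF \<psi>, of V s] V hk k W by simp
      have "sec_map q ?W (sec_map h V s) = sec_map t V s"
        using sec_map_comp[OF qD(1) h(1) h(2)[symmetric] V] e1(4)[of V s] V by simp
      moreover have "sec_map q ?W (sec_map k V s) = sec_map t V s"
        using sec_map_comp[OF qD(1) k(1) k(2)[symmetric], of V s] e2(4)[of V s] V hk W by simp
      ultimately show "sec_map q ?W (sec_map h V s) = sec_map q ?W (sec_map k V s)" by simp
    qed
  qed (use h k hk base in auto)
qed

text \<open>If the pullback of \<open>s\<close> along \<open>h\<close> is invertible at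
  \<open>y\<close>, its further pullback along \<open>q\<close> is invertible at a point
  \<open>x\<close> over \<open>y\<close>. That is the pullback along \<open>t\<close>, and
  \<open>t\<close> reflects units.\<close>

lemma (in parallel_pair) quotient_factor_local:
  assumes q: "is_quotient q" and h: "ms_morphism h" "src h = tgt q" and eq: "mor_eq (h \<odot> q) t"
    and t: "ms_morphism t" "local_morphism t"
  shows "local_morphism h"
  unfolding local_morphism_iff[OF h(1)] h(2)
proof (intro ballI allI impI, elim conjE)
  note qD = quotientD[OF q]
  note e = mor_eqD[OF ms_morphism_comp[OF qD(1) h(1) h(2)[symmetric]] eq]
  fix y V s assume y: "y \<in> topspace (pts (tgt q))" and V: "opn (tgt h) V" "base_map h y \<in> V" "s \<in> carrier (sec (tgt h) V)"
    and u: "unit_at (tgt q) (pre (tgt q) (base_map h) V) (sec_map h V s) y"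
  let ?W = "pre (tgt q) (base_map h) V"
  obtain x where x: "x \<in> topspace (pts X)" "base_map q x = y"
    by (rule quotient_surj[OF q y])
  have W: "opn (tgt q) ?W" "sec_map h V s \<in> carrier (sec (tgt q) ?W)"
    using cohom_pre[OF sec_map_cohom[OF h(1)] V(1)] cohom_closed[OF sec_map_cohom[OF h(1)] V(1,3)] h(2) by simp_all
  have "unit_at X (pre X (base_map q) ?W) (sec_map q ?W (sec_map h V s)) x"
    using unit_at_sec_map[OF qD(1), of x ?W "sec_map h V s"] x W y V(2) u qD(2) by simp
  moreover have "sec_map q ?W (sec_map h V s) = sec_map t V s"
    using sec_map_comp[OF qD(1) h(1) h(2)[symmetric] V(1,3)] e(4)[of V s] V h(2) by simp
  moreover have "pre X (base_map q) ?W = preimage t V"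
    using e(1,3) qD(2) cohom_cont[OF sec_map_cohom[OF qD(1)]] by (auto simp: continuous_map_def Pi_iff)
  ultimately have "unit_at (src t) (preimage t V) (sec_map t V s) x"
    using e(1) qD(2) by simp
  moreover have eqs: "base_map t x = base_map h y" "tgt t = tgt h" "x \<in> topspace (pts (src t))"
    using e(1-3) x qD(2) by auto
  ultimately have "unit_at (tgt t) V s (base_map t x)"
    using V by (intro local_morphismD[OF t eqs(3)]) simp_all
  then show "unit_at (tgt h) V s (base_map h y)"
    using eqs by simp
qed

text \<open>The induced map is constructed in \<open>MS\<close>. For the other two categories it has
  to be local, which it inherits from the test morphism, and for \<open>Fans\<close> its source and
  target are fans because they are those of arrows already given.\<close>

lemma (in parallel_pair) quotient_coequalizer:
  assumes q: "is_quotient q" and ab: "arrow C a" "arrow C b" and aq: "arrow C q"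
  shows "coequalizer C (TY :: ('t \<times> 'k) itself) a b q"
proof -
  note qD = quotientD[OF q]
  have univ: "\<exists>h. arrow C h \<and> src h = tgt q \<and> tgt h = tgt t \<and> mor_eq (h \<odot> q) t \<and>
      (\<forall>h'. arrow C h' \<and> src h' = tgt q \<and> tgt h' = tgt t \<and> mor_eq (h' \<odot> q) t \<longrightarrow> mor_eq h' h)"
    if t: "arrow C t" "src t = X" "mor_eq (t \<odot> a) (t \<odot> b)" for t :: "('x, 'm, 't, 'k) morphism"
  proof -
    have tm: "ms_morphism t" using t(1) by (simp add: arrow_def)
    obtain h where h: "ms_morphism h" "src h = tgt q" "tgt h = tgt t" "mor_eq (h \<odot> q) t"
      by (rule quotient_factor[OF q tm t(2,3)])
    have "arrow C h"
      using h quotient_factor_local[OF q h(1,2,4) tm] t(1) aq unfolding arrow_def by auto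
    moreover have "mor_eq h' h" if "arrow C h' \<and> src h' = tgt q \<and> tgt h' = tgt t \<and> mor_eq (h' \<odot> q) t" for h'
      using quotient_epi[OF q _ _ h(1,2) _ _ h(4), of h'] that h(3) unfolding arrow_def by auto
    ultimately show ?thesis using h by blast
  qed
  show ?thesis
    unfolding coequalizer_def
    using ab aq src_eq tgt_eq qD(2) quotient_coequalizes[OF q] univ by simp
qed

section \<open>Uniqueness of coequalizers up to isomorphism\<close>

lemma arrow_MS: "arrow MS f \<longleftrightarrow> ms_morphism f"
  by (simp add: arrow_def)

lemma coequalizer_univ:
  fixes t :: "('x, 'm, 't, 'k) morphism"
  assumes q: "coequalizer C (TY :: ('t \<times> 'k) itself) a b q"
    and t: "arrow C t" "src t = tgt a" "mor_eq (t \<odot> a) (t \<odot> b)"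
  shows "\<exists>h. arrow C h \<and> src h = tgt q \<and> tgt h = tgt t \<and> mor_eq (h \<odot> q) t \<and>
    (\<forall>h'. arrow C h' \<and> src h' = tgt q \<and> tgt h' = tgt t \<and> mor_eq (h' \<odot> q) t \<longrightarrow> mor_eq h' h)"
proof -
  have "\<forall>t :: ('x, 'm, 't, 'k) morphism. arrow C t \<and> src t = tgt a \<and> mor_eq (t \<odot> a) (t \<odot> b) \<longrightarrow>
      (\<exists>h. arrow C h \<and> src h = tgt q \<and> tgt h = tgt t \<and> mor_eq (h \<odot> q) t \<and>
        (\<forall>h'. arrow C h' \<and> src h' = tgt q \<and> tgt h' = tgt t \<and> mor_eq (h' \<odot> q) t \<longrightarrow> mor_eq h' h))"
    using q unfolding coequalizer_def by (elim conjE)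
  then show ?thesis
    by (rule mp[OF spec[of _ t]]) (intro conjI t)
qed

lemma mor_comp_assoc:
  assumes f: "ms_morphism f" and g: "ms_morphism g" "src g = tgt f" and h: "ms_morphism h" "src h = tgt g"
  shows "mor_eq ((h \<odot> g) \<odot> f) (h \<odot> (g \<odot> f))"
proof -
  have hg: "ms_morphism (h \<odot> g)" and gf: "ms_morphism (g \<odot> f)"
    using ms_morphism_comp f g h by metis+
  show ?thesis
  proof (rule mor_eqI)
    show "ms_morphism ((h \<odot> g) \<odot> f)" by (rule ms_morphism_comp[OF f hg]) (simp add: g)
    show "ms_morphism (h \<odot> (g \<odot> f))" by (rule ms_morphism_comp[OF gf h(1)]) (simp add: h)
    fix V t assume "opn (tgt ((h \<odot> g) \<odot> f)) V" "t \<in> carrier (sec (tgt ((h \<odot> g) \<odot> f)) V)"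
    then have V: "opn (tgt h) V" "t \<in> carrier (sec (tgt h) V)" by simp_all
    have W: "opn (tgt g) (preimage h V)" "sec_map h V t \<in> carrier (sec (tgt g) (preimage h V))"
      using cohom_pre[OF sec_map_cohom[OF h(1)] V(1)] cohom_closed[OF sec_map_cohom[OF h(1)] V] h(2) by simp_all
    have "sec_map ((h \<odot> g) \<odot> f) V t = sec_map f (preimage (h \<odot> g) V) (sec_map (h \<odot> g) V t)"
      using sec_map_comp[OF f hg _, of V t] V g by simp
    also have "sec_map (h \<odot> g) V t = sec_map g (preimage h V) (sec_map h V t)"
      by (rule sec_map_comp[OF g(1) h(1) h(2)[symmetric] V])
    also have "preimage (h \<odot> g) V = preimage g (preimage h V)"
      using ms_morphismD(3)[OF g(1)] h(2) by (auto simp: continuous_map_def Pi_iff)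
    also have "sec_map f (preimage g (preimage h V)) (sec_map g (preimage h V) (sec_map h V t)) =
      sec_map (g \<odot> f) (preimage h V) (sec_map h V t)"
      using sec_map_comp[OF f g(1) g(2)[symmetric] W] by simp
    also have "\<dots> = sec_map (h \<odot> (g \<odot> f)) V t"
      using sec_map_comp[OF gf h(1) _ V] h(2) by simp
    finally show "sec_map ((h \<odot> g) \<odot> f) V t = sec_map (h \<odot> (g \<odot> f)) V t" .
  qed (simp_all add: comp_assoc)
qed

text \<open>The relation \<open>mor_eq\<close> is phrased with the inverse image belonging to its
  left argument. Passing through \<open>sec_map\<close> gives a symmetric description, from which
  transitivity is evident.\<close>

lemma mor_eq_trans:
  assumes fg: "mor_eq f g" and f: "ms_morphism f" and g: "ms_morphism g" and h: "ms_morphism h" and gh: "mor_eq g h"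
  shows "mor_eq f h"
proof -
  note e = mor_eqD[OF f fg] and e' = mor_eqD[OF g gh]
  show ?thesis
  proof (rule mor_eqI[OF f h])
    show "src f = src h" "tgt f = tgt h"
      using e(1,2) e'(1,2) by simp_all
    show "base_map f x = base_map h x" if "x \<in> topspace (pts (src f))" for x
      using e(3)[OF that] e'(3)[of x] e(1) that by simp
    show "sec_map f V t = sec_map h V t" if "opn (tgt f) V" "t \<in> carrier (sec (tgt f) V)" for V t
      using e(4)[OF that] e'(4)[of V t] e(2) that by simp
  qed
qed

lemma mor_comp_cong:
  assumes f: "ms_morphism f" and g: "ms_morphism g" "tgt f = src g" and f': "mor_eq f f'" "ms_morphism f'"
  shows "mor_eq (g \<odot> f) (g \<odot> f')"
proof -
  note e = mor_eqD[OF f f'(1)]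
  show ?thesis
  proof (rule mor_eqI[OF ms_morphism_comp[OF f g] ms_morphism_comp[OF f'(2) g(1)]])
    show "tgt f' = src g" using e g by simp
    fix V t assume "opn (tgt (g \<odot> f)) V" "t \<in> carrier (sec (tgt (g \<odot> f)) V)"
    then have V: "opn (tgt g) V" "t \<in> carrier (sec (tgt g) V)" by simp_all
    have W: "opn (tgt f) (preimage g V)" "sec_map g V t \<in> carrier (sec (tgt f) (preimage g V))"
      using cohom_pre[OF sec_map_cohom[OF g(1)] V(1)] cohom_closed[OF sec_map_cohom[OF g(1)] V] g(2) by simp_all
    show "sec_map (g \<odot> f) V t = sec_map (g \<odot> f') V t"
      using sec_map_comp[OF f g V] sec_map_comp[OF f'(2) g(1) _ V] e(4)[OF W] e(2) g(2) by simp
  qed (use e in auto)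
qed

lemma mor_id_left:
  assumes f: "ms_morphism f"
  shows "mor_eq (mor_id (tgt f) \<odot> f) f"
proof -
  note i = ms_morphism_id[OF ms_morphismD(2)[OF f]]
  show ?thesis
  proof (rule mor_eqI[OF ms_morphism_comp[OF f i] f])
    fix V t assume "opn (tgt (mor_id (tgt f) \<odot> f)) V" "t \<in> carrier (sec (tgt (mor_id (tgt f) \<odot> f)) V)"
    then have V: "opn (tgt f) V" "t \<in> carrier (sec (tgt f) V)" by simp_all
    have P: "pre (tgt f) (\<lambda>x. x) V = V" by (rule pre_ident[OF V(1)])
    show "sec_map (mor_id (tgt f) \<odot> f) V t = sec_map f V t"
      using sec_map_comp[OF f i _, of V t] V sec_map_id[OF ms_morphismD(2)[OF f] V] P by simp
  qed simp_all
qed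

lemma mor_eq_sym:
  assumes fg: "mor_eq f g" and f: "ms_morphism f" and g: "ms_morphism g"
  shows "mor_eq g f"
proof -
  note e = mor_eqD[OF f fg]
  show ?thesis
  proof (rule mor_eqI[OF g f e(1)[symmetric] e(2)[symmetric]])
    show "base_map g x = base_map f x" if "x \<in> topspace (pts (src g))" for x
      using e(3)[of x] e(1) that by simp
    show "sec_map g V t = sec_map f V t" if "opn (tgt g) V" "t \<in> carrier (sec (tgt g) V)" for V t
      using e(4)[of V t] e(2) that by simp
  qed
qed

text \<open>By uniqueness of coequalizers, \<open>q\<close> is isomorphic to the quotient of \<open>ex_quotient\<close>.\<close>

lemma (in parallel_pair) coequalizer_is_quotient:
  fixes q :: "('x, 'm, 'y, 'n) morphism"
  assumes q: "coequalizer MS TYPE('x \<times> 'm) a b q" "coequalizer MS TYPE('y \<times> 'n) a b q"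
  shows "is_quotient q"
proof -
  obtain q0 :: "('x, 'm, 'x, 'm) morphism" where q0: "is_quotient q0"
    using ex_quotient ..
  note D0 = quotientD[OF q0]
  have qm: "ms_morphism q" "src q = X" "mor_eq (q \<odot> a) (q \<odot> b)"
    using q(1) by (auto simp: coequalizer_def arrow_def)
  \<comment> \<open>Tests over the types of \<open>X\<close> admit the subsheaf model as a target
    and yield \<open>h\<close>; tests over the types of the target of \<open>q\<close> make its
    endomorphisms under \<open>q\<close> unique.\<close>
  note univ1 = coequalizer_univ[OF q(1), unfolded arrow_MS]
  note univ2 = coequalizer_univ[OF q(2), unfolded arrow_MS]
  obtain h where h: "ms_morphism h" "src h = tgt q" "tgt h = tgt q0" "mor_eq (h \<odot> q) q0"
    using univ1[OF D0(1,2) quotient_coequalizes[OF q0]] by (elim exE conjE)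
  obtain k where k: "ms_morphism k" "src k = tgt q0" "tgt k = tgt q" "mor_eq (k \<odot> q0) q"
    by (rule quotient_factor[OF q0 qm])
  have hq: "ms_morphism (h \<odot> q)" by (rule ms_morphism_comp[OF qm(1) h(1) h(2)[symmetric]])
  have kq: "ms_morphism (k \<odot> q0)" by (rule ms_morphism_comp[OF D0(1) k(1) k(2)[symmetric]])
  have kh: "ms_morphism (k \<odot> h)" by (rule ms_morphism_comp[OF h(1) k(1)]) (simp add: h k)
  have hk: "ms_morphism (h \<odot> k)" by (rule ms_morphism_comp[OF k(1) h(1)]) (simp add: h k)
  have Q: "monoidal_space (tgt q)" "monoidal_space (tgt q0)"
    using ms_morphismD(2) qm(1) D0(1) by blast+
  have khq: "mor_eq ((k \<odot> h) \<odot> q) q"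
  proof -
    have 1: "mor_eq ((k \<odot> h) \<odot> q) (k \<odot> (h \<odot> q))"
      by (rule mor_comp_assoc[OF qm(1) h(1,2) k(1)]) (simp add: h k)
    have 2: "mor_eq (k \<odot> (h \<odot> q)) (k \<odot> q0)"
      by (rule mor_comp_cong[OF hq k(1) _ h(4) D0(1)]) (simp add: h k)
    have m1: "ms_morphism ((k \<odot> h) \<odot> q)" by (rule ms_morphism_comp[OF qm(1) kh]) (simp add: h)
    have m2: "ms_morphism (k \<odot> (h \<odot> q))" by (rule ms_morphism_comp[OF hq k(1)]) (simp add: h k)
    show ?thesis
      by (rule mor_eq_trans[OF mor_eq_trans[OF 1 m1 m2 kq 2] m1 kq qm(1) k(4)])
  qed
  have hkq: "mor_eq ((h \<odot> k) \<odot> q0) q0"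
  proof -
    have 1: "mor_eq ((h \<odot> k) \<odot> q0) (h \<odot> (k \<odot> q0))"
      by (rule mor_comp_assoc[OF D0(1) k(1,2) h(1)]) (simp add: h k)
    have 2: "mor_eq (h \<odot> (k \<odot> q0)) (h \<odot> q)"
      by (rule mor_comp_cong[OF kq h(1) _ k(4) qm(1)]) (simp add: h k)
    have m1: "ms_morphism ((h \<odot> k) \<odot> q0)" by (rule ms_morphism_comp[OF D0(1) hk]) (simp add: k)
    have m2: "ms_morphism (h \<odot> (k \<odot> q0))" by (rule ms_morphism_comp[OF kq h(1)]) (simp add: h k)
    show ?thesis
      by (rule mor_eq_trans[OF mor_eq_trans[OF 1 m1 m2 hq 2] m1 hq D0(1) h(4)])
  qed
  \<comment> \<open>One composite is the identity because \<open>q0\<close> can be cancelled on the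
    right, the other by uniqueness in the universal property of \<open>q\<close> tested on its own
    target.\<close>
  have hk_id: "mor_eq (h \<odot> k) (mor_id (tgt q0))"
    by (rule quotient_epi[OF q0 hk _ ms_morphism_id[OF Q(2)] _ _ hkq mor_id_left[OF D0(1)]]) (simp_all add: h k)
  have kh_id: "mor_eq (k \<odot> h) (mor_id (tgt q))"
  proof -
    obtain u where u: "ms_morphism u" "src u = tgt q" "tgt u = tgt q"
      and uniq: "\<And>h'. ms_morphism h' \<Longrightarrow> src h' = tgt q \<Longrightarrow> tgt h' = tgt q \<Longrightarrow> mor_eq (h' \<odot> q) q \<Longrightarrow> mor_eq h' u"
      using univ2[OF qm] by auto
    have i: "ms_morphism (mor_id (tgt q))" by (rule ms_morphism_id[OF Q(1)])
    have 1: "mor_eq (k \<odot> h) u" by (rule uniq[OF kh _ _ khq]) (simp_all add: h k)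
    have 2: "mor_eq (mor_id (tgt q)) u" by (rule uniq[OF i _ _ mor_id_left[OF qm(1)]]) simp_all
    show ?thesis
      by (rule mor_eq_trans[OF 1 kh u(1) i mor_eq_sym[OF 2 i u(1)]])
  qed
  have iso: "is_iso k"
    unfolding is_iso_def using k h hk_id kh_id by (intro conjI exI[of _ h]) simp_all
  note isoD = is_isoD[OF iso]
  note e = mor_eqD[OF kq k(4)]
  show ?thesis
    unfolding is_quotient_def
  proof (intro conjI allI impI qm)
    have "homeomorphic_map (pts X) (pts (tgt q)) (base_map k \<circ> base_map q0)"
      by (rule homeomorphic_map_compose[OF D0(3)]) (use isoD(2) k in simp)
    then show "homeomorphic_map (pts X) (pts (tgt q)) (base_map q)"
      by (rule homeomorphic_map_eq) (use e(3) D0(2) in simp)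
    fix V assume V: "opn (tgt q) V"
    let ?W = "preimage k V"
    have W: "opn (tgt q0) ?W" using cohom_pre[OF sec_map_cohom[OF k(1)], of V] V k by simp
    have P: "preimage q0 ?W = preimage q V"
      using e(1,3) ms_morphismD(3)[OF D0(1)] k(2) by (auto simp: continuous_map_def Pi_iff)
    have b1: "bij_betw (sec_map k V) (carrier (sec (tgt q) V)) (carrier (sec (tgt q0) ?W))"
      using isoD(3)[of V] V k by simp
    have b2: "bij_betw (sec_map q0 ?W) (carrier (sec (tgt q0) ?W)) (eq_sec (preimage q V))"
      using q0[unfolded is_quotient_def, THEN conjunct2, THEN conjunct2, THEN conjunct2, THEN spec, THEN mp, OF W]
      unfolding P .
    have eq: "sec_map q V t = (sec_map q0 ?W \<circ> sec_map k V) t" if "t \<in> carrier (sec (tgt q) V)" for t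
      using e(4)[of V t] that V k(3) sec_map_comp[OF D0(1) k(1) k(2)[symmetric], of V t] by simp
    show "bij_betw (sec_map q V) (carrier (sec (tgt q) V)) (eq_sec (preimage q V))"
      by (rule iffD2[OF bij_betw_cong[OF eq] bij_betw_trans[OF b1 b2]])
  qed
qed

section \<open>Products\<close>

lemma mprod_sel:
  shows pts_mprod: "pts (mprod X Y) = prod_topology (pts X) (pts Y)"
    and sec_mprod: "sec (mprod X Y) W = psec (mprod X Y) fst X W \<times>\<times> psec (mprod X Y) snd Y W"
    and res_mprod: "res (mprod X Y) U V = map_prod (\<lambda>\<sigma>. restrict \<sigma> V) (\<lambda>\<sigma>. restrict \<sigma> V)"
  by (simp_all add: mprod_def Let_def direct_sum_def inverse_image_def)

lemma proj_sel [simp]: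
  "src (proj1 X Y) = mprod X Y" "tgt (proj1 X Y) = X" "base_map (proj1 X Y) = fst"
  "src (proj2 X Y) = mprod X Y" "tgt (proj2 X Y) = Y" "base_map (proj2 X Y) = snd"
  by (simp_all add: proj1_def proj2_def)

lemma continuous_fst_mprod: "continuous_map (pts (mprod X Y)) (pts X) fst"
  and continuous_snd_mprod: "continuous_map (pts (mprod X Y)) (pts Y) snd"
  unfolding pts_mprod by (rule continuous_map_fst continuous_map_snd)+

lemma mprod_nbhd:
  assumes W: "opn (mprod X Y) W" "(x, y) \<in> W"
  obtains P Q where "opn X P" "opn Y Q" "x \<in> P" "y \<in> Q" "P \<times> Q \<subseteq> W"
proof -
  have "\<exists>P Q. opn X P \<and> opn Y Q \<and> x \<in> P \<and> y \<in> Q \<and> P \<times> Q \<subseteq> W"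
    using W unfolding pts_mprod openin_prod_topology_alt by simp
  then show thesis
    by (elim exE conjE) (rule that)
qed

lemma psec_one_mult:
  assumes Y: "monoidal_space Y" and f: "continuous_map (pts X) (pts Y) f" and U: "opn X U"
  shows "\<one>\<^bsub>psec X f Y U\<^esub> \<otimes>\<^bsub>psec X f Y U\<^esub> \<one>\<^bsub>psec X f Y U\<^esub> = \<one>\<^bsub>psec X f Y U\<^esub>"
proof -
  have "\<one>\<^bsub>stk Y (f x)\<^esub> \<otimes>\<^bsub>stk Y (f x)\<^esub> \<one>\<^bsub>stk Y (f x)\<^esub> = \<one>\<^bsub>stk Y (f x)\<^esub>" if "x \<in> U" for x
  proof -
    have "f x \<in> topspace (pts Y)"
      using that opn_subset[OF U] f by (auto simp: continuous_map_def Pi_iff)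
    then interpret comm_monoid "stk Y (f x)" by (rule stalk_comm_monoid[OF Y])
    show ?thesis by simp
  qed
  then show ?thesis
    unfolding psec_mult_def psec_one_def by (intro restrict_ext) simp
qed

lemma psec_one_restrict: "V \<subseteq> U \<Longrightarrow> restrict \<one>\<^bsub>psec X f Y U\<^esub> V = \<one>\<^bsub>psec X f Y V\<^esub>"
  unfolding psec_one_def restrict_restrict by (simp add: Int_absorb1)

text \<open>That the product is a monoidal space enters as a hypothesis; for an action it is
  supplied by the action map being a morphism with this source.\<close>

lemma proj1_morphism:
  assumes M: "monoidal_space (mprod X Y)" and X: "monoidal_space X" and Y: "monoidal_space Y"
  shows "ms_morphism (proj1 X Y)"
proof -
  have "sheaf_hom (pts (mprod X Y)) (pull (mprod X Y) fst X) (shf (mprod X Y)) (comap (proj1 X Y))"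
    unfolding sheaf_hom_def
  proof (intro conjI allI impI ballI)
    fix U assume U: "opn (mprod X Y) U"
    show "monoid_hom (psec (mprod X Y) fst X U) (sec (mprod X Y) U) (comap (proj1 X Y) U)"
      using psec_one_closed[OF Y continuous_snd_mprod U] psec_one_mult[OF Y continuous_snd_mprod U]
      by (intro monoid_homI) (simp_all add: sec_mprod proj1_def)
  next
    fix U V \<sigma> assume "opn (mprod X Y) U \<and> opn (mprod X Y) V \<and> V \<subseteq> U"
    then show "comap (proj1 X Y) V (restr (pull (mprod X Y) fst X) U V \<sigma>) =
        res (mprod X Y) U V (comap (proj1 X Y) U \<sigma>)"
      by (simp add: proj1_def psec_restr_def res_mprod psec_one_restrict)
  qed
  then show ?thesis
    using M X continuous_fst_mprod by (simp add: ms_morphism_def)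
qed

lemma proj2_morphism:
  assumes M: "monoidal_space (mprod X Y)" and X: "monoidal_space X" and Y: "monoidal_space Y"
  shows "ms_morphism (proj2 X Y)"
proof -
  have "sheaf_hom (pts (mprod X Y)) (pull (mprod X Y) snd Y) (shf (mprod X Y)) (comap (proj2 X Y))"
    unfolding sheaf_hom_def
  proof (intro conjI allI impI ballI)
    fix U assume U: "opn (mprod X Y) U"
    show "monoid_hom (psec (mprod X Y) snd Y U) (sec (mprod X Y) U) (comap (proj2 X Y) U)"
      using psec_one_closed[OF X continuous_fst_mprod U] psec_one_mult[OF X continuous_fst_mprod U]
      by (intro monoid_homI) (simp_all add: sec_mprod proj2_def)
  next
    fix U V \<sigma> assume "opn (mprod X Y) U \<and> opn (mprod X Y) V \<and> V \<subseteq> U"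
    then show "comap (proj2 X Y) V (restr (pull (mprod X Y) snd Y) U V \<sigma>) =
        res (mprod X Y) U V (comap (proj2 X Y) U \<sigma>)"
      by (simp add: proj2_def psec_restr_def res_mprod psec_one_restrict)
  qed
  then show ?thesis
    using M Y continuous_snd_mprod by (simp add: ms_morphism_def)
qed

lemma sec_map_proj1:
  "sec_map (proj1 X Y) V t =
     (germfun X fst V t (pre (mprod X Y) fst V), \<one>\<^bsub>psec (mprod X Y) snd Y (pre (mprod X Y) fst V)\<^esub>)"
  unfolding sec_map_germfun proj_sel by (simp add: proj1_def)

lemma sec_map_proj2:
  "sec_map (proj2 X Y) V t =
     (\<one>\<^bsub>psec (mprod X Y) fst X (pre (mprod X Y) snd V)\<^esub>, germfun Y snd V t (pre (mprod X Y) snd V))"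
  unfolding sec_map_germfun proj_sel by (simp add: proj2_def)


section \<open>Actions of a torsion group fan\<close>

lemma germ_hom:
  assumes "monoidal_space X" "opn X U" "x \<in> U"
  shows "monoid_hom (sec X U) (stk X x) (gm X x U)"
  using assms by (intro monoid_homI) (simp_all add: germ_in_stalk stalk_mult_same stalk_one)

text \<open>The trivial monoid has one element, so each of its localizations contains a single
  fraction.\<close>

lemma trivial_Spec_section:
  assumes "c \<in> carrier (sec (Spec (singleton_group ())) U)"
  shows "c = \<one>\<^bsub>sec (Spec (singleton_group ())) U\<^esub>"
proof -
  let ?S = "singleton_group ()"
  interpret comm_monoid ?S
    by (rule comm_monoidI) (simp_all add: singleton_group_def)
  show ?thesis
  proof (rule extensionalityI)
    show "c \<in> extensional (basics_in ?S U)" using assms by (simp add: Spec_sec_iff)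
    show "\<one>\<^bsub>sec (Spec ?S) U\<^esub> \<in> extensional (basics_in ?S U)" by (simp add: Spec_one)
    fix p assume p: "p \<in> basics_in ?S U"
    have p': "p \<in> carrier ?S" "basic_open ?S p \<subseteq> U"
      using conjunct1[OF CollectD[OF p]] conjunct2[OF CollectD[OF p]] .
    obtain x a where "c p = fraction ?S (powers ?S p) x a"
      by (rule L_cases[OF p'(1) Spec_secD(1)[OF assms p']])
    then show "c p = \<one>\<^bsub>sec (Spec ?S) U\<^esub> p"
      using p by (simp add: Spec_one localization_one_def)
  qed
qed

text \<open>The morphisms witnessing the unit law are fixed here. The morphism \<open>u\<close>,
  which is \<open>(e eps, id)\<close>, is a section both of the projection and of the action, and
  the two are compared by pulling back along it.\<close>

locale fan_action =
  fixes A :: "'a monoid" and X :: "('x, 'm) mspace"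
    and act :: "('a set \<times> 'x, ('a set, 'a spec_sec, 'x, 'm) prod_sec, 'x, 'm) morphism"
    and e :: "(unit set, unit spec_sec, 'a set, 'a spec_sec) morphism"
    and eps :: "('x, 'm, unit set, unit spec_sec) morphism"
    and u :: "('x, 'm, 'a set \<times> 'x, ('a set, 'a spec_sec, 'x, 'm) prod_sec) morphism"
  assumes A: "comm_group A" and torsion: "\<forall>a\<in>carrier A. \<exists>n::nat. n > 0 \<and> a [^]\<^bsub>A\<^esub> n = \<one>\<^bsub>A\<^esub>"
    and act: "ms_morphism act" "src act = mprod (Spec A) X" "tgt act = X"
    and e: "group_fan_unit A e"
    and eps: "ms_morphism eps" "src eps = X" "tgt eps = Spec (singleton_group ())"
    and u: "is_pairing (e \<odot> eps) (mor_id X) u"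
    and act_u: "mor_eq (act \<odot> u) (mor_id X)"

sublocale fan_action \<subseteq> comm_group A by (rule A)

abbreviation (in fan_action) "G \<equiv> Spec A"
abbreviation (in fan_action) "M \<equiv> mprod (Spec A) X"
abbreviation (in fan_action) "pt \<equiv> carrier A"

lemma (in fan_action) spaces: "monoidal_space X" "monoidal_space M" "monoidal_space G"
  using ms_morphismD(1,2)[OF act(1)] act monoidal_space_Spec by auto

text \<open>A face contains \<open>\<one>\<close>, the product of any element with its inverse, and
  hence contains every element.\<close>

lemma (in fan_action) topspace_G: "topspace (pts G) = {pt}"
proof -
  have 1: "F = pt" if F: "face A F" for F
  proof
    show "F \<subseteq> pt" by (rule face_subset[OF F])
    show "pt \<subseteq> F"
    proof
      fix x assume x: "x \<in> pt"
      have "x \<otimes>\<^bsub>A\<^esub> inv\<^bsub>A\<^esub> x \<in> F" using x face_one[OF F] by simp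
      then show "x \<in> F" using face_mult_iff[OF F x inv_closed[OF x]] by blast
    qed
  qed
  have 2: "face A pt"
    unfolding face_def by (auto intro: submonoid.intro)
  show ?thesis
    unfolding topspace_Spec
  proof (rule Set.set_eqI)
    fix F show "F \<in> {F. face A F} \<longleftrightarrow> F \<in> {pt}"
      using 1[of F] 2 by auto
  qed
qed

lemma (in fan_action) topspace_M: "topspace (pts M) = {pt} \<times> topspace (pts X)"
  by (simp add: pts_mprod topspace_G)

text \<open>The only neighbourhood of the single point is the whole space, so an element of the
  stalk is the germ of a global section, that is, of an element of \<open>A\<close>; the order of
  that element serves.\<close>

lemma (in fan_action) stalk_torsion:
  assumes g: "g \<in> carrier (stk G pt)"
  obtains n :: nat where "n > 0" "g [^]\<^bsub>stk G pt\<^esub> n = \<one>\<^bsub>stk G pt\<^esub>"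
proof -
  obtain U s where U: "opn G U" "pt \<in> U" "s \<in> carrier (sec G U)" "g = gm G pt U s"
    using g by (rule stalk_cases)
  then have UT: "U = topspace (pts G)"
    using topspace_G opn_subset[OF U(1)] by auto
  obtain x where x: "x \<in> carrier A" "s = global_section A x"
    using U(3) unfolding UT by (rule global_section_cases)
  obtain n :: nat where n: "n > 0" "x [^]\<^bsub>A\<^esub> n = \<one>\<^bsub>A\<^esub>"
    using torsion x by auto
  have pt: "pt \<in> topspace (pts G)" using topspace_G by simp
  note ms = sec_monoid[OF spaces(3) U(1)] comm_monoid.axioms(1)[OF stalk_comm_monoid[OF spaces(3) pt]]
  have "s [^]\<^bsub>sec G U\<^esub> n = \<one>\<^bsub>sec G U\<^esub>"
    using monoid_hom_pow[OF global_section_hom monoid_axioms sec_monoid[OF spaces(3) openin_topspace] x(1), of n]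
      monoid_hom_one[OF global_section_hom] n x UT by simp
  then have "g [^]\<^bsub>stk G pt\<^esub> n = \<one>\<^bsub>stk G pt\<^esub>"
    using monoid_hom_pow[OF germ_hom[OF spaces(3) U(1,2)] ms U(3), of n]
      monoid_hom_one[OF germ_hom[OF spaces(3) U(1,2)]] U(4) by simp
  then show thesis by (rule that[OF n(1)])
qed

lemma (in fan_action) uD:
  shows u_morphism: "ms_morphism u" and tgt_u: "tgt u = M" and src_u: "src u = X"
    and proj1_u: "mor_eq (proj1 G X \<odot> u) (e \<odot> eps)" and proj2_u: "mor_eq (proj2 G X \<odot> u) (mor_id X)"
proof -
  have te: "tgt e = G"
    using e by (simp add: group_fan_unit_def is_Spec_map_def)
  show "ms_morphism u" "tgt u = M" "mor_eq (proj1 G X \<odot> u) (e \<odot> eps)" and 2: "mor_eq (proj2 G X \<odot> u) (mor_id X)"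
    using u te by (simp_all add: is_pairing_def)
  show "src u = X"
    using 2 by (simp add: mor_eq_def)
qed

lemma (in fan_action) projs: "ms_morphism (proj1 G X)" "ms_morphism (proj2 G X)"
  using proj1_morphism proj2_morphism spaces by blast+

section \<open>The unit law on points and on sections\<close>

lemma (in fan_action) base_u:
  assumes x: "x \<in> topspace (pts X)"
  shows "base_map u x = (pt, x)"
proof -
  have pu: "ms_morphism (proj2 G X \<odot> u)"
    by (rule ms_morphism_comp[OF u_morphism projs(2)]) (simp add: tgt_u)
  have "snd (base_map u x) = x"
    using mor_eqD(3)[OF pu proj2_u, of x] x src_u by simp
  moreover have "base_map u x \<in> topspace (pts M)"
    using ms_morphismD(3)[OF u_morphism] x unfolding src_u tgt_u by (auto simp: continuous_map_def Pi_iff)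
  ultimately show ?thesis
    unfolding topspace_M by (cases "base_map u x") auto
qed

text \<open>As the group fan has one point, every point of the product is of the form
  \<open>base_map u x\<close>, and there the unit law gives the value of the action.\<close>

lemma (in fan_action) base_act:
  assumes z: "z \<in> topspace (pts M)"
  shows "base_map act z = snd z"
proof -
  have au: "ms_morphism (act \<odot> u)"
    by (rule ms_morphism_comp[OF u_morphism act(1)]) (simp add: tgt_u act)
  obtain x where x: "x \<in> topspace (pts X)" "z = (pt, x)"
    using z unfolding topspace_M by auto
  then show ?thesis
    using mor_eqD(3)[OF au act_u, of x] base_u[OF x(1)] src_u by simp
qed

abbreviation (in fan_action) "B U \<equiv> pre M snd U"

lemma (in fan_action) preimage_act: "preimage act U = B U"
  unfolding act(2) using base_act by auto

lemma (in fan_action) open_B: "opn X U \<Longrightarrow> opn M (B U)"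
  by (rule continuous_pre[OF continuous_snd_mprod])

lemma (in fan_action) preimage_u_B: "opn X U \<Longrightarrow> preimage u (B U) = U"
  using base_u opn_subset[of X U] unfolding src_u topspace_M by auto

lemma (in fan_action) sec_map_u_proj2:
  assumes V: "opn X V" "t \<in> carrier (sec X V)"
  shows "sec_map u (B V) (sec_map (proj2 G X) V t) = t"
proof -
  have pu: "ms_morphism (proj2 G X \<odot> u)"
    by (rule ms_morphism_comp[OF u_morphism projs(2)]) (simp add: tgt_u)
  have "sec_map (proj2 G X \<odot> u) V t = sec_map (mor_id X) V t"
    using mor_eqD(4)[OF pu proj2_u, of V t] V by simp
  then show ?thesis
    using sec_map_comp[OF u_morphism projs(2), of V t] V sec_map_id[OF spaces(1) V] by (simp add: tgt_u)
qed

lemma (in fan_action) sec_map_u_act: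
  assumes V: "opn X V" "t \<in> carrier (sec X V)"
  shows "sec_map u (B V) (sec_map act V t) = t"
proof -
  have au: "ms_morphism (act \<odot> u)"
    by (rule ms_morphism_comp[OF u_morphism act(1)]) (simp add: tgt_u act)
  have "sec_map (act \<odot> u) V t = sec_map (mor_id X) V t"
    using mor_eqD(4)[OF au act_u, of V t] V act by simp
  then show ?thesis
    using sec_map_comp[OF u_morphism act(1), of V t] V sec_map_id[OF spaces(1) V] preimage_act
    by (simp add: tgt_u act)
qed

text \<open>The first component of \<open>u\<close> factors through the spectrum of the trivial
  monoid, where every section is \<open>\<one>\<close>.\<close>

lemma (in fan_action) sec_map_u_proj1:
  assumes c: "c \<in> carrier (glob G)"
  shows "sec_map u (topspace (pts M)) (sec_map (proj1 G X) (topspace (pts G)) c) = \<one>\<^bsub>glob X\<^esub>"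
proof -
  let ?TG = "topspace (pts G)"
  have eD: "ms_morphism e" "src e = Spec (singleton_group ())" "tgt e = G"
    using e by (simp_all add: group_fan_unit_def is_Spec_map_def)
  have pu: "ms_morphism (proj1 G X \<odot> u)"
    by (rule ms_morphism_comp[OF u_morphism projs(1)]) (simp add: tgt_u)
  have P: "pre M fst ?TG = topspace (pts M)"
    by (rule pre_topspace[OF continuous_fst_mprod])
  note ce = sec_map_cohom[OF eD(1)] and ceps = sec_map_cohom[OF eps(1)]
  have oe: "opn (Spec (singleton_group ())) (preimage e ?TG)"
    using cohom_pre[OF ce, of ?TG] eD by simp
  have "sec_map u (topspace (pts M)) (sec_map (proj1 G X) ?TG c) = sec_map (proj1 G X \<odot> u) ?TG c"
    using sec_map_comp[OF u_morphism projs(1), of ?TG c] c P by (simp add: tgt_u)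
  also have "\<dots> = sec_map (e \<odot> eps) ?TG c"
    using mor_eqD(4)[OF pu proj1_u, of ?TG c] c by simp
  also have "\<dots> = sec_map eps (preimage e ?TG) (sec_map e ?TG c)"
    using sec_map_comp[OF eps(1) eD(1), of ?TG c] c eps eD by simp
  also have "sec_map e ?TG c = \<one>\<^bsub>sec (Spec (singleton_group ())) (preimage e ?TG)\<^esub>"
    using cohom_closed[OF ce, of ?TG c] c eD by (intro trivial_Spec_section) simp
  also have "sec_map eps (preimage e ?TG) \<one>\<^bsub>sec (Spec (singleton_group ())) (preimage e ?TG)\<^esub> =
      \<one>\<^bsub>sec (src eps) (preimage eps (preimage e ?TG))\<^esub>"
    using cohom_one[OF ceps, of "preimage e ?TG"] oe eps by simp
  also have "preimage e ?TG = topspace (pts (tgt eps))"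
    using pre_topspace[OF ms_morphismD(3)[OF eD(1)]] eps eD by simp
  also have "preimage eps (topspace (pts (tgt eps))) = topspace (pts X)"
    using pre_topspace[OF ms_morphismD(3)[OF eps(1)]] eps by simp
  finally show ?thesis using eps by simp
qed

text \<open>
  The unit law alone shows that \<open>act\<^sup>\<dagger> m = (\<chi> m, m)\<close> for a locally constant function
  \<open>\<chi> m\<close> with values in the stalk of the group fan.
\<close>

lemma (in fan_action) sec_map_act_snd:
  assumes U: "opn X U" and m: "m \<in> carrier (sec X U)"
  shows "snd (sec_map act U m) = germfun X snd U m (B U)"
proof -
  let ?TG = "topspace (pts G)" and ?TM = "topspace (pts M)"
  note \<phi> = sec_map_cohom[OF act(1), unfolded act(2,3)] and \<psi> = sec_map_cohom[OF u_morphism, unfolded src_u tgt_u]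
  have BU: "pre M (base_map act) W = B W" for W using preimage_act unfolding act(2) .
  obtain \<chi> \<tau> where \<chi>\<tau>: "sec_map act U m = (\<chi>, \<tau>)" by (cases "sec_map act U m")
  have mem: "(\<chi>, \<tau>) \<in> carrier (sec M (B U))"
    using cohom_closed[OF \<phi> U m] unfolding \<chi>\<tau> BU .
  then have \<chi>: "\<chi> \<in> carrier (psec M fst G (B U))" and \<tau>: "\<tau> \<in> carrier (psec M snd X (B U))"
    by (simp_all add: sec_mprod)
  have "\<tau> = germfun X snd U m (B U)"
  proof (rule extensionalityI[OF psec_ext[OF \<tau>]])
    show "germfun X snd U m (B U) \<in> extensional (B U)" by (simp add: germfun_def)
    fix z assume z: "z \<in> B U"
    then obtain x where x: "z = (pt, x)" "x \<in> topspace (pts X)" "x \<in> U"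
      unfolding topspace_M by auto
    obtain W1 V1 c1 where 1: "z \<in> W1" "W1 \<subseteq> B U" "induced_on M fst G W1 V1 c1 \<chi>"
      by (rule psec_cases[OF \<chi> z])
    obtain W2 V2 t where 2: "z \<in> W2" "W2 \<subseteq> B U" "induced_on M snd X W2 V2 t \<tau>"
      by (rule psec_cases[OF \<tau> z])
    note i1 = induced_onD[OF 1(3)] and i2 = induced_onD[OF 2(3)]
    have "pt \<in> V1" using i1(3) 1(1) x(1) by auto
    then have V1: "V1 = ?TG" using opn_subset[OF i1(2)] topspace_G by auto
    have "opn M (W1 \<inter> W2)" using i1(1) i2(1) by (rule openin_Int)
    moreover have "(pt, x) \<in> W1 \<inter> W2" using 1(1) 2(1) x(1) by simp
    ultimately obtain P Q where PQ: "opn G P" "opn X Q" "pt \<in> P" "x \<in> Q" "P \<times> Q \<subseteq> W1 \<inter> W2"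
      by (rule mprod_nbhd)
    \<comment> \<open>Small enough that over \<open>B W\<close> the first component is the pullback
      of one global section \<open>c1\<close> of the group fan and the second the pullback of one
      section of \<open>X\<close>.\<close>
    define W where "W = Q \<inter> V2 \<inter> U"
    have xV2: "x \<in> V2" using i2(3) 2(1) x(1) by auto
    have W: "opn X W" "x \<in> W" "W \<subseteq> U" "W \<subseteq> V2"
      unfolding W_def using PQ(2,4) i2(2) U x(3) xV2 by (auto intro!: openin_Int)
    have BW: "B W \<subseteq> W1" "B W \<subseteq> W2"
    proof -
      have "B W \<subseteq> P \<times> Q" using PQ(3) unfolding topspace_M W_def by auto
      then have "B W \<subseteq> W1 \<inter> W2" using PQ(5) by (rule subset_trans)
      then show "B W \<subseteq> W1" "B W \<subseteq> W2" by simp_all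
    qed
    note oBW = open_B[OF W(1)]
    have BWU: "B W \<subseteq> B U" using W(3) by auto
    let ?t = "res X V2 W t"
    have tc: "?t \<in> carrier (sec X W)" by (rule res_closed[OF spaces(1) i2(2) W(1,4) i2(4)])
    have c1: "c1 \<in> carrier (glob G)" using i1(4) V1 by simp
    have eq\<chi>: "restrict \<chi> (B W) = germfun G fst ?TG c1 (B W)"
      unfolding germfun_def using i1(5) BW(1) V1 by (intro restrict_ext) auto
    have eq\<tau>: "restrict \<tau> (B W) = germfun X snd W ?t (B W)"
      unfolding germfun_def
    proof (rule restrict_ext)
      fix w assume w: "w \<in> B W"
      then show "\<tau> w = gm X (snd w) W ?t"
        using i2(5)[of w] BW(2) germ_res[OF spaces(1) i2(2) W(1) _ W(4) i2(4), of "snd w"] by auto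
    qed
    let ?c = "res M ?TM (B W) (sec_map (proj1 G X) ?TG c1)"
    have BT: "B W \<subseteq> ?TM" by auto
    have P1: "pre M fst ?TG = ?TM" by (rule pre_topspace[OF continuous_fst_mprod])
    have c: "?c = (germfun G fst ?TG c1 (B W), \<one>\<^bsub>psec M snd X (B W)\<^esub>)"
      unfolding sec_map_proj1 P1 res_mprod
      using psec_one_restrict[OF BT, of M snd X] BT by (simp add: germfun_def Int_absorb1)
    have pc: "sec_map (proj1 G X) ?TG c1 \<in> carrier (sec M ?TM)"
      using cohom_closed[OF sec_map_cohom[OF projs(1)], of ?TG c1] c1 P1 by simp
    have cc: "?c \<in> carrier (sec M (B W))"
      by (rule res_closed[OF spaces(2) openin_topspace oBW BT pc])
    have p2: "sec_map (proj2 G X) W ?t \<in> carrier (sec M (B W))"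
      using cohom_closed[OF sec_map_cohom[OF projs(2)], of W ?t] W(1) tc by simp
    \<comment> \<open>In the coproduct sheaf a pair is the product of its two components, each a
      pullback along one projection; the pullback of the pair along \<open>u\<close> can then be
      computed factor by factor.\<close>
    have "res M (B U) (B W) (\<chi>, \<tau>) = ?c \<otimes>\<^bsub>sec M (B W)\<^esub> sec_map (proj2 G X) W ?t"
    proof -
      have 1: "germfun G fst ?TG c1 (B W) \<otimes>\<^bsub>psec M fst G (B W)\<^esub> \<one>\<^bsub>psec M fst G (B W)\<^esub> = germfun G fst ?TG c1 (B W)"
      proof -
        have "gm G (fst w) ?TG c1 \<otimes>\<^bsub>stk G (fst w)\<^esub> \<one>\<^bsub>stk G (fst w)\<^esub> = gm G (fst w) ?TG c1" if "w \<in> B W" for w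
        proof -
          have "fst w \<in> ?TG" using that topspace_M topspace_G by auto
          then interpret S: comm_monoid "stk G (fst w)" by (rule stalk_comm_monoid[OF spaces(3)])
          show ?thesis using \<open>fst w \<in> ?TG\<close> germ_in_stalk[OF openin_topspace _ c1] by simp
        qed
        then show ?thesis
          unfolding psec_mult_def psec_one_def germfun_def by (intro restrict_ext) simp
      qed
      have 2: "\<one>\<^bsub>psec M snd X (B W)\<^esub> \<otimes>\<^bsub>psec M snd X (B W)\<^esub> germfun X snd W ?t (B W) = germfun X snd W ?t (B W)"
      proof -
        have "\<one>\<^bsub>stk X (snd w)\<^esub> \<otimes>\<^bsub>stk X (snd w)\<^esub> gm X (snd w) W ?t = gm X (snd w) W ?t" if "w \<in> B W" for w
        proof -
          have w: "snd w \<in> W" using that by simp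
          interpret S: comm_monoid "stk X (snd w)"
            by (rule stalk_comm_monoid[OF spaces(1) subsetD[OF opn_subset[OF W(1)] w]])
          show ?thesis by (rule S.l_one[OF germ_in_stalk[OF W(1) w tc]])
        qed
        then show ?thesis
          unfolding psec_mult_def psec_one_def germfun_def by (intro restrict_ext) simp
      qed
      have L: "res M (B U) (B W) (\<chi>, \<tau>) = (germfun G fst ?TG c1 (B W), germfun X snd W ?t (B W))"
        unfolding res_mprod by (simp only: map_prod_simp eq\<chi> eq\<tau>)
      show ?thesis
        unfolding L c sec_map_proj2 sec_mprod mult_DirProd 1 2 ..
    qed
    \<comment> \<open>Pullback along \<open>u\<close> sends the factor from the group fan to
      \<open>\<one>\<close> and the other factor to \<open>?t\<close>, while the unit law sends the
      whole section to \<open>m\<close>. Hence \<open>?t\<close> is the restriction of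
      \<open>m\<close>.\<close>
    then have "sec_map u (B W) (res M (B U) (B W) (\<chi>, \<tau>)) =
      sec_map u (B W) ?c \<otimes>\<^bsub>sec X W\<^esub> sec_map u (B W) (sec_map (proj2 G X) W ?t)"
      using cohom_mult[OF \<psi> oBW cc p2] preimage_u_B[OF W(1)] src_u by simp
    also have "sec_map u (B W) ?c = res X (topspace (pts X)) W \<one>\<^bsub>glob X\<^esub>"
      using cohom_res[OF \<psi> openin_topspace oBW BT pc] sec_map_u_proj1[OF c1] preimage_u_B[OF W(1)] src_u
        pre_topspace[OF cohom_cont[OF \<psi>]] by simp
    also have "\<dots> = \<one>\<^bsub>sec X W\<^esub>"
      by (rule res_one[OF spaces(1) openin_topspace W(1) opn_subset[OF W(1)]])
    also have "sec_map u (B W) (sec_map (proj2 G X) W ?t) = ?t"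
      by (rule sec_map_u_proj2[OF W(1) tc])
    also have "\<one>\<^bsub>sec X W\<^esub> \<otimes>\<^bsub>sec X W\<^esub> ?t = ?t"
      by (rule monoid.l_one[OF sec_monoid[OF spaces(1) W(1)] tc])
    also have "sec_map u (B W) (res M (B U) (B W) (\<chi>, \<tau>)) = res X U W (sec_map u (B U) (\<chi>, \<tau>))"
      using cohom_res[OF \<psi> open_B[OF U] oBW BWU mem] preimage_u_B[OF W(1)] preimage_u_B[OF U] src_u by simp
    also have "sec_map u (B U) (\<chi>, \<tau>) = m"
      using sec_map_u_act[OF U m] \<chi>\<tau> by simp
    finally have tm: "res X U W m = ?t" .
    have "\<tau> z = gm X x V2 t"
      using i2(5)[OF 2(1)] x(1) by simp
    also have "\<dots> = gm X x W ?t"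
      by (rule germ_res[OF spaces(1) i2(2) W(1,2,4) i2(4), symmetric])
    also have "\<dots> = gm X x U m"
      unfolding tm[symmetric] by (rule germ_res[OF spaces(1) U W(1,2,3) m])
    finally show "\<tau> z = germfun X snd U m (B U) z"
      using z x(1) by (simp add: germfun_def)
  qed
  then show ?thesis using \<chi>\<tau> by simp
qed

text \<open>The weight of \<open>m\<close> at \<open>x\<close>. For the spectrum of a monoid an
  action is a homomorphism from the monoid to \<open>A\<close>, and \<open>chi\<close> is this
  degree, with values in the stalk of the group fan, which is a copy of \<open>A\<close>.\<close>

definition (in fan_action) chi :: "'x set \<Rightarrow> 'm \<Rightarrow> 'x \<Rightarrow> ('a set set \<times> 'a spec_sec) set" where
  "chi U m x = fst (sec_map act U m) (pt, x)"

lemma (in fan_action) act_cohom: "cohom M (base_map act) X (sec_map act)"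
  using sec_map_cohom[OF act(1)] unfolding act(2,3) .

lemma (in fan_action) sec_map_act:
  assumes U: "opn X U" and m: "m \<in> carrier (sec X U)"
  shows "fst (sec_map act U m) \<in> carrier (psec M fst G (B U))"
  using cohom_closed[OF act_cohom U m] preimage_act[of U] unfolding act(2) by (auto simp: sec_mprod)

lemma (in fan_action) B_mem: "opn X U \<Longrightarrow> x \<in> U \<Longrightarrow> (pt, x) \<in> B U"
  using opn_subset[of X U] topspace_M by auto

lemma (in fan_action) chi_hom:
  assumes U: "opn X U" and x: "x \<in> U"
  shows "monoid_hom (sec X U) (stk G pt) (\<lambda>m. chi U m x)"
proof (rule monoid_homI)
  have P: "pre M (base_map act) U = B U" using preimage_act[of U] unfolding act(2) .
  note z = B_mem[OF U x]
  fix m assume m: "m \<in> carrier (sec X U)"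
  show "chi U m x \<in> carrier (stk G pt)"
    using psec_stalk[OF sec_map_act[OF U m] z] by (simp add: chi_def)
  fix n assume n: "n \<in> carrier (sec X U)"
  show "chi U (m \<otimes>\<^bsub>sec X U\<^esub> n) x = chi U m x \<otimes>\<^bsub>stk G pt\<^esub> chi U n x"
    unfolding chi_def cohom_mult[OF act_cohom U m n] P sec_mprod
    using z by (cases "sec_map act U m"; cases "sec_map act U n") (simp add: psec_mult_def)
next
  have P: "pre M (base_map act) U = B U" using preimage_act[of U] unfolding act(2) .
  show "chi U \<one>\<^bsub>sec X U\<^esub> x = \<one>\<^bsub>stk G pt\<^esub>"
    unfolding chi_def cohom_one[OF act_cohom U] P sec_mprod
    using B_mem[OF U x] by (simp add: psec_one_def)
qed

lemma (in fan_action) chi_res: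
  assumes U: "opn X U" "opn X V" "V \<subseteq> U" "x \<in> V" and m: "m \<in> carrier (sec X U)"
  shows "chi V (res X U V m) x = chi U m x"
proof -
  have P: "pre M (base_map act) U = B U" for U using preimage_act[of U] unfolding act(2) .
  show ?thesis
    unfolding chi_def cohom_res[OF act_cohom U(1-3) m] P res_mprod
    using B_mem[OF U(2,4)] by (cases "sec_map act U m") simp
qed

text \<open>Near \<open>(pt, x)\<close> the first component is induced by one section of the group
  fan, so it depends on the first coordinate only. On a product neighbourhood that coordinate can be
  kept at \<open>pt\<close>.\<close>

lemma (in fan_action) chi_locally_constant:
  assumes U: "opn X U" and x: "x \<in> U" and m: "m \<in> carrier (sec X U)"
  obtains W where "opn X W" "x \<in> W" "W \<subseteq> U" "\<forall>y\<in>W. chi U m y = chi U m x"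
proof -
  obtain W V c where W: "(pt, x) \<in> W" "W \<subseteq> B U" "induced_on M fst G W V c (fst (sec_map act U m))"
    by (rule psec_cases[OF sec_map_act[OF U m] B_mem[OF U x]])
  note i = induced_onD[OF W(3)]
  obtain P Q where PQ: "opn G P" "opn X Q" "pt \<in> P" "x \<in> Q" "P \<times> Q \<subseteq> W"
    by (rule mprod_nbhd[OF i(1) W(1)])
  have const: "chi U m y = gm G pt V c" if "y \<in> Q" for y
    unfolding chi_def using i(5)[of "(pt, y)"] PQ(3,5) that by auto
  show thesis
  proof (rule that[of Q])
    show "Q \<subseteq> U"
    proof
      fix y assume "y \<in> Q"
      then have "(pt, y) \<in> P \<times> Q" using PQ(3) by simp
      then have "(pt, y) \<in> B U" using PQ(5) W(2) by blast
      then show "y \<in> U" by simp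
    qed
    show "\<forall>y\<in>Q. chi U m y = chi U m x"
      using const const[OF PQ(4)] by simp
  qed (use PQ in auto)
qed

sublocale fan_action \<subseteq> pp: parallel_pair act "proj2 (Spec A) X"
  by unfold_locales (use act projs base_act in auto)

text \<open>By \<open>sec_map_act_snd\<close> action and projection have the same second component,
  and the first component of the projection is \<open>\<one>\<close>; what remains is that the first
  component of the action be trivial at every point.\<close>

lemma (in fan_action) eq_sec_iff:
  assumes U: "opn X U" and m: "m \<in> carrier (sec X U)"
  shows "m \<in> pp.eq_sec U \<longleftrightarrow> (\<forall>x\<in>U. chi U m x = \<one>\<^bsub>stk G pt\<^esub>)"
proof -
  have "m \<in> pp.eq_sec U \<longleftrightarrow> fst (sec_map act U m) = \<one>\<^bsub>psec M fst G (B U)\<^esub>"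
    unfolding pp.eq_sec_def sec_map_proj2 using m act(3) sec_map_act_snd[OF U m] by (auto simp: prod_eq_iff)
  also have "\<dots> \<longleftrightarrow> (\<forall>z\<in>B U. fst (sec_map act U m) z = \<one>\<^bsub>stk G (fst z)\<^esub>)"
  proof
    assume R: "\<forall>z\<in>B U. fst (sec_map act U m) z = \<one>\<^bsub>stk G (fst z)\<^esub>"
    show "fst (sec_map act U m) = \<one>\<^bsub>psec M fst G (B U)\<^esub>"
      by (rule extensionalityI[OF psec_ext[OF sec_map_act[OF U m]]]) (use R in \<open>auto simp: psec_one_def\<close>)
  qed (auto simp: psec_one_def)
  also have "\<dots> \<longleftrightarrow> (\<forall>x\<in>U. chi U m x = \<one>\<^bsub>stk G pt\<^esub>)"
    unfolding chi_def topspace_M using opn_subset[OF U] by auto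
  finally show ?thesis .
qed

text \<open>Pulling back along the section \<open>u\<close> of the projection returns
  \<open>t\<close>. Pullback preserves units, so invertibility of the pullback of \<open>t\<close>
  at a point over \<open>x\<close> gives invertibility of \<open>t\<close> at
  \<open>x\<close>.\<close>

lemma (in fan_action) local_proj2: "local_morphism (proj2 G X)"
  unfolding local_morphism_iff[OF projs(2)] proj_sel
proof (intro ballI allI impI, elim conjE)
  fix z V t assume z: "z \<in> topspace (pts M)" and V: "opn X V" "snd z \<in> V" "t \<in> carrier (sec X V)"
    and un: "unit_at M (B V) (sec_map (proj2 G X) V t) z"
  obtain x where x: "x \<in> topspace (pts X)" "z = (pt, x)"
    using z unfolding topspace_M by auto
  have p: "sec_map (proj2 G X) V t \<in> carrier (sec M (B V))"
    using cohom_closed[OF sec_map_cohom[OF projs(2)], of V t] V by simp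
  have "unit_at X (preimage u (B V)) (sec_map u (B V) (sec_map (proj2 G X) V t)) x"
    using unit_at_sec_map[OF u_morphism, of x "B V" "sec_map (proj2 G X) V t"] x V base_u[OF x(1)] un z p
      open_B[OF V(1)] by (simp add: src_u tgt_u)
  then show "unit_at X V t (snd z)"
    using sec_map_u_proj2[OF V(1,3)] preimage_u_B[OF V(1)] x(2) by simp
qed

text \<open>The point is the one whose face is the group of units.\<close>

lemma affine_closed_point:
  assumes aff: "affine Y"
  obtains x where "x \<in> topspace (pts Y)" "\<And>W. opn Y W \<Longrightarrow> x \<in> W \<Longrightarrow> W = topspace (pts Y)"
proof -
  note Y = affine_space[OF aff]
  interpret comm_monoid "glob Y" by (rule sec_comm_monoid[OF Y openin_topspace])
  have "face (glob Y) (Units (glob Y))"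
    by (rule faceI) (auto simp: Units_mult_iff)
  then obtain x where x: "x \<in> topspace (pts Y)" "{p \<in> carrier (glob Y). x \<in> unit_locus Y p} = Units (glob Y)"
    using affine_face[OF aff] by auto
  show thesis
  proof (rule that[OF x(1)])
    fix W assume W: "opn Y W" "x \<in> W"
    then obtain p where p: "p \<in> carrier (glob Y)" "x \<in> unit_locus Y p" "unit_locus Y p \<subseteq> W"
      using affine_basis[OF aff W] by auto
    then have "p \<in> Units (glob Y)" using x(2) by auto
    then show "W = topspace (pts Y)"
      using unit_locus_Units[OF Y] p(3) opn_subset[OF W(1)] by auto
  qed
qed

lemma (in fan_action) chi_constant:
  assumes U: "opn X U" and aff: "affine (open_subspace X U)" and m: "m \<in> carrier (sec X U)"
    and xy: "x \<in> U" "y \<in> U"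
  shows "chi U m x = chi U m y"
proof -
  note s = opn_open_subspace[OF U] open_subspace_sel(2)[OF U]
  obtain x0 where x0: "x0 \<in> U" "\<And>W. opn X W \<Longrightarrow> W \<subseteq> U \<Longrightarrow> x0 \<in> W \<Longrightarrow> W = U"
    by (rule affine_closed_point[OF aff]) (auto simp: s)
  obtain W where W: "opn X W" "x0 \<in> W" "W \<subseteq> U" "\<forall>y\<in>W. chi U m y = chi U m x0"
    by (rule chi_locally_constant[OF U x0(1) m])
  have "W = U" by (rule x0(2)[OF W(1,3,2)])
  then show ?thesis using W(4) xy by simp
qed

text \<open>An affine piece \<open>U\<close> of \<open>X\<close> is carried over by
  \<open>affine_transfer\<close>: torsion of the stalk provides the powers, constancy of the weight
  on \<open>U\<close> gives rigidity, and \<open>eq_sec_inverse\<close> gives the condition on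
  inverses.\<close>

lemma (in fan_action) quotient_fan:
  fixes q :: "('x, 'm, 'y, 'n) morphism"
  assumes fan: "fan X" and q: "pp.is_quotient q"
  shows "fan (tgt q)"
  unfolding fan_iff_affine
proof (intro conjI ballI)
  note qD = pp.quotientD[OF q, unfolded act(3)]
  let ?Q = "tgt q" and ?f = "base_map q"
  show Q: "monoidal_space ?Q" by (rule ms_morphismD(2)[OF qD(1)])
  note \<phi> = sec_map_cohom[OF qD(1), unfolded qD(2)]
  obtain g where hm: "homeomorphic_maps (pts X) (pts ?Q) ?f g"
    by (rule exE[OF qD(3)[unfolded homeomorphic_map_maps]])
  have contg: "continuous_map (pts ?Q) (pts X) g"
    using hm by (simp add: homeomorphic_maps_def)
  fix y assume y: "y \<in> topspace (pts ?Q)"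
  then have gy: "g y \<in> topspace (pts X)" "?f (g y) = y"
    using hm by (auto simp: homeomorphic_maps_def continuous_map_def Pi_iff)
  obtain U where U: "opn X U" "g y \<in> U" "affine (open_subspace X U)"
    using fan gy(1) unfolding fan_iff_affine by auto
  define V where "V = pre ?Q g U"
  have V: "opn ?Q V" unfolding V_def by (rule continuous_pre[OF contg U(1)])
  have PV: "pre X ?f V = U" unfolding V_def by (rule pre_homeomorphic[OF hm opn_subset[OF U(1)]])
  let ?Y = "open_subspace X U" and ?Z = "open_subspace ?Q V"
  note oY = opn_open_subspace[OF U(1)] and oZ = opn_open_subspace[OF V]
  note TY = open_subspace_sel(2)[OF U(1)] and TZ = open_subspace_sel(2)[OF V]
  have P: "pre ?Y ?f W = pre X ?f W" if "W \<subseteq> V" for W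
    using pre_open_subspace[OF cohom_cont[OF \<phi>] V that] unfolding PV .
  interpret SU: comm_monoid "sec X U" by (rule sec_comm_monoid[OF spaces(1) U(1)])
  obtain x0 where x0: "x0 \<in> U"
    using U(2) by blast
  have "affine ?Z"
  proof (rule affine_transfer[OF U(3) monoidal_space_open_subspace[OF Q V], where f = ?f and \<phi> = "sec_map q"])
    show "cohom ?Y ?f ?Z (sec_map q)"
      using cohom_open_subspace[OF \<phi> V] unfolding PV .
    show "homeomorphic_map (pts ?Y) (pts ?Z) ?f"
      using homeomorphic_open_subspace[OF qD(3) V] unfolding PV .
    show "inj_on (sec_map q W) (carrier (sec ?Z W))" if "opn ?Z W" for W
      using qD(4)[of W] that unfolding oZ open_subspace_sel(1) by simp
  next
    fix m assume "m \<in> carrier (glob ?Y)"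
    then have m: "m \<in> carrier (sec X U)" unfolding TY open_subspace_sel(1) .
    \<comment> \<open>One exponent works on the whole piece: it kills the weight at
      \<open>x0\<close>, and the weight is constant on \<open>U\<close>.\<close>
    obtain n :: nat where n: "n > 0" "chi U m x0 [^]\<^bsub>stk G pt\<^esub> n = \<one>\<^bsub>stk G pt\<^esub>"
      by (rule stalk_torsion[OF monoid_hom_closed[OF chi_hom[OF U(1) x0] m]])
    have mn: "m [^]\<^bsub>sec X U\<^esub> n \<in> carrier (sec X U)" using m by simp
    have ptG: "pt \<in> topspace (pts G)" using topspace_G by simp
    have "chi U (m [^]\<^bsub>sec X U\<^esub> n) x0 = \<one>\<^bsub>stk G pt\<^esub>"
      using monoid_hom_pow[OF chi_hom[OF U(1) x0] SU.monoid_axioms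
        comm_monoid.axioms(1)[OF stalk_comm_monoid[OF spaces(3) ptG]] m, of n] n(2) by simp
    then have "\<forall>x\<in>U. chi U (m [^]\<^bsub>sec X U\<^esub> n) x = \<one>\<^bsub>stk G pt\<^esub>"
      using chi_constant[OF U(1,3) mn x0] by simp
    then have "m [^]\<^bsub>sec X U\<^esub> n \<in> pp.eq_sec U"
      using eq_sec_iff[OF U(1) mn] by simp
    then obtain z where "z \<in> carrier (sec ?Q V)" "sec_map q V z = m [^]\<^bsub>sec X U\<^esub> n"
      using qD(5)[OF V] unfolding PV by (metis imageE)
    then show "\<exists>n>0. \<exists>z\<in>carrier (glob ?Z). sec_map q (topspace (pts ?Z)) z = m [^]\<^bsub>glob ?Y\<^esub> (n::nat)"
      using n(1) unfolding TY TZ open_subspace_sel(1) by blast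
  next
    fix m W assume m: "m \<in> carrier (glob ?Y)" and W: "opn ?Z W" "W \<noteq> {}"
      and mem: "res ?Y (topspace (pts ?Y)) (pre ?Y ?f W) m \<in> sec_map q W ` carrier (sec ?Z W)"
    have m: "m \<in> carrier (sec X U)" using m unfolding TY open_subspace_sel(1) .
    have W': "opn ?Q W" "W \<subseteq> V" using W(1) unfolding oZ by auto
    have PW: "opn X (pre X ?f W)" "pre X ?f W \<subseteq> U"
      using cohom_pre[OF \<phi> W'(1)] W'(2) PV by auto
    have mem: "res X U (pre X ?f W) m \<in> pp.eq_sec (pre X ?f W)"
      using mem[unfolded P[OF W'(2)]] unfolding TY open_subspace_sel(1) qD(5)[OF W'(1)] .
    obtain w where w: "w \<in> W" using W(2) by blast
    have "w \<in> topspace (pts ?Q)" using w opn_subset[OF W'(1)] by blast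
    then obtain x where "x \<in> topspace (pts X)" "?f x = w"
      by (rule pp.quotient_surj[OF q, unfolded act(3)])
    then have x: "x \<in> pre X ?f W" using w by simp
    have rc: "res X U (pre X ?f W) m \<in> carrier (sec X (pre X ?f W))"
      by (rule res_closed[OF spaces(1) U(1) PW m])
    have xU: "x \<in> U" using x PW(2) by blast
    have "chi U m x = \<one>\<^bsub>stk G pt\<^esub>"
      using mem eq_sec_iff[OF PW(1) rc] chi_res[OF U(1) PW x m] x by simp
    \<comment> \<open>Trivial weight at a single point of the nonempty set \<open>W\<close> spreads
      to all of \<open>U\<close>, so a section belongs to the subsheaf as soon as a restriction of
      it does.\<close>
    then have "\<forall>y\<in>U. chi U m y = \<one>\<^bsub>stk G pt\<^esub>"
      using chi_constant[OF U(1,3) m xU] by simp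
    then have "m \<in> pp.eq_sec U" using eq_sec_iff[OF U(1) m] by simp
    then show "m \<in> sec_map q (topspace (pts ?Z)) ` carrier (glob ?Z)"
      unfolding TZ open_subspace_sel(1) qD(5)[OF V] PV .
  next
    fix W z m assume W: "opn ?Z W" and z: "z \<in> carrier (sec ?Z W)" and m: "m \<in> carrier (sec ?Y (pre ?Y ?f W))"
      and zm: "sec_map q W z \<otimes>\<^bsub>sec ?Y (pre ?Y ?f W)\<^esub> m = \<one>\<^bsub>sec ?Y (pre ?Y ?f W)\<^esub>"
    have W': "opn ?Q W" "W \<subseteq> V" using W unfolding oZ by auto
    have o: "opn (tgt act) (pre X ?f W)" using cohom_pre[OF \<phi> W'(1)] act(3) by simp
    have "sec_map q W z \<in> pp.eq_sec (pre X ?f W)"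
      using z unfolding open_subspace_sel(1) qD(5)[OF W'(1), symmetric] by (rule imageI)
    then have "m \<in> pp.eq_sec (pre X ?f W)"
      using pp.eq_sec_inverse[OF o] m zm unfolding P[OF W'(2)] open_subspace_sel(1) act(3) by blast
    then show "m \<in> sec_map q W ` carrier (sec ?Z W)"
      unfolding open_subspace_sel(1) qD(5)[OF W'(1)] .
  qed
  moreover have "y \<in> V" using y U(2) by (simp add: V_def)
  ultimately show "\<exists>V. opn ?Q V \<and> y \<in> V \<and> affine (open_subspace ?Q V)"
    using V by blast
qed

text \<open>The quotient in \<open>MS\<close> is tested on two classes: the one with the types of
  \<open>X\<close> contains the subsheaf model, the one with the types of \<open>q\<close> contains
  the target of \<open>q\<close> itself. Together they identify \<open>q\<close> with the model,
  after which the universal property holds against test objects of any types \<open>'t\<close> and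
  \<open>'k\<close>.\<close>

theorem theorem2p8p4:
  fixes A :: "'a monoid" and X :: "('x, 'm) mspace"
    and act :: "('a set \<times> 'x, ('a set, 'a spec_sec, 'x, 'm) prod_sec, 'x, 'm) morphism"
  assumes "comm_group A"
    and "\<forall>a\<in>carrier A. \<exists>n::nat. n > 0 \<and> a [^]\<^bsub>A\<^esub> n = \<one>\<^bsub>A\<^esub>"
    and "fan X"
    and "group_fan_action A X act"
  shows "(\<exists>q :: ('x, 'm, 'x, 'm) morphism. categorical_quotient MS TYPE('x \<times> 'm) A X act q) \<and>
    (\<forall>q :: ('x, 'm, 'y, 'n) morphism.
       categorical_quotient MS TYPE('x \<times> 'm) A X act q \<and>
       categorical_quotient MS TYPE('y \<times> 'n) A X act q \<longrightarrow>
       arrow Fans q \<and>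
       homeomorphic_map (pts X) (pts (tgt q)) (base_map q) \<and>
       categorical_quotient MS TYPE('t \<times> 'k) A X act q \<and>
       categorical_quotient LMS TYPE('t \<times> 'k) A X act q \<and>
       categorical_quotient Fans TYPE('t \<times> 'k) A X act q)"
proof -
  have actD: "arrow Fans act" "src act = mprod (group_fan A) X" "tgt act = X"
    using assms(4) by (simp_all add: group_fan_action_def)
  obtain e eps u where e: "group_fan_unit A e"
    and eps: "ms_morphism eps" "src eps = X" "tgt eps = Spec (singleton_group ())"
    and u: "is_pairing (e \<odot> eps) (mor_id X) u" and au: "mor_eq (act \<odot> u) (mor_id X)"
    using assms(4) unfolding group_fan_action_def by blast
  interpret fan_action A X act e eps u
    by (rule fan_action.intro) (use assms(1,2) actD e eps u au in \<open>simp_all add: arrow_def\<close>)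
  let ?p = "proj2 (group_fan A) X"
  have arr: "arrow C act" "arrow C ?p" for C
    using actD projs(2) local_proj2 by (auto simp: arrow_def)
  show ?thesis
  proof (intro conjI allI impI)
    obtain q :: "('x, 'm, 'x, 'm) morphism" where q: "pp.is_quotient q"
      using pp.ex_quotient actD(3) by auto
    have "arrow MS q" using pp.quotientD(1)[OF q] by (simp add: arrow_def)
    then show "\<exists>q :: ('x, 'm, 'x, 'm) morphism. categorical_quotient MS TYPE('x \<times> 'm) A X act q"
      unfolding categorical_quotient_def using pp.quotient_coequalizer[OF q arr] by blast
  next
    fix q :: "('x, 'm, 'y, 'n) morphism"
    assume "categorical_quotient MS TYPE('x \<times> 'm) A X act q \<and> categorical_quotient MS TYPE('y \<times> 'n) A X act q"
    then have q: "pp.is_quotient q"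
      unfolding categorical_quotient_def using pp.coequalizer_is_quotient by blast
    note qD = pp.quotientD[OF q]
    show F: "arrow Fans q"
      using qD(1,2) actD(3) pp.quotient_local[OF q] quotient_fan[OF assms(3) q] assms(3) by (simp add: arrow_def)
    \<comment> \<open>An arrow of fans is also an arrow of the two larger categories, so one
      application of \<open>quotient_coequalizer\<close> covers all three.\<close>
    then have ar: "arrow C q" for C by (auto simp: arrow_def)
    show "homeomorphic_map (pts X) (pts (tgt q)) (base_map q)"
      using qD(3) actD(3) by simp
    show "categorical_quotient MS TYPE('t \<times> 'k) A X act q" "categorical_quotient LMS TYPE('t \<times> 'k) A X act q"
      "categorical_quotient Fans TYPE('t \<times> 'k) A X act q"
      unfolding categorical_quotient_def by (rule pp.quotient_coequalizer[OF q arr ar])+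
  qed
qed

end
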